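(* Let $d\ge 3$, let $(\mathbf{T}_{d,N})_{N\in\mathbb{N}}$ be a $d$-th order Wigner tensor, let $I$ be an index set, and for each $N\in\mathbb{N}$ let $(u_N^{(i,j)})_{i\in I,\,j\in[d-2]}$ be a family of (deterministic) unit vectors in $\mathbb{S}^{N-1}\subset\mathbb{R}^N$. Put $$\mathbf{K}^{(N)}_{i,i'}=\frac{1}{d(d-1)}\big\langle u_N^{(i,1)}\odot\cdots\odot u_N^{(i,d-2)},\ u_N^{(i',1)}\odot\cdots\odot u_N^{(i',d-2)}\big\rangle,\qquad i,i'\in I .$$ Then the contracted tensor ensemble $$\Big(\tfrac{1}{\sqrt N}\mathbf{T}_{d,N}\big[u_N^{(i,1)}\otimes\cdots\otimes u_N^{(i,d-2)}\big]\Big)_{i\in I}$$ converges in noncommutative distribution almost surely if and only if the limits $\mathbf{K}_{i,i'}=\lim_{N\to\infty}\mathbf{K}^{(N)}_{i,i'}$ exist for every $i,i'\in I$, in which case the limit is a semicircular family $(s_i)_{i\in I}$ of covariance $(\mathbf{K}_{i,i'})_{i,i'\in I}$. In particular, in that case, for each $i\in I$ the empirical spectral distribution of the single matrix $A_N=\frac{1}{\sqrt N}\mathbf{T}_{d,N}[u_N^{(i,1)}\otimes\cdots\otimes u_N^{(i,d-2)}]$ converges weakly almost surely to a semicircle distribution: $$\frac1N\sum_{k=1}^N\delta_{\lambda_k(A_N)}\ \longrightarrow\ \frac{1}{2\pi\mathbf{K}_{i,i}}\,(4\mathbf{K}_{i,i}-x^2)_+^{1/2}\,dx .$$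
   Context: **Wigner tensor.** Let $(X_N(k_1,\dots,k_d))_{N\in\mathbb{N},\,1\le k_1\le\cdots\le k_d\le N}$ be a family of independent real random variables such that (i) entries with $\#\{k_1,\dots,k_d\}\ne1$ are centered; (ii) entries with $\#\{k_1,\dots,k_d\}\ge3$ have variance $\binom{d}{b_1,\dots,b_N}^{-1}=\frac{b_1!\cdots b_N!}{d!}$, where $b_l=\#\{s\in[d]:k_s=l\}$; (iii) $\sup_N\sup_{k_1\le\cdots\le k_d}\mathbb{E}|X_N(k_1,\dots,k_d)|^m\le C_m<\infty$ for every $m\in\mathbb{N}$. The ($d$-th order, unnormalized) Wigner tensor is the random real symmetric tensor $\mathbf{T}_{d,N}(k_1,\dots,k_d)=X_N(k_{i_1},\dots,k_{i_d})$ for $k_1,\dots,k_d\in[N]$, where $k_{i_1}\le\cdots\le k_{i_d}$ is the nondecreasing rearrangement of $k_1,\dots,k_d$. The term refers to the whole sequence $(\mathbf{T}_{d,N})_{N\in\mathbb{N}}$. **Contraction.** $\mathbf{T}_{d,N}[u_1\otimes\cdots\otimes u_{d-2}]$ is the $N\times N$ real symmetric matrix with $(k_1,k_2)$ entry $\sum_{l_1,\dots,l_{d-2}\in[N]}\mathbf{T}_{d,N}(k_1,k_2,l_1,\dots,l_{d-2})\,u_1(l_1)\cdots u_{d-2}(l_{d-2})$. **Symmetrized product.** $v_1\odot\cdots\odot v_p=\frac1{p!}\sum_{\sigma\in\mathfrak{S}_p}v_{\sigma(1)}\otimes\cdots\otimes v_{\sigma(p)}$, and $\langle\cdot,\cdot\rangle$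 is the Euclidean inner product on $(\mathbb{R}^N)^{\otimes p}\cong\mathbb{R}^{N^p}$. **Almost sure convergence in noncommutative distribution.** Random matrices $(\mathbf{A}_N^{(i)})_{i\in I}$ converge in (noncommutative) distribution almost surely if for every finite $I_0\subset I$ the random linear functionals $P\mapsto\frac1N\mathrm{Tr}[P(\mathbf{A}_N^{(i)}:i\in I_0)]$ on the free algebra $\mathbb{C}\langle x_i:i\in I_0\rangle$ converge pointwise almost surely as $N\to\infty$. The limit is a semicircular family $(s_i)$ if these limits equal $\varphi(P(s_i:i\in I_0))$. **Semicircular family.** For a real positive semidefinite $(\mathbf{K}_{i,i'})_{i,i'\in I}$, a (centered) semicircular family of covariance $\mathbf{K}$ is a family $(s_i)_{i\in I}$ in a noncommutative probability space $(\mathcal{A},\varphi)$ (unital complex algebra with unital linear functional) whose joint moments are $\varphi(s_{i(1)}\cdots s_{i(n)})=\sum_{\pi\in\mathcal{NC}_2(n)}\prod_{\{j,k\}\in\pi}\mathbf{K}_{i(j),i(k)}$, where $\mathcal{NC}_2(n)$ is the set of noncrossing pair partitions of $[n]$. *)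

theory Defs
  imports
    "HOL-Probability.Probability"
    "HOL-Library.Poly_Mapping"
    "HOL-Combinatorics.Permutations"
    "Jordan_Normal_Form.Char_Poly"
begin

section \<open>Tensors\<close>

text \<open>
  Indices are zero-based, so that the index set with \<open>N\<close> elements is \<open>{..<N}\<close>.  A tensor of
  order \<open>p\<close> over \<open>\<real>\<^sup>N\<close> is a function on lists, of which only the values on
  \<open>multi_index N p\<close> matter.
\<close>

definition multi_index :: "nat \<Rightarrow> nat \<Rightarrow> nat list set" where
  "multi_index N p = {ks. length ks = p \<and> set ks \<subseteq> {..<N}}"

definition unit_sphere :: "nat \<Rightarrow> real vec set" where
  "unit_sphere N = {v \<in> carrier_vec N. sqrt (scalar_prod v v) = 1}"

definition tensor_prod :: "real vec list \<Rightarrow> nat list \<Rightarrow> real" where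
  "tensor_prod vs ks = (\<Prod>j<length vs. vec_index (vs ! j) (ks ! j))"

definition sym_tensor_prod :: "real vec list \<Rightarrow> nat list \<Rightarrow> real" where
  "sym_tensor_prod vs ks =
     (1 / fact (length vs)) *
     (\<Sum>\<sigma> | \<sigma> permutes {..<length vs}. tensor_prod (permute_list \<sigma> vs) ks)"

definition tensor_inner :: "nat \<Rightarrow> nat \<Rightarrow> (nat list \<Rightarrow> real) \<Rightarrow> (nat list \<Rightarrow> real) \<Rightarrow> real" where
  "tensor_inner N p S T = (\<Sum>ks\<in>multi_index N p. S ks * T ks)"

definition contraction ::
    "nat \<Rightarrow> nat \<Rightarrow> (nat list \<Rightarrow> real) \<Rightarrow> (nat list \<Rightarrow> real) \<Rightarrow> real mat" where
  "contraction N p T U =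
     mat N N (\<lambda>(k1, k2). \<Sum>ls\<in>multi_index N p. T (k1 # k2 # ls) * U ls)"


section \<open>Wigner tensors\<close>

text \<open>
  The entries for all \<open>N\<close> form one single independent family.  Integrability is part of the moment
  bound because \<open>expectation\<close> is \<open>0\<close> on non-integrable functions.
\<close>

locale wigner_tensor = prob_space M for M :: "'w measure" +
  fixes d :: nat and X :: "nat \<Rightarrow> nat list \<Rightarrow> 'w \<Rightarrow> real"
  assumes indep:
    "indep_vars (\<lambda>_. borel) (\<lambda>(N, ks). X N ks) (SIGMA N:UNIV. {ks \<in> multi_index N d. sorted ks})"
  and centered:
    "\<And>N ks. \<lbrakk>ks \<in> multi_index N d; sorted ks; card (set ks) \<noteq> 1\<rbrakk> \<Longrightarrow> expectation (X N ks) = 0"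
  and variance:
    "\<And>N ks. \<lbrakk>ks \<in> multi_index N d; sorted ks; card (set ks) \<ge> 3\<rbrakk> \<Longrightarrow>
       variance (X N ks) = (\<Prod>l<N. fact (count_list ks l)) / fact d"
  and moments:
    "\<And>m :: nat. \<exists>C. \<forall>N. \<forall>ks\<in>multi_index N d. sorted ks \<longrightarrow>
       integrable M (\<lambda>\<omega>. \<bar>X N ks \<omega>\<bar> ^ m) \<and> expectation (\<lambda>\<omega>. \<bar>X N ks \<omega>\<bar> ^ m) \<le> C"

definition wigner_entries :: "(nat \<Rightarrow> nat list \<Rightarrow> 'w \<Rightarrow> real) \<Rightarrow> nat \<Rightarrow> 'w \<Rightarrow> nat list \<Rightarrow> real" where
  "wigner_entries X N \<omega> ks = X N (sort ks) \<omega>"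

text \<open>The vectors \<open>u N i j\<close> are indexed by \<open>j < d - 2\<close>.\<close>

definition contracted_ensemble ::
    "nat \<Rightarrow> (nat \<Rightarrow> nat list \<Rightarrow> 'w \<Rightarrow> real) \<Rightarrow> (nat \<Rightarrow> 'i \<Rightarrow> nat \<Rightarrow> real vec) \<Rightarrow>
     nat \<Rightarrow> 'i \<Rightarrow> 'w \<Rightarrow> real mat" where
  "contracted_ensemble d X u N i \<omega> =
     (1 / sqrt (real N)) \<cdot>\<^sub>m
       contraction N (d - 2) (wigner_entries X N \<omega>) (tensor_prod (map (u N i) [0..<d - 2]))"

definition contraction_cov ::
    "nat \<Rightarrow> (nat \<Rightarrow> 'i \<Rightarrow> nat \<Rightarrow> real vec) \<Rightarrow> nat \<Rightarrow> 'i \<Rightarrow> 'i \<Rightarrow> real" where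
  "contraction_cov d u N i i' =
     1 / (real d * (real d - 1)) *
     tensor_inner N (d - 2)
       (sym_tensor_prod (map (u N i) [0..<d - 2]))
       (sym_tensor_prod (map (u N i') [0..<d - 2]))"


section \<open>Free algebra and noncommutative probability spaces\<close>

text \<open>
  Words form a monoid under concatenation, written additively so that the product of
  \<open>Poly_Mapping\<close> makes \<open>'i ncpoly\<close> the free unital complex algebra on the indeterminates \<open>'i\<close>.
\<close>

datatype 'i ncword = NCWord (letters: "'i list")

instantiation ncword :: (type) monoid_add
begin

definition zero_ncword :: "'a ncword" where
  "zero_ncword = NCWord []"

definition plus_ncword :: "'a ncword \<Rightarrow> 'a ncword \<Rightarrow> 'a ncword" where
  "plus_ncword v w = NCWord (letters v @ letters w)"

instance
  by standard (auto simp: zero_ncword_def plus_ncword_def)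

end

type_synonym 'i ncpoly = "'i ncword \<Rightarrow>\<^sub>0 complex"

definition free_algebra :: "'i set \<Rightarrow> 'i ncpoly set" where
  "free_algebra I = {P. \<forall>w\<in>Poly_Mapping.keys P. set (letters w) \<subseteq> I}"

locale nc_prob_space = vector_space smul
  for smul :: "complex \<Rightarrow> 'a::ring_1 \<Rightarrow> 'a" +
  fixes \<phi> :: "'a \<Rightarrow> complex"
  assumes smul_mult_left: "smul c x * y = smul c (x * y)"
    and smul_mult_right: "x * smul c y = smul c (x * y)"
    and linear_functional: "Vector_Spaces.linear smul (*) \<phi>"
    and unital: "\<phi> 1 = 1"

definition nc_eval ::
    "(complex \<Rightarrow> 'a \<Rightarrow> 'a) \<Rightarrow> ('i \<Rightarrow> 'a::ring_1) \<Rightarrow> 'i ncpoly \<Rightarrow> 'a" where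
  "nc_eval smul s P =
     (\<Sum>w\<in>Poly_Mapping.keys P. smul (Poly_Mapping.lookup P w) (prod_list (map s (letters w))))"


section \<open>Semicircular families\<close>

definition noncrossing_pair_partitions :: "nat \<Rightarrow> nat set set set" where
  "noncrossing_pair_partitions n =
     {\<pi>. partition_on {..<n} \<pi> \<and> (\<forall>B\<in>\<pi>. card B = 2) \<and>
         \<not> (\<exists>B\<in>\<pi>. \<exists>B'\<in>\<pi>. B \<noteq> B' \<and>
              (\<exists>a\<in>B. \<exists>b\<in>B'. \<exists>c\<in>B. \<exists>e\<in>B'. a < b \<and> b < c \<and> c < e))}"

definition psd_on :: "'i set \<Rightarrow> ('i \<Rightarrow> 'i \<Rightarrow> real) \<Rightarrow> bool" where
  "psd_on I K \<longleftrightarrow>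
     (\<forall>i\<in>I. \<forall>j\<in>I. K i j = K j i) \<and>
     (\<forall>F c. finite F \<and> F \<subseteq> I \<longrightarrow> (\<Sum>i\<in>F. \<Sum>j\<in>F. c i * c j * K i j) \<ge> 0)"

text \<open>A block \<open>B = {j, k}\<close> with \<open>j < k\<close> contributes the factor \<open>K (js ! j) (js ! k)\<close>.\<close>

definition semicircular_family ::
    "'i set \<Rightarrow> ('i \<Rightarrow> 'i \<Rightarrow> real) \<Rightarrow> (complex \<Rightarrow> 'a \<Rightarrow> 'a) \<Rightarrow> ('a \<Rightarrow> complex) \<Rightarrow>
     ('i \<Rightarrow> 'a::ring_1) \<Rightarrow> bool" where
  "semicircular_family I K smul \<phi> s \<longleftrightarrow>
     nc_prob_space smul \<phi> \<and> psd_on I K \<and>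
     (\<forall>js. set js \<subseteq> I \<longrightarrow>
        \<phi> (prod_list (map s js)) =
        complex_of_real (\<Sum>\<pi>\<in>noncrossing_pair_partitions (length js).
                           \<Prod>B\<in>\<pi>. K (js ! Min B) (js ! Max B)))"


section \<open>Almost sure convergence in noncommutative distribution\<close>

definition mat_nc_eval :: "nat \<Rightarrow> ('i \<Rightarrow> complex mat) \<Rightarrow> 'i ncpoly \<Rightarrow> complex mat" where
  "mat_nc_eval N A P =
     mat N N (\<lambda>(k, l). \<Sum>w\<in>Poly_Mapping.keys P.
       Poly_Mapping.lookup P w * (foldr (\<lambda>i B. A i * B) (letters w) (1\<^sub>m N)) $$ (k, l))"

definition normalized_trace :: "nat \<Rightarrow> complex mat \<Rightarrow> complex" where
  "normalized_trace N B = (1 / of_nat N) * (\<Sum>k<N. B $$ (k, k))"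

definition nc_converges_as ::
    "'w measure \<Rightarrow> 'i set \<Rightarrow> (nat \<Rightarrow> 'i \<Rightarrow> 'w \<Rightarrow> complex mat) \<Rightarrow> bool" where
  "nc_converges_as M I A \<longleftrightarrow>
     (\<forall>I0. finite I0 \<and> I0 \<subseteq> I \<longrightarrow>
        (AE \<omega> in M. \<forall>P\<in>free_algebra I0.
           convergent (\<lambda>N. normalized_trace N (mat_nc_eval N (\<lambda>i. A N i \<omega>) P))))"

definition nc_converges_as_to ::
    "'w measure \<Rightarrow> 'i set \<Rightarrow> (nat \<Rightarrow> 'i \<Rightarrow> 'w \<Rightarrow> complex mat) \<Rightarrow>
     (complex \<Rightarrow> 'a \<Rightarrow> 'a) \<Rightarrow> ('a \<Rightarrow> complex) \<Rightarrow> ('i \<Rightarrow> 'a::ring_1) \<Rightarrow> bool" where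
  "nc_converges_as_to M I A smul \<phi> s \<longleftrightarrow>
     (\<forall>I0. finite I0 \<and> I0 \<subseteq> I \<longrightarrow>
        (AE \<omega> in M. \<forall>P\<in>free_algebra I0.
           (\<lambda>N. normalized_trace N (mat_nc_eval N (\<lambda>i. A N i \<omega>) P))
             \<longlonglongrightarrow> \<phi> (nc_eval smul s P)))"


section \<open>Empirical spectral distribution and semicircle distribution\<close>

text \<open>
  The real eigenvalues in increasing order, with algebraic multiplicity.  A real symmetric matrix
  has as many of them as it has rows; only such matrices are considered here.
\<close>

definition eigenvalue_list :: "real mat \<Rightarrow> real list" where
  "eigenvalue_list A = sorted_list_of_multiset (proots (char_poly A))"

definition empirical_spectral_distribution :: "real mat \<Rightarrow> real measure" where
  "empirical_spectral_distribution A =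
     distr (uniform_count_measure {..<dim_row A}) borel (\<lambda>k. eigenvalue_list A ! k)"

definition semicircle_distribution :: "real \<Rightarrow> real measure" where
  "semicircle_distribution v =
     density lborel (\<lambda>x. ennreal (1 / (2 * pi * v) * sqrt (max 0 (4 * v - x\<^sup>2))))"

end

theory Submission
  imports
    Defs
    "HOL-Combinatorics.Multiset_Permutations"
    "Jordan_Normal_Form.Schur_Decomposition"
begin

text \<open>
  The normalized traces \<open>T(w)\<close> of words in the contracted matrices are compared with
  \<open>m(w)\<close>, the sum over the noncrossing pairings of \<open>w\<close> for the covariance at size
  \<open>N\<close>.  The latter is determined by \<open>m(i w) = \<Sum>p. K(i, w\<^sub>p) m(w') m(w'')\<close>,
  where \<open>w = w' w\<^sub>p w''\<close>.  Setting a single entry of the tensor to zero changes a matrix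
  only slightly, and expanding the trace of \<open>i w\<close> to second order in each entry gives the same
  recursion for \<open>T\<close> up to a small error, even after multiplication by an arbitrary power of
  \<open>T(i w) - m(i w)\<close> before taking expectations.  By Young's inequality and induction on the
  length of the word, the \<open>q\<close>-th moment of \<open>T(w) - m(w)\<close> is of order
  \<open>N powr ((1 - q) / 2)\<close>.  For \<open>q = 4\<close> this is summable, so \<open>T(w) - m(w)\<close> tends to
  zero almost surely whatever the vectors are.  Hence the traces converge if and only if the
  \<open>m(w)\<close> do, and for words of length two \<open>m\<close> is the covariance itself.

  The error terms are powers of the operator norms, whose moments are bounded by the same
  expansion applied to traces of high powers of one matrix.  The diagonal of the covariance is bounded
  away from zero, so that the limiting semicircle laws are not degenerate; they are the limits of the
  spectral distributions because a compactly supported law is determined by its moments.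
\<close>

section \<open>Matrices as functions\<close>

text \<open>The entries of a contracted matrix are dependent, the vectors may be localized on few
  coordinates, and entries with at most two distinct indices have no prescribed variance. So no
  single coefficient can be assumed small; the estimates are square sums. If \<open>B_k\<close> is
  the matrix multiplying the entry \<open>k\<close>, its entrywise l1 norm is at most
  \<open>d!\<close>, and the squares of these norms sum to at most \<open>d! * N^2\<close> over all
  \<open>k\<close>. Terms with two factors \<open>B_k\<close> therefore sum to the order of the main
  term, and each further factor comes with a gain of \<open>1 / sqrt N\<close>. In the second-order
  term two orderings \<open>s\<close>, \<open>s'\<close> of the same multiset of indices meet. Only
  if they exchange the first two places, \<open>s' ! 0 = s ! 1\<close> and
  \<open>s' ! 1 = s ! 0\<close>, does the sum become a product of two traces; the other
  \<open>d - 2\<close> places then form the symmetrized inner product, with the prescribed variance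
  as its weight. For all other pairs an index of a matrix entry is tied to a further place, and
  Cauchy-Schwarz gains \<open>sqrt N\<close>. Entries with constant index need not be centered, but
  there are only \<open>N\<close> of them.\<close>

text \<open>
  A square matrix of size \<open>N\<close> is a function that vanishes outside \<open>{..<N} \<times> {..<N}\<close>
  (predicate \<open>msupp\<close>); the junk outside this square matters as soon as functions are compared
  for equality.
\<close>

type_synonym fmat = "nat \<Rightarrow> nat \<Rightarrow> real"

definition mmul :: "nat \<Rightarrow> fmat \<Rightarrow> fmat \<Rightarrow> fmat" where
  "mmul N A B = (\<lambda>i j. \<Sum>k<N. A i k * B k j)"

definition mid :: "nat \<Rightarrow> fmat" where
  "mid N = (\<lambda>i j. if i = j \<and> i < N then 1 else 0)"

definition mtr :: "nat \<Rightarrow> fmat \<Rightarrow> real" where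
  "mtr N A = (\<Sum>i<N. A i i)"

definition msupp :: "nat \<Rightarrow> fmat \<Rightarrow> bool" where
  "msupp N A \<longleftrightarrow> (\<forall>a b. A a b \<noteq> 0 \<longrightarrow> a < N \<and> b < N)"

definition msub :: "fmat \<Rightarrow> fmat \<Rightarrow> fmat" where
  "msub A B = (\<lambda>i j. A i j - B i j)"

definition mscale :: "real \<Rightarrow> fmat \<Rightarrow> fmat" where
  "mscale c A = (\<lambda>i j. c * A i j)"

definition wmul :: "nat \<Rightarrow> ('i \<Rightarrow> fmat) \<Rightarrow> 'i list \<Rightarrow> fmat" where
  "wmul N F w = foldr (\<lambda>i B. mmul N (F i) B) w (mid N)"

text \<open>The entrywise l1 norm. It is dual to the maximum norm and so pairs with operator bounds
  inside traces; coefficient matrices have it bounded independently of \<open>N\<close>.\<close>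

definition l1n :: "nat \<Rightarrow> fmat \<Rightarrow> real" where
  "l1n N A = (\<Sum>a<N. \<Sum>b<N. \<bar>A a b\<bar>)"

text \<open>An upper bound for the operator norm, kept as a relation so that bounds compose without
  a supremum. Of the functions \<open>x\<close> only the values below \<open>N\<close>
  enter.\<close>

definition opb :: "nat \<Rightarrow> real \<Rightarrow> fmat \<Rightarrow> bool" where
  "opb N r A \<longleftrightarrow> 0 \<le> r \<and> (\<forall>x. L2_set (\<lambda>a. \<Sum>b<N. A a b * x b) {..<N} \<le> r * L2_set x {..<N})"

lemma mmul_assoc: "mmul N (mmul N A B) C = mmul N A (mmul N B C)"
proof (intro ext)
  fix i j
  have "mmul N (mmul N A B) C i j = (\<Sum>k<N. \<Sum>l<N. A i l * B l k * C k j)"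
    unfolding mmul_def by (simp add: sum_distrib_right)
  also have "\<dots> = (\<Sum>l<N. \<Sum>k<N. A i l * B l k * C k j)" by (rule sum.swap)
  also have "\<dots> = mmul N A (mmul N B C) i j"
    unfolding mmul_def by (simp add: sum_distrib_left mult.assoc)
  finally show "mmul N (mmul N A B) C i j = mmul N A (mmul N B C) i j" .
qed

lemma mtr_comm: "mtr N (mmul N A B) = mtr N (mmul N B A)"
  unfolding mtr_def mmul_def by (subst sum.swap) (simp add: mult.commute)

lemma msupp_mid [simp]: "msupp N (mid N)"
  by (auto simp: msupp_def mid_def split: if_splits)

lemma msupp_mmul [simp]: "msupp N A \<Longrightarrow> msupp N B \<Longrightarrow> msupp N (mmul N A B)"
  unfolding msupp_def mmul_def by (metis (no_types, lifting) mult_eq_0_iff sum.neutral)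

lemma mmul_mid_left [simp]: "msupp N A \<Longrightarrow> mmul N (mid N) A = A"
proof (intro ext)
  fix i j assume A: "msupp N A"
  have "mmul N (mid N) A i j = (\<Sum>k<N. if k = i then A k j else 0)"
    unfolding mmul_def mid_def by (intro sum.cong) auto
  also have "\<dots> = A i j" using A by (auto simp: msupp_def)
  finally show "mmul N (mid N) A i j = A i j" .
qed

lemma mmul_mid_right [simp]: "msupp N A \<Longrightarrow> mmul N A (mid N) = A"
proof (intro ext)
  fix i j assume A: "msupp N A"
  have "mmul N A (mid N) i j = (\<Sum>k<N. if k = j then A i k else 0)"
    unfolding mmul_def mid_def by (intro sum.cong) auto
  also have "\<dots> = A i j" using A by (auto simp: msupp_def)
  finally show "mmul N A (mid N) i j = A i j" .
qed

lemma wmul_simps [simp]: "wmul N F [] = mid N" "wmul N F (i # w) = mmul N (F i) (wmul N F w)"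
  by (auto simp: wmul_def)

lemma msupp_wmul [simp]: "(\<And>i. i \<in> set w \<Longrightarrow> msupp N (F i)) \<Longrightarrow> msupp N (wmul N F w)"
  by (induction w) auto

lemma wmul_append:
  assumes "\<And>i. i \<in> set v \<Longrightarrow> msupp N (F i)"
  shows "wmul N F (w @ v) = mmul N (wmul N F w) (wmul N F v)"
  by (induction w) (use assms in \<open>auto simp: mmul_assoc\<close>)

lemma mmul_msub_left: "mmul N (msub A B) C = msub (mmul N A C) (mmul N B C)"
  by (auto simp: mmul_def msub_def algebra_simps sum_subtractf)

lemma mmul_msub_right: "mmul N C (msub A B) = msub (mmul N C A) (mmul N C B)"
  by (auto simp: mmul_def msub_def algebra_simps sum_subtractf)

lemma mmul_mscale_left: "mmul N (mscale c A) B = mscale c (mmul N A B)"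
  by (auto simp: mmul_def mscale_def sum_distrib_left mult.assoc)

lemma mmul_mscale_right: "mmul N A (mscale c B) = mscale c (mmul N A B)"
  by (auto simp: mmul_def mscale_def sum_distrib_left mult.left_commute)

lemma mtr_mscale: "mtr N (mscale c A) = c * mtr N A"
  by (simp add: mtr_def mscale_def sum_distrib_left)

lemma mtr_msub: "mtr N (msub A B) = mtr N A - mtr N B"
  by (simp add: mtr_def msub_def sum_subtractf)

lemma mtr_mid: "mtr N (mid N) = real N"
  by (simp add: mtr_def mid_def)

lemma mmul_sum_right: "mmul N A (\<lambda>a b. \<Sum>p\<in>P. G p a b) = (\<lambda>a b. \<Sum>p\<in>P. mmul N A (G p) a b)"
  unfolding mmul_def sum_distrib_left by (intro ext) (rule sum.swap)

lemma mmul_sum_left: "mmul N (\<lambda>a b. \<Sum>p\<in>P. G p a b) A = (\<lambda>a b. \<Sum>p\<in>P. mmul N (G p) A a b)"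
  unfolding mmul_def sum_distrib_right by (intro ext) (rule sum.swap)

lemma mtr_sum: "mtr N (\<lambda>a b. \<Sum>p\<in>P. G p a b) = (\<Sum>p\<in>P. mtr N (G p))"
  unfolding mtr_def by (rule sum.swap)

lemma msupp_msub [simp]: "msupp N A \<Longrightarrow> msupp N B \<Longrightarrow> msupp N (msub A B)"
  unfolding msupp_def msub_def by (metis diff_self)

text \<open>Letters are exchanged one at a time: \<open>F\<close> to the left of position
  \<open>p\<close>, \<open>G\<close> to the right. This mixed form reappears as the two arguments of
  \<open>ptrace\<close>.\<close>

lemma wmul_telescope:
  assumes "\<And>i. msupp N (F i)" "\<And>i. msupp N (G i)"
  shows "msub (wmul N F w) (wmul N G w) =
    (\<lambda>a b. \<Sum>p<length w. mmul N (wmul N F (take p w))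
       (mmul N (msub (F (w ! p)) (G (w ! p))) (wmul N G (drop (Suc p) w))) a b)"
proof (induction w)
  case Nil
  then show ?case by (auto simp: msub_def)
next
  case (Cons i w)
  have supp: "msupp N (mmul N (msub (F i) (G i)) (wmul N G w))"
    by (intro msupp_mmul msupp_msub msupp_wmul assms)
  have "msub (wmul N F (i # w)) (wmul N G (i # w)) =
     (\<lambda>a b. mmul N (msub (F i) (G i)) (wmul N G w) a b + mmul N (F i) (msub (wmul N F w) (wmul N G w)) a b)"
    unfolding mmul_msub_left mmul_msub_right by (simp add: msub_def)
  also have "\<dots> = (\<lambda>a b. \<Sum>p<length (i # w). mmul N (wmul N F (take p (i # w)))
       (mmul N (msub (F ((i # w) ! p)) (G ((i # w) ! p))) (wmul N G (drop (Suc p) (i # w)))) a b)"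
    unfolding Cons.IH length_Cons sum.lessThan_Suc_shift using supp
    by (simp add: mmul_sum_right mmul_assoc)
  finally show ?case .
qed

section \<open>Calculus of operator bounds\<close>

lemma opb_nonneg: "opb N r A \<Longrightarrow> 0 \<le> r" by (simp add: opb_def)

lemma opbD: "opb N r A \<Longrightarrow> L2_set (\<lambda>a. \<Sum>b<N. A a b * x b) {..<N} \<le> r * L2_set x {..<N}"
  by (simp add: opb_def)

lemma opb_mono: "opb N r A \<Longrightarrow> r \<le> s \<Longrightarrow> opb N s A"
  unfolding opb_def by (meson L2_set_nonneg mult_right_mono order_trans)

lemma opb_mid: "opb N 1 (mid N)"
proof -
  have "(\<Sum>b<N. mid N a b * x b) = x a" if "a < N" for a x
  proof -
    have "(\<Sum>b<N. mid N a b * x b) = (\<Sum>b<N. if b = a then x b else 0)"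
      using that by (intro sum.cong) (auto simp: mid_def)
    then show ?thesis using that by simp
  qed
  then have "L2_set (\<lambda>a. \<Sum>b<N. mid N a b * x b) {..<N} = L2_set x {..<N}" for x
    by (intro L2_set_cong) auto
  then show ?thesis by (simp add: opb_def)
qed

lemma opb_mmul: assumes "opb N r A" "opb N s B" shows "opb N (r * s) (mmul N A B)"
  unfolding opb_def
proof (intro conjI allI)
  show "0 \<le> r * s" using assms by (simp add: opb_def)
  fix x :: "nat \<Rightarrow> real"
  have "(\<Sum>b<N. mmul N A B a b * x b) = (\<Sum>k<N. A a k * (\<Sum>b<N. B k b * x b))" for a
    unfolding mmul_def sum_distrib_right sum_distrib_left by (subst sum.swap) (simp add: mult.assoc)
  then have "L2_set (\<lambda>a. \<Sum>b<N. mmul N A B a b * x b) {..<N}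
     \<le> r * L2_set (\<lambda>k. \<Sum>b<N. B k b * x b) {..<N}" using opbD[OF assms(1)] by simp
  also have "\<dots> \<le> r * (s * L2_set x {..<N})"
    by (intro mult_left_mono opbD[OF assms(2)]) (use assms in \<open>simp add: opb_def\<close>)
  finally show "L2_set (\<lambda>a. \<Sum>b<N. mmul N A B a b * x b) {..<N} \<le> r * s * L2_set x {..<N}"
    by (simp add: mult.assoc)
qed

lemma opb_add: assumes "opb N r A" "opb N s B" shows "opb N (r + s) (\<lambda>a b. A a b + B a b)"
  unfolding opb_def
proof (intro conjI allI)
  show "0 \<le> r + s" using assms by (simp add: opb_def)
  fix x :: "nat \<Rightarrow> real"
  have "L2_set (\<lambda>a. \<Sum>b<N. (A a b + B a b) * x b) {..<N} \<le>
     L2_set (\<lambda>a. \<Sum>b<N. A a b * x b) {..<N} + L2_set (\<lambda>a. \<Sum>b<N. B a b * x b) {..<N}"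
    using L2_set_triangle_ineq by (simp add: distrib_right sum.distrib)
  also have "\<dots> \<le> r * L2_set x {..<N} + s * L2_set x {..<N}"
    by (intro add_mono opbD assms)
  finally show "L2_set (\<lambda>a. \<Sum>b<N. (A a b + B a b) * x b) {..<N} \<le> (r + s) * L2_set x {..<N}"
    by (simp add: distrib_right)
qed

lemma opb_mscale: assumes "opb N r A" shows "opb N (\<bar>c\<bar> * r) (mscale c A)"
proof -
  have "L2_set (\<lambda>a. \<Sum>b<N. mscale c A a b * x b) {..<N} =
        \<bar>c\<bar> * L2_set (\<lambda>a. \<Sum>b<N. A a b * x b) {..<N}" for x
  proof -
    have "L2_set (\<lambda>a. \<Sum>b<N. mscale c A a b * x b) {..<N} = L2_set (\<lambda>a. \<bar>c\<bar> * (\<Sum>b<N. A a b * x b)) {..<N}"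
      unfolding L2_set_def mscale_def by (simp add: mult.assoc flip: sum_distrib_left) (simp add: power_mult_distrib)
    then show ?thesis by (simp add: L2_set_right_distrib)
  qed
  then show ?thesis using assms unfolding opb_def by (auto simp: mult.assoc mult_left_mono)
qed

lemma opb_msub: assumes "opb N r A" "opb N s B" shows "opb N (r + s) (msub A B)"
proof -
  have "msub A B = (\<lambda>a b. A a b + mscale (-1) B a b)" by (auto simp: msub_def mscale_def)
  then show ?thesis using opb_add[OF assms(1) opb_mscale[OF assms(2), of "-1"]] by simp
qed

lemma opb_zero: "opb N 0 (\<lambda>a b. 0)"
  by (simp add: opb_def L2_set_def)

lemma opb_sum:
  assumes "finite P" "\<And>p. p \<in> P \<Longrightarrow> opb N (r p) (G p)"
  shows "opb N (\<Sum>p\<in>P. r p) (\<lambda>a b. \<Sum>p\<in>P. G p a b)"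
  using assms by (induction P rule: finite_induct) (auto simp: opb_zero intro!: opb_add)

lemma opb_frobenius: "opb N (sqrt (\<Sum>a<N. \<Sum>b<N. (A a b)\<^sup>2)) A"
  unfolding opb_def
proof (intro conjI allI)
  show "0 \<le> sqrt (\<Sum>a<N. \<Sum>b<N. (A a b)\<^sup>2)" by (simp add: sum_nonneg)
  fix x :: "nat \<Rightarrow> real"
  have "(\<Sum>a<N. (\<Sum>b<N. A a b * x b)\<^sup>2) \<le> (\<Sum>a<N. (\<Sum>b<N. (A a b)\<^sup>2) * (\<Sum>b<N. (x b)\<^sup>2))"
    by (intro sum_mono Cauchy_Schwarz_ineq_sum)
  then show "L2_set (\<lambda>a. \<Sum>b<N. A a b * x b) {..<N} \<le> sqrt (\<Sum>a<N. \<Sum>b<N. (A a b)\<^sup>2) * L2_set x {..<N}"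
    unfolding L2_set_def by (simp add: sum_distrib_right flip: real_sqrt_mult)
qed

lemma l1n_nonneg [simp]: "0 \<le> l1n N A" by (simp add: l1n_def sum_nonneg)

lemma frobenius_le_l1n: "(\<Sum>a<N. \<Sum>b<N. (A a b)\<^sup>2) \<le> (l1n N A)\<^sup>2"
proof -
  have "sqrt (\<Sum>(a,b)\<in>{..<N}\<times>{..<N}. (A a b)\<^sup>2) \<le> (\<Sum>(a,b)\<in>{..<N}\<times>{..<N}. \<bar>A a b\<bar>)"
    using L2_set_le_sum_abs[of "\<lambda>(a,b). A a b" "{..<N}\<times>{..<N}"]
    by (simp add: L2_set_def case_prod_unfold)
  then have "sqrt (\<Sum>a<N. \<Sum>b<N. (A a b)\<^sup>2) \<le> l1n N A"
    by (simp add: l1n_def sum.cartesian_product)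
  then show ?thesis by (rule sqrt_le_D)
qed

lemma opb_l1n: "opb N (l1n N A) A"
  using real_sqrt_le_mono[OF frobenius_le_l1n] by (intro opb_mono[OF opb_frobenius]) simp

text \<open>Apply the operator bound to the basis vector at \<open>b\<close>.\<close>

lemma opb_col: assumes "opb N r A" "b < N" shows "(\<Sum>a<N. (A a b)\<^sup>2) \<le> r\<^sup>2"
proof -
  define x where "x = (\<lambda>k. if k = b then 1 else (0::real))"
  have 1: "(\<Sum>k<N. A a k * x k) = A a b" for a
    using assms(2) by (simp add: x_def if_distrib cong: if_cong)
  have 2: "L2_set x {..<N} = 1"
    using assms(2) by (simp add: L2_set_def x_def if_distrib[of "\<lambda>t. t\<^sup>2"] cong: if_cong)
  have "sqrt (\<Sum>a<N. (A a b)\<^sup>2) \<le> r"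
    using opbD[OF assms(1), of x] unfolding 1 2 by (simp add: L2_set_def)
  then show ?thesis using assms(1) opb_nonneg sqrt_le_D by blast
qed

lemma opb_entry: assumes "opb N r A" "a < N" "b < N" shows "\<bar>A a b\<bar> \<le> r"
proof -
  have "(A a b)\<^sup>2 \<le> (\<Sum>a<N. (A a b)\<^sup>2)"
    using assms by (intro member_le_sum) auto
  also have "\<dots> \<le> r\<^sup>2" using opb_col assms by blast
  finally show ?thesis using power2_le_imp_le[of "\<bar>A a b\<bar>" r] opb_nonneg[OF assms(1)] by simp
qed

lemma opb_wmul: assumes "\<And>i. i \<in> set w \<Longrightarrow> opb N r (F i)" shows "opb N (r ^ length w) (wmul N F w)"
  using assms by (induction w) (auto intro!: opb_mmul opb_mid)

lemma opb_wmul_diff: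
  assumes "\<And>i. msupp N (F i)" "\<And>i. msupp N (G i)"
    and "\<And>i. i \<in> set w \<Longrightarrow> opb N r (F i)" "\<And>i. i \<in> set w \<Longrightarrow> opb N r (G i)"
    and "\<And>i. i \<in> set w \<Longrightarrow> opb N s (msub (F i) (G i))"
  shows "opb N (real (length w) * s * r ^ (length w - 1)) (msub (wmul N F w) (wmul N G w))"
proof -
  have "opb N (r ^ p * (s * r ^ (length w - Suc p))) (mmul N (wmul N F (take p w))
       (mmul N (msub (F (w ! p)) (G (w ! p))) (wmul N G (drop (Suc p) w))))" if "p < length w" for p
  proof -
    have "opb N (r ^ p) (wmul N F (take p w))"
      using opb_wmul[of "take p w" N r F] assms(3) that by (simp add: min_def) (meson in_set_takeD)
    moreover have "opb N (r ^ (length w - Suc p)) (wmul N G (drop (Suc p) w))"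
      using opb_wmul[of "drop (Suc p) w" N r G] assms(4) that by (simp add: min_def) (meson in_set_dropD)
    ultimately show ?thesis using assms(5) that by (intro opb_mmul) auto
  qed
  then have "opb N (\<Sum>p<length w. r ^ p * (s * r ^ (length w - Suc p))) (msub (wmul N F w) (wmul N G w))"
    unfolding wmul_telescope[OF assms(1,2)] by (intro opb_sum) auto
  moreover have "(\<Sum>p<length w. r ^ p * (s * r ^ (length w - Suc p))) = (\<Sum>p<length w. s * r ^ (length w - 1))"
    by (intro sum.cong) (auto simp: mult.left_commute simp flip: power_add)
  ultimately show ?thesis by (simp add: mult.assoc)
qed

text \<open>Each entry of \<open>W\<close> is at most \<open>r\<close>, so a trace against a matrix
  of small l1 norm costs no factor \<open>N\<close>, unlike \<open>mtr_bound\<close>.\<close>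

lemma mtr_mmul_bound: assumes "opb N r W" shows "\<bar>mtr N (mmul N B W)\<bar> \<le> l1n N B * r"
proof -
  have "\<bar>mtr N (mmul N B W)\<bar> \<le> (\<Sum>a<N. \<Sum>b<N. \<bar>B a b * W b a\<bar>)"
    unfolding mtr_def mmul_def by (rule order_trans[OF sum_abs]) (intro sum_mono sum_abs)
  also have "\<dots> \<le> (\<Sum>a<N. \<Sum>b<N. \<bar>B a b\<bar> * r)"
    by (intro sum_mono) (auto simp: abs_mult intro!: mult_left_mono opb_entry[OF assms])
  finally show ?thesis by (simp add: l1n_def sum_distrib_right)
qed

lemma mtr_bound: assumes "opb N r W" shows "\<bar>mtr N W\<bar> \<le> real N * r"
proof -
  have "\<bar>mtr N W\<bar> \<le> (\<Sum>a<N. \<bar>W a a\<bar>)" unfolding mtr_def by (rule sum_abs)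
  also have "\<dots> \<le> (\<Sum>a<N. r)" by (intro sum_mono opb_entry[OF assms]) auto
  finally show ?thesis by simp
qed

section \<open>Noncrossing pairings\<close>

text \<open>The partner \<open>p\<close> of the first letter separates the word, and in a
  noncrossing pairing no other pair can link the two pieces. All estimates use this recursion; words
  of odd length get the value \<open>0\<close> because a single letter has no partner.\<close>

fun semicircular_moment :: "('i \<Rightarrow> 'i \<Rightarrow> real) \<Rightarrow> 'i list \<Rightarrow> real" where
  "semicircular_moment K [] = 1"
| "semicircular_moment K (i # w) = (\<Sum>p<length w. K i (w ! p) *
     semicircular_moment K (take p w) * semicircular_moment K (drop (Suc p) w))"

text \<open>Pairings of an arbitrary set of positions instead of \<open>{..<n}\<close>: the pieces
  cut off by a pair are intervals that may start anywhere.\<close>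

definition nc_pairings :: "nat set \<Rightarrow> nat set set set" where
  "nc_pairings A = {\<pi>. partition_on A \<pi> \<and> (\<forall>B\<in>\<pi>. card B = 2) \<and>
         \<not> (\<exists>B\<in>\<pi>. \<exists>B'\<in>\<pi>. B \<noteq> B' \<and>
              (\<exists>a\<in>B. \<exists>b\<in>B'. \<exists>c\<in>B. \<exists>e\<in>B'. a < b \<and> b < c \<and> c < e))}"

definition pairing_sum :: "(nat \<Rightarrow> nat \<Rightarrow> real) \<Rightarrow> nat set \<Rightarrow> real" where
  "pairing_sum f A = (\<Sum>\<pi>\<in>nc_pairings A. \<Prod>B\<in>\<pi>. f (Min B) (Max B))"

lemma finite_nc_pairings: "finite A \<Longrightarrow> finite (nc_pairings A)"
  by (rule finite_subset[of _ "Pow (Pow A)"]) (auto simp: nc_pairings_def partition_on_def)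

lemma nc_pairings_empty: "nc_pairings {} = {{}}"
  by (auto simp: nc_pairings_def partition_on_def)

lemma nc_pairings_block:
  assumes "\<pi> \<in> nc_pairings A" "B \<in> \<pi>"
  obtains x y where "B = {x, y}" "x < y" "x \<in> A" "y \<in> A"
proof -
  have "card B = 2" "B \<subseteq> A" using assms by (auto simp: nc_pairings_def partition_on_def)
  then obtain x y where "B = {x, y}" "x \<noteq> y" by (auto simp: card_2_iff)
  then show ?thesis using \<open>B \<subseteq> A\<close> that[of x y] that[of y x] by (metis insert_commute insert_subset linorder_neqE_nat)
qed

lemma nc_pairings_subset: "\<pi> \<in> nc_pairings A \<Longrightarrow> B \<in> \<pi> \<Longrightarrow> B \<subseteq> A \<and> B \<noteq> {}"
  by (auto simp: nc_pairings_def partition_on_def)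

text \<open>The points under the arc from \<open>a\<close> to \<open>c\<close>, the points beyond
  \<open>c\<close>, and the end points of the arc occupy disjoint ranges, so a crossing would have
  to lie inside one of the two pieces.\<close>

lemma nc_pairings_insert:
  assumes "a < c" "c < b" "\<pi>1 \<in> nc_pairings {Suc a..<c}" "\<pi>2 \<in> nc_pairings {Suc c..<b}"
  shows "insert {a, c} (\<pi>1 \<union> \<pi>2) \<in> nc_pairings {a..<b}"
proof -
  have p1: "partition_on {Suc a..<c} \<pi>1" and p2: "partition_on {Suc c..<b} \<pi>2"
    using assms by (auto simp: nc_pairings_def)
  have U: "\<Union>\<pi>1 = {Suc a..<c}" "\<Union>\<pi>2 = {Suc c..<b}" using p1 p2 by (auto simp: partition_on_def)
  have P: "partition_on {a..<b} (insert {a, c} (\<pi>1 \<union> \<pi>2))"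
  proof (rule partition_onI)
    show "\<Union>(insert {a, c} (\<pi>1 \<union> \<pi>2)) = {a..<b}" using U assms by auto
    show "{} \<notin> insert {a, c} (\<pi>1 \<union> \<pi>2)"
      using p1 p2 by (auto simp: partition_on_def)
    have s: "p \<subseteq> {Suc a..<c}" if "p \<in> \<pi>1" for p using U that by blast
    have t: "p \<subseteq> {Suc c..<b}" if "p \<in> \<pi>2" for p using U that by blast
    have d1: "p \<inter> q = {}" if "p \<in> \<pi>1" "q \<in> \<pi>1" "p \<noteq> q" for p q
      using p1 that by (auto simp: partition_on_def disjoint_def)
    have d2: "p \<inter> q = {}" if "p \<in> \<pi>2" "q \<in> \<pi>2" "p \<noteq> q" for p q
      using p2 that by (auto simp: partition_on_def disjoint_def)
    have m: "(p = {a, c} \<and> x \<in> {a, c}) \<or> (p \<in> \<pi>1 \<and> a < x \<and> x < c) \<or> (p \<in> \<pi>2 \<and> c < x)"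
      if "p \<in> insert {a, c} (\<pi>1 \<union> \<pi>2)" "x \<in> p" for p x
    proof -
      have "p \<in> \<pi>1 \<Longrightarrow> x \<in> {Suc a..<c}" "p \<in> \<pi>2 \<Longrightarrow> x \<in> {Suc c..<b}" using s t that(2) by blast+
      then show ?thesis using that by auto
    qed
    show "disjnt p q" if pq: "p \<in> insert {a, c} (\<pi>1 \<union> \<pi>2)" "q \<in> insert {a, c} (\<pi>1 \<union> \<pi>2)" "p \<noteq> q" for p q
    proof (rule ccontr)
      assume "\<not> disjnt p q"
      then obtain x where x: "x \<in> p" "x \<in> q" by (auto simp: disjnt_def)
      have "p \<in> \<pi>1 \<and> q \<in> \<pi>1 \<or> p \<in> \<pi>2 \<and> q \<in> \<pi>2"
        using m[OF pq(1) x(1)] m[OF pq(2) x(2)] pq(3) assms(1,2) by (elim disjE) auto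
      then show False using d1[of p q] d2[of p q] pq(3) x by blast
    qed
  qed
  have two: "\<forall>B\<in>insert {a, c} (\<pi>1 \<union> \<pi>2). card B = 2"
    using assms by (auto simp: nc_pairings_def card_2_iff)
  have r1: "x \<in> {Suc a..<c}" if "B \<in> \<pi>1" "x \<in> B" for B x using U that by blast
  have r2: "x \<in> {Suc c..<b}" if "B \<in> \<pi>2" "x \<in> B" for B x using U that by blast
  have nc1: "\<not> (w < x \<and> x < y \<and> y < z)" if "B \<in> \<pi>1" "B' \<in> \<pi>1" "B \<noteq> B'" "w \<in> B" "x \<in> B'" "y \<in> B" "z \<in> B'" for B B' w x y z
    using assms(3) that unfolding nc_pairings_def by blast
  have nc2: "\<not> (w < x \<and> x < y \<and> y < z)" if "B \<in> \<pi>2" "B' \<in> \<pi>2" "B \<noteq> B'" "w \<in> B" "x \<in> B'" "y \<in> B" "z \<in> B'" for B B' w x y z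
    using assms(4) that unfolding nc_pairings_def by blast
  have nc: "\<not> (w < x \<and> x < y \<and> y < z)"
    if H: "B \<in> insert {a, c} (\<pi>1 \<union> \<pi>2)" "B' \<in> insert {a, c} (\<pi>1 \<union> \<pi>2)" "B \<noteq> B'"
      "w \<in> B" "x \<in> B'" "y \<in> B" "z \<in> B'" for B B' w x y z
  proof -
    have rB: "B = {a, c} \<or> (B \<in> \<pi>1 \<and> w \<in> {Suc a..<c} \<and> y \<in> {Suc a..<c}) \<or> (B \<in> \<pi>2 \<and> w \<in> {Suc c..<b} \<and> y \<in> {Suc c..<b})"
      using H(1,4,6) r1 r2 by blast
    have rB': "B' = {a, c} \<or> (B' \<in> \<pi>1 \<and> x \<in> {Suc a..<c} \<and> z \<in> {Suc a..<c}) \<or> (B' \<in> \<pi>2 \<and> x \<in> {Suc c..<b} \<and> z \<in> {Suc c..<b})"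
      using H(2,5,7) r1 r2 by blast
    show ?thesis
    proof
      assume o: "w < x \<and> x < y \<and> y < z"
      have n: "\<not> (B \<in> \<pi>1 \<and> B' \<in> \<pi>1)" "\<not> (B \<in> \<pi>2 \<and> B' \<in> \<pi>2)"
        using nc1[OF _ _ H(3-7)] nc2[OF _ _ H(3-7)] o by blast+
      have w: "B = {a, c} \<Longrightarrow> w \<in> {a, c} \<and> y \<in> {a, c}" "B' = {a, c} \<Longrightarrow> x \<in> {a, c} \<and> z \<in> {a, c}"
        using H by auto
      from rB rB' show False
        by (elim disjE conjE) (use n w o H(3) assms(1,2) in auto)
    qed
  qed
  show ?thesis unfolding nc_pairings_def using P two nc by blast
qed

text \<open>A block with one point strictly between \<open>a\<close> and \<open>c\<close> and the
  other beyond \<open>c\<close> would cross \<open>{a, c}\<close>, and no point lies to the left of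
  \<open>a\<close>. So every other block falls into one of the two intervals, which makes this the
  inverse of \<open>nc_pairings_insert\<close>.\<close>

lemma nc_pairings_split:
  assumes "\<pi> \<in> nc_pairings {a..<b}" "{a, c} \<in> \<pi>" "a < c"
  shows "{B\<in>\<pi>. B \<subseteq> {Suc a..<c}} \<in> nc_pairings {Suc a..<c}"
    and "{B\<in>\<pi>. B \<subseteq> {Suc c..<b}} \<in> nc_pairings {Suc c..<b}"
    and "\<pi> = insert {a, c} ({B\<in>\<pi>. B \<subseteq> {Suc a..<c}} \<union> {B\<in>\<pi>. B \<subseteq> {Suc c..<b}})"
proof -
  have P: "partition_on {a..<b} \<pi>" using assms by (auto simp: nc_pairings_def)
  have disj: "B = B'" if "B \<in> \<pi>" "B' \<in> \<pi>" "x \<in> B" "x \<in> B'" for B B' x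
    using P that unfolding partition_on_def disjoint_def by blast
  have nc: "\<not> (w < x \<and> x < y \<and> y < z)" if "B \<in> \<pi>" "B' \<in> \<pi>" "B \<noteq> B'" "w \<in> B" "x \<in> B'" "y \<in> B" "z \<in> B'" for B B' w x y z
    using assms(1) that unfolding nc_pairings_def by blast
  have cases: "B \<subseteq> {Suc a..<c} \<or> B \<subseteq> {Suc c..<b}" if B: "B \<in> \<pi>" "B \<noteq> {a, c}" for B
  proof -
    obtain x y where xy: "B = {x, y}" "x < y" "x \<in> {a..<b}" "y \<in> {a..<b}"
      using nc_pairings_block[OF assms(1) B(1)] .
    have ne: "x \<noteq> a" "x \<noteq> c" "y \<noteq> a" "y \<noteq> c" using disj[OF B(1) assms(2)] B(2) xy by auto
    have "\<not> (a < x \<and> x < c \<and> c < y)"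
    proof
      assume "a < x \<and> x < c \<and> c < y"
      then show False using nc[OF assms(2) B(1) B(2)[symmetric], of a x c y] xy by simp
    qed
    then show ?thesis using xy ne by auto
  qed
  show eq: "\<pi> = insert {a, c} ({B\<in>\<pi>. B \<subseteq> {Suc a..<c}} \<union> {B\<in>\<pi>. B \<subseteq> {Suc c..<b}})"
    using cases assms(2) by blast
  have cover: "\<exists>B\<in>\<pi>. x \<in> B" if "x \<in> {a..<b}" for x using P that by (auto simp: partition_on_def)
  have cb: "c < b" using P assms(2) by (auto simp: partition_on_def)
  have sub: "{B\<in>\<pi>. B \<subseteq> S} \<in> nc_pairings S" if S: "S \<subseteq> {a..<b}" "a \<notin> S" "c \<notin> S"
      "\<And>B x. B \<in> \<pi> \<Longrightarrow> B \<noteq> {a, c} \<Longrightarrow> x \<in> B \<Longrightarrow> x \<in> S \<Longrightarrow> B \<subseteq> S" for S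
  proof -
    have "\<Union>{B\<in>\<pi>. B \<subseteq> S} = S"
    proof (intro equalityI subsetI)
      fix x assume x: "x \<in> S"
      then obtain B where "B \<in> \<pi>" "x \<in> B" using cover S by blast
      moreover have "B \<noteq> {a, c}" using x S \<open>x \<in> B\<close> by auto
      ultimately show "x \<in> \<Union>{B\<in>\<pi>. B \<subseteq> S}" using S(4) x by blast
    qed auto
    then have "partition_on S {B\<in>\<pi>. B \<subseteq> S}" using P by (auto simp: partition_on_def disjoint_def)
    then show ?thesis using assms(1) unfolding nc_pairings_def by blast
  qed
  show "{B\<in>\<pi>. B \<subseteq> {Suc a..<c}} \<in> nc_pairings {Suc a..<c}"
    using cb cases assms(3) by (intro sub) (auto, force+)
  show "{B\<in>\<pi>. B \<subseteq> {Suc c..<b}} \<in> nc_pairings {Suc c..<b}"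
    using cb cases assms(3) by (intro sub) (auto, force+)
qed

text \<open>Pairings are classified by the partner \<open>c\<close> of the least element
  \<open>a\<close>; for fixed \<open>c\<close> they correspond to pairs of pairings of the two
  intervals.\<close>

lemma pairing_sum_rec:
  assumes "a < b"
  shows "pairing_sum f {a..<b} =
    (\<Sum>c\<in>{a<..<b}. f a c * pairing_sum f {Suc a..<c} * pairing_sum f {Suc c..<b})"
proof -
  define Q where "Q c = {\<pi>\<in>nc_pairings {a..<b}. {a, c} \<in> \<pi>}" for c
  have U: "nc_pairings {a..<b} = (\<Union>c\<in>{a<..<b}. Q c)"
  proof (intro equalityI subsetI)
    fix \<pi> assume \<pi>: "\<pi> \<in> nc_pairings {a..<b}"
    then have "\<Union>\<pi> = {a..<b}" by (simp add: nc_pairings_def partition_on_def)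
    then obtain B where B: "B \<in> \<pi>" "a \<in> B" using assms by (metis UnionE atLeastLessThan_iff order_refl)
    obtain x y where "B = {x, y}" "x < y" "x \<in> {a..<b}" "y \<in> {a..<b}"
      using nc_pairings_block[OF \<pi> B(1)] .
    then have "B = {a, y}" "y \<in> {a<..<b}" using B by auto
    then show "\<pi> \<in> (\<Union>c\<in>{a<..<b}. Q c)" using \<pi> B(1) unfolding Q_def by blast
  qed (auto simp: Q_def)
  have dis: "Q c \<inter> Q c' = {}" if "c \<noteq> c'" for c c'
  proof -
    have False if "\<pi> \<in> nc_pairings {a..<b}" "{a, c} \<in> \<pi>" "{a, c'} \<in> \<pi>" for \<pi>
    proof -
      have "disjoint \<pi>" using that(1) by (simp add: nc_pairings_def partition_on_def)
      from disjointD[OF this that(2,3)] have "{a, c} = {a, c'}" by auto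
      then show False using \<open>c \<noteq> c'\<close> by (auto simp: doubleton_eq_iff)
    qed
    then show ?thesis by (auto simp: Q_def)
  qed
  have fin: "finite (Q c)" for c unfolding Q_def using finite_nc_pairings[of "{a..<b}"] by auto
  have sumQ: "(\<Sum>\<pi>\<in>Q c. \<Prod>B\<in>\<pi>. f (Min B) (Max B)) =
      f a c * pairing_sum f {Suc a..<c} * pairing_sum f {Suc c..<b}" if c: "c \<in> {a<..<b}" for c
  proof -
    let ?h = "\<lambda>(\<pi>1, \<pi>2). insert {a, c} (\<pi>1 \<union> \<pi>2)"
    let ?D = "nc_pairings {Suc a..<c} \<times> nc_pairings {Suc c..<b}"
    have inv: "{B \<in> insert {a, c} (\<pi>1 \<union> \<pi>2). B \<subseteq> {Suc a..<c}} = \<pi>1"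
              "{B \<in> insert {a, c} (\<pi>1 \<union> \<pi>2). B \<subseteq> {Suc c..<b}} = \<pi>2"
      if "\<pi>1 \<in> nc_pairings {Suc a..<c}" "\<pi>2 \<in> nc_pairings {Suc c..<b}" for \<pi>1 \<pi>2
    proof -
      have s1: "B \<subseteq> {Suc a..<c} \<and> \<not> B \<subseteq> {Suc c..<b}" if "B \<in> \<pi>1" for B
      proof -
        have "B \<subseteq> {Suc a..<c}" "B \<noteq> {}" using nc_pairings_subset[OF \<open>\<pi>1 \<in> _\<close> that] by auto
        then show ?thesis by fastforce
      qed
      have s2: "B \<subseteq> {Suc c..<b} \<and> \<not> B \<subseteq> {Suc a..<c}" if "B \<in> \<pi>2" for B
      proof -
        have "B \<subseteq> {Suc c..<b}" "B \<noteq> {}" using nc_pairings_subset[OF \<open>\<pi>2 \<in> _\<close> that] by auto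
        then show ?thesis by fastforce
      qed
      show "{B \<in> insert {a, c} (\<pi>1 \<union> \<pi>2). B \<subseteq> {Suc a..<c}} = \<pi>1"
        using s1 s2 by auto
      show "{B \<in> insert {a, c} (\<pi>1 \<union> \<pi>2). B \<subseteq> {Suc c..<b}} = \<pi>2"
        using s1 s2 c by auto
    qed
    have bij: "bij_betw ?h ?D (Q c)"
    proof (rule bij_betw_byWitness[where f' = "\<lambda>\<pi>. ({B\<in>\<pi>. B \<subseteq> {Suc a..<c}}, {B\<in>\<pi>. B \<subseteq> {Suc c..<b}})"])
      show "\<forall>p\<in>?D. ({B\<in>?h p. B \<subseteq> {Suc a..<c}}, {B\<in>?h p. B \<subseteq> {Suc c..<b}}) = p"
      proof
        fix p assume "p \<in> ?D"
        then obtain \<pi>1 \<pi>2 where p: "p = (\<pi>1, \<pi>2)" "\<pi>1 \<in> nc_pairings {Suc a..<c}" "\<pi>2 \<in> nc_pairings {Suc c..<b}"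
          by auto
        show "({B\<in>?h p. B \<subseteq> {Suc a..<c}}, {B\<in>?h p. B \<subseteq> {Suc c..<b}}) = p"
          unfolding p(1) prod.case inv[OF p(2,3)] ..
      qed
      show "\<forall>\<pi>\<in>Q c. ?h ({B\<in>\<pi>. B \<subseteq> {Suc a..<c}}, {B\<in>\<pi>. B \<subseteq> {Suc c..<b}}) = \<pi>"
      proof
        fix \<pi> assume "\<pi> \<in> Q c"
        then have h: "\<pi> \<in> nc_pairings {a..<b}" "{a, c} \<in> \<pi>" "a < c" using c by (auto simp: Q_def)
        show "?h ({B\<in>\<pi>. B \<subseteq> {Suc a..<c}}, {B\<in>\<pi>. B \<subseteq> {Suc c..<b}}) = \<pi>"
          unfolding prod.case by (rule nc_pairings_split(3)[OF h, symmetric])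
      qed
      show "?h ` ?D \<subseteq> Q c" using c nc_pairings_insert by (fastforce simp: Q_def)
      show "(\<lambda>\<pi>. ({B\<in>\<pi>. B \<subseteq> {Suc a..<c}}, {B\<in>\<pi>. B \<subseteq> {Suc c..<b}})) ` Q c \<subseteq> ?D"
        using c nc_pairings_split(1,2) unfolding Q_def by fastforce
    qed
    have "(\<Sum>\<pi>\<in>Q c. \<Prod>B\<in>\<pi>. f (Min B) (Max B)) = (\<Sum>p\<in>?D. \<Prod>B\<in>?h p. f (Min B) (Max B))"
      by (rule sum.reindex_bij_betw[OF bij, symmetric])
    also have "\<dots> = (\<Sum>(\<pi>1, \<pi>2)\<in>?D. f a c * ((\<Prod>B\<in>\<pi>1. f (Min B) (Max B)) * (\<Prod>B\<in>\<pi>2. f (Min B) (Max B))))"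
    proof (intro sum.cong refl, clarify)
      fix \<pi>1 \<pi>2 assume h: "\<pi>1 \<in> nc_pairings {Suc a..<c}" "\<pi>2 \<in> nc_pairings {Suc c..<b}"
      have fin: "finite \<pi>1" "finite \<pi>2" using h
        by (auto simp: nc_pairings_def intro: finite_elements)
      have d: "\<pi>1 \<inter> \<pi>2 = {}" using nc_pairings_subset[OF h(1)] nc_pairings_subset[OF h(2)]
        by (fastforce simp: subset_iff)
      have n: "{a, c} \<notin> \<pi>1 \<union> \<pi>2" using nc_pairings_subset[OF h(1)] nc_pairings_subset[OF h(2)] c by force
      have "Min {a, c} = a" "Max {a, c} = c" using c by auto
      then show "(\<Prod>B\<in>insert {a, c} (\<pi>1 \<union> \<pi>2). f (Min B) (Max B)) =
         f a c * ((\<Prod>B\<in>\<pi>1. f (Min B) (Max B)) * (\<Prod>B\<in>\<pi>2. f (Min B) (Max B)))"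
        using fin d n by (subst prod.insert) (auto simp: prod.union_disjoint)
    qed
    also have "\<dots> = f a c * (pairing_sum f {Suc a..<c} * pairing_sum f {Suc c..<b})"
      unfolding pairing_sum_def sum_product by (simp add: sum_distrib_left sum.cartesian_product case_prod_unfold)
    finally show ?thesis by (simp add: mult.assoc)
  qed
  have "pairing_sum f {a..<b} = (\<Sum>c\<in>{a<..<b}. \<Sum>\<pi>\<in>Q c. \<Prod>B\<in>\<pi>. f (Min B) (Max B))"
    unfolding pairing_sum_def U using fin dis by (subst sum.UNION_disjoint) auto
  then show ?thesis using sumQ by simp
qed

text \<open>The induction runs over words that occur as segments of \<open>js\<close> at any offset
  \<open>a\<close>, because the two pieces in \<open>pairing_sum_rec\<close> start at
  \<open>Suc a\<close> and just after the partner.\<close>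

lemma pairing_sum_sublist:
  "a + length w \<le> length js \<Longrightarrow> w = take (length w) (drop a js) \<Longrightarrow>
   pairing_sum (\<lambda>j k. K (js ! j) (js ! k)) {a..<a + length w} = semicircular_moment K w"
proof (induction w arbitrary: a rule: length_induct)
  case (1 w)
  show ?case
  proof (cases w)
    case Nil
    then show ?thesis by (simp add: pairing_sum_def nc_pairings_empty)
  next
    case (Cons i v)
    have nth: "js ! (a + j) = w ! j" if "j < length w" for j
      using 1(2,3) that by (metis add_leD1 nth_drop nth_take)
    let ?f = "\<lambda>j k. K (js ! j) (js ! k)"
    have "pairing_sum ?f {a..<a + length w} =
       (\<Sum>c\<in>{a<..<a + length w}. ?f a c * pairing_sum ?f {Suc a..<c} * pairing_sum ?f {Suc c..<a + length w})"
      using Cons by (intro pairing_sum_rec) simp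
    also have "\<dots> = (\<Sum>p<length v. ?f a (p + Suc a) * pairing_sum ?f {Suc a..<p + Suc a} *
         pairing_sum ?f {Suc (p + Suc a)..<a + length w})"
    proof -
      have "{a<..<a + length w} = (\<lambda>p. p + Suc a) ` {..<length v}"
      proof (intro equalityI subsetI)
        fix x assume "x \<in> {a<..<a + length w}"
        then have "x = (x - Suc a) + Suc a" "x - Suc a < length v" using Cons by auto
        then show "x \<in> (\<lambda>p. p + Suc a) ` {..<length v}" by blast
      qed (use Cons in auto)
      then show ?thesis by (simp add: sum.reindex inj_on_def)
    qed
    also have "\<dots> = (\<Sum>p<length v. K i (v ! p) * semicircular_moment K (take p v) * semicircular_moment K (drop (Suc p) v))"
    proof (intro sum.cong refl)
      fix p assume p: "p \<in> {..<length v}"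
      have v: "v = take (length v) (drop (Suc a) js)" using 1(3) Cons
        by (metis drop_Suc length_Cons list.sel(3) take_Suc tl_drop tl_take diff_Suc_1)
      have "pairing_sum ?f {Suc a..<Suc a + length (take p v)} = semicircular_moment K (take p v)"
      proof (intro 1(1)[rule_format])
        show "length (take p v) < length w" using Cons by simp
        show "Suc a + length (take p v) \<le> length js" using p 1(2) Cons by simp
        have "take p v = take p (take (length v) (drop (Suc a) js))" using v by simp
        also have "\<dots> = take p (drop (Suc a) js)" using p by (simp add: min_def)
        finally show "take p v = take (length (take p v)) (drop (Suc a) js)" using p by (simp add: min_def)
      qed
      moreover have "pairing_sum ?f {Suc (Suc a + p)..<Suc (Suc a + p) + length (drop (Suc p) v)} =
          semicircular_moment K (drop (Suc p) v)"
      proof (intro 1(1)[rule_format])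
        show "length (drop (Suc p) v) < length w" using Cons by simp
        show "Suc (Suc a + p) + length (drop (Suc p) v) \<le> length js" using p 1(2) Cons by simp
        have "drop (Suc p) v = drop (Suc p) (take (length v) (drop (Suc a) js))" using v by simp
        also have "\<dots> = take (length v - Suc p) (drop (Suc p + Suc a) js)"
          by (simp add: drop_take)
        finally show "drop (Suc p) v = take (length (drop (Suc p) v)) (drop (Suc (Suc a + p)) js)"
          using 1(2) Cons p by (simp add: add.commute min_def)
      qed
      moreover have "?f a (p + Suc a) = K i (v ! p)" using nth[of 0] nth[of "Suc p"] p Cons by (simp add: add.commute)
      moreover have "{Suc a..<p + Suc a} = {Suc a..<Suc a + length (take p v)}"
        "{Suc (p + Suc a)..<a + length w} = {Suc (Suc a + p)..<Suc (Suc a + p) + length (drop (Suc p) v)}"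
        using p Cons by auto
      ultimately show "?f a (p + Suc a) * pairing_sum ?f {Suc a..<p + Suc a} *
         pairing_sum ?f {Suc (p + Suc a)..<a + length w} = K i (v ! p) * semicircular_moment K (take p v) * semicircular_moment K (drop (Suc p) v)"
        by (simp only:)
    qed
    finally show ?thesis using Cons by simp
  qed
qed

lemma semicircular_moment_eq:
  "(\<Sum>\<pi>\<in>noncrossing_pair_partitions (length js). \<Prod>B\<in>\<pi>. K (js ! Min B) (js ! Max B)) = semicircular_moment K js"
  using pairing_sum_sublist[of 0 js js K]
  by (simp add: pairing_sum_def nc_pairings_def noncrossing_pair_partitions_def atLeast0LessThan)

section \<open>Moment bounds\<close>

text \<open>Having all absolute moments is stable under sums and products, so integrability of every
  polynomial expression in the entries is settled by introduction rules.\<close>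

definition has_moments :: "'w measure \<Rightarrow> ('w \<Rightarrow> real) \<Rightarrow> bool" where
  "has_moments M f \<longleftrightarrow> f \<in> borel_measurable M \<and> (\<forall>q::nat. integrable M (\<lambda>\<omega>. \<bar>f \<omega>\<bar> ^ q))"

text \<open>
  Since the bound is required for every \<open>q\<close>, any positive power of \<open>N\<close> in place of
  \<open>sqrt N\<close> gives the same class.  It leaves room for maxima over polynomially many entries.
\<close>

definition moment_bounded :: "'w measure \<Rightarrow> (nat \<Rightarrow> 'w \<Rightarrow> real) \<Rightarrow> bool" where
  "moment_bounded M f \<longleftrightarrow> (\<forall>N\<ge>1. has_moments M (f N)) \<and>
     (\<forall>q::nat. \<exists>C. \<forall>N\<ge>1. (LINT \<omega>|M. \<bar>f N \<omega>\<bar> ^ q) \<le> C * sqrt (real N))"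

context prob_space
begin

lemma has_moments_measurable: "has_moments M f \<Longrightarrow> f \<in> borel_measurable M"
  by (simp add: has_moments_def)

lemma has_moments_integrable: assumes "has_moments M f" shows "integrable M f"
proof -
  have "integrable M (\<lambda>\<omega>. \<bar>f \<omega>\<bar> ^ 1)" using assms unfolding has_moments_def by blast
  then show ?thesis using assms by (auto simp: has_moments_def intro: integrable_abs_cancel)
qed

lemma has_moments_abs_power_integrable: "has_moments M f \<Longrightarrow> integrable M (\<lambda>\<omega>. \<bar>f \<omega>\<bar> ^ q)"
  by (simp add: has_moments_def)

lemma has_moments_bound:
  assumes "has_moments M g" "f \<in> borel_measurable M" "\<And>\<omega>. \<omega> \<in> space M \<Longrightarrow> \<bar>f \<omega>\<bar> \<le> \<bar>g \<omega>\<bar>"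
  shows "has_moments M f"
  unfolding has_moments_def
proof (intro conjI allI)
  fix q :: nat
  have "integrable M (\<lambda>\<omega>. \<bar>g \<omega>\<bar> ^ q)" using assms(1) by (simp add: has_moments_def)
  then show "integrable M (\<lambda>\<omega>. \<bar>f \<omega>\<bar> ^ q)"
    by (rule Bochner_Integration.integrable_bound)
       (use assms in \<open>auto intro!: power_mono AE_I2\<close>)
qed fact

lemma has_moments_const [simp]: "has_moments M (\<lambda>_. c)"
  by (simp add: has_moments_def)

lemma abs_add_power_le: "\<bar>a + b\<bar> ^ q \<le> 2 ^ q * (\<bar>a\<bar> ^ q + \<bar>b\<bar> ^ q)" for a b :: real
proof -
  have "\<bar>a + b\<bar> \<le> 2 * max \<bar>a\<bar> \<bar>b\<bar>" by linarith
  then have "\<bar>a + b\<bar> ^ q \<le> (2 * max \<bar>a\<bar> \<bar>b\<bar>) ^ q" by (rule power_mono) simp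
  also have "\<dots> = 2 ^ q * (max \<bar>a\<bar> \<bar>b\<bar>) ^ q" by (simp add: power_mult_distrib)
  also have "(max \<bar>a\<bar> \<bar>b\<bar>) ^ q \<le> \<bar>a\<bar> ^ q + \<bar>b\<bar> ^ q"
    by (cases "\<bar>a\<bar> \<le> \<bar>b\<bar>") (auto simp: max_def)
  finally show ?thesis by simp
qed

lemma abs_mult_power_le: "\<bar>a * b\<bar> ^ q \<le> \<bar>a\<bar> ^ (2 * q) + \<bar>b\<bar> ^ (2 * q)" for a b :: real
proof -
  have "\<bar>a * b\<bar> ^ q = \<bar>a\<bar> ^ q * \<bar>b\<bar> ^ q" by (simp add: abs_mult power_mult_distrib)
  also have "\<dots> \<le> (\<bar>a\<bar> ^ q)\<^sup>2 + (\<bar>b\<bar> ^ q)\<^sup>2"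
  proof -
    have "0 \<le> \<bar>a\<bar> ^ q * \<bar>b\<bar> ^ q" by simp
    moreover have "2 * (\<bar>a\<bar> ^ q * \<bar>b\<bar> ^ q) \<le> (\<bar>a\<bar> ^ q)\<^sup>2 + (\<bar>b\<bar> ^ q)\<^sup>2"
      using sum_squares_bound[of "\<bar>a\<bar> ^ q" "\<bar>b\<bar> ^ q"] by (simp add: mult.assoc)
    ultimately show ?thesis by linarith
  qed
  finally show ?thesis by (simp add: power_mult[symmetric] mult.commute)
qed

lemma has_moments_add:
  assumes "has_moments M f" "has_moments M g" shows "has_moments M (\<lambda>\<omega>. f \<omega> + g \<omega>)"
  unfolding has_moments_def
proof (intro conjI allI)
  show [measurable]: "(\<lambda>\<omega>. f \<omega> + g \<omega>) \<in> borel_measurable M" using assms by (auto simp: has_moments_def)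
  fix q :: nat
  have "integrable M (\<lambda>\<omega>. 2 ^ q * (\<bar>f \<omega>\<bar> ^ q + \<bar>g \<omega>\<bar> ^ q))"
    using assms by (auto simp: has_moments_def)
  then show "integrable M (\<lambda>\<omega>. \<bar>f \<omega> + g \<omega>\<bar> ^ q)"
    by (rule Bochner_Integration.integrable_bound) (auto intro!: AE_I2 order_trans[OF abs_add_power_le])
qed

lemma has_moments_mult:
  assumes "has_moments M f" "has_moments M g" shows "has_moments M (\<lambda>\<omega>. f \<omega> * g \<omega>)"
  unfolding has_moments_def
proof (intro conjI allI)
  show [measurable]: "(\<lambda>\<omega>. f \<omega> * g \<omega>) \<in> borel_measurable M" using assms by (auto simp: has_moments_def)
  fix q :: nat
  have "integrable M (\<lambda>\<omega>. \<bar>f \<omega>\<bar> ^ (2 * q) + \<bar>g \<omega>\<bar> ^ (2 * q))"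
    using assms by (auto simp: has_moments_def)
  then show "integrable M (\<lambda>\<omega>. \<bar>f \<omega> * g \<omega>\<bar> ^ q)"
    by (rule Bochner_Integration.integrable_bound) (auto intro!: AE_I2 order_trans[OF abs_mult_power_le])
qed

lemma has_moments_abs: "has_moments M f \<Longrightarrow> has_moments M (\<lambda>\<omega>. \<bar>f \<omega>\<bar>)"
  by (auto simp: has_moments_def)

lemma has_moments_diff:
  assumes "has_moments M f" "has_moments M g" shows "has_moments M (\<lambda>\<omega>. f \<omega> - g \<omega>)"
  using has_moments_add[OF assms(1) has_moments_mult[OF has_moments_const[of "-1"] assms(2)]] by simp

lemma has_moments_sum:
  assumes "\<And>i. i \<in> I \<Longrightarrow> has_moments M (f i)" shows "has_moments M (\<lambda>\<omega>. \<Sum>i\<in>I. f i \<omega>)"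
  using assms by (induction I rule: infinite_finite_induct) (auto intro!: has_moments_add)

lemma has_moments_power:
  assumes "has_moments M f" shows "has_moments M (\<lambda>\<omega>. f \<omega> ^ q)"
  by (induction q) (auto intro!: has_moments_mult assms)

lemma moment_bounded_has_moments: "moment_bounded M f \<Longrightarrow> 1 \<le> N \<Longrightarrow> has_moments M (f N)"
  by (simp add: moment_bounded_def)

lemma moment_boundedD:
  assumes "moment_bounded M f"
  obtains C where "C \<ge> 0" "\<And>N. N \<ge> 1 \<Longrightarrow> (LINT \<omega>|M. \<bar>f N \<omega>\<bar> ^ q) \<le> C * sqrt (real N)"
proof -
  obtain C where C: "\<And>N. N \<ge> 1 \<Longrightarrow> (LINT \<omega>|M. \<bar>f N \<omega>\<bar> ^ q) \<le> C * sqrt (real N)"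
    using assms unfolding moment_bounded_def by blast
  show ?thesis
  proof (rule that[of "max C 0"])
    fix N :: nat assume "N \<ge> 1"
    from C[OF this] show "(LINT \<omega>|M. \<bar>f N \<omega>\<bar> ^ q) \<le> max C 0 * sqrt (real N)"
      by (rule order_trans) (simp add: mult_right_mono)
  qed simp
qed

lemma moment_bounded_bound:
  assumes "moment_bounded M g" "\<And>N. N \<ge> 1 \<Longrightarrow> f N \<in> borel_measurable M"
    and "\<And>N \<omega>. N \<ge> 1 \<Longrightarrow> \<omega> \<in> space M \<Longrightarrow> \<bar>f N \<omega>\<bar> \<le> \<bar>g N \<omega>\<bar>"
  shows "moment_bounded M f"
  unfolding moment_bounded_def
proof (intro conjI allI impI)
  fix N :: nat assume N: "1 \<le> N"
  show "has_moments M (f N)"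
    by (rule has_moments_bound[OF moment_bounded_has_moments[OF assms(1) N]]) (use assms N in auto)
next
  fix q
  obtain C where C: "\<And>N. N \<ge> 1 \<Longrightarrow> (LINT \<omega>|M. \<bar>g N \<omega>\<bar> ^ q) \<le> C * sqrt (real N)"
    using assms(1) unfolding moment_bounded_def by blast
  have "(LINT \<omega>|M. \<bar>f N \<omega>\<bar> ^ q) \<le> C * sqrt (real N)" if N: "N \<ge> 1" for N
  proof -
    have gi: "integrable M (\<lambda>\<omega>. \<bar>g N \<omega>\<bar> ^ q)"
      using moment_bounded_has_moments[OF assms(1) N] by (simp add: has_moments_def)
    have "(LINT \<omega>|M. \<bar>f N \<omega>\<bar> ^ q) \<le> (LINT \<omega>|M. \<bar>g N \<omega>\<bar> ^ q)"
      by (rule integral_mono_AE'[OF gi]) (use assms(3)[OF N] in \<open>auto intro!: AE_I2 power_mono\<close>)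
    then show ?thesis using C[OF N] by simp
  qed
  then show "\<exists>C. \<forall>N\<ge>1. (LINT \<omega>|M. \<bar>f N \<omega>\<bar> ^ q) \<le> C * sqrt (real N)" by blast
qed

lemma moment_bounded_const: "moment_bounded M (\<lambda>_ _. c)"
  unfolding moment_bounded_def
proof (intro conjI allI impI)
  fix q
  have "(LINT \<omega>|M. \<bar>c\<bar> ^ q) \<le> \<bar>c\<bar> ^ q * sqrt (real N)" if "N \<ge> 1" for N
    using that by (simp add: prob_space mult_left_mono[of 1 "sqrt (real N)" "\<bar>c\<bar> ^ q", simplified])
  then show "\<exists>C. \<forall>N\<ge>1. (LINT \<omega>|M. \<bar>c\<bar> ^ q) \<le> C * sqrt (real N)" by blast
qed simp

lemma moment_bounded_add:
  assumes "moment_bounded M f" "moment_bounded M g" shows "moment_bounded M (\<lambda>N \<omega>. f N \<omega> + g N \<omega>)"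
  unfolding moment_bounded_def
proof (intro conjI allI impI)
  fix q
  obtain C where C: "\<And>N. N \<ge> 1 \<Longrightarrow> (LINT \<omega>|M. \<bar>f N \<omega>\<bar> ^ q) \<le> C * sqrt (real N)"
    using assms(1) unfolding moment_bounded_def by blast
  obtain D where D: "\<And>N. N \<ge> 1 \<Longrightarrow> (LINT \<omega>|M. \<bar>g N \<omega>\<bar> ^ q) \<le> D * sqrt (real N)"
    using assms(2) unfolding moment_bounded_def by blast
  have "(LINT \<omega>|M. \<bar>f N \<omega> + g N \<omega>\<bar> ^ q) \<le> (2 ^ q * (C + D)) * sqrt (real N)" if N: "N \<ge> 1" for N
  proof -
    have i: "integrable M (\<lambda>\<omega>. \<bar>f N \<omega>\<bar> ^ q)" "integrable M (\<lambda>\<omega>. \<bar>g N \<omega>\<bar> ^ q)"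
      using moment_bounded_has_moments[OF assms(1) N] moment_bounded_has_moments[OF assms(2) N]
      by (simp_all add: has_moments_def)
    have "(LINT \<omega>|M. \<bar>f N \<omega> + g N \<omega>\<bar> ^ q) \<le> (LINT \<omega>|M. 2 ^ q * (\<bar>f N \<omega>\<bar> ^ q + \<bar>g N \<omega>\<bar> ^ q))"
      by (rule integral_mono_AE') (use i in \<open>auto intro!: AE_I2 abs_add_power_le\<close>)
    also have "\<dots> = 2 ^ q * ((LINT \<omega>|M. \<bar>f N \<omega>\<bar> ^ q) + (LINT \<omega>|M. \<bar>g N \<omega>\<bar> ^ q))" using i by simp
    also have "\<dots> \<le> 2 ^ q * (C * sqrt (real N) + D * sqrt (real N))"
      by (intro mult_left_mono add_mono C D N) simp
    finally show ?thesis by (simp add: algebra_simps)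
  qed
  then show "\<exists>C. \<forall>N\<ge>1. (LINT \<omega>|M. \<bar>f N \<omega> + g N \<omega>\<bar> ^ q) \<le> C * sqrt (real N)" by blast
qed (use assms in \<open>auto simp: moment_bounded_def intro!: has_moments_add\<close>)

lemma moment_bounded_mult:
  assumes "moment_bounded M f" "moment_bounded M g" shows "moment_bounded M (\<lambda>N \<omega>. f N \<omega> * g N \<omega>)"
  unfolding moment_bounded_def
proof (intro conjI allI impI)
  fix q
  obtain C where C: "\<And>N. N \<ge> 1 \<Longrightarrow> (LINT \<omega>|M. \<bar>f N \<omega>\<bar> ^ (2 * q)) \<le> C * sqrt (real N)"
    using assms(1) unfolding moment_bounded_def by blast
  obtain D where D: "\<And>N. N \<ge> 1 \<Longrightarrow> (LINT \<omega>|M. \<bar>g N \<omega>\<bar> ^ (2 * q)) \<le> D * sqrt (real N)"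
    using assms(2) unfolding moment_bounded_def by blast
  have "(LINT \<omega>|M. \<bar>f N \<omega> * g N \<omega>\<bar> ^ q) \<le> (C + D) * sqrt (real N)" if N: "N \<ge> 1" for N
  proof -
    have i: "integrable M (\<lambda>\<omega>. \<bar>f N \<omega>\<bar> ^ (2 * q))" "integrable M (\<lambda>\<omega>. \<bar>g N \<omega>\<bar> ^ (2 * q))"
      using moment_bounded_has_moments[OF assms(1) N] moment_bounded_has_moments[OF assms(2) N]
      unfolding has_moments_def by blast+
    have "(LINT \<omega>|M. \<bar>f N \<omega> * g N \<omega>\<bar> ^ q) \<le> (LINT \<omega>|M. \<bar>f N \<omega>\<bar> ^ (2 * q) + \<bar>g N \<omega>\<bar> ^ (2 * q))"
      by (rule integral_mono_AE') (use i in \<open>auto intro!: AE_I2 abs_mult_power_le\<close>)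
    also have "\<dots> = (LINT \<omega>|M. \<bar>f N \<omega>\<bar> ^ (2 * q)) + (LINT \<omega>|M. \<bar>g N \<omega>\<bar> ^ (2 * q))"
      by (rule Bochner_Integration.integral_add[OF i])
    also have "\<dots> \<le> C * sqrt (real N) + D * sqrt (real N)"
      by (intro add_mono C D N)
    finally show ?thesis by (simp add: algebra_simps)
  qed
  then show "\<exists>C. \<forall>N\<ge>1. (LINT \<omega>|M. \<bar>f N \<omega> * g N \<omega>\<bar> ^ q) \<le> C * sqrt (real N)" by blast
qed (use assms in \<open>auto simp: moment_bounded_def intro!: has_moments_mult\<close>)

lemma moment_bounded_abs: "moment_bounded M f \<Longrightarrow> moment_bounded M (\<lambda>N \<omega>. \<bar>f N \<omega>\<bar>)"
  by (auto simp: moment_bounded_def intro: has_moments_abs)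

lemma moment_bounded_sum:
  assumes "\<And>i. i \<in> I \<Longrightarrow> moment_bounded M (f i)" shows "moment_bounded M (\<lambda>N \<omega>. \<Sum>i\<in>I. f i N \<omega>)"
  using assms by (induction I rule: infinite_finite_induct) (auto intro!: moment_bounded_add moment_bounded_const)

lemma moment_bounded_power:
  assumes "moment_bounded M f" shows "moment_bounded M (\<lambda>N \<omega>. f N \<omega> ^ q)"
  by (induction q) (auto intro!: moment_bounded_mult assms moment_bounded_const)

text \<open>
  Taking expectations turns a bound for high powers with a poor rate into the rate \<open>sqrt N\<close>.
\<close>

lemma power_interpolate:
  fixes y :: real and N r :: nat
  assumes "0 \<le> y" "1 \<le> N" "1 \<le> r"
  shows "y \<le> sqrt (real N) + y ^ r / sqrt (real N) ^ (r - 1)"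
proof (cases "y \<le> sqrt (real N)")
  case True
  then show ?thesis using assms by (simp add: add_increasing2)
next
  case False
  have s: "sqrt (real N) > 0" using assms by simp
  have "sqrt (real N) ^ (r - 1) \<le> y ^ (r - 1)" using False by (intro power_mono) auto
  then have "y * sqrt (real N) ^ (r - 1) \<le> y * y ^ (r - 1)" using assms by (intro mult_left_mono)
  also have "y * y ^ (r - 1) = y ^ r" using assms by (metis Suc_diff_le diff_Suc_1 One_nat_def power_Suc)
  finally have "y \<le> y ^ r / sqrt (real N) ^ (r - 1)" using s by (simp add: pos_le_divide_eq)
  then show ?thesis using s by (simp add: add_increasing)
qed

lemma integral_power_interpolate:
  fixes r N :: nat
  assumes "has_moments M f" "1 \<le> N" "1 \<le> r" "(LINT \<omega>|M. \<bar>f \<omega>\<bar> ^ (q * r)) \<le> C * sqrt (real N) ^ r"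
  shows "(LINT \<omega>|M. \<bar>f \<omega>\<bar> ^ q) \<le> (1 + C) * sqrt (real N)"
proof -
  have s: "sqrt (real N) > 0" using assms by simp
  have i: "integrable M (\<lambda>\<omega>. \<bar>f \<omega>\<bar> ^ (q * r))" using assms(1) by (simp add: has_moments_def)
  have "(LINT \<omega>|M. \<bar>f \<omega>\<bar> ^ q) \<le> (LINT \<omega>|M. sqrt (real N) + \<bar>f \<omega>\<bar> ^ (q * r) / sqrt (real N) ^ (r - 1))"
    by (rule integral_mono_AE')
       (use i power_interpolate[OF _ assms(2,3), of "\<bar>f _\<bar> ^ q"] in \<open>auto intro!: AE_I2 simp: power_mult\<close>)
  also have "\<dots> = sqrt (real N) + (LINT \<omega>|M. \<bar>f \<omega>\<bar> ^ (q * r)) / sqrt (real N) ^ (r - 1)"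
    using i by (simp add: prob_space)
  also have "\<dots> \<le> sqrt (real N) + C * sqrt (real N) ^ r / sqrt (real N) ^ (r - 1)"
    by (intro add_left_mono divide_right_mono assms) simp
  also have "C * sqrt (real N) ^ r / sqrt (real N) ^ (r - 1) = C * sqrt (real N)"
  proof -
    have "sqrt (real N) ^ r = sqrt (real N) * sqrt (real N) ^ (r - 1)"
      using assms(3) by (metis Suc_diff_le diff_Suc_1 One_nat_def power_Suc)
    then show ?thesis using s by simp
  qed
  finally show ?thesis by (simp add: algebra_simps)
qed

end

section \<open>Coefficients of the contracted tensor\<close>

definition entry_index :: "nat \<Rightarrow> nat \<Rightarrow> nat list set" where
  "entry_index N d = {ks \<in> multi_index N d. sorted ks}"

lemma finite_multi_index [simp]: "finite (multi_index N p)"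
  unfolding multi_index_def by (rule finite_subset[OF _ finite_lists_length_eq[of "{..<N}" p]]) auto

lemma card_multi_index: "card (multi_index N p) = N ^ p"
proof -
  have "multi_index N p = {xs. set xs \<subseteq> {..<N} \<and> length xs = p}" by (auto simp: multi_index_def)
  then show ?thesis by (simp add: card_lists_length_eq)
qed

lemma finite_entry_index [simp]: "finite (entry_index N d)"
  by (simp add: entry_index_def)

lemma card_entry_index: "card (entry_index N d) \<le> N ^ d"
  unfolding card_multi_index[symmetric] by (rule card_mono) (auto simp: entry_index_def)

text \<open>The inserted \<open>1\<close> keeps the set nonempty and the value at least one, so that
  its powers increase with the exponent.\<close>

definition entry_max :: "nat list set \<Rightarrow> (nat list \<Rightarrow> real) \<Rightarrow> real" where
  "entry_max S x = Max (insert 1 ((\<lambda>k. \<bar>x k\<bar>) ` S))"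

lemma entry_max_ge: "finite S \<Longrightarrow> k \<in> S \<Longrightarrow> \<bar>x k\<bar> \<le> entry_max S x"
  unfolding entry_max_def by (intro Max_ge) auto

lemma entry_max_ge1: "finite S \<Longrightarrow> 1 \<le> entry_max S x"
  unfolding entry_max_def by (intro Max_ge) auto

lemma entry_max_power:
  assumes "finite S" shows "entry_max S x ^ q \<le> 1 + (\<Sum>k\<in>S. \<bar>x k\<bar> ^ q)"
proof -
  have "entry_max S x \<in> insert 1 ((\<lambda>k. \<bar>x k\<bar>) ` S)"
    unfolding entry_max_def by (rule Max_in) (use assms in auto)
  then consider "entry_max S x = 1" | k where "k \<in> S" "entry_max S x = \<bar>x k\<bar>" by auto
  then show ?thesis
  proof cases
    case 1 then show ?thesis by (simp add: sum_nonneg)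
  next
    case 2
    have "\<bar>x k\<bar> ^ q \<le> (\<Sum>k\<in>S. \<bar>x k\<bar> ^ q)" using 2 assms by (intro member_le_sum) auto
    then show ?thesis using 2 by simp
  qed
qed

section \<open>Independence and maximum of the tensor entries\<close>

context wigner_tensor
begin

text \<open>Restriction makes this a random element of a product space. Functionals of the entries
  are then Borel functions on that space, which can be evaluated again after one entry is replaced
  by \<open>0\<close>.\<close>

definition entries :: "nat \<Rightarrow> 'w \<Rightarrow> nat list \<Rightarrow> real" where
  "entries N \<omega> = restrict (\<lambda>k. X N k \<omega>) (entry_index N d)"

lemma X_measurable [measurable]: "k \<in> entry_index N d \<Longrightarrow> X N k \<in> borel_measurable M"
  using indep unfolding indep_vars_def by (force simp: entry_index_def)

lemma entries_measurable [measurable]: "entries N \<in> measurable M (PiM (entry_index N d) (\<lambda>_. borel))"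
  unfolding entries_def by (rule measurable_restrict) measurable

lemma has_moments_X: "k \<in> entry_index N d \<Longrightarrow> has_moments M (X N k)"
  unfolding has_moments_def using X_measurable moments by (force simp: entry_index_def)

text \<open>The modified family is a function of the coordinates other than \<open>k\<close>, hence
  independent of \<open>X N k\<close>, and expectations factorize.\<close>

lemma leave_one_out_expectation:
  fixes g :: "(nat list \<Rightarrow> real) \<Rightarrow> real" and h :: "real \<Rightarrow> real"
  assumes k: "k \<in> entry_index N d"
    and g: "g \<in> borel_measurable (PiM (entry_index N d) (\<lambda>_. borel :: real measure))"
    and h: "h \<in> borel_measurable borel"
    and int: "integrable M (\<lambda>\<omega>. h (X N k \<omega>))" "integrable M (\<lambda>\<omega>. g ((entries N \<omega>)(k := 0)))"
  shows "expectation (\<lambda>\<omega>. h (X N k \<omega>) * g ((entries N \<omega>)(k := 0))) =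
         expectation (\<lambda>\<omega>. h (X N k \<omega>)) * expectation (\<lambda>\<omega>. g ((entries N \<omega>)(k := 0)))"
proof -
  let ?S = "entry_index N d" and ?Y = "\<lambda>(N, ks). X N ks"
  let ?A = "{(N, k)}" and ?B = "{N} \<times> (?S - {k})"
  \<comment> \<open>Rebuilds the modified family from the coordinates in \<open>?B\<close> alone:
    the value at \<open>k\<close> is \<open>0\<close> whatever the entry was.\<close>
  let ?ext = "\<lambda>f. \<lambda>j\<in>?S. if j = k then 0 else f (N, j) :: real"
  have iv: "indep_var (PiM ?A (\<lambda>_. borel)) (\<lambda>\<omega>. restrict (\<lambda>i. ?Y i \<omega>) ?A)
                  (PiM ?B (\<lambda>_. borel)) (\<lambda>\<omega>. restrict (\<lambda>i. ?Y i \<omega>) ?B)"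
    by (rule indep_var_restrict[OF indep]) (use k in \<open>auto simp: entry_index_def\<close>)
  have m1: "(\<lambda>f. h (f (N, k))) \<in> borel_measurable (PiM ?A (\<lambda>_. borel :: real measure))"
    by (rule measurable_compose[OF measurable_component_singleton[of "(N, k)" ?A "\<lambda>_. borel"] h]) simp
  have "?ext \<in> measurable (PiM ?B (\<lambda>_. borel :: real measure)) (PiM ?S (\<lambda>_. borel))"
  proof (rule measurable_restrict)
    fix i assume i: "i \<in> ?S"
    show "(\<lambda>x. if i = k then 0 else x (N, i)) \<in> borel_measurable (PiM ?B (\<lambda>_. borel :: real measure))"
    proof (cases "i = k")
      case False
      then have "(N, i) \<in> ?B" using i by auto
      from measurable_component_singleton[OF this, of "\<lambda>_. borel"] show ?thesis using False by simp
    qed simp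
  qed
  then have m2: "(\<lambda>f. g (?ext f)) \<in> borel_measurable (PiM ?B (\<lambda>_. borel :: real measure))"
    by (rule measurable_compose[OF _ g])
  have "indep_var borel ((\<lambda>f. h (f (N, k))) \<circ> (\<lambda>\<omega>. restrict (\<lambda>i. ?Y i \<omega>) ?A))
                  borel ((\<lambda>f. g (?ext f)) \<circ> (\<lambda>\<omega>. restrict (\<lambda>i. ?Y i \<omega>) ?B))"
    by (rule indep_var_compose[OF iv m1 m2])
  moreover have "(\<lambda>f. h (f (N, k))) \<circ> (\<lambda>\<omega>. restrict (\<lambda>i. ?Y i \<omega>) ?A) = (\<lambda>\<omega>. h (X N k \<omega>))"
    by auto
  moreover have "(\<lambda>f. g (?ext f)) \<circ> (\<lambda>\<omega>. restrict (\<lambda>i. ?Y i \<omega>) ?B) = (\<lambda>\<omega>. g ((entries N \<omega>)(k := 0)))"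
  proof -
    have "?ext (restrict (\<lambda>i. ?Y i \<omega>) ?B) = (entries N \<omega>)(k := 0)" for \<omega>
      using k by (auto simp: entries_def fun_eq_iff)
    then show ?thesis by (simp only: comp_def)
  qed
  ultimately have iv2: "indep_var borel (\<lambda>\<omega>. h (X N k \<omega>)) borel (\<lambda>\<omega>. g ((entries N \<omega>)(k := 0)))"
    by simp
  show ?thesis by (rule indep_var_lebesgue_integral[OF iv2 int])
qed

lemma entry_max_measurable:
  assumes "finite S" "S \<subseteq> entry_index N d"
  shows "entry_max S \<in> borel_measurable (PiM (entry_index N d) (\<lambda>_. borel :: real measure))"
proof -
  \<comment> \<open>\<open>None\<close> indexes the constant \<open>1\<close>, which turns the
    expression into a maximum of finitely many measurable functions.\<close>
  have *: "entry_max S = (\<lambda>x. Max ((\<lambda>z. case z of None \<Rightarrow> 1 | Some k \<Rightarrow> \<bar>x k\<bar>) ` insert None (Some ` S)))"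
    by (auto simp: entry_max_def image_image fun_eq_iff)
  show ?thesis unfolding *
  proof (rule borel_measurable_Max)
    fix i assume i: "i \<in> insert None (Some ` S)"
    show "(\<lambda>x. case i of None \<Rightarrow> 1 | Some k \<Rightarrow> \<bar>x k\<bar>) \<in> borel_measurable (PiM (entry_index N d) (\<lambda>_. borel :: real measure))"
    proof (cases i)
      case (Some k)
      then have "k \<in> entry_index N d" using i assms by auto
      from measurable_component_singleton[OF this, of "\<lambda>_. borel"]
      have [measurable]: "(\<lambda>x. x k) \<in> borel_measurable (PiM (entry_index N d) (\<lambda>_. borel :: real measure))" by simp
      show ?thesis unfolding Some option.case by measurable
    qed simp
  qed (use assms in auto)
qed

definition Xmax :: "nat \<Rightarrow> 'w \<Rightarrow> real" where
  "Xmax N \<omega> = entry_max (entry_index N d) (entries N \<omega>)"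

lemma Xmax_ge: "k \<in> entry_index N d \<Longrightarrow> \<bar>X N k \<omega>\<bar> \<le> Xmax N \<omega>"
  unfolding Xmax_def using entry_max_ge[of "entry_index N d" k "entries N \<omega>"] by (simp add: entries_def)

lemma Xmax_ge1: "1 \<le> Xmax N \<omega>"
  unfolding Xmax_def by (rule entry_max_ge1) simp

lemma Xmax_power_le: "Xmax N \<omega> ^ q \<le> 1 + (\<Sum>k\<in>entry_index N d. \<bar>X N k \<omega>\<bar> ^ q)"
  using entry_max_power[of "entry_index N d" "entries N \<omega>" q] by (simp add: Xmax_def entries_def)

lemma Xmax_measurable [measurable]: "Xmax N \<in> borel_measurable M"
  unfolding Xmax_def[abs_def]
  by (rule measurable_compose[OF entries_measurable entry_max_measurable]) auto

lemma Xmax_moments: "has_moments M (Xmax N)"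
proof (rule has_moments_bound)
  show "has_moments M (\<lambda>\<omega>. 1 + (\<Sum>k\<in>entry_index N d. \<bar>X N k \<omega>\<bar>))"
    by (intro has_moments_add has_moments_sum has_moments_abs has_moments_X has_moments_const)
  show "\<bar>Xmax N \<omega>\<bar> \<le> \<bar>1 + (\<Sum>k\<in>entry_index N d. \<bar>X N k \<omega>\<bar>)\<bar>" for \<omega>
    using Xmax_power_le[of N \<omega> 1] Xmax_ge1[of N \<omega>] by (simp add: sum_nonneg)
qed measurable

text \<open>Bounding the maximum by a sum over at most \<open>N ^ d\<close> entries loses a power of
  \<open>N\<close>; interpolation from a moment of higher order repairs this.\<close>

lemma Xmax_moment_bounded: "moment_bounded M Xmax"
  unfolding moment_bounded_def
proof (intro conjI allI impI Xmax_moments)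
  fix q
  \<comment> \<open>\<open>sqrt N ^ r\<close> equals \<open>N ^ max 1 d\<close>, which dominates the
    number of entries; the \<open>max\<close> keeps \<open>r \<ge> 1\<close>.\<close>
  define r where "r = 2 * max 1 d"
  obtain C where C: "\<forall>N. \<forall>ks\<in>multi_index N d. sorted ks \<longrightarrow>
       integrable M (\<lambda>\<omega>. \<bar>X N ks \<omega>\<bar> ^ (q * r)) \<and> expectation (\<lambda>\<omega>. \<bar>X N ks \<omega>\<bar> ^ (q * r)) \<le> C"
    using moments by blast
  have "(LINT \<omega>|M. \<bar>Xmax N \<omega>\<bar> ^ q) \<le> (1 + (1 + \<bar>C\<bar>)) * sqrt (real N)" if N: "N \<ge> 1" for N
  proof (rule integral_power_interpolate[OF Xmax_moments N])
    show "1 \<le> r" by (simp add: r_def)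
    have i: "integrable M (\<lambda>\<omega>. \<bar>X N k \<omega>\<bar> ^ (q * r))" if "k \<in> entry_index N d" for k
      using has_moments_X[OF that] by (simp add: has_moments_def)
    have "(LINT \<omega>|M. \<bar>Xmax N \<omega>\<bar> ^ (q * r)) \<le> (LINT \<omega>|M. 1 + (\<Sum>k\<in>entry_index N d. \<bar>X N k \<omega>\<bar> ^ (q * r)))"
    proof (rule integral_mono_AE')
      show "AE \<omega> in M. \<bar>Xmax N \<omega>\<bar> ^ (q * r) \<le> 1 + (\<Sum>k\<in>entry_index N d. \<bar>X N k \<omega>\<bar> ^ (q * r))"
        using Xmax_power_le[of N _ "q * r"] Xmax_ge1[of N] by (auto intro!: AE_I2 simp: abs_of_nonneg order_trans[OF zero_le_one])
    qed (use i in \<open>auto intro!: AE_I2 add_nonneg_nonneg sum_nonneg\<close>)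
    also have "\<dots> = 1 + (\<Sum>k\<in>entry_index N d. LINT \<omega>|M. \<bar>X N k \<omega>\<bar> ^ (q * r))"
      using i by (simp add: prob_space)
    also have "\<dots> \<le> 1 + (\<Sum>k\<in>entry_index N d. \<bar>C\<bar>)"
    proof (intro add_left_mono sum_mono)
      fix k assume "k \<in> entry_index N d"
      then have "expectation (\<lambda>\<omega>. \<bar>X N k \<omega>\<bar> ^ (q * r)) \<le> C" using C by (auto simp: entry_index_def)
      then show "expectation (\<lambda>\<omega>. \<bar>X N k \<omega>\<bar> ^ (q * r)) \<le> \<bar>C\<bar>" by simp
    qed
    also have "\<dots> \<le> (1 + \<bar>C\<bar>) * sqrt (real N) ^ r"
    proof -
      have "real (card (entry_index N d)) \<le> real N ^ d"
        using card_entry_index[of N d] by (metis of_nat_le_iff of_nat_power)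
      also have "\<dots> \<le> real N ^ max 1 d" using N by (intro power_increasing) auto
      also have "\<dots> = sqrt (real N) ^ r" by (simp add: r_def power_mult)
      finally have 1: "real (card (entry_index N d)) \<le> sqrt (real N) ^ r" .
      have 2: "1 \<le> sqrt (real N) ^ r" using N by simp
      have "real (card (entry_index N d)) * \<bar>C\<bar> \<le> sqrt (real N) ^ r * \<bar>C\<bar>"
        using 1 by (intro mult_right_mono) auto
      then show ?thesis using 2 by (simp add: algebra_simps)
    qed
    finally show "(LINT \<omega>|M. \<bar>Xmax N \<omega>\<bar> ^ (q * r)) \<le> (1 + \<bar>C\<bar>) * sqrt (real N) ^ r" .
  qed
  then show "\<exists>C. \<forall>N\<ge>1. (LINT \<omega>|M. \<bar>Xmax N \<omega>\<bar> ^ q) \<le> C * sqrt (real N)" by blast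
qed

end

section \<open>Rearrangements of multi-indices and products of unit vectors\<close>

definition rearrangements :: "nat \<Rightarrow> nat list \<Rightarrow> nat list set" where
  "rearrangements N s = {s' \<in> multi_index N (length s). sort s' = sort s}"

lemma sort_eq_iff_mset: "sort xs = sort ys \<longleftrightarrow> mset xs = mset (ys :: nat list)"
  by (metis mset_sort properties_for_sort sorted_sort)

lemma finite_rearrangements [simp]: "finite (rearrangements N s)"
  by (simp add: rearrangements_def)

lemma card_rearrangements: "card (rearrangements N s) \<le> fact (length s)"
proof -
  have "card (rearrangements N s) \<le> card (permutations_of_multiset (mset s))"
    by (rule card_mono[OF finite_permutations_of_multiset]) (auto simp: rearrangements_def permutations_of_multiset_def sort_eq_iff_mset)
  also have "\<dots> \<le> fact (size (mset s))"
    unfolding card_permutations_of_multiset(1) by simp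
  finally show ?thesis by simp
qed

lemma sum_multi_index_Suc: "(\<Sum>s\<in>multi_index N (Suc p). f s) = (\<Sum>a<N. \<Sum>l\<in>multi_index N p. f (a # l))"
proof -
  have "multi_index N (Suc p) = (\<lambda>(a, l). a # l) ` ({..<N} \<times> multi_index N p)"
    by (auto simp: multi_index_def length_Suc_conv)
  then show ?thesis
    by (simp add: sum.reindex inj_on_def sum.cartesian_product case_prod_unfold)
qed

lemma sum_multi_index_0: "(\<Sum>s\<in>multi_index N 0. f s) = f []"
proof -
  have "multi_index N 0 = {[]}" by (auto simp: multi_index_def)
  then show ?thesis by simp
qed

lemma tensor_prod_Nil [simp]: "tensor_prod [] ks = 1"
  by (simp add: tensor_prod_def)

lemma tensor_prod_Cons [simp]: "tensor_prod (v # vs) (k # ks) = vec_index v k * tensor_prod vs ks"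
  by (simp add: tensor_prod_def prod.lessThan_Suc_shift del: prod.lessThan_Suc)

lemma tensor_prod_norm:
  assumes "\<And>v. v \<in> set vs \<Longrightarrow> v \<in> unit_sphere N"
  shows "(\<Sum>l\<in>multi_index N (length vs). (tensor_prod vs l)\<^sup>2) = 1"
  using assms
proof (induction vs)
  case Nil
  then show ?case by (simp add: card_multi_index)
next
  case (Cons v vs)
  have "v \<in> unit_sphere N" using Cons by simp
  then have v: "(\<Sum>a<N. (vec_index v a)\<^sup>2) = 1"
    by (auto simp: unit_sphere_def scalar_prod_def power2_eq_square atLeast0LessThan)
  have "(\<Sum>l\<in>multi_index N (length (v # vs)). (tensor_prod (v # vs) l)\<^sup>2) =
     (\<Sum>a<N. (vec_index v a)\<^sup>2 * (\<Sum>l\<in>multi_index N (length vs). (tensor_prod vs l)\<^sup>2))"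
    by (simp add: sum_multi_index_Suc power_mult_distrib sum_distrib_left)
  then show ?case using v Cons by simp
qed

section \<open>Coefficient matrices of single entries\<close>

locale contraction_coefficients =
  fixes N d :: nat
  assumes d3: "d \<ge> 3" and N1: "N \<ge> 1"
begin

text \<open>The matrix that multiplies the entry \<open>x k\<close> in the contraction, without the
  factor \<open>1 / sqrt N\<close>. It is formed for a general tensor \<open>U\<close> of order
  \<open>d - 2\<close>, whose Euclidean norm is what the estimates refer to.\<close>

definition coefm :: "(nat list \<Rightarrow> real) \<Rightarrow> nat list \<Rightarrow> fmat" where
  "coefm U k = (\<lambda>a b. if a < N \<and> b < N then
      (\<Sum>l\<in>multi_index N (d - 2). if sort (a # b # l) = k then U l else 0) else 0)"

text \<open>The contracted matrix as a deterministic function of the family of entries;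
  \<open>sort\<close> implements the symmetry of the tensor.\<close>

definition ensm :: "(nat list \<Rightarrow> real) \<Rightarrow> (nat list \<Rightarrow> real) \<Rightarrow> fmat" where
  "ensm U x = (\<lambda>a b. if a < N \<and> b < N then
      (\<Sum>l\<in>multi_index N (d - 2). x (sort (a # b # l)) * U l) / sqrt (real N) else 0)"

lemma d_eq: "d = Suc (Suc (d - 2))" using d3 by simp

lemma sum_MI: "(\<Sum>s\<in>multi_index N d. f s) = (\<Sum>a<N. \<Sum>b<N. \<Sum>l\<in>multi_index N (d - 2). f (a # b # l))"
  by (subst d_eq) (simp add: sum_multi_index_Suc)

lemma Cons2_MI: "a < N \<Longrightarrow> b < N \<Longrightarrow> l \<in> multi_index N (d - 2) \<Longrightarrow> a # b # l \<in> multi_index N d"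
  using d3 by (auto simp: multi_index_def)

lemma sort_MI: "s \<in> multi_index N d \<Longrightarrow> sort s \<in> entry_index N d"
  by (auto simp: multi_index_def entry_index_def)

text \<open>Translates between tuples grouped by the entry that they name and the triple of row,
  column and contracted indices.\<close>

lemma sum_fiber:
  "(\<Sum>s\<in>{s\<in>multi_index N d. sort s = k}. f s) =
   (\<Sum>a<N. \<Sum>b<N. \<Sum>l\<in>multi_index N (d - 2). if sort (a # b # l) = k then f (a # b # l) else 0)"
proof -
  have "(\<Sum>s\<in>{s\<in>multi_index N d. sort s = k}. f s) = (\<Sum>s\<in>multi_index N d. if sort s = k then f s else 0)"
    by (simp add: sum.If_cases Int_def)
  then show ?thesis by (simp add: sum_MI)
qed

lemma sum_fibers: "(\<Sum>k\<in>entry_index N d. \<Sum>s\<in>{s\<in>multi_index N d. sort s = k}. f s) = (\<Sum>s\<in>multi_index N d. f s)"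
  by (rule sum.group) (auto simp: sort_MI)

lemma card_fiber: "card {s\<in>multi_index N d. sort s = k} \<le> fact d"
proof (cases "{s\<in>multi_index N d. sort s = k} = {}")
  case False
  then obtain s where s: "s \<in> multi_index N d" "sort s = k" by auto
  then have "length s = d" by (simp add: multi_index_def)
  then have "{s\<in>multi_index N d. sort s = k} = rearrangements N s" using s by (auto simp: rearrangements_def)
  then show ?thesis using card_rearrangements[of N s] \<open>length s = d\<close> by simp
next
  case True
  then show ?thesis by (simp only: card.empty)
qed

lemma card_fiber_real: "real (card {s\<in>multi_index N d. sort s = k}) \<le> fact d"
  by (metis card_fiber of_nat_fact of_nat_le_iff)

lemma msupp_coefm [simp]: "msupp N (coefm U k)"
  by (auto simp: msupp_def coefm_def split: if_splits)

lemma msupp_ensm [simp]: "msupp N (ensm U x)"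
  by (auto simp: msupp_def ensm_def split: if_splits)

lemma coefm_sym: "coefm U k a b = coefm U k b a"
proof -
  have "sort (a # b # l) = sort (b # a # l)" for l by (subst sort_eq_iff_mset) (simp add: add_mset_commute)
  then show ?thesis unfolding coefm_def by auto
qed

lemma ensm_sym: "ensm U x a b = ensm U x b a"
proof -
  have "sort (a # b # l) = sort (b # a # l)" for l by (subst sort_eq_iff_mset) (simp add: add_mset_commute)
  then show ?thesis unfolding ensm_def by auto
qed

lemma ensm_expand:
  "ensm U x = (\<lambda>a b. \<Sum>k\<in>entry_index N d. mscale (x k / sqrt (real N)) (coefm U k) a b)"
proof (intro ext)
  fix a b
  show "ensm U x a b = (\<Sum>k\<in>entry_index N d. mscale (x k / sqrt (real N)) (coefm U k) a b)"
  proof (cases "a < N \<and> b < N")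
    case True
    have "x (sort (a # b # l)) * U l = (\<Sum>k\<in>entry_index N d. x k * (if sort (a # b # l) = k then U l else 0))"
      if "l \<in> multi_index N (d - 2)" for l
    proof -
      have "sort (a # b # l) \<in> entry_index N d" using sort_MI[OF Cons2_MI[of a b l]] True that by simp
      then show ?thesis by (simp add: if_distrib cong: if_cong)
    qed
    then have "ensm U x a b = (\<Sum>l\<in>multi_index N (d - 2). \<Sum>k\<in>entry_index N d. x k * (if sort (a # b # l) = k then U l else 0)) / sqrt (real N)"
      using True by (simp add: ensm_def)
    also have "\<dots> = (\<Sum>k\<in>entry_index N d. \<Sum>l\<in>multi_index N (d - 2). x k * (if sort (a # b # l) = k then U l else 0)) / sqrt (real N)"
      by (subst sum.swap) rule
    also have "\<dots> = (\<Sum>k\<in>entry_index N d. mscale (x k / sqrt (real N)) (coefm U k) a b)"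
      using True by (simp add: mscale_def coefm_def sum_distrib_left sum_divide_distrib)
    finally show ?thesis .
  qed (auto simp: ensm_def mscale_def coefm_def)
qed

lemma ensm_leave_one_out:
  assumes "k \<in> entry_index N d"
  shows "msub (ensm U x) (ensm U (x(k := 0))) = mscale (x k / sqrt (real N)) (coefm U k)"
proof (intro ext)
  fix a b
  have "ensm U y a b = (\<Sum>j\<in>entry_index N d - {k}. mscale (y j / sqrt (real N)) (coefm U j) a b) + mscale (y k / sqrt (real N)) (coefm U k) a b" for y
    unfolding ensm_expand using assms by (subst sum.remove[of _ k]) auto
  note this[of x] this[of "x(k := 0)"]
  moreover have "(\<Sum>j\<in>entry_index N d - {k}. mscale ((x(k := 0)) j / sqrt (real N)) (coefm U j) a b) =
     (\<Sum>j\<in>entry_index N d - {k}. mscale (x j / sqrt (real N)) (coefm U j) a b)"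
    by (intro sum.cong) auto
  moreover have "mscale ((x(k := 0)) k / sqrt (real N)) (coefm U k) a b = 0" by (simp add: mscale_def)
  ultimately show "msub (ensm U x) (ensm U (x(k := 0))) a b = mscale (x k / sqrt (real N)) (coefm U k) a b"
    by (simp add: msub_def)
qed

text \<open>Norm at most one instead of equal to one admits the zero tensor, which is later assigned
  to labels outside \<open>I\<close>.\<close>

definition subunit :: "(nat list \<Rightarrow> real) \<Rightarrow> bool" where
  "subunit U \<longleftrightarrow> (\<Sum>l\<in>multi_index N (d - 2). (U l)\<^sup>2) \<le> 1"

lemma subunit_abs_le: assumes "subunit U" "l \<in> multi_index N (d - 2)" shows "\<bar>U l\<bar> \<le> 1"
proof -
  have "(U l)\<^sup>2 \<le> (\<Sum>l\<in>multi_index N (d - 2). (U l)\<^sup>2)"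
    using assms by (intro member_le_sum) auto
  then have "(U l)\<^sup>2 \<le> 1" using assms by (simp add: subunit_def)
  then show ?thesis by (simp add: abs_square_le_1)
qed

lemma l1n_coefm_le: "l1n N (coefm U k) \<le> (\<Sum>s\<in>{s\<in>multi_index N d. sort s = k}. \<bar>U (drop 2 s)\<bar>)"
  unfolding sum_fiber l1n_def
proof (intro sum_mono)
  fix a b assume "a \<in> {..<N}" "b \<in> {..<N}"
  then have "\<bar>coefm U k a b\<bar> \<le> (\<Sum>l\<in>multi_index N (d - 2). \<bar>if sort (a # b # l) = k then U l else 0\<bar>)"
    by (simp add: coefm_def)
  also have "\<dots> = (\<Sum>l\<in>multi_index N (d - 2). if sort (a # b # l) = k then \<bar>U (drop 2 (a # b # l))\<bar> else 0)"
    by (intro sum.cong) auto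
  finally show "\<bar>coefm U k a b\<bar> \<le> \<dots>" .
qed

lemma drop2_MI: "s \<in> multi_index N d \<Longrightarrow> drop 2 s \<in> multi_index N (d - 2)"
  by (auto simp: multi_index_def dest: in_set_dropD)

lemma l1n_coefm_fact: assumes "subunit U" shows "l1n N (coefm U k) \<le> fact d"
proof -
  have "(\<Sum>s\<in>{s\<in>multi_index N d. sort s = k}. \<bar>U (drop 2 s)\<bar>) \<le> (\<Sum>s\<in>{s\<in>multi_index N d. sort s = k}. 1)"
    by (intro sum_mono subunit_abs_le[OF assms] drop2_MI) auto
  also have "\<dots> \<le> fact d" using card_fiber_real[of k] by simp
  finally show ?thesis using l1n_coefm_le[of U k] by linarith
qed

lemma sum_drop2_sq: assumes "subunit U" shows "(\<Sum>s\<in>multi_index N d. (U (drop 2 s))\<^sup>2) \<le> (real N)\<^sup>2"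
proof -
  have "(\<Sum>s\<in>multi_index N d. (U (drop 2 s))\<^sup>2) = (real N)\<^sup>2 * (\<Sum>l\<in>multi_index N (d - 2). (U l)\<^sup>2)"
    by (simp add: sum_MI power2_eq_square)
  also have "\<dots> \<le> (real N)\<^sup>2 * 1" by (rule mult_left_mono) (use assms in \<open>auto simp: subunit_def\<close>)
  finally show ?thesis by simp
qed

text \<open>Cauchy-Schwarz on each fibre costs its size, at most \<open>d!\<close>. In the sum over
  all tuples the row and the column index are free and give \<open>N^2\<close>, the contracted ones
  give the norm of \<open>U\<close>.\<close>

lemma sum_l1n_sq: assumes "subunit U" shows "(\<Sum>k\<in>entry_index N d. (l1n N (coefm U k))\<^sup>2) \<le> fact d * (real N)\<^sup>2"
proof -
  have "(l1n N (coefm U k))\<^sup>2 \<le> fact d * (\<Sum>s\<in>{s\<in>multi_index N d. sort s = k}. (U (drop 2 s))\<^sup>2)" for k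
  proof -
    let ?R = "{s\<in>multi_index N d. sort s = k}"
    have "(l1n N (coefm U k))\<^sup>2 \<le> (\<Sum>s\<in>?R. \<bar>U (drop 2 s)\<bar> * 1)\<^sup>2"
      by (intro power_mono) (use l1n_coefm_le in auto)
    also have "\<dots> \<le> (\<Sum>s\<in>?R. \<bar>U (drop 2 s)\<bar>\<^sup>2) * (\<Sum>s\<in>?R. 1\<^sup>2)"
      by (rule Cauchy_Schwarz_ineq_sum)
    also have "\<dots> \<le> (\<Sum>s\<in>?R. \<bar>U (drop 2 s)\<bar>\<^sup>2) * fact d"
      by (intro mult_left_mono) (use card_fiber_real[of k] in \<open>auto simp: sum_nonneg\<close>)
    finally show ?thesis by (simp add: mult.commute)
  qed
  then have "(\<Sum>k\<in>entry_index N d. (l1n N (coefm U k))\<^sup>2) \<le>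
      fact d * (\<Sum>k\<in>entry_index N d. \<Sum>s\<in>{s\<in>multi_index N d. sort s = k}. (U (drop 2 s))\<^sup>2)"
    unfolding sum_distrib_left by (intro sum_mono) simp
  also have "\<dots> \<le> fact d * (real N)\<^sup>2"
    unfolding sum_fibers by (intro mult_left_mono sum_drop2_sq assms) simp
  finally show ?thesis .
qed

text \<open>Only the row index is free: the column index is weighted by \<open>y\<close> and the
  others by \<open>U\<close>. For a unit vector \<open>y\<close> this is of order \<open>N\<close>,
  a factor \<open>N\<close> better than the sum of the squared l1 norms.\<close>

lemma sum_coefm_sq_vec:
  assumes "subunit U"
  shows "(\<Sum>k\<in>entry_index N d. \<Sum>a<N. (\<Sum>b<N. coefm U k a b * y b)\<^sup>2) \<le> fact d * real N * (\<Sum>b<N. (y b)\<^sup>2)"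
proof -
  let ?ind = "\<lambda>k a b l. if sort (a # b # l) = k then 1 else (0::real)"
  let ?MI = "multi_index N (d - 2)"
  have 1: "(\<Sum>b<N. coefm U k a b * y b)\<^sup>2 \<le> fact d * (\<Sum>b<N. \<Sum>l\<in>?MI. ?ind k a b l * ((U l)\<^sup>2 * (y b)\<^sup>2))"
    if a: "a < N" for k a
  proof -
    \<comment> \<open>The indicator is doubled so that Cauchy-Schwarz keeps it in both factors: one
      counts tuples of the fibre, the other still remembers the constraint
      \<open>sort (a # b # l) = k\<close>.\<close>
    have "(\<Sum>b<N. coefm U k a b * y b) = (\<Sum>b<N. \<Sum>l\<in>?MI. ?ind k a b l * (?ind k a b l * (U l * y b)))"
    proof (intro sum.cong refl)
      fix b assume b: "b \<in> {..<N}"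
      show "coefm U k a b * y b = (\<Sum>l\<in>?MI. ?ind k a b l * (?ind k a b l * (U l * y b)))"
        using a b unfolding coefm_def by (simp add: sum_distrib_right) (intro sum.cong refl, auto)
    qed
    then have "(\<Sum>b<N. coefm U k a b * y b)\<^sup>2 =
        (\<Sum>p\<in>{..<N}\<times>?MI. ?ind k a (fst p) (snd p) * (?ind k a (fst p) (snd p) * (U (snd p) * y (fst p))))\<^sup>2"
      by (simp add: sum.cartesian_product case_prod_unfold)
    also have "\<dots> \<le> (\<Sum>p\<in>{..<N}\<times>?MI. (?ind k a (fst p) (snd p))\<^sup>2) * (\<Sum>p\<in>{..<N}\<times>?MI. (?ind k a (fst p) (snd p) * (U (snd p) * y (fst p)))\<^sup>2)"
      by (rule Cauchy_Schwarz_ineq_sum)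
    also have "(\<Sum>p\<in>{..<N}\<times>?MI. (?ind k a (fst p) (snd p) * (U (snd p) * y (fst p)))\<^sup>2) =
        (\<Sum>b<N. \<Sum>l\<in>?MI. ?ind k a b l * ((U l)\<^sup>2 * (y b)\<^sup>2))"
      unfolding sum.cartesian_product by (intro sum.cong) (auto simp: power_mult_distrib)
    also have "(\<Sum>p\<in>{..<N}\<times>?MI. (?ind k a (fst p) (snd p))\<^sup>2) \<le> fact d"
    proof -
      have "(\<Sum>p\<in>{..<N}\<times>?MI. (?ind k a (fst p) (snd p))\<^sup>2) = (\<Sum>b<N. \<Sum>l\<in>?MI. ?ind k a b l)"
        unfolding sum.cartesian_product by (intro sum.cong) auto
      also have "\<dots> \<le> (\<Sum>a<N. \<Sum>b<N. \<Sum>l\<in>?MI. ?ind k a b l)"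
        using a by (intro member_le_sum[of a "{..<N}" "\<lambda>a. \<Sum>b<N. \<Sum>l\<in>?MI. ?ind k a b l"]) (auto intro!: sum_nonneg)
      also have "\<dots> = real (card {s\<in>multi_index N d. sort s = k})"
        using sum_fiber[where k = k and f = "\<lambda>_. 1::real"] by simp
      also have "\<dots> \<le> fact d" using card_fiber_real[of k] by simp
      finally show ?thesis .
    qed
    finally show ?thesis by (auto simp: mult_right_mono sum_nonneg)
  qed
  have "(\<Sum>k\<in>entry_index N d. \<Sum>a<N. (\<Sum>b<N. coefm U k a b * y b)\<^sup>2) \<le>
     (\<Sum>k\<in>entry_index N d. \<Sum>a<N. fact d * (\<Sum>b<N. \<Sum>l\<in>?MI. ?ind k a b l * ((U l)\<^sup>2 * (y b)\<^sup>2)))"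
    by (intro sum_mono 1) simp
  also have "\<dots> = fact d * (\<Sum>k\<in>entry_index N d. \<Sum>s\<in>{s\<in>multi_index N d. sort s = k}. (U (drop 2 s))\<^sup>2 * (y (s ! 1))\<^sup>2)"
    unfolding sum_fiber sum_distrib_left by (intro sum.cong refl) auto
  also have "\<dots> = fact d * (real N * ((\<Sum>l\<in>?MI. (U l)\<^sup>2) * (\<Sum>b<N. (y b)\<^sup>2)))"
    unfolding sum_fibers sum_MI by (simp add: sum_distrib_left sum_distrib_right sum.swap[of _ "{..<N}" ?MI])
  also have "\<dots> \<le> fact d * (real N * (1 * (\<Sum>b<N. (y b)\<^sup>2)))"
    by (intro mult_left_mono mult_right_mono) (use assms in \<open>auto simp: subunit_def sum_nonneg\<close>)
  finally show ?thesis by (simp add: mult.assoc)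
qed

end

section \<open>Symmetrized products and the covariance\<close>

lemma length_multi_index: "l \<in> multi_index N p \<Longrightarrow> length l = p"
  by (simp add: multi_index_def)

text \<open>Absent values contribute \<open>0! = 1\<close>.\<close>

lemma count_list_prod: "(\<Prod>x<N. fact (count_list l x) :: real) = of_nat (\<Prod>x\<in>set_mset (mset l). fact (count (mset l) x))"
  if "set l \<subseteq> {..<N}" for N :: nat
proof -
  have "(\<Prod>x<N. fact (count_list l x) :: real) = (\<Prod>x\<in>set l. fact (count_list l x))"
    by (rule prod.mono_neutral_right) (use that in \<open>auto simp: count_list_0_iff\<close>)
  then show ?thesis by (simp add: count_mset)
qed

lemma card_rearrangements_eq:
  assumes "l \<in> multi_index N p"
  shows "real (card (rearrangements N l)) * (\<Prod>x<N. fact (count_list l x)) = fact p"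
proof -
  have "rearrangements N l = permutations_of_multiset (mset l)"
    using assms by (auto simp: rearrangements_def permutations_of_multiset_def sort_eq_iff_mset multi_index_def
        dest: mset_eq_setD mset_eq_length)
  moreover have "set l \<subseteq> {..<N}" using assms by (simp add: multi_index_def)
  moreover have "real (card (permutations_of_multiset (mset l)) * (\<Prod>x\<in>set_mset (mset l). fact (count (mset l) x))) = fact p"
    unfolding card_permutations_of_multiset_aux using length_multi_index[OF assms] by simp
  ultimately show ?thesis by (simp only: count_list_prod of_nat_mult)
qed

lemma permute_list_multi_index:
  assumes "\<sigma> permutes {..<p}" "l \<in> multi_index N p" shows "permute_list \<sigma> l \<in> multi_index N p"
  using assms by (auto simp: multi_index_def)

text \<open>All fibres of \<open>\<sigma> \<mapsto> permute_list \<sigma> l\<close> are translates of each other.\<close>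

lemma sum_permutations_rearrangements:
  fixes g :: "nat list \<Rightarrow> real"
  assumes l: "l \<in> multi_index N p"
  shows "(\<Sum>\<sigma> | \<sigma> permutes {..<p}. g (permute_list \<sigma> l)) =
     (\<Prod>x<N. fact (count_list l x)) * (\<Sum>l'\<in>rearrangements N l. g l')"
proof -
  let ?P = "{\<sigma>. \<sigma> permutes {..<p}}"
  let ?F = "\<lambda>l'. {\<sigma>\<in>?P. permute_list \<sigma> l = l'}"
  have len: "length l = p" using l by (rule length_multi_index)
  have finP: "finite ?P" by (rule finite_permutations) simp
  have maps: "permute_list \<sigma> l \<in> rearrangements N l" if "\<sigma> \<in> ?P" for \<sigma>
    using that permute_list_multi_index[of \<sigma> p l N] l len
    by (simp add: rearrangements_def sort_eq_iff_mset)
  have fib: "card (?F l') = card (?F l)" if l': "l' \<in> rearrangements N l" for l'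
  proof -
    have "mset l' = mset l" using l' by (simp add: rearrangements_def sort_eq_iff_mset)
    then obtain \<tau> where \<tau>: "\<tau> permutes {..<p}" "permute_list \<tau> l = l'"
      using mset_eq_permutation[of l' l] len by auto
    have comp: "permute_list (\<tau> \<circ> \<sigma>) l = permute_list \<sigma> (permute_list \<tau> l)" if "\<sigma> permutes {..<p}" for \<sigma>
      using that len by (intro permute_list_compose) auto
    have "bij_betw (\<lambda>\<sigma>. \<sigma> \<circ> \<tau>) (?F l) (?F l')"
    proof (rule bij_betw_byWitness[where f' = "\<lambda>\<sigma>. \<sigma> \<circ> inv_into UNIV \<tau>"])
      have comp2: "permute_list (\<sigma> \<circ> \<rho>) l = permute_list \<rho> (permute_list \<sigma> l)" if "\<rho> permutes {..<p}" for \<sigma> \<rho>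
        using that len by (intro permute_list_compose) auto
      have inv: "\<tau> \<circ> inv_into UNIV \<tau> = id" "inv_into UNIV \<tau> \<circ> \<tau> = id" using permutes_inv_o[OF \<tau>(1)] by auto
      have l'l: "permute_list (inv_into UNIV \<tau>) l' = l"
        using comp2[OF permutes_inv[OF \<tau>(1)], of \<tau>] \<tau>(2) inv by simp
      show "\<forall>\<sigma>\<in>?F l. (\<sigma> \<circ> \<tau>) \<circ> inv_into UNIV \<tau> = \<sigma>" using inv by (simp add: comp_assoc)
      show "\<forall>\<sigma>\<in>?F l'. (\<sigma> \<circ> inv_into UNIV \<tau>) \<circ> \<tau> = \<sigma>" using inv by (simp add: comp_assoc)
      show "(\<lambda>\<sigma>. \<sigma> \<circ> \<tau>) ` ?F l \<subseteq> ?F l'"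
        using comp2[OF \<tau>(1)] \<tau> by (auto intro: permutes_compose)
      show "(\<lambda>\<sigma>. \<sigma> \<circ> inv_into UNIV \<tau>) ` ?F l' \<subseteq> ?F l"
        using comp2[OF permutes_inv[OF \<tau>(1)]] l'l permutes_inv[OF \<tau>(1)] by (auto intro: permutes_compose)
    qed
    then show ?thesis by (rule bij_betw_same_card[symmetric])
  qed
  have grp: "(\<Sum>\<sigma>\<in>?P. h (permute_list \<sigma> l)) = real (card (?F l)) * (\<Sum>l'\<in>rearrangements N l. h l')" for h :: "nat list \<Rightarrow> real"
  proof -
    have "(\<Sum>\<sigma>\<in>?P. h (permute_list \<sigma> l)) = (\<Sum>l'\<in>rearrangements N l. \<Sum>\<sigma>\<in>?F l'. h (permute_list \<sigma> l))"
      by (rule sum.group[symmetric]) (use finP maps in auto)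
    also have "\<dots> = (\<Sum>l'\<in>rearrangements N l. real (card (?F l')) * h l')" by (intro sum.cong) auto
    also have "\<dots> = (\<Sum>l'\<in>rearrangements N l. real (card (?F l)) * h l')" by (intro sum.cong refl) (simp only: fib)
    finally show ?thesis by (simp add: sum_distrib_left)
  qed
  \<comment> \<open>With the constant function \<open>1\<close> the identity counts permutations,
    which determines the common fibre size, the order of the stabilizer of \<open>l\<close>.\<close>
  have "fact p = real (card (?F l)) * real (card (rearrangements N l))"
    using grp[of "\<lambda>_. 1"] card_permutations[of "{..<p}" p] by simp
  moreover have "real (card (rearrangements N l)) * (\<Prod>x<N. fact (count_list l x)) = fact p"
    by (rule card_rearrangements_eq[OF l])
  ultimately have "real (card (?F l)) = (\<Prod>x<N. fact (count_list l x))"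
    by (metis (no_types, lifting) fact_nonzero mult.commute mult_cancel_left mult_eq_0_iff)
  then show ?thesis using grp[of g] by simp
qed

lemma tensor_prod_permute:
  assumes "\<sigma> permutes {..<length vs}" "length ks = length vs"
  shows "tensor_prod (permute_list \<sigma> vs) ks = tensor_prod vs (permute_list (inv_into UNIV \<sigma>) ks)"
proof -
  have "tensor_prod (permute_list \<sigma> vs) ks = (\<Prod>j<length vs. vec_index (vs ! \<sigma> j) (ks ! j))"
    using assms by (auto simp: tensor_prod_def permute_list_nth intro!: prod.cong)
  also have "\<dots> = (\<Prod>j<length vs. vec_index (vs ! \<sigma> (inv_into UNIV \<sigma> j)) (ks ! inv_into UNIV \<sigma> j))"
    by (rule prod.permute[OF permutes_inv[OF assms(1)], unfolded comp_def])
  also have "\<dots> = tensor_prod vs (permute_list (inv_into UNIV \<sigma>) ks)"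
    unfolding tensor_prod_def
    using assms permutes_inv[OF assms(1)] by (intro prod.cong) (auto simp: permute_list_nth permutes_inverses[OF assms(1)])
  finally show ?thesis .
qed

lemma sym_tensor_prod_permute:
  assumes "length ks = length vs"
  shows "sym_tensor_prod vs ks = 1 / fact (length vs) * (\<Sum>\<sigma> | \<sigma> permutes {..<length vs}. tensor_prod vs (permute_list \<sigma> ks))"
proof -
  have "(\<Sum>\<sigma> | \<sigma> permutes {..<length vs}. tensor_prod (permute_list \<sigma> vs) ks) =
        (\<Sum>\<sigma> | \<sigma> permutes {..<length vs}. tensor_prod vs (permute_list (inv_into UNIV \<sigma>) ks))"
    using assms by (intro sum.cong) (auto simp: tensor_prod_permute)
  also have "\<dots> = (\<Sum>\<sigma> | \<sigma> permutes {..<length vs}. tensor_prod vs (permute_list \<sigma> ks))"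
    by (rule sum_permutations_inverse[symmetric])
  finally show ?thesis by (simp add: sym_tensor_prod_def)
qed

text \<open>Averaging over permutations becomes a sum over rearrangements weighted by the stabilizer
  order. This weight is the product of factorials that also occurs in the variance of an entry,
  which is what links that variance to the symmetrized product.\<close>

lemma sym_tensor_prod_rearrangements:
  assumes "l \<in> multi_index N (length vs)"
  shows "sym_tensor_prod vs l = (\<Prod>x<N. fact (count_list l x)) / fact (length vs) * (\<Sum>l'\<in>rearrangements N l. tensor_prod vs l')"
  using sum_permutations_rearrangements[OF assms, of "tensor_prod vs"] sym_tensor_prod_permute[of l vs] length_multi_index[OF assms]
  by simp

lemma sum_permute_multi_index:
  fixes g :: "nat list \<Rightarrow> real"
  assumes "\<sigma> permutes {..<p}"
  shows "(\<Sum>l\<in>multi_index N p. g (permute_list \<sigma> l)) = (\<Sum>l\<in>multi_index N p. g l)"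
proof (rule sum.reindex_bij_witness[where i = "permute_list (inv_into UNIV \<sigma>)" and j = "permute_list \<sigma>"])
  have inv: "\<sigma> \<circ> inv_into UNIV \<sigma> = id" "inv_into UNIV \<sigma> \<circ> \<sigma> = id" using permutes_inv_o[OF assms] by auto
  note pi = permutes_inv[OF assms]
  fix l assume l: "l \<in> multi_index N p"
  have len: "length l = p" using l by (rule length_multi_index)
  show "permute_list (inv_into UNIV \<sigma>) (permute_list \<sigma> l) = l"
    using permute_list_compose[of "inv_into UNIV \<sigma>" l \<sigma>] pi inv len by simp
  show "permute_list \<sigma> (permute_list (inv_into UNIV \<sigma>) l) = l"
    using permute_list_compose[of \<sigma> l "inv_into UNIV \<sigma>"] assms inv len by simp
  show "permute_list \<sigma> l \<in> multi_index N p" "permute_list (inv_into UNIV \<sigma>) l \<in> multi_index N p"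
    using permute_list_multi_index l assms pi by auto
qed rule

text \<open>Symmetrization is a self-adjoint projection, so applying it to one argument
  suffices.\<close>

lemma sym_tensor_prod_inner:
  assumes "length vs = p" "length ws = p"
  shows "tensor_inner N p (sym_tensor_prod vs) (sym_tensor_prod ws) = tensor_inner N p (tensor_prod vs) (sym_tensor_prod ws)"
proof -
  have invar: "sym_tensor_prod ws (permute_list \<sigma> l) = sym_tensor_prod ws l" if "\<sigma> permutes {..<p}" "l \<in> multi_index N p" for \<sigma> l
  proof -
    have l': "permute_list \<sigma> l \<in> multi_index N p" using permute_list_multi_index that by blast
    have ms: "mset (permute_list \<sigma> l) = mset l" using that length_multi_index by (metis mset_permute_list)
    have "rearrangements N (permute_list \<sigma> l) = rearrangements N l"
      using ms length_multi_index[OF that(2)] by (simp add: rearrangements_def sort_eq_iff_mset)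
    moreover have "count_list (permute_list \<sigma> l) x = count_list l x" for x using ms by (metis count_mset)
    ultimately show ?thesis
      using sym_tensor_prod_rearrangements[of l N ws] sym_tensor_prod_rearrangements[of "permute_list \<sigma> l" N ws] l' that assms by simp
  qed
  let ?P = "{\<sigma>. \<sigma> permutes {..<p}}"
  have "tensor_inner N p (sym_tensor_prod vs) (sym_tensor_prod ws) =
     (\<Sum>l\<in>multi_index N p. 1 / fact p * (\<Sum>\<sigma>\<in>?P. tensor_prod vs (permute_list \<sigma> l) * sym_tensor_prod ws (permute_list \<sigma> l)))"
    unfolding tensor_inner_def
    by (intro sum.cong refl) (simp add: sym_tensor_prod_permute[of _ vs] length_multi_index assms invar sum_distrib_right)
  also have "\<dots> = 1 / fact p * (\<Sum>\<sigma>\<in>?P. \<Sum>l\<in>multi_index N p. tensor_prod vs (permute_list \<sigma> l) * sym_tensor_prod ws (permute_list \<sigma> l))"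
    by (subst sum.swap) (simp add: sum_distrib_left)
  also have "\<dots> = 1 / fact p * (\<Sum>\<sigma>\<in>?P. tensor_inner N p (tensor_prod vs) (sym_tensor_prod ws))"
  proof -
    have "(\<Sum>l\<in>multi_index N p. tensor_prod vs (permute_list \<sigma> l) * sym_tensor_prod ws (permute_list \<sigma> l)) =
       tensor_inner N p (tensor_prod vs) (sym_tensor_prod ws)" if "\<sigma> \<in> ?P" for \<sigma>
      unfolding tensor_inner_def
      using sum_permute_multi_index[of \<sigma> p "\<lambda>l. tensor_prod vs l * sym_tensor_prod ws l" N] that by simp
    then show ?thesis by simp
  qed
  also have "\<dots> = tensor_inner N p (tensor_prod vs) (sym_tensor_prod ws)"
    using card_permutations[of "{..<p}" p] by simp
  finally show ?thesis .
qed

context contraction_coefficients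
begin

text \<open>The covariance in the form in which the trace expansion produces it: if \<open>a\<close>
  and \<open>b\<close> are distinct and do not occur in \<open>l\<close>, the weight of
  \<open>l\<close> is the prescribed variance of the entry at \<open>a # b # l\<close>.\<close>

definition pair_cov :: "(nat list \<Rightarrow> real) \<Rightarrow> (nat list \<Rightarrow> real) \<Rightarrow> real" where
  "pair_cov U U' = (\<Sum>l\<in>multi_index N (d - 2). U l * ((\<Prod>x<N. fact (count_list l x)) / fact d *
      (\<Sum>l'\<in>rearrangements N l. U' l')))"

text \<open>The prefactor combines by \<open>d * (d - 1) * (d - 2)! = d!\<close>, and one of the two
  symmetrizations is dropped.\<close>

lemma contraction_cov_eq:
  "contraction_cov d u N i i' = pair_cov (tensor_prod (map (u N i) [0..<d - 2])) (tensor_prod (map (u N i') [0..<d - 2]))"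
proof -
  have f: "real d * (real d - 1) * fact (d - 2) = fact d"
    using fact_Suc[of "d - 1", where 'a = real] fact_Suc[of "d - 2", where 'a = real] d3
    by (cases d; cases "d - 1") auto
  have "tensor_inner N (d - 2) (sym_tensor_prod (map (u N i) [0..<d - 2])) (sym_tensor_prod (map (u N i') [0..<d - 2]))
     = tensor_inner N (d - 2) (tensor_prod (map (u N i) [0..<d - 2])) (sym_tensor_prod (map (u N i') [0..<d - 2]))"
    by (rule sym_tensor_prod_inner) auto
  also have "\<dots> = (\<Sum>l\<in>multi_index N (d - 2). tensor_prod (map (u N i) [0..<d - 2]) l *
      ((\<Prod>x<N. fact (count_list l x)) / fact (d - 2) * (\<Sum>l'\<in>rearrangements N l. tensor_prod (map (u N i') [0..<d - 2]) l')))"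
    unfolding tensor_inner_def by (intro sum.cong refl) (simp add: sym_tensor_prod_rearrangements)
  finally show ?thesis
    unfolding contraction_cov_def pair_cov_def sum_distrib_left
    by (simp only:) (simp add: sum_distrib_left mult_ac flip: f)
qed

end

section \<open>Pairs of rearrangements in the second-order term\<close>

lemma rearrangements_MI: "s \<in> multi_index N p \<Longrightarrow> rearrangements N s = {s'\<in>multi_index N p. sort s' = sort s}"
  by (simp add: rearrangements_def multi_index_def)

lemma sum_rearrangements_swap:
  fixes f :: "nat list \<Rightarrow> nat list \<Rightarrow> real"
  shows "(\<Sum>s\<in>multi_index N p. \<Sum>s'\<in>rearrangements N s. f s s') = (\<Sum>s\<in>multi_index N p. \<Sum>s'\<in>rearrangements N s. f s' s)"
proof -
  have "(\<Sum>s\<in>multi_index N p. \<Sum>s'\<in>rearrangements N s. f s s') =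
     (\<Sum>s\<in>multi_index N p. \<Sum>s' | s' \<in> multi_index N p \<and> sort s' = sort s. f s s')"
    by (intro sum.cong refl) (auto simp: rearrangements_MI)
  also have "\<dots> = (\<Sum>s'\<in>multi_index N p. \<Sum>s | s \<in> multi_index N p \<and> sort s' = sort s. f s s')"
    by (rule sum.swap_restrict) auto
  also have "\<dots> = (\<Sum>s\<in>multi_index N p. \<Sum>s'\<in>rearrangements N s. f s' s)"
    by (intro sum.cong refl) (auto simp: rearrangements_MI)
  finally show ?thesis .
qed

context contraction_coefficients
begin

lemma card_rearrangements_real: "s \<in> multi_index N d \<Longrightarrow> real (card (rearrangements N s)) \<le> fact d"
  using card_fiber_real[of "sort s"] by (simp add: rearrangements_MI)

text \<open>Opening both coefficient matrices gives two tuples that name the same entry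
  \<open>k\<close>; place \<open>0\<close> of a tuple is the row, place \<open>1\<close> the column,
  and the rest goes into the tensor.\<close>

lemma pair_trace:
  "mtr N (mmul N (coefm U k) (mmul N W1 (mmul N (coefm U' k) W2))) =
   (\<Sum>s\<in>{s\<in>multi_index N d. sort s = k}. \<Sum>s'\<in>{s\<in>multi_index N d. sort s = k}.
      (U (drop 2 s) * W1 (s ! 1) (s' ! 0)) * (U' (drop 2 s') * W2 (s' ! 1) (s ! 0)))"
proof -
  let ?MI = "multi_index N (d - 2)"
  have inner: "mmul N W1 (mmul N (coefm U' k) W2) b a =
      (\<Sum>s'\<in>{s\<in>multi_index N d. sort s = k}. W1 b (s' ! 0) * (U' (drop 2 s') * W2 (s' ! 1) a))" for a b
  proof -
    have "mmul N W1 (mmul N (coefm U' k) W2) b a = (\<Sum>c<N. \<Sum>e<N. W1 b c * (coefm U' k c e * W2 e a))"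
      by (simp add: mmul_def sum_distrib_left)
    also have "\<dots> = (\<Sum>c<N. \<Sum>e<N. \<Sum>l\<in>?MI. if sort (c # e # l) = k then W1 b c * (U' l * W2 e a) else 0)"
    proof (intro sum.cong refl)
      fix c e assume "c \<in> {..<N}" "e \<in> {..<N}"
      then have "W1 b c * (coefm U' k c e * W2 e a) = (\<Sum>l\<in>?MI. W1 b c * ((if sort (c # e # l) = k then U' l else 0) * W2 e a))"
        unfolding coefm_def by (simp only: lessThan_iff simp_thms if_True sum_distrib_left sum_distrib_right)
      also have "\<dots> = (\<Sum>l\<in>?MI. if sort (c # e # l) = k then W1 b c * (U' l * W2 e a) else 0)"
        by (intro sum.cong refl) auto
      finally show "W1 b c * (coefm U' k c e * W2 e a) = \<dots>" .
    qed
    finally show ?thesis unfolding sum_fiber by (simp cong: if_cong)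
  qed
  have "mtr N (mmul N (coefm U k) (mmul N W1 (mmul N (coefm U' k) W2))) =
     (\<Sum>a<N. \<Sum>b<N. coefm U k a b * mmul N W1 (mmul N (coefm U' k) W2) b a)"
    by (simp add: mtr_def mmul_def)
  also have "\<dots> = (\<Sum>a<N. \<Sum>b<N. \<Sum>l\<in>?MI. if sort (a # b # l) = k then U l * mmul N W1 (mmul N (coefm U' k) W2) b a else 0)"
  proof (intro sum.cong refl)
    fix a b assume "a \<in> {..<N}" "b \<in> {..<N}"
    then have "coefm U k a b * mmul N W1 (mmul N (coefm U' k) W2) b a =
        (\<Sum>l\<in>?MI. (if sort (a # b # l) = k then U l else 0) * mmul N W1 (mmul N (coefm U' k) W2) b a)"
      by (simp only: coefm_def[of U] lessThan_iff simp_thms if_True sum_distrib_right)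
    also have "\<dots> = (\<Sum>l\<in>?MI. if sort (a # b # l) = k then U l * mmul N W1 (mmul N (coefm U' k) W2) b a else 0)"
      by (intro sum.cong refl) auto
    finally show "coefm U k a b * mmul N W1 (mmul N (coefm U' k) W2) b a = \<dots>" .
  qed
  also have "\<dots> = (\<Sum>s\<in>{s\<in>multi_index N d. sort s = k}. U (drop 2 s) * mmul N W1 (mmul N (coefm U' k) W2) (s ! 1) (s ! 0))"
    unfolding sum_fiber by (simp cong: if_cong)
  also have "\<dots> = (\<Sum>s\<in>{s\<in>multi_index N d. sort s = k}. \<Sum>s'\<in>{s\<in>multi_index N d. sort s = k}.
      (U (drop 2 s) * W1 (s ! 1) (s' ! 0)) * (U' (drop 2 s') * W2 (s' ! 1) (s ! 0)))"
    unfolding inner sum_distrib_left by (intro sum.cong refl) (simp add: mult_ac)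
  finally show ?thesis .
qed

lemma pair_trace_sum:
  "(\<Sum>k\<in>entry_index N d. v k * mtr N (mmul N (coefm U k) (mmul N W1 (mmul N (coefm U' k) W2)))) =
   (\<Sum>s\<in>multi_index N d. \<Sum>s'\<in>rearrangements N s.
      v (sort s) * ((U (drop 2 s) * W1 (s ! 1) (s' ! 0)) * (U' (drop 2 s') * W2 (s' ! 1) (s ! 0))))"
proof -
  have "(\<Sum>k\<in>entry_index N d. v k * mtr N (mmul N (coefm U k) (mmul N W1 (mmul N (coefm U' k) W2)))) =
    (\<Sum>k\<in>entry_index N d. \<Sum>s\<in>{s\<in>multi_index N d. sort s = k}. \<Sum>s'\<in>rearrangements N s.
      v (sort s) * ((U (drop 2 s) * W1 (s ! 1) (s' ! 0)) * (U' (drop 2 s') * W2 (s' ! 1) (s ! 0))))"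
    unfolding pair_trace sum_distrib_left by (intro sum.cong refl) (auto simp: rearrangements_MI)
  then show ?thesis unfolding sum_fibers .
qed

text \<open>If \<open>s' ! 0\<close> is not \<open>s ! 1\<close>, it equals \<open>s ! j\<close> for
  some other place \<open>j\<close>, since both tuples have the same letters. Then
  \<open>s ! 1\<close> runs through a column of \<open>W\<close> while a different place holds the
  column fixed, and a column has square sum at most \<open>r^2\<close> instead of
  \<open>N * r^2\<close>.\<close>

lemma offdiag_sum:
  assumes "subunit U" "opb N r W"
  shows "(\<Sum>s\<in>multi_index N d. \<Sum>s'\<in>rearrangements N s. of_bool (s' ! 0 \<noteq> s ! 1) * (U (drop 2 s) * W (s ! 1) (s' ! 0))\<^sup>2)
     \<le> fact d * real d * real N * r\<^sup>2"
proof -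
  let ?t = "\<lambda>s j. (U (drop 2 s) * W (s ! 1) (s ! j))\<^sup>2"
  have col: "(\<Sum>a<N. (W a b)\<^sup>2) \<le> r\<^sup>2" if "b < N" for b by (rule opb_col[OF assms(2) that])
  have U1: "(\<Sum>l\<in>multi_index N (d - 2). (U l)\<^sup>2) \<le> 1" using assms(1) by (simp add: subunit_def)
  \<comment> \<open>For \<open>j = 0\<close> the row index labels the columns of \<open>W\<close>
    and supplies the factor \<open>N\<close>; for \<open>j \<ge> 2\<close> the column is labelled by
    a contracted index, and the row index is free.\<close>
  have each: "(\<Sum>s\<in>multi_index N d. ?t s j) \<le> real N * r\<^sup>2" if j: "j \<in> {..<d} - {1}" for j
  proof (cases j)
    case 0
    have "(\<Sum>s\<in>multi_index N d. ?t s j) = (\<Sum>a<N. \<Sum>b<N. (\<Sum>l\<in>multi_index N (d - 2). (U l)\<^sup>2) * (W b a)\<^sup>2)"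
      unfolding sum_MI 0 by (simp add: power_mult_distrib sum_distrib_right)
    also have "\<dots> \<le> (\<Sum>a<N. \<Sum>b<N. 1 * (W b a)\<^sup>2)"
      by (intro sum_mono mult_right_mono U1) auto
    also have "\<dots> \<le> (\<Sum>a<N. r\<^sup>2)" using col by (intro sum_mono) auto
    finally show ?thesis by simp
  next
    case (Suc j')
    then obtain i where i: "j = Suc (Suc i)" "i < d - 2" using j by (cases j') auto
    have "(\<Sum>s\<in>multi_index N d. ?t s j) = (\<Sum>a<N. \<Sum>b<N. \<Sum>l\<in>multi_index N (d - 2). (U l)\<^sup>2 * (W b (l ! i))\<^sup>2)"
      unfolding sum_MI i(1) by (simp add: power_mult_distrib)
    also have "\<dots> = real N * (\<Sum>b<N. \<Sum>l\<in>multi_index N (d - 2). (U l)\<^sup>2 * (W b (l ! i))\<^sup>2)" by simp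
    also have "\<dots> = real N * (\<Sum>l\<in>multi_index N (d - 2). (U l)\<^sup>2 * (\<Sum>b<N. (W b (l ! i))\<^sup>2))"
      by (subst sum.swap) (simp add: sum_distrib_left)
    also have "\<dots> \<le> real N * (\<Sum>l\<in>multi_index N (d - 2). (U l)\<^sup>2 * r\<^sup>2)"
    proof (intro mult_left_mono sum_mono)
      fix l assume "l \<in> multi_index N (d - 2)"
      then have "l ! i \<in> set l" "set l \<subseteq> {..<N}" using i by (auto simp: multi_index_def)
      then have "l ! i < N" by blast
      then show "(\<Sum>b<N. (W b (l ! i))\<^sup>2) \<le> r\<^sup>2" by (rule col)
    qed auto
    also have "\<dots> = real N * ((\<Sum>l\<in>multi_index N (d - 2). (U l)\<^sup>2) * r\<^sup>2)" by (simp add: sum_distrib_right)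
    also have "\<dots> \<le> real N * (1 * r\<^sup>2)" by (intro mult_left_mono mult_right_mono U1) auto
    finally show ?thesis by simp
  qed
  have pt: "of_bool (s' ! 0 \<noteq> s ! 1) * (U (drop 2 s) * W (s ! 1) (s' ! 0))\<^sup>2 \<le> (\<Sum>j\<in>{..<d} - {1}. ?t s j)"
    if s: "s \<in> multi_index N d" "s' \<in> rearrangements N s" for s s'
  proof (cases "s' ! 0 = s ! 1")
    case False
    have len: "length s = d" "length s' = d" using s by (auto simp: rearrangements_def multi_index_def)
    have "mset s' = mset s" using s by (simp add: rearrangements_def sort_eq_iff_mset)
    then have "s' ! 0 \<in> set s" using len d3 by (metis mset_eq_setD nth_mem less_le_trans zero_less_numeral)
    then obtain j where j: "j < d" "s ! j = s' ! 0" using len by (auto simp: in_set_conv_nth)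
    then have "j \<in> {..<d} - {1}" using False by auto
    then have "?t s j \<le> (\<Sum>j\<in>{..<d} - {1}. ?t s j)" by (intro member_le_sum) auto
    then show ?thesis using False j by simp
  qed (simp add: sum_nonneg)
  have "(\<Sum>s\<in>multi_index N d. \<Sum>s'\<in>rearrangements N s. of_bool (s' ! 0 \<noteq> s ! 1) * (U (drop 2 s) * W (s ! 1) (s' ! 0))\<^sup>2)
     \<le> (\<Sum>s\<in>multi_index N d. \<Sum>s'\<in>rearrangements N s. \<Sum>j\<in>{..<d} - {1}. ?t s j)"
    by (intro sum_mono pt)
  also have "\<dots> \<le> (\<Sum>s\<in>multi_index N d. fact d * (\<Sum>j\<in>{..<d} - {1}. ?t s j))"
  proof (intro sum_mono)
    fix s assume s: "s \<in> multi_index N d"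
    show "(\<Sum>s'\<in>rearrangements N s. \<Sum>j\<in>{..<d} - {1}. ?t s j) \<le> fact d * (\<Sum>j\<in>{..<d} - {1}. ?t s j)"
      using card_rearrangements_real[OF s] by (simp add: mult_right_mono sum_nonneg)
  qed
  also have "\<dots> = fact d * (\<Sum>j\<in>{..<d} - {1}. \<Sum>s\<in>multi_index N d. ?t s j)"
    by (subst sum.swap) (simp add: sum_distrib_left)
  also have "\<dots> \<le> fact d * (\<Sum>j\<in>{..<d} - {1}. real N * r\<^sup>2)"
    by (intro mult_left_mono sum_mono each) auto
  also have "\<dots> \<le> fact d * (real d * (real N * r\<^sup>2))"
    using d3 by (intro mult_left_mono) (auto simp: algebra_simps)
  finally show ?thesis by (simp add: mult.assoc)
qed

text \<open>Every entry of \<open>W\<close> is bounded by \<open>r\<close> only. This is a factor of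
  order \<open>N\<close> worse than \<open>offdiag_sum\<close> and serves for the other matrix of
  the pair.\<close>

lemma all_sum:
  assumes "subunit U" "opb N r W"
  shows "(\<Sum>s\<in>multi_index N d. \<Sum>s'\<in>rearrangements N s. (U (drop 2 s) * W (s ! 1) (s' ! 0))\<^sup>2)
     \<le> fact d * (real N)\<^sup>2 * r\<^sup>2"
proof -
  have "(\<Sum>s\<in>multi_index N d. \<Sum>s'\<in>rearrangements N s. (U (drop 2 s) * W (s ! 1) (s' ! 0))\<^sup>2)
     \<le> (\<Sum>s\<in>multi_index N d. \<Sum>s'\<in>rearrangements N s. (U (drop 2 s))\<^sup>2 * r\<^sup>2)"
  proof (intro sum_mono)
    fix s s' assume s: "s \<in> multi_index N d" "s' \<in> rearrangements N s"
    have "length s = d" "length s' = d" "set s \<subseteq> {..<N}" "set s' \<subseteq> {..<N}"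
      using s by (auto simp: rearrangements_def multi_index_def)
    then have "s ! 1 < N" "s' ! 0 < N" using d3
      by (metis lessThan_iff less_le_trans nth_mem one_less_numeral_iff semiring_norm(77) subsetD zero_less_numeral)+
    then have "\<bar>W (s ! 1) (s' ! 0)\<bar> \<le> r" by (rule opb_entry[OF assms(2)])
    then have "(W (s ! 1) (s' ! 0))\<^sup>2 \<le> r\<^sup>2" using abs_le_square_iff opb_nonneg[OF assms(2)] by fastforce
    then show "(U (drop 2 s) * W (s ! 1) (s' ! 0))\<^sup>2 \<le> (U (drop 2 s))\<^sup>2 * r\<^sup>2"
      by (simp add: power_mult_distrib mult_left_mono)
  qed
  also have "\<dots> \<le> (\<Sum>s\<in>multi_index N d. fact d * ((U (drop 2 s))\<^sup>2 * r\<^sup>2))"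
    using card_rearrangements_real by (intro sum_mono) (simp add: mult_right_mono)
  also have "\<dots> = fact d * ((\<Sum>s\<in>multi_index N d. (U (drop 2 s))\<^sup>2) * r\<^sup>2)"
    by (simp add: sum_distrib_left sum_distrib_right)
  also have "\<dots> \<le> fact d * ((real N)\<^sup>2 * r\<^sup>2)"
    by (intro mult_left_mono mult_right_mono sum_drop2_sq assms) auto
  finally show ?thesis by (simp add: mult.assoc)
qed

text \<open>A Schur test: \<open>2 * \<bar>a * b\<bar> \<le> a^2 + b^2\<close> together with the
  symmetry of being a rearrangement, each class having at most \<open>d!\<close> members.\<close>

lemma sum_rearrangements_abs:
  assumes "subunit U" "subunit U'"
  shows "(\<Sum>l\<in>multi_index N (d - 2). \<bar>U l\<bar> * (\<Sum>l'\<in>rearrangements N l. \<bar>U' l'\<bar>)) \<le> fact d"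
proof -
  have card: "real (card (rearrangements N l)) \<le> fact d" if "l \<in> multi_index N (d - 2)" for l
  proof -
    have "card (rearrangements N l) \<le> fact (d - 2)" using card_rearrangements[of N l] length_multi_index[OF that] by simp
    also have "\<dots> \<le> fact d" by (rule fact_mono_nat) simp
    finally show ?thesis by (metis of_nat_fact of_nat_le_iff)
  qed
  have sq: "(\<Sum>l\<in>multi_index N (d - 2). \<Sum>l'\<in>rearrangements N l. (U l)\<^sup>2) \<le> fact d" if "subunit U" for U
  proof -
    have "(\<Sum>l\<in>multi_index N (d - 2). \<Sum>l'\<in>rearrangements N l. (U l)\<^sup>2) \<le> (\<Sum>l\<in>multi_index N (d - 2). fact d * (U l)\<^sup>2)"
      using card by (intro sum_mono) (simp add: mult_right_mono)
    also have "\<dots> \<le> fact d * 1" unfolding sum_distrib_left[symmetric]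
      using that by (intro mult_left_mono) (auto simp: subunit_def)
    finally show ?thesis by simp
  qed
  have "(\<Sum>l\<in>multi_index N (d - 2). \<bar>U l\<bar> * (\<Sum>l'\<in>rearrangements N l. \<bar>U' l'\<bar>)) \<le>
    (\<Sum>l\<in>multi_index N (d - 2). \<Sum>l'\<in>rearrangements N l. (U l)\<^sup>2 / 2 + (U' l')\<^sup>2 / 2)"
    unfolding sum_distrib_left
  proof (intro sum_mono)
    fix l l' show "\<bar>U l\<bar> * \<bar>U' l'\<bar> \<le> (U l)\<^sup>2 / 2 + (U' l')\<^sup>2 / 2"
      using sum_squares_bound[of "\<bar>U l\<bar>" "\<bar>U' l'\<bar>"] by simp
  qed
  also have "\<dots> = (\<Sum>l\<in>multi_index N (d - 2). \<Sum>l'\<in>rearrangements N l. (U l)\<^sup>2) / 2 +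
     (\<Sum>l\<in>multi_index N (d - 2). \<Sum>l'\<in>rearrangements N l. (U' l')\<^sup>2) / 2"
    by (simp add: sum.distrib sum_divide_distrib)
  also have "(\<Sum>l\<in>multi_index N (d - 2). \<Sum>l'\<in>rearrangements N l. (U' l')\<^sup>2) = (\<Sum>l\<in>multi_index N (d - 2). \<Sum>l'\<in>rearrangements N l. (U' l)\<^sup>2)"
    by (rule sum_rearrangements_swap)
  finally show ?thesis using sq[OF assms(1)] sq[OF assms(2)] by linarith
qed

text \<open>What the second-order term asks of the weights \<open>v\<close>: a uniform bound, and
  the exact value where three distinct indices occur. On tuples with at most two of them the value
  is otherwise free, so constant tuples may be given weight \<open>0\<close>.\<close>

definition pair_variance :: "real \<Rightarrow> (nat list \<Rightarrow> real) \<Rightarrow> bool" where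
  "pair_variance V v \<longleftrightarrow> 1 \<le> V \<and> (\<forall>k\<in>entry_index N d. \<bar>v k\<bar> \<le> V \<and>
     (card (set k) \<ge> 3 \<longrightarrow> v k = (\<Prod>x<N. fact (count_list k x)) / fact d))"

text \<open>When the first two places are exchanged, \<open>W1\<close> and \<open>W2\<close> are
  evaluated on their diagonals and the sums over \<open>a\<close> and \<open>b\<close> separate into
  traces. The weight agrees with that of \<open>pair_cov\<close> unless \<open>a = b\<close> or one
  of them occurs in \<open>l\<close>, which for each \<open>l\<close> concerns \<open>O(N)\<close>
  of the \<open>N^2\<close> pairs.\<close>

lemma reversed_part:
  assumes "subunit U" "subunit U'" "opb N r1 W1" "opb N r2 W2" "pair_variance V v"
  shows "\<bar>(\<Sum>s\<in>multi_index N d. \<Sum>s'\<in>rearrangements N s. of_bool (s' ! 0 = s ! 1 \<and> s' ! 1 = s ! 0) *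
      (v (sort s) * ((U (drop 2 s) * W1 (s ! 1) (s' ! 0)) * (U' (drop 2 s') * W2 (s' ! 1) (s ! 0)))))
     - pair_cov U U' * mtr N W1 * mtr N W2\<bar> \<le> 4 * real d * fact d * V * real N * r1 * r2"
proof -
  let ?MI = "multi_index N (d - 2)"
  let ?S = "\<lambda>l. \<Sum>l'\<in>rearrangements N l. U' l'"
  let ?c = "\<lambda>l. (\<Prod>x<N. fact (count_list l x)) / fact d :: real"
  let ?bad = "\<lambda>a b l. a = b \<or> a \<in> set l \<or> b \<in> set (l :: nat list)"
  have r: "0 \<le> r1" "0 \<le> r2" using assms opb_nonneg by auto
  have V: "1 \<le> V" using assms(5) by (simp add: pair_variance_def)
  have inner: "(\<Sum>s'\<in>rearrangements N (a # b # l). of_bool (s' ! 0 = (a # b # l) ! 1 \<and> s' ! 1 = (a # b # l) ! 0) *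
      (v (sort (a # b # l)) * ((U (drop 2 (a # b # l)) * W1 ((a # b # l) ! 1) (s' ! 0)) * (U' (drop 2 s') * W2 (s' ! 1) ((a # b # l) ! 0)))))
      = v (sort (a # b # l)) * U l * ?S l * (W1 b b * W2 a a)"
    if ab: "a < N" "b < N" "l \<in> ?MI" for a b l
  proof -
    let ?g = "\<lambda>s'. v (sort (a # b # l)) * ((U l * W1 b (s' ! 0)) * (U' (drop 2 s') * W2 (s' ! 1) a))"
    have eq: "{s' \<in> rearrangements N (a # b # l). s' ! 0 = b \<and> s' ! 1 = a} = (\<lambda>l'. b # a # l') ` rearrangements N l"
    proof (intro equalityI subsetI)
      fix s' assume s': "s' \<in> {s' \<in> rearrangements N (a # b # l). s' ! 0 = b \<and> s' ! 1 = a}"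
      then have len: "length s' = Suc (Suc (length l))" by (auto simp: rearrangements_def multi_index_def)
      then obtain x y l' where s'eq: "s' = x # y # l'" by (metis length_Suc_conv)
      then have xy: "x = b" "y = a" using s' by auto
      have "sort s' = sort (a # b # l)" using s' unfolding rearrangements_def by blast
      then have "mset s' = mset (a # b # l)" by (simp only: sort_eq_iff_mset)
      then have "mset l' = mset l" using s'eq xy by (simp add: add_mset_commute)
      then have "l' \<in> rearrangements N l" using s' s'eq xy
        by (auto simp: rearrangements_def multi_index_def sort_eq_iff_mset)
      then show "s' \<in> (\<lambda>l'. b # a # l') ` rearrangements N l" using s'eq xy by blast
    next
      fix s' assume "s' \<in> (\<lambda>l'. b # a # l') ` rearrangements N l"
      then obtain l' where l': "s' = b # a # l'" "l' \<in> rearrangements N l" by blast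
      have "mset l' = mset l" using l' by (simp add: rearrangements_def sort_eq_iff_mset)
      then have "sort s' = sort (a # b # l)" by (subst sort_eq_iff_mset) (simp add: l' add_mset_commute)
      then show "s' \<in> {s' \<in> rearrangements N (a # b # l). s' ! 0 = b \<and> s' ! 1 = a}"
        using l' ab by (auto simp: rearrangements_def multi_index_def)
    qed
    have "(\<Sum>s'\<in>rearrangements N (a # b # l). of_bool (s' ! 0 = b \<and> s' ! 1 = a) * ?g s') =
      (\<Sum>s'\<in>{s' \<in> rearrangements N (a # b # l). s' ! 0 = b \<and> s' ! 1 = a}. ?g s')"
      by (intro sum.mono_neutral_cong_right) auto
    also have "\<dots> = (\<Sum>l'\<in>rearrangements N l. ?g (b # a # l'))"
      unfolding eq by (subst sum.reindex) (auto simp: inj_on_def)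
    finally show ?thesis by (simp add: sum_distrib_left sum_distrib_right mult_ac)
  qed
  have main: "pair_cov U U' * mtr N W1 * mtr N W2 =
      (\<Sum>a<N. \<Sum>b<N. \<Sum>l\<in>?MI. ?c l * U l * ?S l * (W1 b b * W2 a a))"
  proof -
    have "(\<Sum>a<N. \<Sum>b<N. \<Sum>l\<in>?MI. ?c l * U l * ?S l * (W1 b b * W2 a a)) = (\<Sum>a<N. \<Sum>b<N. pair_cov U U' * (W1 b b * W2 a a))"
      by (simp add: pair_cov_def sum_distrib_left sum_distrib_right mult_ac)
    also have "\<dots> = (\<Sum>b<N. \<Sum>a<N. pair_cov U U' * (W1 b b * W2 a a))" by (rule sum.swap)
    also have "\<dots> = pair_cov U U' * ((\<Sum>b<N. W1 b b) * (\<Sum>a<N. W2 a a))"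
      by (subst sum_product) (simp only: sum_distrib_left)
    finally show ?thesis by (simp add: mtr_def mult.assoc)
  qed
  have diff: "\<bar>v (sort (a # b # l)) * U l * ?S l * (W1 b b * W2 a a) - ?c l * U l * ?S l * (W1 b b * W2 a a)\<bar>
     \<le> of_bool (?bad a b l) * (2 * V * r1 * r2 * (\<bar>U l\<bar> * (\<Sum>l'\<in>rearrangements N l. \<bar>U' l'\<bar>)))"
    if ab: "a < N" "b < N" "l \<in> ?MI" for a b l
  proof (cases "?bad a b l")
    case True
    have k: "sort (a # b # l) \<in> entry_index N d" by (intro sort_MI Cons2_MI ab)
    have c0: "0 \<le> ?c l" by (intro divide_nonneg_nonneg prod_nonneg) auto
    have c1: "?c l \<le> 1"
    proof -
      have "l \<in> rearrangements N l" using ab(3) by (simp add: rearrangements_def multi_index_def)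
      then have "rearrangements N l \<noteq> {}" by blast
      then have pos: "1 \<le> real (card (rearrangements N l))" using card_gt_0_iff[of "rearrangements N l"] by simp
      have "(\<Prod>x<N. fact (count_list l x) :: real) \<le> real (card (rearrangements N l)) * (\<Prod>x<N. fact (count_list l x))"
        using mult_right_mono[OF pos, of "\<Prod>x<N. fact (count_list l x)"] by (simp add: prod_nonneg)
      also have "\<dots> = fact (d - 2)" by (rule card_rearrangements_eq[OF ab(3)])
      also have "\<dots> \<le> fact d" by (rule fact_mono) simp
      finally show ?thesis by simp
    qed
    have vV: "\<bar>v (sort (a # b # l))\<bar> \<le> V" using assms(5) k by (simp add: pair_variance_def)
    have "\<bar>v (sort (a # b # l)) - ?c l\<bar> \<le> 2 * V" using vV c0 c1 V by linarith
    moreover have "\<bar>?S l\<bar> \<le> (\<Sum>l'\<in>rearrangements N l. \<bar>U' l'\<bar>)" by (rule sum_abs)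
    moreover have "\<bar>W1 b b\<bar> \<le> r1" "\<bar>W2 a a\<bar> \<le> r2" using ab assms opb_entry by blast+
    ultimately have "\<bar>v (sort (a # b # l)) - ?c l\<bar> * (\<bar>U l\<bar> * \<bar>?S l\<bar>) * (\<bar>W1 b b\<bar> * \<bar>W2 a a\<bar>) \<le>
        (2 * V) * (\<bar>U l\<bar> * (\<Sum>l'\<in>rearrangements N l. \<bar>U' l'\<bar>)) * (r1 * r2)"
      using V r by (intro mult_mono mult_nonneg_nonneg) (auto simp: sum_nonneg)
    moreover have "v (sort (a # b # l)) * U l * ?S l * (W1 b b * W2 a a) - ?c l * U l * ?S l * (W1 b b * W2 a a) =
       (v (sort (a # b # l)) - ?c l) * (U l * ?S l) * (W1 b b * W2 a a)" by (simp only: left_diff_distrib mult.assoc)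
    ultimately show ?thesis using True by (simp only: abs_mult of_bool_eq mult_1 mult_ac)
  next
    case False
    have k: "sort (a # b # l) \<in> entry_index N d" by (intro sort_MI Cons2_MI ab)
    \<comment> \<open>Here \<open>d \<ge> 3\<close> enters: a letter of \<open>l\<close> completes
      \<open>a\<close> and \<open>b\<close> to three distinct indices, for which the weight is
      prescribed.\<close>
    have "l \<noteq> []" using ab(3) d3 by (auto simp: multi_index_def)
    then have "\<exists>c. c \<in> set l" by (cases l) auto
    then obtain c where c: "c \<in> set l" by blast
    have "card {a, b, c} = 3" using False c by (auto simp: card_insert_if)
    moreover have "set (sort (a # b # l)) = insert a (insert b (set l))" by (simp only: set_sort list.set)
    then have "card {a, b, c} \<le> card (set (sort (a # b # l)))" using c by (intro card_mono) auto
    ultimately have "v (sort (a # b # l)) = (\<Prod>x<N. fact (count_list (sort (a # b # l)) x)) / fact d"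
      using assms(5) k by (simp add: pair_variance_def)
    \<comment> \<open>Outside \<open>l\<close> the letters \<open>a\<close> and \<open>b\<close>
      have multiplicity one and contribute \<open>1!\<close>, so only the factorials of
      \<open>l\<close> remain.\<close>
    also have "(\<Prod>x<N. fact (count_list (sort (a # b # l)) x) :: real) = (\<Prod>x<N. fact (count_list l x))"
    proof (intro prod.cong refl)
      fix x
      have "count_list (sort (a # b # l)) x = count_list (a # b # l) x" by (metis count_mset mset_sort)
      also have "\<dots> = count_list l x + of_bool (x = a \<or> x = b)" using False by auto
      finally show "(fact (count_list (sort (a # b # l)) x) :: real) = fact (count_list l x)"
        using False by (auto simp: count_list_0_iff)
    qed
    finally have "v (sort (a # b # l)) = ?c l" .
    then show ?thesis using False by simp
  qed
  have bad: "(\<Sum>a<N. \<Sum>b<N. of_bool (?bad a b l)) \<le> 2 * real d * real N" if l: "l \<in> ?MI" for l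
  proof -
    have cl: "(\<Sum>a<N. of_bool (a \<in> set l) :: real) \<le> real (d - 2)"
    proof -
      have "(\<Sum>a<N. of_bool (a \<in> set l) :: real) = real (card ({..<N} \<inter> set l))" by (simp add: of_bool_def sum.If_cases)
      also have "card ({..<N} \<inter> set l) \<le> card (set l)" by (intro card_mono) auto
      also have "card (set l) \<le> d - 2" using card_length[of l] length_multi_index[OF l] by simp
      finally show ?thesis by simp
    qed
    have "(\<Sum>a<N. \<Sum>b<N. of_bool (?bad a b l) :: real) \<le> (\<Sum>a<N. \<Sum>b<N. of_bool (a = b) + of_bool (a \<in> set l) + of_bool (b \<in> set l))"
      by (intro sum_mono) auto
    also have "\<dots> = real N + 2 * (real N * (\<Sum>a<N. of_bool (a \<in> set l)))"
      by (simp add: sum.distrib sum_distrib_left of_bool_def[of "_ = _"])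
    also have "\<dots> \<le> real N + 2 * (real N * real (d - 2))" by (intro add_left_mono mult_left_mono cl) auto
    also have "\<dots> \<le> 2 * real d * real N" using d3 by (simp add: of_nat_diff algebra_simps)
    finally show ?thesis .
  qed
  have "\<bar>(\<Sum>a<N. \<Sum>b<N. \<Sum>l\<in>?MI. v (sort (a # b # l)) * U l * ?S l * (W1 b b * W2 a a)) -
      (\<Sum>a<N. \<Sum>b<N. \<Sum>l\<in>?MI. ?c l * U l * ?S l * (W1 b b * W2 a a))\<bar> \<le>
      (\<Sum>a<N. \<Sum>b<N. \<Sum>l\<in>?MI. of_bool (?bad a b l) * (2 * V * r1 * r2 * (\<bar>U l\<bar> * (\<Sum>l'\<in>rearrangements N l. \<bar>U' l'\<bar>))))"
    unfolding sum_subtractf[symmetric]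
    by (intro order_trans[OF sum_abs] sum_mono diff) auto
  also have "\<dots> = (\<Sum>l\<in>?MI. (\<Sum>a<N. \<Sum>b<N. of_bool (?bad a b l)) * (2 * V * r1 * r2 * (\<bar>U l\<bar> * (\<Sum>l'\<in>rearrangements N l. \<bar>U' l'\<bar>))))"
    unfolding sum_distrib_right by (subst sum.swap[of _ "?MI"], subst sum.swap[of _ "?MI" "{..<N}"]) simp
  also have "\<dots> \<le> (\<Sum>l\<in>?MI. (2 * real d * real N) * (2 * V * r1 * r2 * (\<bar>U l\<bar> * (\<Sum>l'\<in>rearrangements N l. \<bar>U' l'\<bar>))))"
    using V r by (intro sum_mono mult_right_mono bad mult_nonneg_nonneg) (auto simp: sum_nonneg)
  also have "\<dots> = (2 * real d * real N) * (2 * V * r1 * r2) * (\<Sum>l\<in>?MI. \<bar>U l\<bar> * (\<Sum>l'\<in>rearrangements N l. \<bar>U' l'\<bar>))"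
    by (simp add: sum_distrib_left mult_ac)
  also have "\<dots> \<le> (2 * real d * real N) * (2 * V * r1 * r2) * fact d"
    using V r by (intro mult_left_mono sum_rearrangements_abs assms mult_nonneg_nonneg) auto
  finally show ?thesis unfolding sum_MI main using inner by (simp add: mult_ac)
qed

lemma L2_pair_bound:
  fixes f g :: "nat list \<Rightarrow> nat list \<Rightarrow> real"
  assumes "(\<Sum>s\<in>multi_index N d. \<Sum>s'\<in>rearrangements N s. (f s s')\<^sup>2) \<le> A\<^sup>2"
    and "(\<Sum>s\<in>multi_index N d. \<Sum>s'\<in>rearrangements N s. (g s s')\<^sup>2) \<le> B\<^sup>2" and "0 \<le> A" "0 \<le> B"
  shows "(\<Sum>s\<in>multi_index N d. \<Sum>s'\<in>rearrangements N s. \<bar>f s s'\<bar> * \<bar>g s s'\<bar>) \<le> A * B"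
proof -
  let ?P = "SIGMA s:multi_index N d. rearrangements N s"
  have "(\<Sum>(s, s')\<in>?P. \<bar>f s s'\<bar> * \<bar>g s s'\<bar>) \<le> L2_set (\<lambda>(s, s'). f s s') ?P * L2_set (\<lambda>(s, s'). g s s') ?P"
    using L2_set_mult_ineq[of "\<lambda>(s, s'). f s s'" "\<lambda>(s, s'). g s s'" ?P] by (simp add: case_prod_unfold)
  also have "\<dots> \<le> A * B"
  proof (intro mult_mono)
    show "L2_set (\<lambda>(s, s'). f s s') ?P \<le> A" "L2_set (\<lambda>(s, s'). g s s') ?P \<le> B"
      using assms unfolding L2_set_def by (auto simp: sum.Sigma case_prod_unfold intro!: real_le_lsqrt)
  qed (use assms in auto)
  finally show ?thesis by (simp add: sum.Sigma)
qed

text \<open>A pair that is not an exchange violates one of two equations. The matrix belonging to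
  the violated one has a square sum of order \<open>N\<close> by \<open>offdiag_sum\<close>, the
  other one of order \<open>N^2\<close> by \<open>all_sum\<close>; Cauchy-Schwarz gives
  \<open>N * sqrt N\<close> against a main term of order \<open>N^2\<close>. The constant
  \<open>6\<close> is \<open>4\<close> from the exchanges plus \<open>1\<close> for each of the two
  violations.\<close>

lemma pair_trace_bound:
  assumes "subunit U" "subunit U'" "opb N r1 W1" "opb N r2 W2" "pair_variance V v"
  shows "\<bar>(\<Sum>k\<in>entry_index N d. v k * mtr N (mmul N (coefm U k) (mmul N W1 (mmul N (coefm U' k) W2))))
     - pair_cov U U' * mtr N W1 * mtr N W2\<bar> \<le> 6 * real d * fact d * V * real N * sqrt (real N) * r1 * r2"
proof -
  let ?f = "\<lambda>s s'. U (drop 2 s) * W1 (s ! 1) (s' ! 0)"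
  let ?g = "\<lambda>s s'. U' (drop 2 s') * W2 (s' ! 1) (s ! 0)"
  let ?rev = "\<lambda>s s'. s' ! 0 = s ! 1 \<and> s' ! 1 = (s :: nat list) ! 0"
  let ?A = "\<lambda>r. sqrt (fact d * real d * real N) * r" and ?B = "\<lambda>r. sqrt (fact d) * real N * r"
  have r: "0 \<le> r1" "0 \<le> r2" using assms opb_nonneg by auto
  have V: "1 \<le> V" using assms(5) by (simp add: pair_variance_def)
  have AB: "?A r * ?B r' \<le> fact d * real d * real N * sqrt (real N) * r * r'" if "0 \<le> r" "0 \<le> r'" for r r'
  proof -
    have "sqrt (real d) \<le> real d" using d3 sqrt_le_D real_le_lsqrt[of "real d" "real d"] by (simp add: power2_eq_square)
    then have "(fact d * real N * sqrt (real N) * r * r') * sqrt (real d) \<le> (fact d * real N * sqrt (real N) * r * r') * real d"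
      using that by (intro mult_left_mono) auto
    moreover have "?A r * ?B r' = (sqrt (fact d) * sqrt (fact d)) * real N * sqrt (real N) * r * r' * sqrt (real d)"
      by (simp only: real_sqrt_mult mult_ac)
    moreover have "sqrt (fact d) * sqrt (fact d) = (fact d :: real)" by simp
    ultimately show ?thesis by (simp only: mult_ac)
  qed
  have ab: "\<bar>of_bool P :: real\<bar> = of_bool P" for P by (cases P) auto
  have ob: "(of_bool P * y)\<^sup>2 = of_bool P * y\<^sup>2" for P and y :: real by (cases P) auto
  have alpha: "(\<Sum>s\<in>multi_index N d. \<Sum>s'\<in>rearrangements N s. \<bar>of_bool (s' ! 0 \<noteq> s ! 1) * ?f s s'\<bar> * \<bar>?g s s'\<bar>) \<le> ?A r1 * ?B r2"
  proof (rule L2_pair_bound)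
    show "(\<Sum>s\<in>multi_index N d. \<Sum>s'\<in>rearrangements N s. (of_bool (s' ! 0 \<noteq> s ! 1) * ?f s s')\<^sup>2) \<le> (?A r1)\<^sup>2"
      using offdiag_sum[OF assms(1,3)] unfolding ob by (simp add: power_mult_distrib[of "sqrt _"])
    have "(\<Sum>s\<in>multi_index N d. \<Sum>s'\<in>rearrangements N s. (?g s s')\<^sup>2) =
      (\<Sum>s\<in>multi_index N d. \<Sum>s'\<in>rearrangements N s. (U' (drop 2 s) * W2 (s ! 1) (s' ! 0))\<^sup>2)"
      by (rule sum_rearrangements_swap)
    also have "\<dots> \<le> (?B r2)\<^sup>2" using all_sum[OF assms(2,4)] by (simp add: power_mult_distrib)
    finally show "(\<Sum>s\<in>multi_index N d. \<Sum>s'\<in>rearrangements N s. (?g s s')\<^sup>2) \<le> (?B r2)\<^sup>2" .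
  qed (use r in auto)
  \<comment> \<open>Exchanging the roles of \<open>s\<close> and \<open>s'\<close> brings the second
    equation into the form of the first.\<close>
  have beta: "(\<Sum>s\<in>multi_index N d. \<Sum>s'\<in>rearrangements N s. \<bar>of_bool (s' ! 1 \<noteq> s ! 0) * ?g s s'\<bar> * \<bar>?f s s'\<bar>) \<le> ?A r2 * ?B r1"
  proof (rule L2_pair_bound)
    have "(\<Sum>s\<in>multi_index N d. \<Sum>s'\<in>rearrangements N s. (of_bool (s' ! 1 \<noteq> s ! 0) * ?g s s')\<^sup>2) =
      (\<Sum>s\<in>multi_index N d. \<Sum>s'\<in>rearrangements N s. (of_bool (s ! 1 \<noteq> s' ! 0) * (U' (drop 2 s) * W2 (s ! 1) (s' ! 0)))\<^sup>2)"
      by (rule sum_rearrangements_swap)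
    also have "\<dots> = (\<Sum>s\<in>multi_index N d. \<Sum>s'\<in>rearrangements N s. of_bool (s' ! 0 \<noteq> s ! 1) * (U' (drop 2 s) * W2 (s ! 1) (s' ! 0))\<^sup>2)"
      by (intro sum.cong refl) auto
    also have "\<dots> \<le> (?A r2)\<^sup>2"
      using offdiag_sum[OF assms(2,4)] by (simp add: power_mult_distrib[of "sqrt _"])
    finally show "(\<Sum>s\<in>multi_index N d. \<Sum>s'\<in>rearrangements N s. (of_bool (s' ! 1 \<noteq> s ! 0) * ?g s s')\<^sup>2) \<le> (?A r2)\<^sup>2" .
    show "(\<Sum>s\<in>multi_index N d. \<Sum>s'\<in>rearrangements N s. (?f s s')\<^sup>2) \<le> (?B r1)\<^sup>2"
      using all_sum[OF assms(1,3)] by (simp add: power_mult_distrib)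
  qed (use r in auto)
  have other: "\<bar>\<Sum>s\<in>multi_index N d. \<Sum>s'\<in>rearrangements N s. of_bool (\<not> ?rev s s') * (v (sort s) * (?f s s' * ?g s s'))\<bar>
     \<le> V * (?A r1 * ?B r2 + ?A r2 * ?B r1)"
  proof -
    have "\<bar>\<Sum>s\<in>multi_index N d. \<Sum>s'\<in>rearrangements N s. of_bool (\<not> ?rev s s') * (v (sort s) * (?f s s' * ?g s s'))\<bar>
      \<le> (\<Sum>s\<in>multi_index N d. \<Sum>s'\<in>rearrangements N s. V * (\<bar>of_bool (s' ! 0 \<noteq> s ! 1) * ?f s s'\<bar> * \<bar>?g s s'\<bar> + \<bar>of_bool (s' ! 1 \<noteq> s ! 0) * ?g s s'\<bar> * \<bar>?f s s'\<bar>))"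
    proof (intro order_trans[OF sum_abs] sum_mono)
      fix s s' assume s: "s \<in> multi_index N d"
      have "\<bar>v (sort s)\<bar> \<le> V" using assms(5) sort_MI[OF s] by (simp add: pair_variance_def)
      then have vb: "\<bar>v (sort s)\<bar> * (\<bar>?f s s'\<bar> * \<bar>?g s s'\<bar>) \<le> V * (\<bar>?f s s'\<bar> * \<bar>?g s s'\<bar>)"
        by (intro mult_right_mono) auto
      have V0: "0 \<le> V * (\<bar>?f s s'\<bar> * \<bar>?g s s'\<bar>)" using V by auto
      have "\<bar>of_bool (\<not> ?rev s s') * (v (sort s) * (?f s s' * ?g s s'))\<bar> = of_bool (\<not> ?rev s s') * (\<bar>v (sort s)\<bar> * (\<bar>?f s s'\<bar> * \<bar>?g s s'\<bar>))"
        by (simp only: abs_mult) simp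
      also have "\<dots> \<le> of_bool (\<not> ?rev s s') * (V * (\<bar>?f s s'\<bar> * \<bar>?g s s'\<bar>))"
        by (intro mult_left_mono vb) auto
      also have "\<dots> \<le> (of_bool (s' ! 0 \<noteq> s ! 1) + of_bool (s' ! 1 \<noteq> s ! 0)) * (V * (\<bar>?f s s'\<bar> * \<bar>?g s s'\<bar>))"
        by (intro mult_right_mono V0) auto
      also have "\<dots> = V * (\<bar>of_bool (s' ! 0 \<noteq> s ! 1) * ?f s s'\<bar> * \<bar>?g s s'\<bar> + \<bar>of_bool (s' ! 1 \<noteq> s ! 0) * ?g s s'\<bar> * \<bar>?f s s'\<bar>)"
        by (simp only: abs_mult ab distrib_left distrib_right mult_ac) 
      finally show "\<bar>of_bool (\<not> ?rev s s') * (v (sort s) * (?f s s' * ?g s s'))\<bar> \<le> \<dots>" .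
    qed
    also have "\<dots> = V * ((\<Sum>s\<in>multi_index N d. \<Sum>s'\<in>rearrangements N s. \<bar>of_bool (s' ! 0 \<noteq> s ! 1) * ?f s s'\<bar> * \<bar>?g s s'\<bar>) +
       (\<Sum>s\<in>multi_index N d. \<Sum>s'\<in>rearrangements N s. \<bar>of_bool (s' ! 1 \<noteq> s ! 0) * ?g s s'\<bar> * \<bar>?f s s'\<bar>))"
      by (simp only: sum_distrib_left sum.distrib distrib_left)
    also have "\<dots> \<le> V * (?A r1 * ?B r2 + ?A r2 * ?B r1)"
      using V by (intro mult_left_mono add_mono alpha beta) auto
    finally show ?thesis .
  qed
  have split: "(\<Sum>k\<in>entry_index N d. v k * mtr N (mmul N (coefm U k) (mmul N W1 (mmul N (coefm U' k) W2)))) =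
     (\<Sum>s\<in>multi_index N d. \<Sum>s'\<in>rearrangements N s. of_bool (?rev s s') * (v (sort s) * (?f s s' * ?g s s'))) +
     (\<Sum>s\<in>multi_index N d. \<Sum>s'\<in>rearrangements N s. of_bool (\<not> ?rev s s') * (v (sort s) * (?f s s' * ?g s s')))"
    unfolding pair_trace_sum sum.distrib[symmetric] by (intro sum.cong refl) auto
  have N1': "1 \<le> sqrt (real N)" using N1 by simp
  have "V * (?A r1 * ?B r2 + ?A r2 * ?B r1) \<le> V * (2 * (fact d * real d * real N * sqrt (real N) * r1 * r2))"
    using AB[OF r] AB[OF r(2,1)] V by (intro mult_left_mono) (auto simp: mult_ac)
  moreover have "4 * real d * fact d * V * real N * r1 * r2 \<le> 4 * real d * fact d * V * real N * r1 * r2 * sqrt (real N)"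
  proof -
    have "0 \<le> 4 * real d * fact d * V * real N * r1 * r2"
      using V r by (intro mult_nonneg_nonneg) auto
    from mult_left_mono[OF N1' this] show ?thesis by simp
  qed
  ultimately show ?thesis
    using reversed_part[OF assms] other unfolding split by (simp add: abs_le_iff mult_ac)
qed

end

section \<open>Operator norms\<close>

text \<open>Powers are words over a one-letter alphabet, so the lemmas on \<open>wmul\<close>
  apply.\<close>

definition mpow :: "nat \<Rightarrow> fmat \<Rightarrow> nat \<Rightarrow> fmat" where
  "mpow N A j = wmul N (\<lambda>_. A) (replicate j ())"

definition msym :: "fmat \<Rightarrow> bool" where
  "msym A \<longleftrightarrow> (\<forall>a b. A a b = A b a)"

definition frob :: "nat \<Rightarrow> fmat \<Rightarrow> real" where
  "frob N A = (\<Sum>a<N. \<Sum>b<N. (A a b)\<^sup>2)"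

definition mtp :: "fmat \<Rightarrow> fmat" where
  "mtp A = (\<lambda>a b. A b a)"

lemma mpow_simps [simp]: "mpow N A 0 = mid N" "mpow N A (Suc j) = mmul N A (mpow N A j)"
  by (auto simp: mpow_def)

lemma msupp_mpow [simp]: "msupp N A \<Longrightarrow> msupp N (mpow N A j)"
  by (simp add: mpow_def)

lemma mpow_add: "msupp N A \<Longrightarrow> mpow N A (j + k) = mmul N (mpow N A j) (mpow N A k)"
  by (simp add: mpow_def replicate_add wmul_append)

lemma mtp_mmul: "mtp (mmul N A B) = mmul N (mtp B) (mtp A)"
  by (simp add: mtp_def mmul_def mult.commute)

lemma msym_iff_mtp: "msym A \<longleftrightarrow> mtp A = A"
  by (auto simp: msym_def mtp_def fun_eq_iff)

lemma mpow_comm: "msupp N A \<Longrightarrow> mmul N (mpow N A j) A = mmul N A (mpow N A j)"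
  using mpow_add[of N A j 1] mpow_add[of N A 1 j] by simp

lemma msym_mpow: assumes "msym A" "msupp N A" shows "msym (mpow N A j)"
proof (induction j)
  case 0
  then show ?case by (auto simp: msym_def mid_def)
next
  case (Suc j)
  then show ?case using assms by (simp add: msym_iff_mtp mtp_mmul mpow_comm)
qed

lemma frob_nonneg [simp]: "0 \<le> frob N A"
  by (simp add: frob_def sum_nonneg)

lemma frob_mtp: "frob N (mtp A) = frob N A"
  unfolding frob_def mtp_def by (rule sum.swap)

lemma mtr_CS: "\<bar>mtr N (mmul N (mtp P) Q)\<bar> \<le> sqrt (frob N P) * sqrt (frob N Q)"
proof -
  let ?D = "{..<N} \<times> {..<N}"
  have "mtr N (mmul N (mtp P) Q) = (\<Sum>b<N. \<Sum>a<N. P a b * Q a b)"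
    by (simp add: mtr_def mmul_def mtp_def)
  also have "\<dots> = (\<Sum>p\<in>?D. P (snd p) (fst p) * Q (snd p) (fst p))" by (simp add: sum.cartesian_product case_prod_unfold)
  finally have "\<bar>mtr N (mmul N (mtp P) Q)\<bar> \<le> (\<Sum>p\<in>?D. \<bar>P (snd p) (fst p)\<bar> * \<bar>Q (snd p) (fst p)\<bar>)"
    using sum_abs[of "\<lambda>p. P (snd p) (fst p) * Q (snd p) (fst p)" ?D] by (simp add: abs_mult)
  also have "\<dots> \<le> L2_set (\<lambda>p. P (snd p) (fst p)) ?D * L2_set (\<lambda>p. Q (snd p) (fst p)) ?D"
    by (rule L2_set_mult_ineq)
  moreover have "L2_set (\<lambda>p. A (snd p) (fst p)) ?D = sqrt (frob N A)" for A
    unfolding frob_mtp[of N A, symmetric] by (simp add: L2_set_def frob_def mtp_def sum.cartesian_product case_prod_unfold)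
  ultimately show ?thesis by simp
qed

lemma mtr_self: "mtr N (mmul N (mtp P) P) = frob N P"
  unfolding frob_mtp[of N P, symmetric] by (simp add: mtr_def mmul_def mtp_def frob_def power2_eq_square)

lemma frob_mmul: assumes "opb N r X" shows "frob N (mmul N X B) \<le> r\<^sup>2 * frob N B"
proof -
  have "frob N (mmul N X B) = (\<Sum>b<N. \<Sum>a<N. (\<Sum>c<N. X a c * B c b)\<^sup>2)"
    unfolding frob_def mmul_def by (rule sum.swap)
  also have "\<dots> \<le> (\<Sum>b<N. r\<^sup>2 * (\<Sum>c<N. (B c b)\<^sup>2))"
  proof (intro sum_mono)
    fix b
    have "(L2_set (\<lambda>a. \<Sum>c<N. X a c * B c b) {..<N})\<^sup>2 \<le> (r * L2_set (\<lambda>c. B c b) {..<N})\<^sup>2"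
      by (intro power_mono opbD[OF assms]) simp
    then show "(\<Sum>a<N. (\<Sum>c<N. X a c * B c b)\<^sup>2) \<le> r\<^sup>2 * (\<Sum>c<N. (B c b)\<^sup>2)"
      by (simp add: L2_set_def power_mult_distrib sum_nonneg)
  qed
  also have "\<dots> = r\<^sup>2 * frob N B"
    unfolding sum_distrib_left[symmetric] frob_def by (subst sum.swap) rule
  finally show ?thesis .
qed

lemma frob_le_l1n: "frob N A \<le> (l1n N A)\<^sup>2"
  unfolding frob_def by (rule frobenius_le_l1n)

text \<open>Termwise, \<open>2 b^2 + 2 (b - a)^2 - a^2\<close> is the square of
  \<open>2 b - a\<close>.\<close>

lemma frob_msub: "frob N A \<le> 2 * frob N B + 2 * frob N (msub B A)"
proof -
  have "(A a b)\<^sup>2 \<le> 2 * (B a b)\<^sup>2 + 2 * (msub B A a b)\<^sup>2" for a b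
    using zero_le_power2[of "2 * B a b - A a b"] unfolding msub_def power2_eq_square by (simp add: algebra_simps)
  then have "frob N A \<le> (\<Sum>a<N. \<Sum>b<N. 2 * (B a b)\<^sup>2 + 2 * (msub B A a b)\<^sup>2)"
    unfolding frob_def by (intro sum_mono)
  then show ?thesis by (simp add: frob_def sum.distrib sum_distrib_left)
qed

text \<open>
  With \<open>P m = U^m B V^(h - m)\<close> the trace of \<open>B U^(m+m') B V^(2h-m-m')\<close> is the Frobenius inner product
  of \<open>P m\<close> and \<open>P m'\<close>; so the largest \<open>frob (P m)\<close> is attained at \<open>m = 0\<close> or \<open>m = h\<close>.
\<close>

lemma trace_interpolation:
  assumes "msym U" "msym V" "msym B" "msupp N U" "msupp N V" "msupp N B" "j \<le> 2 * h"
  shows "\<bar>mtr N (mmul N B (mmul N (mpow N U j) (mmul N B (mpow N V (2 * h - j)))))\<bar>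
    \<le> frob N (mmul N (mpow N U h) B) + frob N (mmul N (mpow N V h) B)"
proof -
  define P where "P m = mmul N (mpow N U m) (mmul N B (mpow N V (h - m)))" for m
  define E where "E m = frob N (P m)" for m
  have tp: "mtp (mpow N U j) = mpow N U j" "mtp (mpow N V j) = mpow N V j" "mtp B = B" for j
    using msym_mpow assms by (auto simp: msym_iff_mtp)
  have ip: "mtr N (mmul N (mtp (P m)) (P m')) =
      mtr N (mmul N B (mmul N (mpow N U (m + m')) (mmul N B (mpow N V (2 * h - (m + m'))))))"
    if "m \<le> h" "m' \<le> h" for m m'
  proof -
    have "mtr N (mmul N (mtp (P m)) (P m')) =
       mtr N (mmul N (mpow N V (h - m)) (mmul N B (mmul N (mpow N U m) (mmul N (mpow N U m') (mmul N B (mpow N V (h - m')))))))"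
      by (simp add: P_def mtp_mmul tp mmul_assoc)
    also have "\<dots> = mtr N (mmul N B (mmul N (mmul N (mpow N U m) (mpow N U m')) (mmul N B (mmul N (mpow N V (h - m')) (mpow N V (h - m))))))"
      by (subst mtr_comm) (simp add: mmul_assoc)
    also have "mmul N (mpow N V (h - m')) (mpow N V (h - m)) = mpow N V (2 * h - (m + m'))"
    proof -
      have "h - m' + (h - m) = 2 * h - (m + m')" using that by arith
      then show ?thesis using mpow_add[OF assms(5), of "h - m'" "h - m"] by simp
    qed
    finally show ?thesis by (simp add: mpow_add assms)
  qed
  have ipE: "\<bar>mtr N (mmul N (mtp (P m)) (P m'))\<bar> \<le> sqrt (E m) * sqrt (E m')" for m m'
    unfolding E_def by (rule mtr_CS)
  have E0: "0 \<le> E m" for m by (simp add: E_def)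
  \<comment> \<open>The inner product depends only on the sum of the two arguments, so
    Cauchy-Schwarz makes \<open>E\<close> log-convex at midpoints.\<close>
  have Emid: "E m \<le> sqrt (E m1) * sqrt (E m2)" if "m1 \<le> h" "m2 \<le> h" "m1 + m2 = 2 * m" "m \<le> h" for m m1 m2
  proof -
    have "E m = mtr N (mmul N (mtp (P m)) (P m))" unfolding E_def by (rule mtr_self[symmetric])
    also have "\<dots> = mtr N (mmul N (mtp (P m1)) (P m2))" using that by (simp add: ip mult_2)
    finally show ?thesis using ipE[of m1 m2] by simp
  qed
  define Mx where "Mx = Max (E ` {..h})"
  have Mx_ge: "E m \<le> Mx" if "m \<le> h" for m unfolding Mx_def using that by (intro Max_ge) auto
  have "Mx \<in> E ` {..h}" unfolding Mx_def by (rule Max_in) auto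
  then obtain m where m: "m \<le> h" "E m = Mx" by auto
  have Mx0: "0 \<le> Mx" using E0[of m] m by simp
  \<comment> \<open>\<open>m\<close> is the midpoint of \<open>0\<close> and \<open>2 * m\<close>,
    or of \<open>h\<close> and \<open>2 * m - h\<close>. One partner is an end point, at the other
    \<open>E\<close> is at most \<open>Mx\<close>.\<close>
  have "Mx \<le> sqrt (max (E 0) (E h)) * sqrt Mx"
  proof (cases "2 * m \<le> h")
    case True
    then have "Mx \<le> sqrt (E 0) * sqrt (E (2 * m))" using Emid[of 0 "2 * m" m] m by simp
    also have "\<dots> \<le> sqrt (max (E 0) (E h)) * sqrt Mx" using True Mx_ge[of "2 * m"] by (intro mult_mono) (auto simp: Mx0 E0 le_max_iff_disj)
    finally show ?thesis .
  next
    case False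
    then have "Mx \<le> sqrt (E h) * sqrt (E (2 * m - h))" using Emid[of h "2 * m - h" m] m by simp
    also have "\<dots> \<le> sqrt (max (E 0) (E h)) * sqrt Mx" using False m Mx_ge[of "2 * m - h"] by (intro mult_mono) (auto simp: Mx0 E0 le_max_iff_disj)
    finally show ?thesis .
  qed
  then have "sqrt Mx * sqrt Mx \<le> sqrt (max (E 0) (E h)) * sqrt Mx" using Mx0 by simp
  then have "sqrt Mx \<le> sqrt (max (E 0) (E h))"
  proof (cases "Mx = 0")
    case False
    then have "0 < sqrt Mx" using Mx0 by simp
    then show ?thesis using mult_right_le_imp_le[of "sqrt Mx" "sqrt Mx"] \<open>sqrt Mx * sqrt Mx \<le> _\<close> by blast
  qed (simp add: le_max_iff_disj E0)
  then have fin: "Mx \<le> E 0 + E h" using E0[of 0] E0[of h] by (simp add: max_def split: if_splits)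
  obtain a b where ab: "a \<le> h" "b \<le> h" "a + b = j"
  proof (cases "j \<le> h")
    case True then show ?thesis using that[of j 0] by simp
  next
    case False then show ?thesis using that[of h "j - h"] assms(7) by simp
  qed
  have "\<bar>mtr N (mmul N B (mmul N (mpow N U j) (mmul N B (mpow N V (2 * h - j)))))\<bar> \<le> sqrt (E a) * sqrt (E b)"
    using ipE[of a b] ip[of a b] ab by simp
  also have "\<dots> \<le> sqrt Mx * sqrt Mx" using Mx_ge ab by (intro mult_mono) (auto simp: Mx0 E0)
  finally have "\<bar>mtr N (mmul N B (mmul N (mpow N U j) (mmul N B (mpow N V (2 * h - j)))))\<bar> \<le> E 0 + E h"
    using fin Mx0 by simp
  moreover have "E 0 = frob N (mmul N (mpow N V h) B)"
  proof -
    have "P 0 = mtp (mmul N (mpow N V h) B)" by (simp add: P_def mtp_mmul tp assms)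
    then show ?thesis by (simp add: E_def frob_mtp)
  qed
  moreover have "E h = frob N (mmul N (mpow N U h) B)" by (simp add: E_def P_def assms)
  ultimately show ?thesis by simp
qed

section \<open>Even trace powers and operator norms of symmetric matrices\<close>

definition tpow :: "nat \<Rightarrow> fmat \<Rightarrow> nat \<Rightarrow> real" where
  "tpow N A p = mtr N (mpow N A (2 * p))"

lemma tpow_frob: assumes "msym A" "msupp N A" shows "tpow N A p = frob N (mpow N A p)"
proof -
  have "mtp (mpow N A p) = mpow N A p" using msym_mpow[OF assms] by (simp add: msym_iff_mtp)
  then show ?thesis
    unfolding tpow_def mtr_self[symmetric] mult_2 mpow_add[OF assms(2)] by simp
qed

lemma tpow_nonneg: "msym A \<Longrightarrow> msupp N A \<Longrightarrow> 0 \<le> tpow N A p"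
  by (simp add: tpow_frob)

lemma tpow_0: "tpow N A 0 = real N"
  by (simp add: tpow_def mtr_mid)

lemma mtr_mpow_CS: assumes "msym A" "msupp N A" shows "\<bar>mtr N (mpow N A (a + b))\<bar> \<le> sqrt (tpow N A a) * sqrt (tpow N A b)"
proof -
  have "mtp (mpow N A a) = mpow N A a" using msym_mpow[OF assms] by (simp add: msym_iff_mtp)
  then show ?thesis using mtr_CS[of N "mpow N A a" "mpow N A b"] assms by (simp add: mpow_add tpow_frob)
qed

lemma tpow_log_convex: assumes "msym A" "msupp N A" shows "(tpow N A (Suc j))\<^sup>2 \<le> tpow N A j * tpow N A (Suc (Suc j))"
proof -
  have "j + Suc (Suc j) = 2 * Suc j" by simp
  then have "\<bar>tpow N A (Suc j)\<bar> \<le> sqrt (tpow N A j) * sqrt (tpow N A (Suc (Suc j)))"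
    using mtr_mpow_CS[OF assms, of j "Suc (Suc j)"] unfolding tpow_def by metis
  then have "\<bar>tpow N A (Suc j)\<bar>\<^sup>2 \<le> (sqrt (tpow N A j) * sqrt (tpow N A (Suc (Suc j))))\<^sup>2"
    by (intro power_mono) auto
  then show ?thesis using assms by (simp add: power_mult_distrib tpow_nonneg)
qed

text \<open>Iterated log-convexity, started at \<open>tpow N A 0 = N\<close>. In terms of
  eigenvalues it is the Hoelder inequality between consecutive even powers.\<close>

lemma tpow_power_le: assumes "msym A" "msupp N A" shows "tpow N A j ^ Suc j \<le> real N * tpow N A (Suc j) ^ j"
proof (induction j)
  case 0
  then show ?case by (simp add: tpow_0)
next
  case (Suc j)
  let ?t = "tpow N A"
  have nn: "0 \<le> ?t i" for i by (rule tpow_nonneg[OF assms])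
  show ?case
  proof (cases "?t (Suc j) = 0")
    case True
    then show ?thesis using nn by simp
  next
    case False
    then have pos: "?t (Suc j) > 0" using nn[of "Suc j"] by simp
    have "((?t (Suc j))\<^sup>2) ^ Suc j \<le> (?t j * ?t (Suc (Suc j))) ^ Suc j"
      by (intro power_mono tpow_log_convex assms) simp
    also have "\<dots> = ?t j ^ Suc j * ?t (Suc (Suc j)) ^ Suc j" by (rule power_mult_distrib)
    also have "\<dots> \<le> (real N * ?t (Suc j) ^ j) * ?t (Suc (Suc j)) ^ Suc j"
      by (intro mult_right_mono Suc.IH) (simp add: nn)
    finally have "((?t (Suc j))\<^sup>2) ^ Suc j \<le> (real N * ?t (Suc j) ^ j) * ?t (Suc (Suc j)) ^ Suc j" .
    moreover have "2 * Suc j = j + Suc (Suc j)" by simp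
    then have "((?t (Suc j))\<^sup>2) ^ Suc j = ?t (Suc j) ^ j * ?t (Suc j) ^ Suc (Suc j)"
      by (metis power_mult power_add)
    ultimately have "?t (Suc j) ^ j * ?t (Suc j) ^ Suc (Suc j) \<le> ?t (Suc j) ^ j * (real N * ?t (Suc (Suc j)) ^ Suc j)"
      by (simp only: mult_ac)
    moreover have "0 < ?t (Suc j) ^ j" using pos by simp
    ultimately show ?thesis by (simp only: mult_le_cancel_left_pos)
  qed
qed

text \<open>By symmetry the left side is the inner product of \<open>x\<close> with the image of
  \<open>x\<close> under the \<open>2 * m\<close>-th power.\<close>

lemma mpow_vec_norm:
  assumes "msym A" "msupp N A"
  shows "(L2_set (\<lambda>a. \<Sum>b<N. mpow N A m a b * x b) {..<N})\<^sup>2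
    \<le> L2_set x {..<N} * L2_set (\<lambda>a. \<Sum>b<N. mpow N A (2 * m) a b * x b) {..<N}"
proof -
  let ?P = "mpow N A m"
  have s: "?P a b = ?P b a" for a b using msym_mpow[OF assms] by (simp add: msym_def)
  have "(L2_set (\<lambda>a. \<Sum>b<N. ?P a b * x b) {..<N})\<^sup>2 = (\<Sum>a<N. (\<Sum>b<N. ?P a b * x b) * (\<Sum>c<N. ?P a c * x c))"
    by (simp add: L2_set_def sum_nonneg power2_eq_square)
  also have "\<dots> = (\<Sum>a<N. \<Sum>b<N. x b * (?P b a * (\<Sum>c<N. ?P a c * x c)))"
    by (intro sum.cong refl) (simp add: sum_distrib_right s[of _ "_"] mult_ac)
  also have "\<dots> = (\<Sum>b<N. x b * (\<Sum>a<N. ?P b a * (\<Sum>c<N. ?P a c * x c)))"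
    by (subst sum.swap) (simp add: sum_distrib_left)
  also have "\<dots> = (\<Sum>b<N. x b * (\<Sum>c<N. mpow N A (2 * m) b c * x c))"
  proof -
    have "(\<Sum>a<N. ?P b a * (\<Sum>c<N. ?P a c * x c)) = (\<Sum>c<N. mpow N A (2 * m) b c * x c)" for b
      unfolding mult_2 mpow_add[OF assms(2)] mmul_def sum_distrib_left sum_distrib_right
      by (subst sum.swap) (simp add: mult.assoc)
    then show ?thesis by simp
  qed
  also have "\<dots> \<le> (\<Sum>b<N. \<bar>x b\<bar> * \<bar>\<Sum>c<N. mpow N A (2 * m) b c * x c\<bar>)"
    by (intro sum_mono) (simp flip: abs_mult)
  also have "\<dots> \<le> L2_set x {..<N} * L2_set (\<lambda>a. \<Sum>b<N. mpow N A (2 * m) a b * x b) {..<N}"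
    by (rule L2_set_mult_ineq)
  finally show ?thesis .
qed

text \<open>Repeated squaring takes the place of diagonalization:
  \<open>|A x|^(2^s) |x| \<le> |A^(2^s) x| |x|^(2^s)\<close>, and the operator norm of the last
  power is at most its Frobenius norm, the square root of a trace. Hence the exponents are powers of
  two.\<close>

lemma opb_tpow:
  assumes "msym A" "msupp N A"
  shows "opb N (root (2 * 2 ^ s) (tpow N A (2 ^ s))) A"
  unfolding opb_def
proof (intro conjI allI)
  show "0 \<le> root (2 * 2 ^ s) (tpow N A (2 ^ s))" using tpow_nonneg[OF assms] by simp
  fix x
  define n where "n m = L2_set (\<lambda>a. \<Sum>b<N. mpow N A m a b * x b) {..<N}" for m
  define l where "l = L2_set x {..<N}"
  have nn: "0 \<le> n m" "0 \<le> l" for m by (auto simp: n_def l_def)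
  have ind: "n 1 ^ (2 ^ s) * l \<le> n (2 ^ s) * l ^ (2 ^ s)" for s
  proof (induction s)
    case (Suc s)
    show ?case
    proof (cases "l = 0")
      case False
      then have lp: "l > 0" using nn by simp
      have "(n 1 ^ (2 ^ s) * l)\<^sup>2 \<le> (n (2 ^ s) * l ^ (2 ^ s))\<^sup>2" by (intro power_mono Suc.IH) (simp add: nn)
      also have "\<dots> = (n (2 ^ s))\<^sup>2 * l ^ (2 ^ Suc s)" by (simp add: power_mult_distrib power_mult[symmetric] mult.commute)
      also have "\<dots> \<le> (l * n (2 ^ Suc s)) * l ^ (2 ^ Suc s)"
        using mpow_vec_norm[OF assms, of "2 ^ s" x] by (intro mult_right_mono) (auto simp: n_def l_def)
      finally have "l * (n 1 ^ (2 ^ Suc s) * l) \<le> l * (n (2 ^ Suc s) * l ^ (2 ^ Suc s))"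
        by (simp add: power_mult_distrib power_mult[symmetric] power2_eq_square[of l] mult_ac)
      then show ?thesis using lp by simp
    next
      case True
      have "0 \<le> n (2 ^ Suc s) * l ^ (2 ^ Suc s)" by (intro mult_nonneg_nonneg zero_le_power nn)
      then show ?thesis using True by simp
    qed
  qed (simp add: nn)
  show "L2_set (\<lambda>a. \<Sum>b<N. A a b * x b) {..<N} \<le> root (2 * 2 ^ s) (tpow N A (2 ^ s)) * L2_set x {..<N}"
  proof (cases "l = 0")
    case True
    then have "\<forall>b\<in>{..<N}. x b = 0" by (simp add: l_def L2_set_eq_0_iff)
    then have "L2_set (\<lambda>a. \<Sum>b<N. A a b * x b) {..<N} = 0" by (simp add: L2_set_def)
    then show ?thesis using True by (simp add: l_def)
  next
    case False
    then have lp: "l > 0" using nn by simp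
    let ?r = "root (2 * 2 ^ s) (tpow N A (2 ^ s))"
    have "opb N (sqrt (frob N (mpow N A (2 ^ s)))) (mpow N A (2 ^ s))"
      unfolding frob_def by (rule opb_frobenius)
    then have "n (2 ^ s) \<le> sqrt (tpow N A (2 ^ s)) * l"
      unfolding n_def l_def tpow_frob[OF assms, symmetric] by (rule opbD)
    then have "n (2 ^ s) * l ^ (2 ^ s) \<le> (sqrt (tpow N A (2 ^ s)) * l) * l ^ (2 ^ s)"
      by (rule mult_right_mono) (simp add: nn)
    with ind[of s] have "l * n 1 ^ (2 ^ s) \<le> l * (sqrt (tpow N A (2 ^ s)) * l ^ (2 ^ s))" by (simp add: mult_ac)
    then have "n 1 ^ (2 ^ s) \<le> sqrt (tpow N A (2 ^ s)) * l ^ (2 ^ s)" using lp by simp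
    also have "sqrt (tpow N A (2 ^ s)) = ?r ^ (2 ^ s)"
    proof -
      have "(?r ^ (2 ^ s))\<^sup>2 = ?r ^ (2 * 2 ^ s)" by (simp add: power_mult[symmetric] mult.commute)
      also have "\<dots> = tpow N A (2 ^ s)" using tpow_nonneg[OF assms] by (simp add: real_root_pow_pos2)
      finally show ?thesis using tpow_nonneg[OF assms] by (intro real_sqrt_unique) auto
    qed
    also have "?r ^ (2 ^ s) * l ^ (2 ^ s) = (?r * l) ^ (2 ^ s)" by (simp add: power_mult_distrib)
    finally have "n 1 \<le> ?r * l"
      using power_le_imp_le_base[of "n 1" "2 ^ s - 1" "?r * l"] tpow_nonneg[OF assms] nn by simp
    moreover have "mpow N A 1 = A" using assms by simp
    ultimately show ?thesis by (simp add: n_def l_def)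
  qed
qed

text \<open>
  For symmetric matrices this is the operator norm, written so that its measurability and the bounds by
  traces are immediate.
\<close>

definition opnorm :: "nat \<Rightarrow> fmat \<Rightarrow> real" where
  "opnorm N A = (INF s. root (2 * 2 ^ s) (tpow N A (2 ^ s)))"

lemma opnorm_bdd: "msym A \<Longrightarrow> msupp N A \<Longrightarrow> bdd_below (range (\<lambda>s. root (2 * 2 ^ s) (tpow N A (2 ^ s))))"
  by (intro bdd_belowI[of _ 0]) (auto simp: tpow_nonneg)

lemma opnorm_nonneg: "msym A \<Longrightarrow> msupp N A \<Longrightarrow> 0 \<le> opnorm N A"
  unfolding opnorm_def by (intro cINF_greatest) (auto simp: tpow_nonneg)

lemma opb_opnorm: assumes "msym A" "msupp N A" shows "opb N (opnorm N A) A"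
  unfolding opb_def
proof (intro conjI allI opnorm_nonneg assms)
  fix x
  let ?n = "L2_set (\<lambda>a. \<Sum>b<N. A a b * x b) {..<N}" and ?l = "L2_set x {..<N}"
  have r: "?n \<le> root (2 * 2 ^ s) (tpow N A (2 ^ s)) * ?l" for s by (rule opbD[OF opb_tpow[OF assms]])
  show "?n \<le> opnorm N A * ?l"
  proof (cases "?l = 0")
    case True
    then show ?thesis using r[of 0] by simp
  next
    case False
    then have lp: "?l > 0" using L2_set_nonneg[of x "{..<N}"] by linarith
    have "?n / ?l \<le> opnorm N A"
      unfolding opnorm_def using r lp by (intro cINF_greatest) (auto simp: pos_divide_le_eq)
    then show ?thesis using lp by (simp add: pos_divide_le_eq)
  qed
qed

lemma opnorm_power_le: assumes "msym A" "msupp N A" shows "opnorm N A ^ (2 * 2 ^ s) \<le> tpow N A (2 ^ s)"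
proof -
  have "opnorm N A \<le> root (2 * 2 ^ s) (tpow N A (2 ^ s))"
    unfolding opnorm_def by (intro cINF_lower opnorm_bdd assms) simp
  then have "opnorm N A ^ (2 * 2 ^ s) \<le> root (2 * 2 ^ s) (tpow N A (2 ^ s)) ^ (2 * 2 ^ s)"
    by (intro power_mono opnorm_nonneg assms)
  then show ?thesis using tpow_nonneg[OF assms] by (simp add: real_root_pow_pos2)
qed

text \<open>Sharpens \<open>mtr_CS\<close> by taking absolute values before the diagonal is summed;
  this serves the entries that are not centered.\<close>

lemma diag_CS: "(\<Sum>b<N. \<bar>mmul N (mtp P) Q b b\<bar>) \<le> sqrt (frob N P) * sqrt (frob N Q)"
proof -
  let ?D = "{..<N} \<times> {..<N}"
  have "(\<Sum>b<N. \<bar>mmul N (mtp P) Q b b\<bar>) \<le> (\<Sum>b<N. \<Sum>a<N. \<bar>P a b\<bar> * \<bar>Q a b\<bar>)"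
    unfolding mmul_def mtp_def by (intro sum_mono order_trans[OF sum_abs]) (simp add: abs_mult)
  also have "\<dots> = (\<Sum>p\<in>?D. \<bar>P (snd p) (fst p)\<bar> * \<bar>Q (snd p) (fst p)\<bar>)" by (simp add: sum.cartesian_product case_prod_unfold)
  also have "\<dots> \<le> L2_set (\<lambda>p. P (snd p) (fst p)) ?D * L2_set (\<lambda>p. Q (snd p) (fst p)) ?D"
    by (rule L2_set_mult_ineq)
  moreover have "L2_set (\<lambda>p. A (snd p) (fst p)) ?D = sqrt (frob N A)" for A
    unfolding frob_mtp[of N A, symmetric] by (simp add: L2_set_def frob_def mtp_def sum.cartesian_product case_prod_unfold)
  ultimately show ?thesis by simp
qed

lemma mpow_telescope:
  assumes "msupp N A" "msupp N B"
  shows "msub (mpow N A m) (mpow N B m) =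
    (\<lambda>a b. \<Sum>j<m. mmul N (mpow N A j) (mmul N (msub A B) (mpow N B (m - Suc j))) a b)"
proof -
  have "msub (mpow N A m) (mpow N B m) = (\<lambda>a b. \<Sum>j<m. mmul N (wmul N (\<lambda>_. A) (take j (replicate m ())))
     (mmul N (msub A B) (wmul N (\<lambda>_. B) (drop (Suc j) (replicate m ())))) a b)"
    using wmul_telescope[of N "\<lambda>_. A" "\<lambda>_. B" "replicate m ()"] assms unfolding mpow_def by simp
  also have "\<dots> = (\<lambda>a b. \<Sum>j<m. mmul N (mpow N A j) (mmul N (msub A B) (mpow N B (m - Suc j))) a b)"
    unfolding mpow_def by (intro ext sum.cong refl) (simp add: min_def)
  finally show ?thesis .
qed

text \<open>For consecutive even trace powers \<open>t\<close> and \<open>T\<close>, the lower one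
  is absorbed into an eighth of the higher one. Otherwise \<open>T\<close> is below
  \<open>8 * C * y * t\<close>, and the Hoelder bound in the first premise turns this into an upper
  bound for \<open>t\<close> alone.\<close>

lemma young_trace:
  fixes t T C y :: real
  assumes "t ^ p \<le> n * T ^ (p - 1)" "0 \<le> t" "0 \<le> T" "0 \<le> C" "0 \<le> y" "p \<ge> 1" "0 \<le> n"
  shows "C * y * t \<le> T / 8 + n * (8 * C * y) ^ p"
proof (cases "C * y * t \<le> T / 8")
  case True
  then show ?thesis using assms by (simp add: add_increasing2)
next
  case False
  have cy: "0 \<le> 8 * C * y" using assms by simp
  have t: "t > 0" using False assms by (cases "t = 0") auto
  have "T \<le> 8 * C * y * t" using False by simp
  then have "T ^ (p - 1) \<le> (8 * C * y * t) ^ (p - 1)" using assms by (intro power_mono)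
  then have "t ^ p \<le> n * (8 * C * y * t) ^ (p - 1)" using assms by (meson mult_left_mono order_trans)
  moreover have "t ^ p = t * t ^ (p - 1)" using assms by (metis Suc_pred' less_eq_Suc_le One_nat_def power_Suc)
  ultimately have "t * t ^ (p - 1) \<le> (n * (8 * C * y) ^ (p - 1)) * t ^ (p - 1)" by (simp add: power_mult_distrib mult_ac)
  then have tle: "t \<le> n * (8 * C * y) ^ (p - 1)" using t by simp
  have "C * y * t \<le> 8 * C * y * t" using cy t by (simp add: mult_right_mono)
  also have "\<dots> \<le> 8 * C * y * (n * (8 * C * y) ^ (p - 1))" using cy tle by (intro mult_left_mono)
  also have "\<dots> = n * (8 * C * y) ^ p" using assms(6) by (cases p) (auto simp: mult_ac)
  finally show ?thesis using assms by simp
qed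

text \<open>The threshold \<open>L\<close> is such that \<open>\<rho> > L * y\<close> forces
  \<open>8 C (1 + D)^(2 p - 4) y^4 \<le> \<rho>^4\<close>; otherwise \<open>\<rho>\<close> itself is
  of order \<open>y\<close>.\<close>

lemma young_norm:
  fixes \<rho> T C y D :: real
  assumes "\<rho> ^ (2 * p) \<le> T" "0 \<le> \<rho>" "0 \<le> C" "0 \<le> y" "0 \<le> D" "p \<ge> 2"
  defines "L \<equiv> max 1 (8 * C * (1 + D) ^ (2 * p - 4))"
  shows "C * y ^ 4 * (\<rho> + D * y) ^ (2 * p - 4) \<le> T / 8 + C * (L + D) ^ (2 * p - 4) * y ^ (2 * p)"
proof -
  have T0: "0 \<le> T" using assms(1,2) by (meson order_trans zero_le_power)
  have L: "1 \<le> L" "8 * C * (1 + D) ^ (2 * p - 4) \<le> L" by (auto simp: L_def)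
  have e: "4 + (2 * p - 4) = 2 * p" using assms(6) by simp
  show ?thesis
  proof (cases "\<rho> \<le> L * y")
    case True
    then have "\<rho> + D * y \<le> (L + D) * y" by (simp add: algebra_simps)
    then have "(\<rho> + D * y) ^ (2 * p - 4) \<le> ((L + D) * y) ^ (2 * p - 4)"
      using assms by (intro power_mono) auto
    then have "C * y ^ 4 * (\<rho> + D * y) ^ (2 * p - 4) \<le> C * y ^ 4 * ((L + D) * y) ^ (2 * p - 4)"
      using assms by (intro mult_left_mono) auto
    also have "\<dots> = C * (L + D) ^ (2 * p - 4) * (y ^ 4 * y ^ (2 * p - 4))" by (simp add: power_mult_distrib)
    also have "y ^ 4 * y ^ (2 * p - 4) = y ^ (2 * p)" unfolding power_add[symmetric] e ..
    finally show ?thesis using T0 by simp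
  next
    case False
    then have y: "L * y \<le> \<rho>" by simp
    have "1 * y \<le> L * y" using L assms by (intro mult_right_mono) auto
    then have y\<rho>: "y \<le> \<rho>" using y by simp
    have "\<rho> + D * y \<le> (1 + D) * \<rho>" using y\<rho> assms mult_left_mono[of y \<rho> D] by (simp add: algebra_simps)
    then have a: "(\<rho> + D * y) ^ (2 * p - 4) \<le> ((1 + D) * \<rho>) ^ (2 * p - 4)"
      using assms by (intro power_mono) auto
    have "(L * y) ^ 4 \<le> \<rho> ^ 4" using y L assms by (intro power_mono) auto
    moreover have "L * y ^ 4 \<le> L ^ 4 * y ^ 4"
      using L by (intro mult_right_mono) (auto simp: self_le_power)
    ultimately have b: "L * y ^ 4 \<le> \<rho> ^ 4" by (simp add: power_mult_distrib)
    have "8 * (C * y ^ 4 * (\<rho> + D * y) ^ (2 * p - 4)) \<le> 8 * (C * y ^ 4 * ((1 + D) * \<rho>) ^ (2 * p - 4))"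
      using a assms by (intro mult_left_mono) auto
    also have "\<dots> = (8 * C * (1 + D) ^ (2 * p - 4)) * y ^ 4 * \<rho> ^ (2 * p - 4)" by (simp add: power_mult_distrib)
    also have "\<dots> \<le> L * y ^ 4 * \<rho> ^ (2 * p - 4)"
      using L assms by (intro mult_right_mono) auto
    also have "\<dots> \<le> \<rho> ^ 4 * \<rho> ^ (2 * p - 4)" using b assms by (intro mult_right_mono) auto
    also have "\<dots> = \<rho> ^ (2 * p)" unfolding power_add[symmetric] e ..
    also have "\<dots> \<le> T" by fact
    finally have "C * y ^ 4 * (\<rho> + D * y) ^ (2 * p - 4) \<le> T / 8" by simp
    moreover have "0 \<le> C * (L + D) ^ (2 * p - 4) * y ^ (2 * p)"
      using assms L by (intro mult_nonneg_nonneg zero_le_power) auto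
    ultimately show ?thesis by simp
  qed
qed

section \<open>Pointwise estimates for high trace powers\<close>

context contraction_coefficients
begin

lemma single_trace:
  "mtr N (mmul N (coefm U k) W) = (\<Sum>s\<in>{s\<in>multi_index N d. sort s = k}. U (drop 2 s) * W (s ! 1) (s ! 0))"
proof -
  have "mtr N (mmul N (coefm U k) W) = (\<Sum>a<N. \<Sum>b<N. coefm U k a b * W b a)"
    by (simp add: mtr_def mmul_def)
  also have "\<dots> = (\<Sum>a<N. \<Sum>b<N. \<Sum>l\<in>multi_index N (d - 2). if sort (a # b # l) = k then U l * W b a else 0)"
  proof (intro sum.cong refl)
    fix a b assume "a \<in> {..<N}" "b \<in> {..<N}"
    then have "coefm U k a b * W b a = (\<Sum>l\<in>multi_index N (d - 2). (if sort (a # b # l) = k then U l else 0) * W b a)"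
      by (simp only: coefm_def lessThan_iff simp_thms if_True sum_distrib_right)
    also have "\<dots> = (\<Sum>l\<in>multi_index N (d - 2). if sort (a # b # l) = k then U l * W b a else 0)"
      by (intro sum.cong refl) auto
    finally show "coefm U k a b * W b a = \<dots>" .
  qed
  also have "\<dots> = (\<Sum>s\<in>{s\<in>multi_index N d. sort s = k}. U (drop 2 s) * W (s ! 1) (s ! 0))"
    unfolding sum_fiber by (simp cong: if_cong)
  finally show ?thesis .
qed

definition diagonal_index :: "nat list set" where
  "diagonal_index = {k\<in>entry_index N d. card (set k) = 1}"

lemma diagonal_index_eq: "diagonal_index = replicate d ` {..<N}"
proof (intro equalityI subsetI)
  fix k assume "k \<in> diagonal_index"
  then have k: "k \<in> entry_index N d" "card (set k) = 1" by (auto simp: diagonal_index_def)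
  then obtain a where a: "set k = {a}" by (auto simp: card_1_singleton_iff)
  then have "k = replicate (length k) a" by (metis replicate_length_same singletonD)
  moreover have "length k = d" "a < N" using k a by (auto simp: entry_index_def multi_index_def)
  ultimately show "k \<in> replicate d ` {..<N}" by auto
next
  fix k assume "k \<in> replicate d ` {..<N}"
  then obtain a where "a < N" "k = replicate d a" by auto
  then show "k \<in> diagonal_index" using d3 by (auto simp: diagonal_index_def entry_index_def multi_index_def)
qed

lemma diagonal_trace:
  assumes "a < N" shows "mtr N (mmul N (coefm U (replicate d a)) W) = U (replicate (d - 2) a) * W a a"
proof -
  have "{s\<in>multi_index N d. sort s = replicate d a} = {replicate d a}"
  proof (intro equalityI subsetI)
    fix s assume "s \<in> {s\<in>multi_index N d. sort s = replicate d a}"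
    then have "sort s = replicate d a" "length s = d" by (auto simp: multi_index_def)
    then have "set s \<subseteq> {a}" by (metis set_replicate_conv_if set_sort empty_subsetI order_refl)
    then have "s = replicate (length s) a" by (metis replicate_length_same singletonD subsetD)
    then show "s \<in> {replicate d a}" using \<open>length s = d\<close> by simp
  next
    fix s assume "s \<in> {replicate d a}"
    moreover have "sort (replicate d a) = replicate d a" by (rule sorted_sort_id) simp
    ultimately show "s \<in> {s\<in>multi_index N d. sort s = replicate d a}" using assms by (auto simp: multi_index_def)
  qed
  then show ?thesis using d3 unfolding single_trace by (simp add: drop_replicate)
qed

text \<open>An entry with constant index touches a single matrix position, so its first-order
  contribution is controlled by the diagonal of \<open>W\<close>. Absolute values are taken since
  these entries offer no cancellation.\<close>

lemma diagonal_sum_bound: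
  assumes "subunit U"
  shows "(\<Sum>k\<in>diagonal_index. \<bar>mtr N (mmul N (coefm U k) W)\<bar>) \<le> (\<Sum>a<N. \<bar>W a a\<bar>)"
proof -
  have "inj_on (replicate d) {..<N}" using d3 by (intro inj_onI) (auto simp: replicate_eq_replicate)
  then have "(\<Sum>k\<in>diagonal_index. \<bar>mtr N (mmul N (coefm U k) W)\<bar>) = (\<Sum>a<N. \<bar>mtr N (mmul N (coefm U (replicate d a)) W)\<bar>)"
    unfolding diagonal_index_eq by (subst sum.reindex) auto
  also have "\<dots> \<le> (\<Sum>a<N. \<bar>W a a\<bar>)"
  proof (intro sum_mono)
    fix a assume "a \<in> {..<N}"
    then have "\<bar>U (replicate (d - 2) a)\<bar> \<le> 1" by (intro subunit_abs_le[OF assms]) (auto simp: multi_index_def)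
    then show "\<bar>mtr N (mmul N (coefm U (replicate d a)) W)\<bar> \<le> \<bar>W a a\<bar>"
      using \<open>a \<in> {..<N}\<close> by (simp add: diagonal_trace abs_mult mult_left_le_one_le)
  qed
  finally show ?thesis .
qed

lemma msym_ensm [simp]: "msym (ensm U x)"
  unfolding msym_def using ensm_sym by blast

lemma msym_coefm [simp]: "msym (coefm U k)"
  unfolding msym_def using coefm_sym by blast

lemma sum_frob_coefm:
  assumes "subunit U" shows "(\<Sum>k\<in>entry_index N d. frob N (mmul N P (coefm U k))) \<le> fact d * real N * frob N P"
proof -
  have "(\<Sum>k\<in>entry_index N d. frob N (mmul N P (coefm U k))) =
     (\<Sum>a<N. \<Sum>k\<in>entry_index N d. \<Sum>b<N. (\<Sum>c<N. coefm U k b c * P a c)\<^sup>2)"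
    unfolding frob_def mmul_def by (subst sum.swap) (simp add: mult.commute coefm_sym[of U _ _ "_"])
  also have "\<dots> \<le> (\<Sum>a<N. fact d * real N * (\<Sum>c<N. (P a c)\<^sup>2))"
    by (intro sum_mono sum_coefm_sq_vec assms)
  finally show ?thesis by (simp add: frob_def sum_distrib_left)
qed

text \<open>The change caused by one entry is a multiple of its coefficient matrix, whose operator
  norm is at most its l1 norm and hence at most \<open>d!\<close>.\<close>

lemma opb_leave_one_out:
  assumes "subunit U" "k \<in> entry_index N d" "\<bar>x k\<bar> \<le> y" "opb N r (ensm U x)"
  shows "opb N (\<bar>x k\<bar> / sqrt (real N) * l1n N (coefm U k)) (msub (ensm U x) (ensm U (x(k := 0))))"
    and "opb N (r + fact d * y) (ensm U (x(k := 0)))"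
    and "\<bar>x k\<bar> / sqrt (real N) * l1n N (coefm U k) \<le> y / sqrt (real N) * l1n N (coefm U k)"
proof -
  have N: "1 \<le> sqrt (real N)" using N1 by simp
  have "opb N (\<bar>x k / sqrt (real N)\<bar> * l1n N (coefm U k)) (mscale (x k / sqrt (real N)) (coefm U k))"
    by (rule opb_mscale[OF opb_l1n])
  then show 1: "opb N (\<bar>x k\<bar> / sqrt (real N) * l1n N (coefm U k)) (msub (ensm U x) (ensm U (x(k := 0))))"
    unfolding ensm_leave_one_out[OF assms(2)] using N by simp
  have e: "ensm U (x(k := 0)) = msub (ensm U x) (msub (ensm U x) (ensm U (x(k := 0))))"
    by (simp add: msub_def)
  have "\<bar>x k\<bar> / sqrt (real N) \<le> \<bar>x k\<bar> / 1" using N by (intro divide_left_mono) auto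
  then have "\<bar>x k\<bar> / sqrt (real N) \<le> y" using assms(3) by simp
  then have "\<bar>x k\<bar> / sqrt (real N) * l1n N (coefm U k) \<le> y * fact d"
    using assms(3) by (intro mult_mono l1n_coefm_fact assms(1)) auto
  then have "opb N (r + fact d * y) (msub (ensm U x) (msub (ensm U x) (ensm U (x(k := 0)))))"
    by (intro opb_mono[OF opb_msub[OF assms(4) 1]]) (simp add: mult.commute)
  then show "opb N (r + fact d * y) (ensm U (x(k := 0)))" using e by metis
  show "\<bar>x k\<bar> / sqrt (real N) * l1n N (coefm U k) \<le> y / sqrt (real N) * l1n N (coefm U k)"
    using assms(3) by (intro mult_right_mono divide_right_mono) auto
qed

text \<open>Telescoping puts a second coefficient matrix between powers of the old and of the new
  matrix. \<open>trace_interpolation\<close> moves all powers to one side at equal exponent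
  \<open>h\<close>; the Frobenius norm for the new matrix is then compared with that for the old
  one, and the second summand pays for the comparison.\<close>

lemma power_trace_diff:
  assumes U: "subunit U" and k: "k \<in> entry_index N d" and y: "\<bar>x k\<bar> \<le> y" and r: "opb N r (ensm U x)"
  shows "\<bar>x k * (mtr N (mmul N (coefm U k) (mpow N (ensm U x) (2 * h + 1))) - mtr N (mmul N (coefm U k) (mpow N (ensm U (x(k := 0))) (2 * h + 1))))\<bar>
    \<le> real (2 * h + 1) * y\<^sup>2 / sqrt (real N) * (3 * frob N (mmul N (mpow N (ensm U x) h) (coefm U k)) +
        2 * (real h)\<^sup>2 * (fact d)\<^sup>2 * y\<^sup>2 / real N * (l1n N (coefm U k))\<^sup>2 * (r + fact d * y) ^ (2 * h - 2))"
    (is "_ \<le> _ * (?E1 + ?E2)")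
proof -
  let ?B = "coefm U k" and ?A = "ensm U x" and ?V = "ensm U (x(k := 0))"
  let ?R = "r + fact d * y" and ?\<beta> = "l1n N (coefm U k)"
  have y0: "0 \<le> y" using y by simp
  have r0: "0 \<le> r" using r by (rule opb_nonneg)
  have rV: "opb N ?R ?V" by (rule opb_leave_one_out(2)[OF U k y r])
  have rA: "opb N ?R ?A" by (rule opb_mono[OF r]) (use y0 in simp)
  have rD: "opb N (y / sqrt (real N) * ?\<beta>) (msub ?A ?V)"
    by (rule opb_mono[OF opb_leave_one_out(1)[OF U k y r] opb_leave_one_out(3)[OF U k y r]])
  let ?m = "2 * h + 1"
  have tel: "mtr N (mmul N ?B (mpow N ?A ?m)) - mtr N (mmul N ?B (mpow N ?V ?m)) =
     (\<Sum>j<?m. x k / sqrt (real N) * mtr N (mmul N ?B (mmul N (mpow N ?A j) (mmul N ?B (mpow N ?V (2 * h - j))))))"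
  proof -
    have "mtr N (mmul N ?B (mpow N ?A ?m)) - mtr N (mmul N ?B (mpow N ?V ?m)) = mtr N (mmul N ?B (msub (mpow N ?A ?m) (mpow N ?V ?m)))"
      by (simp add: mmul_msub_right mtr_msub del: mpow_simps)
    also have "msub (mpow N ?A ?m) (mpow N ?V ?m) = (\<lambda>a b. \<Sum>j<?m. mmul N (mpow N ?A j)
       (mmul N (msub ?A ?V) (mpow N ?V (2 * h - j))) a b)"
      using mpow_telescope[of N ?A ?V ?m] by simp
    also have "mtr N (mmul N ?B \<dots>) = (\<Sum>j<?m. mtr N (mmul N ?B (mmul N (mpow N ?A j) (mmul N (msub ?A ?V) (mpow N ?V (2 * h - j))))))"
      by (simp only: mmul_sum_right mtr_sum)
    also have "\<dots> = (\<Sum>j<?m. x k / sqrt (real N) * mtr N (mmul N ?B (mmul N (mpow N ?A j) (mmul N ?B (mpow N ?V (2 * h - j))))))"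
      unfolding ensm_leave_one_out[OF k] by (simp only: mmul_mscale_left mmul_mscale_right mtr_mscale)
    finally show ?thesis .
  qed
  have V: "frob N (mmul N (mpow N ?V h) ?B) \<le> 2 * frob N (mmul N (mpow N ?A h) ?B) + ?E2"
  proof -
    have "opb N (real h * (y / sqrt (real N) * ?\<beta>) * ?R ^ (h - 1)) (msub (mpow N ?A h) (mpow N ?V h))"
      using opb_wmul_diff[of N "\<lambda>_. ?A" "\<lambda>_. ?V" "replicate h ()" ?R "y / sqrt (real N) * ?\<beta>"] rA rV rD
      unfolding mpow_def by simp
    then have "frob N (mmul N (msub (mpow N ?A h) (mpow N ?V h)) ?B) \<le> (real h * (y / sqrt (real N) * ?\<beta>) * ?R ^ (h - 1))\<^sup>2 * frob N ?B"
      by (rule frob_mmul)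
    also have "\<dots> \<le> (real h * (y / sqrt (real N) * ?\<beta>) * ?R ^ (h - 1))\<^sup>2 * (fact d)\<^sup>2"
    proof (intro mult_left_mono)
      have "frob N ?B \<le> ?\<beta>\<^sup>2" by (rule frob_le_l1n)
      also have "\<dots> \<le> (fact d)\<^sup>2" by (intro power_mono l1n_coefm_fact U) simp
      finally show "frob N ?B \<le> (fact d)\<^sup>2" .
    qed simp
    also have "\<dots> = (real h)\<^sup>2 * (fact d)\<^sup>2 * y\<^sup>2 / real N * ?\<beta>\<^sup>2 * ?R ^ (2 * h - 2)"
    proof -
      have "(h - 1) * 2 = 2 * h - 2" by simp
      then have "(?R ^ (h - 1))\<^sup>2 = ?R ^ (2 * h - 2)" by (simp only: power_mult[symmetric])
      then show ?thesis using N1 by (simp add: power_mult_distrib power_divide mult_ac)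
    qed
    finally have "frob N (mmul N (msub (mpow N ?A h) (mpow N ?V h)) ?B) \<le> (real h)\<^sup>2 * (fact d)\<^sup>2 * y\<^sup>2 / real N * ?\<beta>\<^sup>2 * ?R ^ (2 * h - 2)" .
    then show ?thesis
      using frob_msub[of N "mmul N (mpow N ?V h) ?B" "mmul N (mpow N ?A h) ?B"] by (simp add: mmul_msub_left)
  qed
  have each: "\<bar>mtr N (mmul N ?B (mmul N (mpow N ?A j) (mmul N ?B (mpow N ?V (2 * h - j)))))\<bar> \<le> ?E1 + ?E2" if "j < ?m" for j
  proof -
    have "\<bar>mtr N (mmul N ?B (mmul N (mpow N ?A j) (mmul N ?B (mpow N ?V (2 * h - j)))))\<bar>
      \<le> frob N (mmul N (mpow N ?A h) ?B) + frob N (mmul N (mpow N ?V h) ?B)"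
      by (rule trace_interpolation) (use that in auto)
    then show ?thesis using V by simp
  qed
  have E0: "0 \<le> ?E1 + ?E2" using y0 r0 by (intro add_nonneg_nonneg mult_nonneg_nonneg divide_nonneg_nonneg zero_le_power) auto
  have "\<bar>x k * (mtr N (mmul N ?B (mpow N ?A ?m)) - mtr N (mmul N ?B (mpow N ?V ?m)))\<bar>
    = \<bar>x k\<bar> * (\<bar>x k\<bar> / sqrt (real N)) * \<bar>\<Sum>j<?m. mtr N (mmul N ?B (mmul N (mpow N ?A j) (mmul N ?B (mpow N ?V (2 * h - j)))))\<bar>"
  proof -
    have "\<bar>a * (\<Sum>j<m. c * f j)\<bar> = \<bar>a\<bar> * \<bar>c\<bar> * \<bar>\<Sum>j<m. f j\<bar>" for a c :: real and f and m :: nat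
      by (simp only: sum_distrib_left[symmetric] abs_mult mult.assoc)
    moreover have "\<bar>x k / sqrt (real N)\<bar> = \<bar>x k\<bar> / sqrt (real N)" by simp
    ultimately show ?thesis unfolding tel by (simp only:)
  qed
  also have "\<dots> \<le> y * (y / sqrt (real N)) * (\<Sum>j<?m. ?E1 + ?E2)"
    using y y0 each by (intro mult_mono divide_right_mono order_trans[OF sum_abs] sum_mono) auto
  also have "\<dots> = real (2 * h + 1) * y\<^sup>2 / sqrt (real N) * (?E1 + ?E2)"
    by (simp add: power2_eq_square)
  finally show ?thesis .
qed

text \<open>An upper bound for the part of the trace power that survives in expectation. Three
  inequalities of Young type, for constant indices, for the Frobenius sums and for the operator
  norm, each cost one eighth of \<open>tpow N A p\<close>, hence \<open>3 / 8\<close>; the rest is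
  of order \<open>N * y ^ (2 * p)\<close>.\<close>

lemma trace_moment_pointwise:
  assumes U: "subunit U" and y: "\<And>k. k \<in> entry_index N d \<Longrightarrow> \<bar>x k\<bar> \<le> y" "1 \<le> y" and s: "s \<ge> 1"
  defines "A \<equiv> ensm U x" and "p \<equiv> 2 ^ s"
  defines "C1 \<equiv> 2 + 3 * real (2 * p - 1) * fact d" and "C2 \<equiv> 2 * real (2 * p - 1) * (real (p - 1))\<^sup>2 * (fact d) ^ 3"
  shows "1 / sqrt (real N) * ((\<Sum>k\<in>diagonal_index. x k * mtr N (mmul N (coefm U k) (mpow N A (2 * p - 1)))) +
     (\<Sum>k\<in>entry_index N d - diagonal_index. x k * (mtr N (mmul N (coefm U k) (mpow N A (2 * p - 1))) -
         mtr N (mmul N (coefm U k) (mpow N (ensm U (x(k := 0))) (2 * p - 1))))))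
    \<le> 3 / 8 * tpow N A p + ((8 * C1) ^ p + C2 * (max 1 (8 * C2 * (1 + fact d) ^ (2 * p - 4)) + fact d) ^ (2 * p - 4)) * real N * y ^ (2 * p)"
proof -
  have p2: "2 \<le> p" using s unfolding p_def by (metis power_increasing power_one_right one_le_numeral)
  define h where "h = p - 1"
  have ph: "2 * p - 1 = 2 * h + 1" "p = Suc h" "2 * h - 2 = 2 * p - 4" using p2 by (auto simp: h_def)
  have A: "msym A" "msupp N A" by (auto simp: A_def)
  define T where "T = tpow N A p"
  define t where "t = tpow N A h"
  have T0: "0 \<le> T" "0 \<le> t" unfolding T_def t_def by (auto intro!: tpow_nonneg A)
  \<comment> \<open>The bound of \<open>opb_tpow\<close>, chosen because its \<open>2 * p\<close>-th
    power is exactly \<open>T\<close>.\<close>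
  define \<rho> where "\<rho> = root (2 * p) T"
  have \<rho>: "opb N \<rho> A" unfolding \<rho>_def T_def p_def by (rule opb_tpow[OF A])
  have \<rho>T: "\<rho> ^ (2 * p) = T" unfolding \<rho>_def using T0 p2 by (simp add: real_root_pow_pos2)
  have \<rho>0: "0 \<le> \<rho>" using \<rho> by (rule opb_nonneg)
  have N: "1 \<le> sqrt (real N)" "1 \<le> real N" using N1 by auto
  let ?W = "mpow N A (2 * p - 1)"
  have S1: "1 / sqrt (real N) * (\<Sum>k\<in>diagonal_index. x k * mtr N (mmul N (coefm U k) ?W)) \<le> 2 * y\<^sup>2 * t + T / 8"
  proof -
    have "(\<Sum>k\<in>diagonal_index. x k * mtr N (mmul N (coefm U k) ?W)) \<le> (\<Sum>k\<in>diagonal_index. y * \<bar>mtr N (mmul N (coefm U k) ?W)\<bar>)"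
    proof (intro sum_mono)
      fix k assume "k \<in> diagonal_index"
      then have "\<bar>x k\<bar> \<le> y" using y by (auto simp: diagonal_index_def)
      then have "\<bar>x k\<bar> * \<bar>mtr N (mmul N (coefm U k) ?W)\<bar> \<le> y * \<bar>mtr N (mmul N (coefm U k) ?W)\<bar>" by (rule mult_right_mono) simp
      then show "x k * mtr N (mmul N (coefm U k) ?W) \<le> y * \<bar>mtr N (mmul N (coefm U k) ?W)\<bar>"
        by (metis abs_le_D1 abs_mult)
    qed
    also have "\<dots> \<le> y * (\<Sum>a<N. \<bar>?W a a\<bar>)"
      unfolding sum_distrib_left[symmetric] using y(2) by (intro mult_left_mono diagonal_sum_bound U) auto
    also have "(\<Sum>a<N. \<bar>?W a a\<bar>) \<le> sqrt t * sqrt T"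
    proof -
      have "2 * p - 1 = h + p" using p2 by (simp add: h_def)
      then have "?W = mmul N (mtp (mpow N A h)) (mpow N A p)"
        using msym_mpow[OF A, of h] A by (simp only: mpow_add msym_iff_mtp)
      then show ?thesis using diag_CS[of N "mpow N A h" "mpow N A p"] unfolding t_def T_def tpow_frob[OF A] by simp
    qed
    finally have a: "(\<Sum>k\<in>diagonal_index. x k * mtr N (mmul N (coefm U k) ?W)) \<le> y * (sqrt t * sqrt T)" using y(2) by simp
    have "1 / sqrt (real N) * (\<Sum>k\<in>diagonal_index. x k * mtr N (mmul N (coefm U k) ?W)) \<le> 1 / sqrt (real N) * (y * (sqrt t * sqrt T))"
      by (intro mult_left_mono a) simp
    also have "\<dots> \<le> 1 * (y * (sqrt t * sqrt T))" using N y(2) T0 by (intro mult_right_mono) (auto simp: divide_le_eq_1)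
    also have "\<dots> = (y * sqrt t) * sqrt T" by simp
    also have "\<dots> \<le> 2 * (y * sqrt t)\<^sup>2 + (sqrt T)\<^sup>2 / 8"
    proof -
      have "2 * a * b \<le> 4 * a\<^sup>2 + b\<^sup>2 / 4" for a b :: real using zero_le_power2[of "2 * a - b / 2"]
        by (simp add: power2_diff power_divide power_mult_distrib)
      from this[of "y * sqrt t" "sqrt T"] show ?thesis by simp
    qed
    finally show ?thesis using T0 by (simp add: power_mult_distrib)
  qed
  let ?c = "real (2 * h + 1) * y\<^sup>2 / sqrt (real N)"
  let ?R = "\<rho> + fact d * y"
  let ?q = "2 * (real h)\<^sup>2 * (fact d)\<^sup>2 * y\<^sup>2 / real N"
  have S2: "1 / sqrt (real N) * (\<Sum>k\<in>entry_index N d - diagonal_index. x k * (mtr N (mmul N (coefm U k) ?W) -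
         mtr N (mmul N (coefm U k) (mpow N (ensm U (x(k := 0))) (2 * p - 1)))))
     \<le> real (2 * h + 1) * y\<^sup>2 * (3 * fact d * t + 2 * (real h)\<^sup>2 * (fact d) ^ 3 * y\<^sup>2 * ?R ^ (2 * h - 2))"
  proof -
    have "(\<Sum>k\<in>entry_index N d - diagonal_index. x k * (mtr N (mmul N (coefm U k) ?W) -
         mtr N (mmul N (coefm U k) (mpow N (ensm U (x(k := 0))) (2 * p - 1)))))
      \<le> (\<Sum>k\<in>entry_index N d - diagonal_index. ?c * (3 * frob N (mmul N (mpow N A h) (coefm U k)) + ?q * (l1n N (coefm U k))\<^sup>2 * ?R ^ (2 * h - 2)))"
    proof (intro sum_mono)
      fix k assume "k \<in> entry_index N d - diagonal_index"
      then have k: "k \<in> entry_index N d" by simp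
      from power_trace_diff[OF U k y(1)[OF k] \<rho>[unfolded A_def], of h]
      show "x k * (mtr N (mmul N (coefm U k) ?W) - mtr N (mmul N (coefm U k) (mpow N (ensm U (x(k := 0))) (2 * p - 1))))
        \<le> ?c * (3 * frob N (mmul N (mpow N A h) (coefm U k)) + ?q * (l1n N (coefm U k))\<^sup>2 * ?R ^ (2 * h - 2))"
        unfolding ph(1) A_def by (rule order_trans[OF abs_ge_self])
    qed
    also have "\<dots> \<le> (\<Sum>k\<in>entry_index N d. ?c * (3 * frob N (mmul N (mpow N A h) (coefm U k)) + ?q * (l1n N (coefm U k))\<^sup>2 * ?R ^ (2 * h - 2)))"
      using y(2) \<rho>0 by (intro sum_mono2 mult_nonneg_nonneg add_nonneg_nonneg zero_le_power divide_nonneg_nonneg) auto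
    also have "\<dots> = ?c * (3 * (\<Sum>k\<in>entry_index N d. frob N (mmul N (mpow N A h) (coefm U k))) +
         ?q * ?R ^ (2 * h - 2) * (\<Sum>k\<in>entry_index N d. (l1n N (coefm U k))\<^sup>2))"
    proof -
      have "(\<Sum>k\<in>K. c * (3 * f k + q * g k * z)) = c * (3 * (\<Sum>k\<in>K. f k) + q * z * (\<Sum>k\<in>K. g k))"
        for K and f g :: "nat list \<Rightarrow> real" and c q z :: real
        by (simp add: sum.distrib sum_distrib_left sum_distrib_right algebra_simps)
      then show ?thesis .
    qed
    also have "\<dots> \<le> ?c * (3 * (fact d * real N * frob N (mpow N A h)) + ?q * ?R ^ (2 * h - 2) * (fact d * (real N)\<^sup>2))"
      using y(2) \<rho>0 by (intro mult_left_mono add_mono sum_frob_coefm sum_l1n_sq U mult_nonneg_nonneg zero_le_power divide_nonneg_nonneg) auto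
    finally have "1 / sqrt (real N) * (\<Sum>k\<in>entry_index N d - diagonal_index. x k * (mtr N (mmul N (coefm U k) ?W) -
         mtr N (mmul N (coefm U k) (mpow N (ensm U (x(k := 0))) (2 * p - 1)))))
       \<le> 1 / sqrt (real N) * (?c * (3 * (fact d * real N * t) + ?q * ?R ^ (2 * h - 2) * (fact d * (real N)\<^sup>2)))"
      unfolding t_def tpow_frob[OF A] by (intro mult_left_mono) auto
    also have "\<dots> = real (2 * h + 1) * y\<^sup>2 * (3 * fact d * t + 2 * (real h)\<^sup>2 * (fact d) ^ 3 * y\<^sup>2 * ?R ^ (2 * h - 2))"
    proof -
      have q: "?q * ?R ^ (2 * h - 2) * (fact d * (real N)\<^sup>2) = real N * (2 * (real h)\<^sup>2 * (fact d) ^ 3 * y\<^sup>2 * ?R ^ (2 * h - 2))"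
        using N by (simp add: power2_eq_square power3_eq_cube field_simps)
      have "1 / sqrt (real N) * (?c * (real N * Z)) = real (2 * h + 1) * y\<^sup>2 * Z" for Z
      proof -
        have "1 / sqrt (real N) * (?c * (real N * Z)) = (real (2 * h + 1) * y\<^sup>2 * Z) * (real N / (sqrt (real N) * sqrt (real N)))"
          by simp
        then show ?thesis using N by simp
      qed
      from this[of "3 * fact d * t + 2 * (real h)\<^sup>2 * (fact d) ^ 3 * y\<^sup>2 * ?R ^ (2 * h - 2)"] show ?thesis
        unfolding q by (simp add: algebra_simps)
    qed
    finally show ?thesis .
  qed
  have C: "0 \<le> C1" "0 \<le> C2" by (auto simp: C1_def C2_def)
  have tp: "t ^ p \<le> real N * T ^ (p - 1)"
    using tpow_power_le[OF A, of h] unfolding t_def T_def ph(2) by simp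
  have Y1: "C1 * y\<^sup>2 * t \<le> T / 8 + real N * (8 * C1 * y\<^sup>2) ^ p"
    by (rule young_trace[OF tp]) (use T0 C p2 in auto)
  have Y2: "C2 * y ^ 4 * ?R ^ (2 * p - 4) \<le> T / 8 + C2 * (max 1 (8 * C2 * (1 + fact d) ^ (2 * p - 4)) + fact d) ^ (2 * p - 4) * y ^ (2 * p)"
    by (rule young_norm) (use \<rho>T \<rho>0 C y(2) p2 in auto)
  \<comment> \<open>\<open>C1\<close> collects all terms with the lower trace power
    \<open>t\<close>, \<open>C2\<close> those with the operator bound.\<close>
  have "2 * y\<^sup>2 * t + real (2 * h + 1) * y\<^sup>2 * (3 * fact d * t + 2 * (real h)\<^sup>2 * (fact d) ^ 3 * y\<^sup>2 * ?R ^ (2 * h - 2))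
     = C1 * y\<^sup>2 * t + C2 * y ^ 4 * ?R ^ (2 * p - 4)"
    unfolding C1_def C2_def ph(1,3) h_def[symmetric] by (simp add: algebra_simps power2_eq_square power4_eq_xxxx)
  moreover have "real N * (8 * C1 * y\<^sup>2) ^ p = (8 * C1) ^ p * real N * y ^ (2 * p)"
  proof -
    have "y ^ (2 * p) = (y\<^sup>2) ^ p" by (rule power_mult)
    then show ?thesis by (simp only: power_mult_distrib mult_ac)
  qed
  moreover define Q where "Q = C2 * (max 1 (8 * C2 * (1 + fact d) ^ (2 * p - 4)) + fact d) ^ (2 * p - 4)"
  moreover have "Q * y ^ (2 * p) * 1 \<le> Q * y ^ (2 * p) * real N"
    using N C y(2) unfolding Q_def by (intro mult_left_mono mult_nonneg_nonneg zero_le_power) auto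
  moreover have "((8 * C1) ^ p + Q) * real N * y ^ (2 * p) = (8 * C1) ^ p * real N * y ^ (2 * p) + Q * y ^ (2 * p) * real N"
  proof -
    have "(a + Q) * n * w = a * n * w + Q * w * n" for a n w :: real by (simp add: algebra_simps)
    then show ?thesis .
  qed
  ultimately have "2 * y\<^sup>2 * t + T / 8 + real (2 * h + 1) * y\<^sup>2 * (3 * fact d * t + 2 * (real h)\<^sup>2 * (fact d) ^ 3 * y\<^sup>2 * ?R ^ (2 * h - 2))
    \<le> 3 / 8 * T + ((8 * C1) ^ p + C2 * (max 1 (8 * C2 * (1 + fact d) ^ (2 * p - 4)) + fact d) ^ (2 * p - 4)) * real N * y ^ (2 * p)"
    using Y1 Y2 unfolding Q_def by linarith
  then show ?thesis using S1 S2 unfolding T_def by (simp only: distrib_left)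
qed

end

section \<open>Integrability, measurability and the moments of the operator norm\<close>

lemma (in prob_space) has_moments_mmul:
  assumes "\<And>a b. has_moments M (\<lambda>\<omega>. A \<omega> a b)" "\<And>a b. has_moments M (\<lambda>\<omega>. B \<omega> a b)"
  shows "has_moments M (\<lambda>\<omega>. mmul N (A \<omega>) (B \<omega>) a b)"
  unfolding mmul_def by (intro has_moments_sum has_moments_mult assms)

lemma (in prob_space) has_moments_wmul:
  assumes "\<And>i a b. has_moments M (\<lambda>\<omega>. F \<omega> i a b)"
  shows "has_moments M (\<lambda>\<omega>. wmul N (F \<omega>) w a b)"
proof (induction w arbitrary: a b)
  case (Cons i w)
  then show ?case using has_moments_mmul[of "\<lambda>\<omega>. F \<omega> i" "\<lambda>\<omega>. wmul N (F \<omega>) w"] assms by simp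
qed simp

lemma (in prob_space) has_moments_mtr:
  assumes "\<And>a b. has_moments M (\<lambda>\<omega>. A \<omega> a b)" shows "has_moments M (\<lambda>\<omega>. mtr N (A \<omega>))"
  unfolding mtr_def by (intro has_moments_sum assms)

lemma measurable_mmul:
  assumes "\<And>a b. (\<lambda>x. A x a b) \<in> borel_measurable L" "\<And>a b. (\<lambda>x. B x a b) \<in> borel_measurable L"
  shows "(\<lambda>x. mmul N (A x) (B x) a b) \<in> borel_measurable L"
  unfolding mmul_def by (intro borel_measurable_sum borel_measurable_times assms)

lemma measurable_wmul:
  assumes "\<And>i a b. (\<lambda>x. F x i a b) \<in> borel_measurable L"
  shows "(\<lambda>x. wmul N (F x) w a b) \<in> borel_measurable L"
proof (induction w arbitrary: a b)
  case (Cons i w)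
  then show ?case using measurable_mmul[of "\<lambda>x. F x i" L "\<lambda>x. wmul N (F x) w"] assms by simp
qed simp

lemma measurable_mtr:
  assumes "\<And>a b. (\<lambda>x. A x a b) \<in> borel_measurable L" shows "(\<lambda>x. mtr N (A x)) \<in> borel_measurable L"
  unfolding mtr_def by (intro borel_measurable_sum assms)

locale wigner_matrix = wigner_tensor M d X + contraction_coefficients N d
  for M :: "'w measure" and d :: nat and X :: "nat \<Rightarrow> nat list \<Rightarrow> 'w \<Rightarrow> real" and N :: nat
begin

abbreviation (input) "SP \<equiv> PiM (entry_index N d) (\<lambda>_. borel :: real measure)"

lemma measurable_ensm: "(\<lambda>x. ensm U x a b) \<in> borel_measurable SP"
proof -
  have "(\<lambda>x. x k) \<in> borel_measurable SP" if "k \<in> entry_index N d" for k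
    using measurable_component_singleton[OF that, of "\<lambda>_. borel"] by simp
  then show ?thesis
    unfolding ensm_expand mscale_def by (intro borel_measurable_sum borel_measurable_times borel_measurable_divide) auto
qed

lemma has_moments_ensm_gen:
  assumes "\<And>k. k \<in> entry_index N d \<Longrightarrow> has_moments M (\<lambda>\<omega>. Z \<omega> k)"
  shows "has_moments M (\<lambda>\<omega>. ensm U (Z \<omega>) a b)"
  unfolding ensm_expand mscale_def divide_inverse
  by (intro has_moments_sum has_moments_mult assms) auto

lemma has_moments_entries: "k \<in> entry_index N d \<Longrightarrow> has_moments M (\<lambda>\<omega>. entries N \<omega> k)"
  using has_moments_X[of k N] by (simp add: entries_def)

lemma has_moments_ensm: "has_moments M (\<lambda>\<omega>. ensm U (entries N \<omega>) a b)"
  by (rule has_moments_ensm_gen) (rule has_moments_entries)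

lemma has_moments_ensm_loo: "has_moments M (\<lambda>\<omega>. ensm U ((entries N \<omega>)(k := 0)) a b)"
proof (rule has_moments_ensm_gen)
  fix j assume "j \<in> entry_index N d"
  then show "has_moments M (\<lambda>\<omega>. ((entries N \<omega>)(k := 0)) j)"
    using has_moments_entries by (cases "j = k") auto
qed

lemma has_moments_mpow_trace: "has_moments M (\<lambda>\<omega>. mtr N (mmul N B (mpow N (ensm U (entries N \<omega>)) m)))"
  unfolding mpow_def by (intro has_moments_mtr has_moments_mmul has_moments_wmul has_moments_ensm has_moments_const)

lemma has_moments_mpow_trace_loo: "has_moments M (\<lambda>\<omega>. mtr N (mmul N B (mpow N (ensm U ((entries N \<omega>)(k := 0))) m)))"
  unfolding mpow_def by (intro has_moments_mtr has_moments_mmul has_moments_wmul has_moments_ensm_loo has_moments_const)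

lemma has_moments_tpow: "has_moments M (\<lambda>\<omega>. tpow N (ensm U (entries N \<omega>)) p)"
  unfolding tpow_def mpow_def by (intro has_moments_mtr has_moments_wmul has_moments_ensm)

lemma expectation_centered_loo:
  assumes k: "k \<in> entry_index N d - diagonal_index" and g: "g \<in> borel_measurable SP"
    and h: "has_moments M (\<lambda>\<omega>. g ((entries N \<omega>)(k := 0)))"
  shows "expectation (\<lambda>\<omega>. X N k \<omega> * g ((entries N \<omega>)(k := 0))) = 0"
proof -
  have "expectation (X N k) = 0" using k centered[of k N] by (auto simp: diagonal_index_def entry_index_def)
  moreover have "expectation (\<lambda>\<omega>. (\<lambda>x. x) (X N k \<omega>) * g ((entries N \<omega>)(k := 0))) =
      expectation (\<lambda>\<omega>. (\<lambda>x. x) (X N k \<omega>)) * expectation (\<lambda>\<omega>. g ((entries N \<omega>)(k := 0)))"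
    using k by (intro leave_one_out_expectation g has_moments_integrable[OF h])
      (auto intro: has_moments_integrable has_moments_X)
  ultimately show ?thesis by simp
qed

lemma mtr_ensm_expand:
  "mtr N (mmul N (ensm U x) W) = 1 / sqrt (real N) * (\<Sum>k\<in>entry_index N d. x k * mtr N (mmul N (coefm U k) W))"
  unfolding ensm_expand mmul_sum_left mtr_sum mmul_mscale_left mtr_mscale
  by (simp add: sum_distrib_left)

text \<open>For nonconstant \<open>k\<close> the product of \<open>X N k\<close> with a function of
  the other entries has mean zero. Once these terms are subtracted the pointwise estimate applies,
  and its \<open>3 / 8\<close> of the left side is moved over. The constant is explicit to make
  visible that it depends on neither \<open>N\<close> nor \<open>U\<close>.\<close>

lemma expectation_tpow:
  assumes U: "subunit U" and s: "s \<ge> 1"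
  shows "expectation (\<lambda>\<omega>. tpow N (ensm U (entries N \<omega>)) (2 ^ s)) \<le>
     2 * ((8 * (2 + 3 * real (2 * 2 ^ s - 1) * fact d)) ^ 2 ^ s +
       (2 * real (2 * 2 ^ s - 1) * (real (2 ^ s - 1))\<^sup>2 * (fact d) ^ 3) *
       (max 1 (8 * (2 * real (2 * 2 ^ s - 1) * (real (2 ^ s - 1))\<^sup>2 * (fact d) ^ 3) * (1 + fact d) ^ (2 * 2 ^ s - 4)) + fact d) ^ (2 * 2 ^ s - 4)) *
     real N * expectation (\<lambda>\<omega>. Xmax N \<omega> ^ (2 * 2 ^ s))" (is "_ \<le> 2 * ?C * _ * _")
proof -
  let ?p = "2 ^ s :: nat" and ?S = "entry_index N d"
  let ?A = "\<lambda>\<omega>. ensm U (entries N \<omega>)" and ?V = "\<lambda>k \<omega>. ensm U ((entries N \<omega>)(k := 0))"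
  let ?m = "2 * ?p - 1"
  let ?f = "\<lambda>k \<omega>. mtr N (mmul N (coefm U k) (mpow N (?A \<omega>) ?m))"
  let ?g = "\<lambda>k \<omega>. mtr N (mmul N (coefm U k) (mpow N (?V k \<omega>) ?m))"
  let ?T = "\<lambda>\<omega>. tpow N (?A \<omega>) ?p"
  have pm: "2 * ?p = Suc ?m" by simp
  have ent: "entries N \<omega> k = X N k \<omega>" if "k \<in> ?S" for k \<omega> using that by (simp add: entries_def)
  have T: "?T \<omega> = 1 / sqrt (real N) * (\<Sum>k\<in>?S. X N k \<omega> * ?f k \<omega>)" for \<omega>
  proof -
    have "?T \<omega> = mtr N (mmul N (?A \<omega>) (mpow N (?A \<omega>) ?m))"
      unfolding tpow_def by (subst pm) (simp only: mpow_simps)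
    then show ?thesis unfolding mtr_ensm_expand using ent by simp
  qed
  let ?D = "\<lambda>\<omega>. 1 / sqrt (real N) * ((\<Sum>k\<in>diagonal_index. X N k \<omega> * ?f k \<omega>) + (\<Sum>k\<in>?S - diagonal_index. X N k \<omega> * (?f k \<omega> - ?g k \<omega>)))"
  have sub: "diagonal_index \<subseteq> ?S" by (auto simp: diagonal_index_def)
  have hmX: "has_moments M (X N k)" if "k \<in> ?S" for k by (rule has_moments_X[OF that])
  have hmf: "has_moments M (?f k)" "has_moments M (?g k)" for k
    by (rule has_moments_mpow_trace has_moments_mpow_trace_loo)+
  have hg: "has_moments M (\<lambda>\<omega>. X N k \<omega> * ?g k \<omega>)" if "k \<in> ?S" for k by (intro has_moments_mult hmX hmf that)
  have hmD: "has_moments M ?D"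
    using sub by (intro has_moments_mult has_moments_add has_moments_sum has_moments_diff has_moments_const hmX hmf) auto
  have TD: "?T \<omega> = ?D \<omega> + 1 / sqrt (real N) * (\<Sum>k\<in>?S - diagonal_index. X N k \<omega> * ?g k \<omega>)" for \<omega>
  proof -
    have "(\<Sum>k\<in>?S. X N k \<omega> * ?f k \<omega>) = (\<Sum>k\<in>diagonal_index. X N k \<omega> * ?f k \<omega>) + (\<Sum>k\<in>?S - diagonal_index. X N k \<omega> * ?f k \<omega>)"
      using sub by (simp add: sum.subset_diff add.commute)
    also have "(\<Sum>k\<in>?S - diagonal_index. X N k \<omega> * ?f k \<omega>) = (\<Sum>k\<in>?S - diagonal_index. X N k \<omega> * (?f k \<omega> - ?g k \<omega>)) + (\<Sum>k\<in>?S - diagonal_index. X N k \<omega> * ?g k \<omega>)"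
      by (simp add: sum.distrib[symmetric] algebra_simps)
    finally show ?thesis unfolding T by (simp only: distrib_left add.assoc)
  qed
  have zero: "expectation (\<lambda>\<omega>. X N k \<omega> * ?g k \<omega>) = 0" if k: "k \<in> ?S - diagonal_index" for k
  proof -
    have "(\<lambda>x. mtr N (mmul N (coefm U k) (mpow N (ensm U x) ?m))) \<in> borel_measurable SP"
      unfolding mpow_def by (intro measurable_mtr measurable_mmul measurable_wmul measurable_ensm borel_measurable_const)
    from expectation_centered_loo[OF k this] hmf(2)[of k] show ?thesis by simp
  qed
  have ED: "expectation ?T = expectation ?D"
  proof -
    have i: "integrable M (\<lambda>\<omega>. X N k \<omega> * ?g k \<omega>)" if "k \<in> ?S - diagonal_index" for k
      using hg that by (intro has_moments_integrable) auto
    have "expectation ?T = expectation ?D + expectation (\<lambda>\<omega>. 1 / sqrt (real N) * (\<Sum>k\<in>?S - diagonal_index. X N k \<omega> * ?g k \<omega>))"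
    proof -
      have "has_moments M (\<lambda>\<omega>. 1 / sqrt (real N) * (\<Sum>k\<in>?S - diagonal_index. X N k \<omega> * ?g k \<omega>))"
        by (intro has_moments_mult[OF has_moments_const] has_moments_sum) (rule hg, simp)
      then show ?thesis unfolding TD by (intro Bochner_Integration.integral_add has_moments_integrable[OF hmD] has_moments_integrable)
    qed
    also have "expectation (\<lambda>\<omega>. 1 / sqrt (real N) * (\<Sum>k\<in>?S - diagonal_index. X N k \<omega> * ?g k \<omega>)) =
       1 / sqrt (real N) * (\<Sum>k\<in>?S - diagonal_index. expectation (\<lambda>\<omega>. X N k \<omega> * ?g k \<omega>))"
      using i by simp
    also have "(\<Sum>k\<in>?S - diagonal_index. expectation (\<lambda>\<omega>. X N k \<omega> * ?g k \<omega>)) = 0"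
      by (intro sum.neutral ballI zero)
    finally show ?thesis by (simp only: mult_zero_right add_0_right)
  qed
  have "expectation ?D \<le> expectation (\<lambda>\<omega>. 3 / 8 * ?T \<omega> + ?C * real N * Xmax N \<omega> ^ (2 * ?p))"
  proof (rule integral_mono)
    show "integrable M ?D" by (rule has_moments_integrable[OF hmD])
    show "integrable M (\<lambda>\<omega>. 3 / 8 * ?T \<omega> + ?C * real N * Xmax N \<omega> ^ (2 * ?p))"
      by (intro has_moments_integrable has_moments_add has_moments_mult has_moments_const has_moments_tpow has_moments_power Xmax_moments)
    fix \<omega>
    have y: "\<bar>entries N \<omega> k\<bar> \<le> Xmax N \<omega>" if "k \<in> ?S" for k using Xmax_ge[OF that] ent[OF that] by simp
    have 1: "(\<Sum>k\<in>diagonal_index. entries N \<omega> k * ?f k \<omega>) = (\<Sum>k\<in>diagonal_index. X N k \<omega> * ?f k \<omega>)"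
      using sub ent by (intro sum.cong) auto
    have 2: "(\<Sum>k\<in>?S - diagonal_index. entries N \<omega> k * (?f k \<omega> - ?g k \<omega>)) = (\<Sum>k\<in>?S - diagonal_index. X N k \<omega> * (?f k \<omega> - ?g k \<omega>))"
      using ent by (intro sum.cong) auto
    show "?D \<omega> \<le> 3 / 8 * ?T \<omega> + ?C * real N * Xmax N \<omega> ^ (2 * ?p)"
      using trace_moment_pointwise[OF U, of "entries N \<omega>" "Xmax N \<omega>" s, OF y Xmax_ge1 s] unfolding 1 2 .
  qed
  also have "\<dots> = 3 / 8 * expectation ?T + ?C * real N * expectation (\<lambda>\<omega>. Xmax N \<omega> ^ (2 * ?p))"
    using has_moments_integrable[OF has_moments_tpow] has_moments_integrable[OF has_moments_power[OF Xmax_moments]] by simp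
  finally have *: "expectation ?T \<le> 3 / 8 * expectation ?T + ?C * real N * expectation (\<lambda>\<omega>. Xmax N \<omega> ^ (2 * ?p))" unfolding ED .
  \<comment> \<open>Together with \<open>*\<close> this shows that the other summand is nonnegative,
    so that the factor \<open>8 / 5\<close> may be enlarged to \<open>2\<close>.\<close>
  have "0 \<le> expectation ?T" by (intro integral_nonneg_AE) (simp add: tpow_nonneg)
  then show ?thesis using * by linarith
qed

lemma measurable_opnorm: "(\<lambda>\<omega>. opnorm N (ensm U (entries N \<omega>))) \<in> borel_measurable M"
  unfolding opnorm_def
proof (rule borel_measurable_cINF_real)
  fix s
  have [measurable]: "(\<lambda>\<omega>. tpow N (ensm U (entries N \<omega>)) (2 ^ s)) \<in> borel_measurable M"
    by (rule has_moments_measurable[OF has_moments_tpow])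
  have "continuous_on UNIV (root (2 * 2 ^ s))" by (intro continuous_intros)
  then have [measurable]: "root (2 * 2 ^ s) \<in> borel_measurable borel" by (rule borel_measurable_continuous_onI)
  show "(\<lambda>\<omega>. root (2 * 2 ^ s) (tpow N (ensm U (entries N \<omega>)) (2 ^ s))) \<in> borel_measurable M" by measurable
qed simp

lemma has_moments_opnorm: "has_moments M (\<lambda>\<omega>. opnorm N (ensm U (entries N \<omega>)))"
proof (rule has_moments_bound[OF _ measurable_opnorm])
  show "has_moments M (\<lambda>\<omega>. 1 + tpow N (ensm U (entries N \<omega>)) (2 ^ 0))"
    by (intro has_moments_add has_moments_const has_moments_tpow)
  fix \<omega>
  let ?A = "ensm U (entries N \<omega>)"
  have "opnorm N ?A \<le> 1 + (opnorm N ?A)\<^sup>2"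
    using zero_le_power2[of "opnorm N ?A - 1"] opnorm_nonneg[of ?A N] by (simp add: power2_diff)
  also have "\<dots> \<le> 1 + tpow N ?A (2 ^ 0)" using opnorm_power_le[of ?A N 0] by simp
  finally show "\<bar>opnorm N ?A\<bar> \<le> \<bar>1 + tpow N ?A (2 ^ 0)\<bar>" using opnorm_nonneg[of ?A N] tpow_nonneg[of ?A N] by simp
qed

end

context wigner_tensor
begin

lemma moment_bounded_opnorm:
  assumes d: "d \<ge> 3" and U: "\<And>N. N \<ge> 1 \<Longrightarrow> contraction_coefficients.subunit N d (U N)"
  shows "moment_bounded M (\<lambda>N \<omega>. opnorm N (contraction_coefficients.ensm N d (U N) (entries N \<omega>)))"
proof -
  let ?A = "\<lambda>N \<omega>. contraction_coefficients.ensm N d (U N) (entries N \<omega>)"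
  have loc: "wigner_matrix M d X N" if "N \<ge> 1" for N
    using that d by unfold_locales auto
  have hm: "has_moments M (\<lambda>\<omega>. opnorm N (?A N \<omega>))" if "N \<ge> 1" for N
    by (rule wigner_matrix.has_moments_opnorm[OF loc[OF that]])
  have nn: "0 \<le> opnorm N (?A N \<omega>)" if "N \<ge> 1" for N \<omega>
  proof -
    interpret contraction_coefficients N d using that d by unfold_locales auto
    show ?thesis by (simp add: opnorm_nonneg)
  qed
  show ?thesis
    unfolding moment_bounded_def
  proof (intro conjI allI impI hm)
    fix q :: nat
    \<comment> \<open>Now the trace power controls the moment of order \<open>4 * 2 ^ q\<close>. Its
      bound \<open>N * sqrt N\<close> is at most \<open>sqrt N ^ 4\<close>, and interpolation with
      exponent \<open>4\<close> leaves the order \<open>2 ^ q\<close>, which exceeds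
      \<open>q\<close>.\<close>
    define s where "s = Suc q"
    obtain C where C: "C \<ge> 0" "\<And>N. N \<ge> 1 \<Longrightarrow> expectation (\<lambda>\<omega>. tpow N (?A N \<omega>) (2 ^ s)) \<le> C * real N * expectation (\<lambda>\<omega>. Xmax N \<omega> ^ (2 * 2 ^ s))"
    proof -
      define C where "C = 2 * ((8 * (2 + 3 * real (2 * 2 ^ s - 1) * fact d)) ^ 2 ^ s +
       (2 * real (2 * 2 ^ s - 1) * (real (2 ^ s - 1))\<^sup>2 * (fact d) ^ 3) *
       (max 1 (8 * (2 * real (2 * 2 ^ s - 1) * (real (2 ^ s - 1))\<^sup>2 * (fact d) ^ 3) * (1 + fact d) ^ (2 * 2 ^ s - 4)) + fact d) ^ (2 * 2 ^ s - 4))"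
      show ?thesis
      proof (rule that[of C])
        show "0 \<le> C" unfolding C_def by (intro mult_nonneg_nonneg add_nonneg_nonneg zero_le_power of_nat_0_le_iff) (auto simp: le_max_iff_disj)
        fix N :: nat assume "N \<ge> 1"
        show "expectation (\<lambda>\<omega>. tpow N (?A N \<omega>) (2 ^ s)) \<le> C * real N * expectation (\<lambda>\<omega>. Xmax N \<omega> ^ (2 * 2 ^ s))"
          unfolding C_def by (rule wigner_matrix.expectation_tpow[OF loc[OF \<open>N \<ge> 1\<close>] U[OF \<open>N \<ge> 1\<close>]]) (simp add: s_def)
      qed
    qed
    obtain D where D: "D \<ge> 0" "\<And>N. N \<ge> 1 \<Longrightarrow> (LINT \<omega>|M. \<bar>Xmax N \<omega>\<bar> ^ (2 * 2 ^ s)) \<le> D * sqrt (real N)"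
      by (rule moment_boundedD[OF Xmax_moment_bounded]) blast
    have "(LINT \<omega>|M. \<bar>opnorm N (?A N \<omega>)\<bar> ^ q) \<le> (1 + (1 + C * D)) * sqrt (real N)" if N: "N \<ge> 1" for N
    proof -
      interpret wigner_matrix M d X N by (rule loc[OF N])
      let ?o = "\<lambda>\<omega>. opnorm N (?A N \<omega>)"
      have sN: "1 \<le> sqrt (real N)" using N by simp
      have e: "2 ^ q * 4 = 2 * (2 ^ s :: nat)" by (simp add: s_def)
      have "(LINT \<omega>|M. \<bar>?o \<omega>\<bar> ^ (2 ^ q * 4)) \<le> expectation (\<lambda>\<omega>. tpow N (?A N \<omega>) (2 ^ s))"
        unfolding e using opnorm_power_le[of "?A N _" N s] nn[OF N]
        by (intro integral_mono has_moments_abs_power_integrable[OF hm[OF N]] has_moments_integrable[OF has_moments_tpow]) simp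
      also have "\<dots> \<le> C * real N * expectation (\<lambda>\<omega>. Xmax N \<omega> ^ (2 * 2 ^ s))" by (rule C(2)[OF N])
      also have "expectation (\<lambda>\<omega>. Xmax N \<omega> ^ (2 * 2 ^ s)) = (LINT \<omega>|M. \<bar>Xmax N \<omega>\<bar> ^ (2 * 2 ^ s))"
        using order_trans[OF zero_le_one Xmax_ge1] by simp
      also have "C * real N * (LINT \<omega>|M. \<bar>Xmax N \<omega>\<bar> ^ (2 * 2 ^ s)) \<le> C * real N * (D * sqrt (real N))"
        using C(1) by (intro mult_left_mono D(2) N) auto
      also have "\<dots> = (C * D) * sqrt (real N) ^ 3" by (simp add: power3_eq_cube)
      also have "\<dots> \<le> (C * D) * sqrt (real N) ^ 4"
        using C D sN by (intro mult_left_mono power_increasing) auto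
      finally have "(LINT \<omega>|M. \<bar>?o \<omega>\<bar> ^ (2 ^ q * 4)) \<le> (C * D) * sqrt (real N) ^ 4" .
      then have b: "(LINT \<omega>|M. \<bar>?o \<omega>\<bar> ^ 2 ^ q) \<le> (1 + C * D) * sqrt (real N)"
        by (intro integral_power_interpolate[OF hm[OF N] N]) auto
      have "(LINT \<omega>|M. \<bar>?o \<omega>\<bar> ^ q) \<le> (LINT \<omega>|M. 1 + \<bar>?o \<omega>\<bar> ^ 2 ^ q)"
      proof (intro integral_mono has_moments_abs_power_integrable[OF hm[OF N]] Bochner_Integration.integrable_add)
        fix \<omega>
        show "\<bar>?o \<omega>\<bar> ^ q \<le> 1 + \<bar>?o \<omega>\<bar> ^ 2 ^ q"
        proof (cases "\<bar>?o \<omega>\<bar> \<le> 1")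
          case True
          then have "\<bar>?o \<omega>\<bar> ^ q \<le> 1" by (intro power_le_one) auto
          then show ?thesis by (simp add: add_increasing2)
        next
          case False
          then have "\<bar>?o \<omega>\<bar> ^ q \<le> \<bar>?o \<omega>\<bar> ^ 2 ^ q" by (intro power_increasing) (auto simp: less_exp less_imp_le)
          then show ?thesis by simp
        qed
      qed simp
      also have "\<dots> = 1 + (LINT \<omega>|M. \<bar>?o \<omega>\<bar> ^ 2 ^ q)"
        using has_moments_abs_power_integrable[OF hm[OF N]] by (simp add: prob_space)
      also have "\<dots> \<le> sqrt (real N) + (1 + C * D) * sqrt (real N)" using b sN by linarith
      finally show ?thesis by (simp add: algebra_simps)
    qed
    then show "\<exists>C. \<forall>N\<ge>1. (LINT \<omega>|M. \<bar>opnorm N (?A N \<omega>)\<bar> ^ q) \<le> C * sqrt (real N)" by blast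
  qed
qed

end

text \<open>\<open>b\<close> enters the bound only through \<open>a - b\<close>: in the application
  \<open>a\<close> is the value of interest and the difference is small.\<close>

lemma power_diff_bound:
  fixes a b :: real
  shows "\<bar>a ^ Suc m - b ^ Suc m\<bar> \<le> real (Suc m) * \<bar>a - b\<bar> * (\<bar>a\<bar> + \<bar>a - b\<bar>) ^ m"
proof (induction m)
  case (Suc m)
  let ?s = "\<bar>a\<bar> + \<bar>a - b\<bar>"
  have b: "\<bar>b\<bar> \<le> ?s" by linarith
  have "a ^ Suc (Suc m) - b ^ Suc (Suc m) = a * (a ^ Suc m - b ^ Suc m) + (a - b) * b ^ Suc m"
    by (simp add: algebra_simps)
  then have "\<bar>a ^ Suc (Suc m) - b ^ Suc (Suc m)\<bar> \<le> \<bar>a * (a ^ Suc m - b ^ Suc m)\<bar> + \<bar>(a - b) * b ^ Suc m\<bar>"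
    by (simp only: abs_triangle_ineq)
  also have "\<dots> = \<bar>a\<bar> * \<bar>a ^ Suc m - b ^ Suc m\<bar> + \<bar>a - b\<bar> * \<bar>b\<bar> ^ Suc m"
    by (simp only: abs_mult power_abs)
  also have "\<dots> \<le> ?s * (real (Suc m) * \<bar>a - b\<bar> * ?s ^ m) + \<bar>a - b\<bar> * ?s ^ Suc m"
    using b by (intro add_mono mult_mono power_mono Suc.IH) auto
  also have "\<dots> = real (Suc (Suc m)) * \<bar>a - b\<bar> * ?s ^ Suc m" by (simp add: algebra_simps)
  finally show ?case .
qed simp

section \<open>The Schwinger-Dyson equation\<close>

locale contraction_family = contraction_coefficients N d for N d :: nat +
  fixes Uf :: "'i \<Rightarrow> nat list \<Rightarrow> real" and J :: "'i set"
  assumes finJ: "finite J" and subU: "\<And>i. subunit (Uf i)"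
begin

definition fam :: "(nat list \<Rightarrow> real) \<Rightarrow> 'i \<Rightarrow> fmat" where
  "fam x i = ensm (Uf i) x"

definition word_mat :: "(nat list \<Rightarrow> real) \<Rightarrow> 'i list \<Rightarrow> fmat" where
  "word_mat x w = wmul N (fam x) w"

text \<open>One quantity in which all error terms are measured. It dominates the entries and the
  operator norms over \<open>J\<close>, also after an entry is set to zero, for which the summand
  with \<open>entry_max\<close> makes room; the \<open>1\<close> makes its powers increase with the
  exponent.\<close>

definition size_bound :: "(nat list \<Rightarrow> real) \<Rightarrow> real" where
  "size_bound x = 1 + fact d * entry_max (entry_index N d) x + (\<Sum>j\<in>J. opnorm N (fam x j))"

definition coef_size :: "nat list \<Rightarrow> real" where
  "coef_size k = (\<Sum>j\<in>J. l1n N (coefm (Uf j) k))"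

lemma msupp_fam [simp]: "msupp N (fam x i)" and msym_fam [simp]: "msym (fam x i)"
  by (auto simp: fam_def)

lemma msupp_word_mat [simp]: "msupp N (word_mat x w)"
  by (simp add: word_mat_def)

lemma entry_max_pos: "1 \<le> entry_max (entry_index N d) x"
  by (rule entry_max_ge1) simp

lemma sum_opnorm_nonneg: "0 \<le> (\<Sum>j\<in>J. opnorm N (fam x j))"
  by (intro sum_nonneg opnorm_nonneg) auto

lemma fact_d1: "(1::real) \<le> fact d" by (rule fact_ge_1)

lemma entry_max_le_size: "fact d * entry_max (entry_index N d) x \<le> size_bound x"
  using sum_opnorm_nonneg[of x] by (simp add: size_bound_def)

lemma size_ge1: "1 \<le> size_bound x"
proof -
  have "0 \<le> fact d * entry_max (entry_index N d) x" using entry_max_pos[of x] by simp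
  then show ?thesis using sum_opnorm_nonneg[of x] by (simp add: size_bound_def)
qed

lemma entry_le_size: "k \<in> entry_index N d \<Longrightarrow> \<bar>x k\<bar> \<le> size_bound x"
proof -
  assume "k \<in> entry_index N d"
  then have "\<bar>x k\<bar> \<le> entry_max (entry_index N d) x" by (intro entry_max_ge) auto
  also have "\<dots> \<le> fact d * entry_max (entry_index N d) x"
    using mult_right_mono[OF fact_d1, of "entry_max (entry_index N d) x"] entry_max_pos[of x] by simp
  finally show ?thesis using entry_max_le_size[of x] by simp
qed

lemma opb_fam: assumes "j \<in> J" shows "opb N (size_bound x) (fam x j)"
proof (rule opb_mono[OF opb_opnorm])
  have "opnorm N (fam x j) \<le> (\<Sum>j\<in>J. opnorm N (fam x j))"
    using assms finJ by (intro member_le_sum opnorm_nonneg) auto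
  moreover have "0 \<le> fact d * entry_max (entry_index N d) x" using entry_max_pos[of x] by simp
  ultimately show "opnorm N (fam x j) \<le> size_bound x" by (simp add: size_bound_def)
qed auto

lemma opb_fam_loo: assumes "j \<in> J" "k \<in> entry_index N d" shows "opb N (size_bound x) (fam (x(k := 0)) j)"
proof -
  have "\<bar>x k\<bar> \<le> entry_max (entry_index N d) x" using assms by (intro entry_max_ge) auto
  moreover have "opb N (opnorm N (fam x j)) (ensm (Uf j) x)" using opb_opnorm[of "fam x j" N] by (simp add: fam_def)
  ultimately have o: "opb N (opnorm N (fam x j) + fact d * entry_max (entry_index N d) x) (fam (x(k := 0)) j)"
    unfolding fam_def by (intro opb_leave_one_out(2)[where x = x] subU assms)
  have "opnorm N (fam x j) \<le> (\<Sum>j\<in>J. opnorm N (fam x j))"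
    using assms finJ by (intro member_le_sum opnorm_nonneg) auto
  then show ?thesis by (intro opb_mono[OF o]) (simp add: size_bound_def)
qed

lemma coef_size_nonneg [simp]: "0 \<le> coef_size k"
  by (simp add: coef_size_def sum_nonneg)

lemma l1n_le_coef_size: "j \<in> J \<Longrightarrow> l1n N (coefm (Uf j) k) \<le> coef_size k"
  unfolding coef_size_def using finJ by (intro member_le_sum) auto

lemma coef_size_le: "coef_size k \<le> real (card J) * fact d"
proof -
  have "coef_size k \<le> (\<Sum>j\<in>J. fact d)" unfolding coef_size_def by (intro sum_mono l1n_coefm_fact subU)
  then show ?thesis by simp
qed

lemma sum_coef_size_sq: "(\<Sum>k\<in>entry_index N d. (coef_size k)\<^sup>2) \<le> (real (card J))\<^sup>2 * fact d * (real N)\<^sup>2"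
proof -
  have "(coef_size k)\<^sup>2 \<le> real (card J) * (\<Sum>j\<in>J. (l1n N (coefm (Uf j) k))\<^sup>2)" for k
    using Cauchy_Schwarz_ineq_sum[of "\<lambda>_. 1" "\<lambda>j. l1n N (coefm (Uf j) k)" J] by (simp add: coef_size_def)
  then have "(\<Sum>k\<in>entry_index N d. (coef_size k)\<^sup>2) \<le> (\<Sum>k\<in>entry_index N d. real (card J) * (\<Sum>j\<in>J. (l1n N (coefm (Uf j) k))\<^sup>2))"
    by (intro sum_mono)
  also have "\<dots> = real (card J) * (\<Sum>j\<in>J. \<Sum>k\<in>entry_index N d. (l1n N (coefm (Uf j) k))\<^sup>2)"
    by (subst sum.swap) (simp add: sum_distrib_left)
  also have "\<dots> \<le> real (card J) * (\<Sum>j\<in>J. fact d * (real N)\<^sup>2)"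
    by (intro mult_left_mono sum_mono sum_l1n_sq subU) auto
  finally show ?thesis by (simp add: power2_eq_square mult.assoc)
qed

lemma opb_word: "set w \<subseteq> J \<Longrightarrow> opb N (size_bound x ^ length w) (word_mat x w)"
  unfolding word_mat_def by (rule opb_wmul) (auto intro: opb_fam)

lemma opb_word_loo: "set w \<subseteq> J \<Longrightarrow> k \<in> entry_index N d \<Longrightarrow> opb N (size_bound x ^ length w) (word_mat (x(k := 0)) w)"
  unfolding word_mat_def by (rule opb_wmul) (auto intro: opb_fam_loo)

text \<open>One differing letter brings \<open>coef_size k / sqrt N\<close>, and the bound on the
  entry \<open>x k\<close> supplies the power of \<open>size_bound\<close> that this letter would
  have had.\<close>

lemma opb_word_diff:
  assumes w: "set w \<subseteq> J" and k: "k \<in> entry_index N d"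
  shows "opb N (real (length w) * (coef_size k / sqrt (real N)) * size_bound x ^ length w) (msub (word_mat x w) (word_mat (x(k := 0)) w))"
proof -
  let ?t = "size_bound x"
  have t: "1 \<le> ?t" by (rule size_ge1)
  have d: "opb N (?t * (coef_size k / sqrt (real N))) (msub (fam x i) (fam (x(k := 0)) i))" if "i \<in> set w" for i
  proof -
    have i: "i \<in> J" using that w by auto
    have "opb N (\<bar>x k\<bar> / sqrt (real N) * l1n N (coefm (Uf i) k)) (msub (fam x i) (fam (x(k := 0)) i))"
      unfolding fam_def by (rule opb_leave_one_out(1)[OF subU k order_refl opb_opnorm]) auto
    moreover have "\<bar>x k\<bar> / sqrt (real N) * l1n N (coefm (Uf i) k) \<le> ?t / sqrt (real N) * coef_size k"
      using t by (intro mult_mono divide_right_mono entry_le_size k l1n_le_coef_size i) auto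
    ultimately show ?thesis using opb_mono by (simp add: mult.assoc)
  qed
  have "opb N (real (length w) * (?t * (coef_size k / sqrt (real N))) * ?t ^ (length w - 1)) (msub (word_mat x w) (word_mat (x(k := 0)) w))"
    unfolding word_mat_def
    by (rule opb_wmul_diff) (use w k d opb_fam opb_fam_loo in auto)
  moreover have "real (length w) * (?t * (coef_size k / sqrt (real N))) * ?t ^ (length w - 1) =
     real (length w) * (coef_size k / sqrt (real N)) * ?t ^ length w"
    by (cases "length w") auto
  ultimately show ?thesis by (simp only:)
qed

lemma word_trace_telescope:
  assumes k: "k \<in> entry_index N d"
  shows "mtr N (mmul N C (msub (word_mat x w) (word_mat (x(k := 0)) w))) =
    (\<Sum>p<length w. x k / sqrt (real N) * mtr N (mmul N C (mmul N (word_mat x (take p w))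
        (mmul N (coefm (Uf (w ! p)) k) (word_mat (x(k := 0)) (drop (Suc p) w))))))"
proof -
  have "msub (word_mat x w) (word_mat (x(k := 0)) w) =
    (\<lambda>a b. \<Sum>p<length w. mmul N (word_mat x (take p w))
       (mmul N (msub (fam x (w ! p)) (fam (x(k := 0)) (w ! p))) (word_mat (x(k := 0)) (drop (Suc p) w))) a b)"
    unfolding word_mat_def by (rule wmul_telescope) auto
  also have "\<dots> = (\<lambda>a b. \<Sum>p<length w. mscale (x k / sqrt (real N)) (mmul N (word_mat x (take p w))
       (mmul N (coefm (Uf (w ! p)) k) (word_mat (x(k := 0)) (drop (Suc p) w)))) a b)"
    unfolding fam_def ensm_leave_one_out[OF k] by (simp only: mmul_mscale_left mmul_mscale_right)
  finally show ?thesis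
    by (simp only: mmul_sum_right mtr_sum mmul_mscale_right mtr_mscale)
qed

lemma word_trace_diff:
  assumes w: "set w \<subseteq> J" and k: "k \<in> entry_index N d"
  shows "\<bar>mtr N (word_mat x w) - mtr N (word_mat (x(k := 0)) w)\<bar> \<le> real (length w) * (coef_size k / sqrt (real N)) * size_bound x ^ length w"
proof -
  let ?t = "size_bound x"
  have t: "1 \<le> ?t" by (rule size_ge1)
  have "mtr N (word_mat x w) - mtr N (word_mat (x(k := 0)) w) = mtr N (mmul N (mid N) (msub (word_mat x w) (word_mat (x(k := 0)) w)))"
    by (simp add: mtr_msub)
  then have "\<bar>mtr N (word_mat x w) - mtr N (word_mat (x(k := 0)) w)\<bar> \<le>
    (\<Sum>p<length w. \<bar>x k / sqrt (real N) * mtr N (mmul N (mid N) (mmul N (word_mat x (take p w))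
        (mmul N (coefm (Uf (w ! p)) k) (word_mat (x(k := 0)) (drop (Suc p) w)))))\<bar>)"
    unfolding word_trace_telescope[OF k] by (simp only: sum_abs)
  also have "\<dots> \<le> (\<Sum>p<length w. (coef_size k / sqrt (real N)) * ?t ^ length w)"
  proof (intro sum_mono)
    fix p assume p: "p \<in> {..<length w}"
    let ?P = "word_mat x (take p w)" and ?Q = "word_mat (x(k := 0)) (drop (Suc p) w)" and ?B = "coefm (Uf (w ! p)) k"
    have J: "w ! p \<in> J" "set (take p w) \<subseteq> J" "set (drop (Suc p) w) \<subseteq> J"
      using w p set_take_subset[of p w] set_drop_subset[of "Suc p" w] by auto
    have eq: "mtr N (mmul N (mid N) (mmul N ?P (mmul N ?B ?Q))) = mtr N (mmul N ?B (mmul N ?Q ?P))"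
      by (simp add: mtr_comm[of N ?P] mmul_assoc)
    have "\<bar>mtr N (mmul N (mid N) (mmul N ?P (mmul N ?B ?Q)))\<bar> \<le> l1n N ?B * (?t ^ length (drop (Suc p) w) * ?t ^ length (take p w))"
      unfolding eq by (intro mtr_mmul_bound opb_mmul opb_word opb_word_loo J k)
    also have "\<dots> \<le> coef_size k * (?t ^ length (drop (Suc p) w) * ?t ^ length (take p w))"
      using t by (intro mult_right_mono l1n_le_coef_size J) auto
    also have "?t ^ length (drop (Suc p) w) * ?t ^ length (take p w) = ?t ^ (length w - 1)"
      using p by (simp add: power_add[symmetric] min_def)
    finally have b: "\<bar>mtr N (mmul N (mid N) (mmul N ?P (mmul N ?B ?Q)))\<bar> \<le> coef_size k * ?t ^ (length w - 1)" .
    have "\<bar>x k / sqrt (real N) * mtr N (mmul N (mid N) (mmul N ?P (mmul N ?B ?Q)))\<bar> \<le> (?t / sqrt (real N)) * (coef_size k * ?t ^ (length w - 1))"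
      unfolding abs_mult using b t entry_le_size[OF k, of x] by (intro mult_mono) (auto intro: divide_right_mono)
    also have "\<dots> = (coef_size k / sqrt (real N)) * (?t * ?t ^ (length w - 1))" by simp
    also have "?t * ?t ^ (length w - 1) = ?t ^ length w" using p by (cases "length w") auto
    finally show "\<bar>x k / sqrt (real N) * mtr N (mmul N (mid N) (mmul N ?P (mmul N ?B ?Q)))\<bar> \<le> (coef_size k / sqrt (real N)) * ?t ^ length w" .
  qed
  finally show ?thesis by simp
qed

text \<open>The second-order coefficient when position \<open>p\<close> of \<open>w\<close> is
  expanded. Letters before \<open>p\<close> are evaluated at \<open>x\<close> and letters after it
  at \<open>y\<close>, as the telescoping sum requires.\<close>

definition ptrace :: "'i \<Rightarrow> 'i list \<Rightarrow> nat \<Rightarrow> nat list \<Rightarrow> (nat list \<Rightarrow> real) \<Rightarrow> (nat list \<Rightarrow> real) \<Rightarrow> real" where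
  "ptrace i w p k x y = mtr N (mmul N (coefm (Uf i) k) (mmul N (word_mat x (take p w))
      (mmul N (coefm (Uf (w ! p)) k) (word_mat y (drop (Suc p) w)))))"

text \<open>
  Everything that is discarded when \<open>x k * Tr (B_k W) * Z\<close> is replaced by its second-order
  Taylor term in \<open>x k\<close>, up to summands that are independent of \<open>x k\<close> or centred.
\<close>

definition remainder :: "'i \<Rightarrow> 'i list \<Rightarrow> nat list \<Rightarrow> real \<Rightarrow> ((nat list \<Rightarrow> real) \<Rightarrow> real) \<Rightarrow> (nat list \<Rightarrow> real) \<Rightarrow> real" where
  "remainder i w k v Z x = (let x' = x(k := 0) in
     x k * mtr N (mmul N (coefm (Uf i) k) (word_mat x' w)) * (Z x - Z x') +
     (\<Sum>p<length w. 1 / sqrt (real N) *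
        ((x k)\<^sup>2 * (ptrace i w p k x x' - ptrace i w p k x' x') * Z x +
         (x k)\<^sup>2 * ptrace i w p k x' x' * (Z x - Z x') +
         v * ptrace i w p k x' x' * (Z x' - Z x) +
         v * (ptrace i w p k x' x' - ptrace i w p k x x) * Z x)))"

text \<open>A second-order expansion as an exact identity for arbitrary \<open>Z\<close> and
  \<open>v\<close>. The last two terms vanish in expectation when the entry is centered with second
  moment \<open>v\<close> and independent of the others, as their remaining factors do not involve
  it; the second term becomes the recursion.\<close>

lemma remainder_eq:
  assumes k: "k \<in> entry_index N d"
  shows "x k * mtr N (mmul N (coefm (Uf i) k) (word_mat x w)) * Z x =
     remainder i w k v Z x + (\<Sum>p<length w. 1 / sqrt (real N) * (v * ptrace i w p k x x * Z x)) +
     x k * (mtr N (mmul N (coefm (Uf i) k) (word_mat (x(k := 0)) w)) * Z (x(k := 0))) +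
     (\<Sum>p<length w. 1 / sqrt (real N) * (((x k)\<^sup>2 - v) * (ptrace i w p k (x(k := 0)) (x(k := 0)) * Z (x(k := 0)))))"
proof -
  let ?x' = "x(k := 0)" and ?B = "coefm (Uf i) k"
  have "mtr N (mmul N ?B (word_mat x w)) - mtr N (mmul N ?B (word_mat ?x' w)) =
     (\<Sum>p<length w. x k / sqrt (real N) * ptrace i w p k x ?x')"
    using word_trace_telescope[OF k, of ?B x w] by (simp add: mmul_msub_right mtr_msub ptrace_def)
  then have a: "mtr N (mmul N ?B (word_mat x w)) = mtr N (mmul N ?B (word_mat ?x' w)) + (\<Sum>p<length w. x k / sqrt (real N) * ptrace i w p k x ?x')"
    by simp
  let ?c = "1 / sqrt (real N)" and ?m = "mtr N (mmul N ?B (word_mat ?x' w))"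
  have b: "x k * (\<Sum>p<length w. x k / sqrt (real N) * ptrace i w p k x ?x') * Z x =
     (\<Sum>p<length w. ?c * ((x k)\<^sup>2 * ptrace i w p k x ?x' * Z x))"
    by (simp add: sum_distrib_left sum_distrib_right power2_eq_square mult_ac)
  let ?S1 = "\<Sum>p<length w. ?c * ((x k)\<^sup>2 * (ptrace i w p k x ?x' - ptrace i w p k ?x' ?x') * Z x +
         (x k)\<^sup>2 * ptrace i w p k ?x' ?x' * (Z x - Z ?x') +
         v * ptrace i w p k ?x' ?x' * (Z ?x' - Z x) +
         v * (ptrace i w p k ?x' ?x' - ptrace i w p k x x) * Z x)"
  let ?S2 = "\<Sum>p<length w. ?c * (v * ptrace i w p k x x * Z x)"
  let ?S3 = "\<Sum>p<length w. ?c * (((x k)\<^sup>2 - v) * (ptrace i w p k ?x' ?x' * Z ?x'))"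
  have alg: "c * (q * (f - f2) * z + q * f2 * (z - z') + v * f2 * (z' - z) + v * (f2 - f1) * z) +
      c * (v * f1 * z) + c * ((q - v) * (f2 * z')) = c * (q * f * z)" for c q f f1 f2 z z' :: real
    by (simp add: algebra_simps)
  have S: "?S1 + ?S2 + ?S3 = (\<Sum>p<length w. ?c * ((x k)\<^sup>2 * ptrace i w p k x ?x' * Z x))"
    unfolding sum.distrib[symmetric] by (intro sum.cong refl alg)
  have "x k * mtr N (mmul N ?B (word_mat x w)) * Z x = x k * ?m * Z x + (?S1 + ?S2 + ?S3)"
    unfolding a S b[symmetric] by (simp only: distrib_left distrib_right)
  moreover have "x k * ?m * Z x = x k * ?m * (Z x - Z ?x') + x k * (?m * Z ?x')" by (simp only: right_diff_distrib mult.assoc diff_add_cancel)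
  ultimately show ?thesis unfolding remainder_def Let_def by linarith
qed

text \<open>Each coefficient matrix is worth a factor \<open>b\<close>; passing from
  \<open>x\<close> to \<open>x'\<close> on one side exposes a third one together with
  \<open>1 / sqrt N\<close>.\<close>

lemma ptrace_bounds:
  fixes x :: "nat list \<Rightarrow> real"
  assumes w: "set w \<subseteq> J" "i \<in> J" and k: "k \<in> entry_index N d" and p: "p < length w"
  defines "t \<equiv> size_bound x" and "x' \<equiv> x(k := 0)" and "n \<equiv> length w" and "b \<equiv> coef_size k"
  shows "\<bar>ptrace i w p k x' x'\<bar> \<le> b\<^sup>2 * t ^ n"
    and "\<bar>ptrace i w p k x x' - ptrace i w p k x' x'\<bar> \<le> real n / sqrt (real N) * b ^ 3 * t ^ n"
    and "\<bar>ptrace i w p k x x - ptrace i w p k x x'\<bar> \<le> real n / sqrt (real N) * b ^ 3 * t ^ n"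
proof -
  have t: "1 \<le> t" unfolding t_def by (rule size_ge1)
  have b0: "0 \<le> b" by (simp add: b_def)
  let ?w1 = "take p w" and ?w2 = "drop (Suc p) w"
  let ?B = "coefm (Uf i) k" and ?B' = "coefm (Uf (w ! p)) k"
  have J: "w ! p \<in> J" "set ?w1 \<subseteq> J" "set ?w2 \<subseteq> J"
    using w p set_take_subset[of p w] set_drop_subset[of "Suc p" w] by auto
  have lB: "l1n N ?B \<le> b" "l1n N ?B' \<le> b" unfolding b_def using l1n_le_coef_size J w by auto
  have oB': "opb N b ?B'" by (rule opb_mono[OF opb_l1n lB(2)])
  have len: "length ?w1 + length ?w2 = n - 1" using p by (simp add: n_def)
  have tn: "t ^ length ?w1 * t ^ length ?w2 \<le> t ^ n"
    unfolding power_add[symmetric] len using t by (intro power_increasing) auto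
  have gen: "\<bar>mtr N (mmul N ?B (mmul N P (mmul N ?B' Q)))\<bar> \<le> b * (r * (b * s))" if "opb N r P" "opb N s Q" for P Q r s
  proof -
    have o: "opb N (r * (b * s)) (mmul N P (mmul N ?B' Q))" by (intro opb_mmul that oB')
    have "\<bar>mtr N (mmul N ?B (mmul N P (mmul N ?B' Q)))\<bar> \<le> l1n N ?B * (r * (b * s))"
      by (rule mtr_mmul_bound[OF o])
    also have "\<dots> \<le> b * (r * (b * s))" using lB(1) opb_nonneg[OF o] by (rule mult_right_mono)
    finally show ?thesis .
  qed
  have o1: "opb N (t ^ length ?w1) (word_mat x ?w1)" "opb N (t ^ length ?w1) (word_mat x' ?w1)"
    "opb N (t ^ length ?w2) (word_mat x' ?w2)"
    unfolding t_def x'_def by (intro opb_word opb_word_loo J k)+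
  have lw: "real (length ?w1) \<le> real n" "real (length ?w2) \<le> real n" using p by (auto simp: n_def)
  have c0: "0 \<le> b / sqrt (real N)" using b0 by simp
  have o: "opb N (real (length ?w1) * (b / sqrt (real N)) * t ^ length ?w1) (msub (word_mat x ?w1) (word_mat x' ?w1))"
    "opb N (real (length ?w2) * (b / sqrt (real N)) * t ^ length ?w2) (msub (word_mat x ?w2) (word_mat x' ?w2))"
    unfolding t_def x'_def b_def by (intro opb_word_diff J k)+
  have o2: "opb N (real n * (b / sqrt (real N)) * t ^ length ?w1) (msub (word_mat x ?w1) (word_mat x' ?w1))"
    "opb N (real n * (b / sqrt (real N)) * t ^ length ?w2) (msub (word_mat x ?w2) (word_mat x' ?w2))"
    using t by - (rule opb_mono[OF o(1)] opb_mono[OF o(2)], intro mult_right_mono lw c0 zero_le_power, linarith)+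
  have "\<bar>ptrace i w p k x' x'\<bar> \<le> b * (t ^ length ?w1 * (b * t ^ length ?w2))"
    unfolding ptrace_def by (rule gen[OF o1(2,3)])
  also have "\<dots> = b\<^sup>2 * (t ^ length ?w1 * t ^ length ?w2)" by (simp add: power2_eq_square)
  also have "\<dots> \<le> b\<^sup>2 * t ^ n" using tn by (intro mult_left_mono) auto
  finally show "\<bar>ptrace i w p k x' x'\<bar> \<le> b\<^sup>2 * t ^ n" .
  have "ptrace i w p k x x' - ptrace i w p k x' x' = mtr N (mmul N ?B (mmul N (msub (word_mat x ?w1) (word_mat x' ?w1)) (mmul N ?B' (word_mat x' ?w2))))"
    by (simp add: ptrace_def mmul_msub_left mmul_msub_right mtr_msub)
  also have "\<bar>\<dots>\<bar> \<le> b * ((real n * (b / sqrt (real N)) * t ^ length ?w1) * (b * t ^ length ?w2))"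
    by (rule gen[OF o2(1) o1(3)])
  also have "\<dots> = real n / sqrt (real N) * b ^ 3 * (t ^ length ?w1 * t ^ length ?w2)" by (simp add: power3_eq_cube)
  also have "\<dots> \<le> real n / sqrt (real N) * b ^ 3 * t ^ n" using tn b0 by (intro mult_left_mono) auto
  finally show "\<bar>ptrace i w p k x x' - ptrace i w p k x' x'\<bar> \<le> real n / sqrt (real N) * b ^ 3 * t ^ n" .
  have "ptrace i w p k x x - ptrace i w p k x x' = mtr N (mmul N ?B (mmul N (word_mat x ?w1) (mmul N ?B' (msub (word_mat x ?w2) (word_mat x' ?w2)))))"
    by (simp add: ptrace_def mmul_msub_left mmul_msub_right mtr_msub)
  also have "\<bar>\<dots>\<bar> \<le> b * (t ^ length ?w1 * (b * (real n * (b / sqrt (real N)) * t ^ length ?w2)))"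
    by (rule gen[OF o1(1) o2(2)])
  also have "\<dots> = real n / sqrt (real N) * b ^ 3 * (t ^ length ?w1 * t ^ length ?w2)" by (simp add: power3_eq_cube)
  also have "\<dots> \<le> real n / sqrt (real N) * b ^ 3 * t ^ n" using tn b0 by (intro mult_left_mono) auto
  finally show "\<bar>ptrace i w p k x x - ptrace i w p k x x'\<bar> \<le> real n / sqrt (real N) * b ^ 3 * t ^ n" .
qed

end

context contraction_family
begin

definition ntrace :: "(nat list \<Rightarrow> real) \<Rightarrow> 'i list \<Rightarrow> real" where
  "ntrace x w = mtr N (word_mat x w) / real N"

lemma ntrace_bound: assumes "set w \<subseteq> J" shows "\<bar>ntrace x w\<bar> \<le> size_bound x ^ length w"
proof -
  have "\<bar>mtr N (word_mat x w)\<bar> \<le> real N * size_bound x ^ length w"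
    by (rule mtr_bound[OF opb_word[OF assms]])
  then show ?thesis using N1 by (simp add: ntrace_def pos_divide_le_eq mult.commute)
qed

text \<open>Every term contains at least two factors \<open>coef_size k\<close>, from two
  coefficient matrices or from one of them and the change of \<open>Y\<close>. Exactly two are kept,
  since their sum over \<open>k\<close> is of order \<open>N^2\<close>; further ones are bounded by
  \<open>b0\<close>.\<close>

lemma remainder_bound:
  fixes x :: "nat list \<Rightarrow> real" and r :: nat and m :: real
  assumes w: "set w \<subseteq> J" "i \<in> J" and u: "set u \<subseteq> J" "length u = Suc (length w)"
    and k: "k \<in> entry_index N d" and v: "\<bar>v\<bar> \<le> V" "1 \<le> V"
  defines "Y \<equiv> \<lambda>x. ntrace x u - m" and "n \<equiv> length w" and "b0 \<equiv> real (card J) * fact d" and "t \<equiv> size_bound x"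
  shows "\<bar>remainder i w k v (\<lambda>x. Y x ^ Suc r) x\<bar> \<le> (coef_size k)\<^sup>2 *
     ((real n)\<^sup>2 * b0 * (1 + 2 * V) * t ^ (2 * n + 3) / real N * \<bar>Y x\<bar> ^ Suc r +
      (1 + real n * (1 + V) * b0) * real (Suc r) * real (n + 1) * t ^ (2 * n + 3) / (real N * sqrt (real N)) *
        (\<bar>Y x\<bar> + real (n + 1) * b0 * t ^ (2 * n + 3) / sqrt (real N)) ^ r)"
proof -
  define b where "b = coef_size k"
  define s where "s = sqrt (real N)"
  have s: "1 \<le> s" "s * s = real N" using N1 by (auto simp: s_def)
  have Npos: "0 < real N" using N1 by simp
  have t: "1 \<le> t" unfolding t_def by (rule size_ge1)
  have b: "0 \<le> b" "b \<le> b0" unfolding b_def b0_def by (auto intro: coef_size_le)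
  let ?x' = "x(k := 0)"
  define \<delta> where "\<delta> = \<bar>Y x ^ Suc r - Y ?x' ^ Suc r\<bar>"
  define a where "a = \<bar>Y x\<bar> ^ Suc r"
  define Dy where "Dy = real (n + 1) * b * t ^ (n + 1) / (real N * s)"
  define Q where "Q = (\<bar>Y x\<bar> + real (n + 1) * b0 * t ^ (2 * n + 3) / s) ^ r"
  have Dy0: "0 \<le> Dy" using b t Npos s by (simp add: Dy_def)
  have dY: "\<bar>Y x - Y ?x'\<bar> \<le> Dy"
  proof -
    have "\<bar>mtr N (word_mat x u) - mtr N (word_mat ?x' u)\<bar> \<le> real (length u) * (b / s) * t ^ length u"
      unfolding b_def s_def t_def by (rule word_trace_diff[OF u(1) k])
    then have "\<bar>mtr N (word_mat x u) - mtr N (word_mat ?x' u)\<bar> / real N \<le> real (length u) * (b / s) * t ^ length u / real N"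
      by (rule divide_right_mono) simp
    moreover have "length u = n + 1" using u(2) by (simp add: n_def)
    moreover have "Y x - Y ?x' = (mtr N (word_mat x u) - mtr N (word_mat ?x' u)) / real N"
      by (simp add: Y_def ntrace_def diff_divide_distrib)
    ultimately show ?thesis by (simp add: Dy_def mult.commute)
  qed
  \<comment> \<open>Gives up a factor \<open>1 / N\<close> and replaces \<open>b\<close> by
    \<open>b0\<close>, so that \<open>Q\<close> does not depend on \<open>k\<close>.\<close>
  have DyQ: "Dy \<le> real (n + 1) * b0 * t ^ (2 * n + 3) / s"
  proof -
    have "t ^ (n + 1) \<le> t ^ (2 * n + 3)" using t by (intro power_increasing) auto
    then have "real (n + 1) * b * t ^ (n + 1) \<le> real (n + 1) * b0 * t ^ (2 * n + 3)"
      using b t by (intro mult_mono mult_nonneg_nonneg) auto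
    moreover have "s \<le> real N * s" using N1 s by simp
    ultimately show ?thesis unfolding Dy_def using b t s by (intro frac_le) auto
  qed
  have \<delta>: "\<delta> \<le> real (Suc r) * Dy * Q"
  proof -
    have "\<delta> \<le> real (Suc r) * \<bar>Y x - Y ?x'\<bar> * (\<bar>Y x\<bar> + \<bar>Y x - Y ?x'\<bar>) ^ r"
      unfolding \<delta>_def by (rule power_diff_bound)
    also have "\<dots> \<le> real (Suc r) * Dy * Q"
      unfolding Q_def using dY DyQ Dy0 by (intro mult_mono mult_left_mono power_mono add_left_mono) auto
    finally show ?thesis .
  qed
  have \<delta>0: "0 \<le> \<delta>" and a0: "0 \<le> a" by (auto simp: \<delta>_def a_def)
  have Q0: "0 \<le> Q" unfolding Q_def using b t s by (intro zero_le_power add_nonneg_nonneg divide_nonneg_nonneg mult_nonneg_nonneg) auto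
  have xk: "\<bar>x k\<bar> \<le> t" unfolding t_def by (rule entry_le_size[OF k])
  then have xk2: "(x k)\<^sup>2 \<le> t\<^sup>2" using t by (simp add: abs_le_square_iff[symmetric])
  define D where "D = real n / s * b ^ 3 * t ^ n"
  define P where "P = b\<^sup>2 * t ^ n"
  have D0: "0 \<le> D" and P0: "0 \<le> P" using b t s by (auto simp: D_def P_def)
  have first: "\<bar>x k * mtr N (mmul N (coefm (Uf i) k) (word_mat ?x' w)) * (Y x ^ Suc r - Y ?x' ^ Suc r)\<bar> \<le> t * (b * t ^ n) * \<delta>"
  proof -
    have "\<bar>mtr N (mmul N (coefm (Uf i) k) (word_mat ?x' w))\<bar> \<le> l1n N (coefm (Uf i) k) * t ^ n"
      unfolding t_def n_def by (intro mtr_mmul_bound opb_word_loo w k)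
    also have "\<dots> \<le> b * t ^ n" unfolding b_def using t by (intro mult_right_mono l1n_le_coef_size w) auto
    finally show ?thesis unfolding abs_mult \<delta>_def using xk t b by (intro mult_mono) auto
  qed
  have each: "\<bar>1 / sqrt (real N) *
        ((x k)\<^sup>2 * (ptrace i w p k x ?x' - ptrace i w p k ?x' ?x') * Y x ^ Suc r +
         (x k)\<^sup>2 * ptrace i w p k ?x' ?x' * (Y x ^ Suc r - Y ?x' ^ Suc r) +
         v * ptrace i w p k ?x' ?x' * (Y ?x' ^ Suc r - Y x ^ Suc r) +
         v * (ptrace i w p k ?x' ?x' - ptrace i w p k x x) * Y x ^ Suc r)\<bar>
      \<le> 1 / s * (t\<^sup>2 * D * a + t\<^sup>2 * P * \<delta> + V * P * \<delta> + V * (2 * D) * a)" if p: "p < n" for p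
  proof -
    have pb: "\<bar>ptrace i w p k ?x' ?x'\<bar> \<le> P" "\<bar>ptrace i w p k x ?x' - ptrace i w p k ?x' ?x'\<bar> \<le> D"
      "\<bar>ptrace i w p k x x - ptrace i w p k x ?x'\<bar> \<le> D"
      using ptrace_bounds[OF w k p[unfolded n_def], of x] unfolding P_def D_def b_def t_def n_def s_def by auto
    have pb2: "\<bar>ptrace i w p k ?x' ?x' - ptrace i w p k x x\<bar> \<le> 2 * D" using pb by linarith
    have ya: "\<bar>Y x ^ Suc r\<bar> = a" by (simp only: a_def power_abs)
    have e1: "\<bar>(x k)\<^sup>2 * (ptrace i w p k x ?x' - ptrace i w p k ?x' ?x') * Y x ^ Suc r\<bar> \<le> t\<^sup>2 * D * a"
      unfolding abs_mult ya using pb xk2 D0 a0 by (intro mult_mono mult_nonneg_nonneg) auto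
    have e2: "\<bar>(x k)\<^sup>2 * ptrace i w p k ?x' ?x' * (Y x ^ Suc r - Y ?x' ^ Suc r)\<bar> \<le> t\<^sup>2 * P * \<delta>"
      unfolding abs_mult \<delta>_def using pb xk2 P0 by (intro mult_mono mult_nonneg_nonneg) auto
    have e3: "\<bar>v * ptrace i w p k ?x' ?x' * (Y ?x' ^ Suc r - Y x ^ Suc r)\<bar> \<le> V * P * \<delta>"
      unfolding abs_mult \<delta>_def abs_minus_commute[of "Y ?x' ^ Suc r"] using pb v P0 by (intro mult_mono mult_nonneg_nonneg) auto
    have e4: "\<bar>v * (ptrace i w p k ?x' ?x' - ptrace i w p k x x) * Y x ^ Suc r\<bar> \<le> V * (2 * D) * a"
      unfolding abs_mult ya using pb2 v D0 a0 by (intro mult_mono mult_nonneg_nonneg) auto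
    have abs4: "\<bar>p1 + p2 + p3 + p4\<bar> \<le> q1 + q2 + q3 + q4" if "\<bar>p1\<bar> \<le> q1" "\<bar>p2\<bar> \<le> q2" "\<bar>p3\<bar> \<le> q3" "\<bar>p4\<bar> \<le> q4"
      for p1 p2 p3 p4 q1 q2 q3 q4 :: real using that by linarith
    show ?thesis unfolding s_def[symmetric] abs_mult[of "1 / s"]
      by (rule mult_mono[OF _ abs4[OF e1 e2 e3 e4]]) (use s in auto)
  qed
  have "\<bar>remainder i w k v (\<lambda>x. Y x ^ Suc r) x\<bar> \<le> t * (b * t ^ n) * \<delta> +
      (\<Sum>p<n. 1 / s * (t\<^sup>2 * D * a + t\<^sup>2 * P * \<delta> + V * P * \<delta> + V * (2 * D) * a))"
    unfolding remainder_def Let_def n_def[symmetric]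
    by (rule order_trans[OF abs_triangle_ineq add_mono[OF first order_trans[OF sum_abs sum_mono[OF each]]]]) simp
  also have "\<dots> = real n / s * (t\<^sup>2 + 2 * V) * D * a + (t * (b * t ^ n) + real n / s * (t\<^sup>2 + V) * P) * \<delta>"
    by (simp add: algebra_simps add_divide_distrib)
  also have "\<dots> \<le> b\<^sup>2 * ((real n)\<^sup>2 * b0 * (1 + 2 * V) * t ^ (2 * n + 3) / real N * a) +
      b\<^sup>2 * ((1 + real n * (1 + V) * b0) * real (Suc r) * real (n + 1) * t ^ (2 * n + 3) / (real N * s) * Q)"
  proof (rule add_mono)
    have tV: "t\<^sup>2 + c * V \<le> (1 + c * V) * t\<^sup>2" if "0 \<le> c" for c
    proof -
      have "c * V * 1 \<le> c * V * t\<^sup>2" using that v t by (intro mult_left_mono) (auto simp: one_le_power)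
      then show ?thesis by (simp add: algebra_simps)
    qed
    have Db: "D \<le> real n / s * (b\<^sup>2 * b0) * t ^ n"
      unfolding D_def using b t s by (intro mult_right_mono mult_left_mono) (auto simp: power3_eq_cube power2_eq_square mult.assoc intro!: mult_left_mono)
    have "real n / s * (t\<^sup>2 + 2 * V) * D * a \<le> real n / s * ((1 + 2 * V) * t\<^sup>2) * (real n / s * (b\<^sup>2 * b0) * t ^ n) * a"
      using Db tV[of 2] D0 a0 s v t b by (intro mult_right_mono mult_mono mult_left_mono) auto
    also have "\<dots> = b\<^sup>2 * ((real n)\<^sup>2 * b0 * (1 + 2 * V) * t ^ (n + 2) / (s * s) * a)"
      by (simp add: power_add power2_eq_square)
    also have "\<dots> \<le> b\<^sup>2 * ((real n)\<^sup>2 * b0 * (1 + 2 * V) * t ^ (2 * n + 3) / real N * a)"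
      unfolding s(2) using t v b a0 by (intro mult_left_mono mult_right_mono divide_right_mono power_increasing) auto
    finally show "real n / s * (t\<^sup>2 + 2 * V) * D * a \<le> b\<^sup>2 * ((real n)\<^sup>2 * b0 * (1 + 2 * V) * t ^ (2 * n + 3) / real N * a)" .
    have "t * (b * t ^ n) + real n / s * (t\<^sup>2 + V) * P \<le> b * t ^ (n + 2) + real n * ((1 + V) * t\<^sup>2) * (b * b0 * t ^ n)"
    proof (rule add_mono)
      have "t * (b * t ^ n) = b * t ^ (n + 1)" by simp
      also have "\<dots> \<le> b * t ^ (n + 2)" using t b by (intro mult_left_mono power_increasing) auto
      finally show "t * (b * t ^ n) \<le> b * t ^ (n + 2)" .
      have 1: "real n / s \<le> real n"
      proof -
        have "real n / s \<le> real n / 1" using s by (intro divide_left_mono) auto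
        then show ?thesis by simp
      qed
      have 2: "t\<^sup>2 + V \<le> (1 + V) * t\<^sup>2" using tV[of 1] by simp
      have 3: "P \<le> b * b0 * t ^ n" unfolding P_def power2_eq_square using b t by (intro mult_right_mono mult_left_mono) auto
      show "real n / s * (t\<^sup>2 + V) * P \<le> real n * ((1 + V) * t\<^sup>2) * (b * b0 * t ^ n)"
        by (rule mult_mono[OF mult_mono[OF 1 2] 3]) (use v t P0 in auto)
    qed
    also have "\<dots> = b * t ^ (n + 2) * (1 + real n * (1 + V) * b0)" by (simp add: algebra_simps power_add power2_eq_square)
    finally have e: "t * (b * t ^ n) + real n / s * (t\<^sup>2 + V) * P \<le> b * t ^ (n + 2) * (1 + real n * (1 + V) * b0)" .
    have "(t * (b * t ^ n) + real n / s * (t\<^sup>2 + V) * P) * \<delta> \<le> (b * t ^ (n + 2) * (1 + real n * (1 + V) * b0)) * (real (Suc r) * Dy * Q)"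
      using e \<delta> \<delta>0 b t v by (intro mult_mono mult_nonneg_nonneg add_nonneg_nonneg) auto
    also have "\<dots> = b\<^sup>2 * ((1 + real n * (1 + V) * b0) * real (Suc r) * real (n + 1) * (t ^ (n + 2) * t ^ (n + 1)) / (real N * s) * Q)"
      by (simp only: Dy_def power2_eq_square times_divide_eq_left times_divide_eq_right mult_ac)
    \<comment> \<open>The exponent \<open>n + 2\<close> comes from the traces with the entry
      squared, \<open>n + 1\<close> from the change of the trace of \<open>u\<close>, a word of
      length \<open>n + 1\<close>; this is the origin of \<open>2 * n + 3\<close>.\<close>
    also have "t ^ (n + 2) * t ^ (n + 1) = t ^ (2 * n + 3)" unfolding power_add[symmetric] by (rule arg_cong) simp
    finally show "(t * (b * t ^ n) + real n / s * (t\<^sup>2 + V) * P) * \<delta> \<le>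
      b\<^sup>2 * ((1 + real n * (1 + V) * b0) * real (Suc r) * real (n + 1) * t ^ (2 * n + 3) / (real N * s) * Q)" .
  qed
  also have "\<dots> = b\<^sup>2 * ((real n)\<^sup>2 * b0 * (1 + 2 * V) * t ^ (2 * n + 3) / real N * a +
      (1 + real n * (1 + V) * b0) * real (Suc r) * real (n + 1) * t ^ (2 * n + 3) / (real N * s) * Q)"
    by (rule distrib_left[symmetric])
  finally show ?thesis by (simp only: b_def s_def a_def Q_def)
qed

end

section \<open>The equation in expectation\<close>

locale wigner_family = wigner_matrix M d X N + contraction_family N d Uf J
  for M :: "'w measure" and d X N and Uf :: "'i \<Rightarrow> nat list \<Rightarrow> real" and J
begin

lemma has_moments_fam: "has_moments M (\<lambda>\<omega>. fam (entries N \<omega>) i a b)"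
  unfolding fam_def by (rule has_moments_ensm)

lemma has_moments_fam_loo: "has_moments M (\<lambda>\<omega>. fam ((entries N \<omega>)(k := 0)) i a b)"
  unfolding fam_def by (rule has_moments_ensm_loo)

lemma has_moments_word: "has_moments M (\<lambda>\<omega>. word_mat (entries N \<omega>) w a b)"
  unfolding word_mat_def by (intro has_moments_wmul has_moments_fam)

lemma has_moments_word_loo: "has_moments M (\<lambda>\<omega>. word_mat ((entries N \<omega>)(k := 0)) w a b)"
  unfolding word_mat_def by (intro has_moments_wmul has_moments_fam_loo)

lemma has_moments_ntrace: "has_moments M (\<lambda>\<omega>. ntrace (entries N \<omega>) w)"
  unfolding ntrace_def divide_inverse by (intro has_moments_mult has_moments_mtr has_moments_word has_moments_const)

lemma has_moments_ntrace_loo: "has_moments M (\<lambda>\<omega>. ntrace ((entries N \<omega>)(k := 0)) w)"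
  unfolding ntrace_def divide_inverse by (intro has_moments_mult has_moments_mtr has_moments_word_loo has_moments_const)

lemma measurable_word: "(\<lambda>x. word_mat x w a b) \<in> borel_measurable SP"
  unfolding word_mat_def fam_def by (intro measurable_wmul measurable_ensm)

lemma measurable_ntrace: "(\<lambda>x. ntrace x w) \<in> borel_measurable SP"
  unfolding ntrace_def by (intro borel_measurable_divide measurable_mtr measurable_word) auto

lemma has_moments_size: "has_moments M (\<lambda>\<omega>. size_bound (entries N \<omega>))"
  unfolding size_bound_def fam_def Xmax_def[symmetric]
  by (intro has_moments_add has_moments_mult has_moments_const has_moments_sum Xmax_moments has_moments_opnorm)

text \<open>Constant indices are estimated by absolute values and stay outside the second-order
  expansion. With weight \<open>0\<close> for them, sums over all entries agree with sums over the
  nonconstant ones.\<close>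

definition entry_var :: "nat list \<Rightarrow> real" where
  "entry_var k = (if k \<in> diagonal_index then 0 else expectation (\<lambda>\<omega>. (X N k \<omega>)\<^sup>2))"

lemma pair_variance_entry_var:
  assumes "1 \<le> V" "\<And>k. k \<in> entry_index N d \<Longrightarrow> expectation (\<lambda>\<omega>. (X N k \<omega>)\<^sup>2) \<le> V"
  shows "pair_variance V entry_var"
  unfolding pair_variance_def
proof (intro conjI ballI impI assms(1))
  fix k assume k: "k \<in> entry_index N d"
  have "0 \<le> expectation (\<lambda>\<omega>. (X N k \<omega>)\<^sup>2)" by (intro integral_nonneg_AE) simp
  then show "\<bar>entry_var k\<bar> \<le> V" using assms k by (simp add: entry_var_def)
  assume c: "3 \<le> card (set k)"
  then have nd: "k \<notin> diagonal_index" by (auto simp: diagonal_index_def)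
  have "expectation (X N k) = 0" using centered[of k N] k c by (auto simp: entry_index_def)
  then have "variance (X N k) = expectation (\<lambda>\<omega>. (X N k \<omega>)\<^sup>2)" by simp
  moreover have "variance (X N k) = (\<Prod>l<N. fact (count_list k l)) / fact d"
    using variance[of k N] k c by (auto simp: entry_index_def)
  ultimately show "entry_var k = (\<Prod>x<N. fact (count_list k x)) / fact d" using nd by (simp add: entry_var_def)
qed

text \<open>The constant \<open>m\<close> and the exponent are free, so that the equation can be
  tested against powers of the fluctuation itself. The summands of \<open>Cm\<close> come in turn
  from constant indices, the part of the remainder without change of \<open>Y\<close>, the pairing
  error, the part with change of \<open>Y\<close>, and the shift inside the last power.
  Normalization, sums over \<open>k\<close> and the factors of the remainder combine to the order
  \<open>1 / sqrt N\<close> for \<open>G\<close> and \<open>1 / N\<close> for its square.\<close>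

lemma schwinger_dyson:
  fixes r :: nat and m :: real
  assumes iw: "set (i # w) \<subseteq> J" and V: "1 \<le> V" "\<And>k. k \<in> entry_index N d \<Longrightarrow> expectation (\<lambda>\<omega>. (X N k \<omega>)\<^sup>2) \<le> V"
  defines "Y \<equiv> \<lambda>x. ntrace x (i # w) - m" and "n \<equiv> length w" and "b0 \<equiv> real (card J) * fact d"
  defines "Cm \<equiv> 1 + (real (card J))\<^sup>2 * fact d * ((real n)\<^sup>2 * b0 * (1 + 2 * V)) + real n * (6 * real d * fact d * V) +
     (real (card J))\<^sup>2 * fact d * ((1 + real n * (1 + V) * b0) * real (Suc r) * real (n + 1)) + real (n + 1) * b0"
  defines "G \<equiv> \<lambda>x. Cm * size_bound x ^ (2 * n + 3) / sqrt (real N)"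
  shows "\<bar>expectation (\<lambda>\<omega>. ntrace (entries N \<omega>) (i # w) * Y (entries N \<omega>) ^ Suc r) -
     expectation (\<lambda>\<omega>. (\<Sum>p<n. pair_cov (Uf i) (Uf (w ! p)) * ntrace (entries N \<omega>) (take p w) * ntrace (entries N \<omega>) (drop (Suc p) w)) * Y (entries N \<omega>) ^ Suc r)\<bar>
    \<le> expectation (\<lambda>\<omega>. G (entries N \<omega>) * \<bar>Y (entries N \<omega>)\<bar> ^ Suc r + (G (entries N \<omega>))\<^sup>2 * (\<bar>Y (entries N \<omega>)\<bar> + G (entries N \<omega>)) ^ r)"
proof -
  let ?S = "entry_index N d" and ?ND = "entry_index N d - diagonal_index" and ?s = "sqrt (real N)"
  let ?Z = "\<lambda>x. Y x ^ Suc r"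
  let ?e = "\<lambda>\<omega>. entries N \<omega>" and ?l = "\<lambda>k \<omega>. (entries N \<omega>)(k := 0)"
  let ?pt = "\<lambda>p k x. ptrace i w p k x x"
  define A where "A x = ntrace x (i # w) * ?Z x" for x
  define C where "C x = (\<Sum>p<n. pair_cov (Uf i) (Uf (w ! p)) * ntrace x (take p w) * ntrace x (drop (Suc p) w)) * ?Z x" for x
  define g1 where "g1 k x = mtr N (mmul N (coefm (Uf i) k) (word_mat x w)) * ?Z x" for k x
  define g2 where "g2 k p x = ?pt p k x * ?Z x" for k p x
  \<comment> \<open>Collects the terms of mean zero. They are removed pointwise, before absolute
    values are taken.\<close>
  define B where "B x = 1 / (real N * ?s) * (\<Sum>k\<in>?ND. x k * g1 k (x(k := 0)) + (\<Sum>p<n. 1 / ?s * (((x k)\<^sup>2 - entry_var k) * g2 k p (x(k := 0)))))" for x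
  have iJ: "i \<in> J" "set w \<subseteq> J" using iw by auto
  have pv: "pair_variance V entry_var" by (rule pair_variance_entry_var[OF V])
  have ent: "entries N \<omega> k = X N k \<omega>" if "k \<in> ?S" for k \<omega> using that by (simp add: entries_def)
  have s1: "1 \<le> ?s" "?s * ?s = real N" "0 < real N" using N1 by auto
  have b00: "0 \<le> b0" by (simp add: b0_def)
  have sub: "diagonal_index \<subseteq> ?S" by (auto simp: diagonal_index_def)
  have pointwise: "\<bar>A x - B x - C x\<bar> \<le> G x * \<bar>Y x\<bar> ^ Suc r + (G x)\<^sup>2 * (\<bar>Y x\<bar> + G x) ^ r" for x
  proof -
    define t where "t = size_bound x"
    define a where "a = \<bar>Y x\<bar> ^ Suc r"
    have t: "1 \<le> t" unfolding t_def by (rule size_ge1)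
    have a0: "0 \<le> a" by (simp add: a_def)
    have Za: "\<bar>?Z x\<bar> = a" by (simp only: a_def power_abs)
    let ?tr = "\<lambda>k. mtr N (mmul N (coefm (Uf i) k) (word_mat x w))"
    have Aexp: "A x = 1 / (real N * ?s) * ((\<Sum>k\<in>diagonal_index. x k * ?tr k * ?Z x) + (\<Sum>k\<in>?ND. x k * ?tr k * ?Z x))"
    proof -
      have "mtr N (word_mat x (i # w)) = 1 / ?s * (\<Sum>k\<in>?S. x k * ?tr k)"
        unfolding mtr_ensm_expand[symmetric] by (simp add: word_mat_def fam_def)
      then have "A x = (1 / ?s * (\<Sum>k\<in>?S. x k * ?tr k)) / real N * ?Z x"
        by (simp only: A_def ntrace_def)
      also have "\<dots> = 1 / (real N * ?s) * ((\<Sum>k\<in>?S. x k * ?tr k) * ?Z x)" by simp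
      also have "(\<Sum>k\<in>?S. x k * ?tr k) * ?Z x = (\<Sum>k\<in>?S. x k * ?tr k * ?Z x)" by (rule sum_distrib_right)
      finally have "A x = 1 / (real N * ?s) * (\<Sum>k\<in>?S. x k * ?tr k * ?Z x)" .
      then show ?thesis using sub by (simp add: sum.subset_diff[of diagonal_index ?S] add.commute)
    qed
    have rem: "x k * ?tr k * ?Z x = remainder i w k (entry_var k) ?Z x + (\<Sum>p<n. 1 / ?s * (entry_var k * ?pt p k x * ?Z x)) +
       (x k * g1 k (x(k := 0)) + (\<Sum>p<n. 1 / ?s * (((x k)\<^sup>2 - entry_var k) * g2 k p (x(k := 0)))))" if "k \<in> ?ND" for k
      using remainder_eq[of k x i w ?Z "entry_var k"] that unfolding g1_def g2_def n_def by simp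
    have var0: "(\<Sum>k\<in>?ND. \<Sum>p<n. 1 / ?s * (entry_var k * ?pt p k x * ?Z x)) = 1 / ?s * (\<Sum>p<n. (\<Sum>k\<in>?S. entry_var k * ?pt p k x) * ?Z x)"
    proof -
      have "(\<Sum>k\<in>?S. entry_var k * ?pt p k x) = (\<Sum>k\<in>?ND. entry_var k * ?pt p k x)" for p
        by (rule sum.mono_neutral_right) (auto simp: entry_var_def)
      then show ?thesis by (subst sum.swap) (simp add: sum_distrib_left sum_distrib_right sum_divide_distrib)
    qed
    have AB: "A x - B x = 1 / (real N * ?s) * (\<Sum>k\<in>diagonal_index. x k * ?tr k * ?Z x) +
       1 / (real N * ?s) * (\<Sum>k\<in>?ND. remainder i w k (entry_var k) ?Z x) +
       1 / (real N * ?s) * (1 / ?s * (\<Sum>p<n. (\<Sum>k\<in>?S. entry_var k * ?pt p k x) * ?Z x))"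
    proof -
      have "(\<Sum>k\<in>?ND. x k * ?tr k * ?Z x) = (\<Sum>k\<in>?ND. remainder i w k (entry_var k) ?Z x) +
         1 / ?s * (\<Sum>p<n. (\<Sum>k\<in>?S. entry_var k * ?pt p k x) * ?Z x) +
         (\<Sum>k\<in>?ND. x k * g1 k (x(k := 0)) + (\<Sum>p<n. 1 / ?s * (((x k)\<^sup>2 - entry_var k) * g2 k p (x(k := 0)))))"
        unfolding var0[symmetric] sum.distrib[symmetric] by (intro sum.cong refl rem)
      then show ?thesis unfolding Aexp B_def by (simp only: distrib_left)
    qed
    have T1: "\<bar>1 / (real N * ?s) * (\<Sum>k\<in>diagonal_index. x k * ?tr k * ?Z x)\<bar> \<le> t ^ (2 * n + 3) / ?s * a"
    proof -
      have "\<bar>\<Sum>k\<in>diagonal_index. x k * ?tr k * ?Z x\<bar> \<le> (\<Sum>k\<in>diagonal_index. t * \<bar>?tr k\<bar> * a)"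
        unfolding Za[symmetric] t_def using sub
        by (intro order_trans[OF sum_abs] sum_mono) (auto simp: abs_mult intro!: mult_right_mono entry_le_size)
      also have "\<dots> = t * a * (\<Sum>k\<in>diagonal_index. \<bar>?tr k\<bar>)" by (simp add: sum_distrib_left mult_ac)
      also have "\<dots> \<le> t * a * (\<Sum>j<N. \<bar>word_mat x w j j\<bar>)"
        using t a0 by (intro mult_left_mono diagonal_sum_bound subU) auto
      also have "\<dots> \<le> t * a * (\<Sum>j<N. t ^ n)"
        using t a0 unfolding n_def t_def by (intro mult_left_mono sum_mono opb_entry[OF opb_word] iJ) auto
      finally have "\<bar>\<Sum>k\<in>diagonal_index. x k * ?tr k * ?Z x\<bar> \<le> real N * (t ^ (n + 1) * a)" by (simp add: mult_ac)
      then have "1 / (real N * ?s) * \<bar>\<Sum>k\<in>diagonal_index. x k * ?tr k * ?Z x\<bar> \<le> 1 / (real N * ?s) * (real N * (t ^ (n + 1) * a))"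
        by (rule mult_left_mono) simp
      also have "\<dots> = t ^ (n + 1) / ?s * a" using s1 by simp
      also have "\<dots> \<le> t ^ (2 * n + 3) / ?s * a"
        using t a0 s1 by (intro mult_right_mono divide_right_mono power_increasing) auto
      finally show ?thesis by (simp add: abs_mult)
    qed
    let ?c4 = "(real (card J))\<^sup>2 * fact d" and ?c1 = "(real n)\<^sup>2 * b0 * (1 + 2 * V)"
    let ?c2 = "(1 + real n * (1 + V) * b0) * real (Suc r) * real (n + 1)"
    define Q where "Q = (\<bar>Y x\<bar> + real (n + 1) * b0 * t ^ (2 * n + 3) / ?s) ^ r"
    have Q0: "0 \<le> Q" unfolding Q_def using b00 t s1 by (intro zero_le_power add_nonneg_nonneg divide_nonneg_nonneg mult_nonneg_nonneg) auto
    have T2: "\<bar>1 / (real N * ?s) * (\<Sum>k\<in>?ND. remainder i w k (entry_var k) ?Z x)\<bar> \<le>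
        ?c4 * ?c1 * t ^ (2 * n + 3) / ?s * a + ?c4 * ?c2 * t ^ (2 * n + 3) / real N * Q"
    proof -
      let ?E = "?c1 * t ^ (2 * n + 3) / real N * a + ?c2 * t ^ (2 * n + 3) / (real N * ?s) * Q"
      have E0: "0 \<le> ?E" using b00 t V a0 Q0 by (intro add_nonneg_nonneg mult_nonneg_nonneg divide_nonneg_nonneg zero_le_power) auto
      have "\<bar>\<Sum>k\<in>?ND. remainder i w k (entry_var k) ?Z x\<bar> \<le> (\<Sum>k\<in>?ND. (coef_size k)\<^sup>2 * ?E)"
      proof (intro order_trans[OF sum_abs] sum_mono)
        fix k assume k: "k \<in> ?ND"
        then have "\<bar>entry_var k\<bar> \<le> V" using pv by (auto simp: pair_variance_def)
        then have "\<bar>remainder i w k (entry_var k) ?Z x\<bar> \<le> (coef_size k)\<^sup>2 *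
           (?c1 * t ^ (2 * n + 3) / real N * \<bar>Y x\<bar> ^ Suc r + ?c2 * t ^ (2 * n + 3) / (real N * ?s) *
              (\<bar>Y x\<bar> + real (n + 1) * b0 * t ^ (2 * n + 3) / ?s) ^ r)"
          unfolding Y_def n_def b0_def t_def using k iJ iw V(1) by (intro remainder_bound) auto
        then show "\<bar>remainder i w k (entry_var k) ?Z x\<bar> \<le> (coef_size k)\<^sup>2 * ?E"
          by (simp only: a_def Q_def)
      qed
      also have "\<dots> \<le> (\<Sum>k\<in>?S. (coef_size k)\<^sup>2 * ?E)" using E0 by (intro sum_mono2) auto
      also have "\<dots> = (\<Sum>k\<in>?S. (coef_size k)\<^sup>2) * ?E" by (rule sum_distrib_right[symmetric])
      also have "\<dots> \<le> (?c4 * (real N)\<^sup>2) * ?E" by (intro mult_right_mono sum_coef_size_sq E0)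
      finally have "1 / (real N * ?s) * \<bar>\<Sum>k\<in>?ND. remainder i w k (entry_var k) ?Z x\<bar> \<le> 1 / (real N * ?s) * ((?c4 * (real N)\<^sup>2) * ?E)"
        by (rule mult_left_mono) simp
      also have "\<dots> = ?c4 * ?c1 * t ^ (2 * n + 3) / ?s * a + ?c4 * ?c2 * t ^ (2 * n + 3) / (?s * ?s) * Q"
      proof -
        have "1 / (N' * s) * ((c4 * N'\<^sup>2) * (c1 * T / N' * a + c2 * T / (N' * s) * Q)) = c4 * c1 * T / s * a + c4 * c2 * T / (s * s) * Q"
          if "N' > 0" "s > 0" for N' s c4 c1 c2 T a Q :: real
          using that by (simp add: field_simps power2_eq_square)
        from this[of "real N" ?s] show ?thesis using s1 by simp
      qed
      finally show ?thesis using s1 by (simp add: abs_mult)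
    qed
    \<comment> \<open>For each position \<open>p\<close> the sum over the entries is the
      second-order term of \<open>pair_trace_bound\<close>, whose error \<open>N * sqrt N\<close>
      meets the normalization \<open>1 / N^2\<close>.\<close>
    have T3: "\<bar>1 / (real N * ?s) * (1 / ?s * (\<Sum>p<n. (\<Sum>k\<in>?S. entry_var k * ?pt p k x) * ?Z x)) - C x\<bar> \<le>
        real n * (6 * real d * fact d * V) * t ^ (2 * n + 3) / ?s * a"
    proof -
      let ?K = "\<lambda>p. pair_cov (Uf i) (Uf (w ! p))"
      let ?M = "\<lambda>w. mtr N (word_mat x w)"
      have eq3: "1 / (real N * ?s) * (1 / ?s * (\<Sum>p<n. (\<Sum>k\<in>?S. entry_var k * ?pt p k x) * ?Z x)) - C x =
        (\<Sum>p<n. 1 / (real N)\<^sup>2 * ((\<Sum>k\<in>?S. entry_var k * ?pt p k x) - ?K p * ?M (take p w) * ?M (drop (Suc p) w)) * ?Z x)"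
      proof -
        have "1 / (real N * ?s) * (1 / ?s * (\<Sum>p<n. (\<Sum>k\<in>?S. entry_var k * ?pt p k x) * ?Z x)) =
           (\<Sum>p<n. 1 / (real N)\<^sup>2 * (\<Sum>k\<in>?S. entry_var k * ?pt p k x) * ?Z x)"
        proof -
          have "1 / (real N * ?s) * (1 / ?s * y) = 1 / (real N)\<^sup>2 * y" for y
            by (simp add: power2_eq_square)
          then have "1 / (real N * ?s) * (1 / ?s * (\<Sum>p<n. (\<Sum>k\<in>?S. entry_var k * ?pt p k x) * ?Z x)) =
             1 / (real N)\<^sup>2 * (\<Sum>p<n. (\<Sum>k\<in>?S. entry_var k * ?pt p k x) * ?Z x)" .
          also have "\<dots> = (\<Sum>p<n. 1 / (real N)\<^sup>2 * ((\<Sum>k\<in>?S. entry_var k * ?pt p k x) * ?Z x))"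
            by (rule sum_distrib_left)
          finally show ?thesis by (simp only: mult.assoc)
        qed
        moreover have "C x = (\<Sum>p<n. 1 / (real N)\<^sup>2 * (?K p * ?M (take p w) * ?M (drop (Suc p) w)) * ?Z x)"
          by (simp add: C_def ntrace_def sum_distrib_right power2_eq_square)
        ultimately show ?thesis by (simp only: sum_subtractf[symmetric] right_diff_distrib left_diff_distrib)
      qed
      have "\<bar>1 / (real N * ?s) * (1 / ?s * (\<Sum>p<n. (\<Sum>k\<in>?S. entry_var k * ?pt p k x) * ?Z x)) - C x\<bar> \<le> (\<Sum>p<n. 1 / (real N)\<^sup>2 * (6 * real d * fact d * V * real N * ?s * t ^ n) * a)"
        unfolding eq3
      proof (intro order_trans[OF sum_abs] sum_mono)
        fix p assume p: "p \<in> {..<n}"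
        have J: "set (take p w) \<subseteq> J" "set (drop (Suc p) w) \<subseteq> J"
          using iJ set_take_subset[of p w] set_drop_subset[of "Suc p" w] by auto
        have "\<bar>(\<Sum>k\<in>?S. entry_var k * ?pt p k x) - ?K p * ?M (take p w) * ?M (drop (Suc p) w)\<bar> \<le>
          6 * real d * fact d * V * real N * ?s * t ^ length (take p w) * t ^ length (drop (Suc p) w)"
          unfolding ptrace_def t_def by (intro pair_trace_bound subU opb_word J pv)
        also have "\<dots> = 6 * real d * fact d * V * real N * ?s * t ^ (n - 1)"
        proof -
          have "length (take p w) + length (drop (Suc p) w) = n - 1" using p by (simp add: n_def)
          then show ?thesis by (metis mult.assoc power_add)
        qed
        also have "\<dots> \<le> 6 * real d * fact d * V * real N * ?s * t ^ n"
          using t V by (intro mult_left_mono power_increasing mult_nonneg_nonneg) auto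
        finally show "\<bar>1 / (real N)\<^sup>2 * ((\<Sum>k\<in>?S. entry_var k * ?pt p k x) - ?K p * ?M (take p w) * ?M (drop (Suc p) w)) * ?Z x\<bar>
          \<le> 1 / (real N)\<^sup>2 * (6 * real d * fact d * V * real N * ?s * t ^ n) * a"
          unfolding abs_mult Za using a0 by (intro mult_right_mono mult_left_mono) (auto intro: divide_right_mono)
      qed
      also have "\<dots> = real n * (6 * real d * fact d * V) * t ^ n / ?s * a"
      proof -
        have "1 / (s * s)\<^sup>2 * (c * (s * s) * s * T) * a = c * T / s * a" if "s > 0" for c s T a :: real
          using that by (simp add: power2_eq_square)
        from this[of ?s "6 * real d * fact d * V" "t ^ n" a] show ?thesis using s1 by (simp add: mult_ac)
      qed
      also have "\<dots> \<le> real n * (6 * real d * fact d * V) * t ^ (2 * n + 3) / ?s * a"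
        using t V a0 by (intro mult_right_mono divide_right_mono mult_left_mono power_increasing mult_nonneg_nonneg) auto
      finally show ?thesis .
    qed
    let ?T = "t ^ (2 * n + 3)"
    have c0: "0 \<le> ?c4" "0 \<le> ?c1" "0 \<le> ?c2" "0 \<le> real n * (6 * real d * fact d * V)" "0 \<le> real (n + 1) * b0"
      using b00 V by (auto intro!: mult_nonneg_nonneg add_nonneg_nonneg)
    have c42: "0 \<le> ?c4 * ?c1" "0 \<le> ?c4 * ?c2" using c0 by (auto intro: mult_nonneg_nonneg simp del: of_nat_Suc)
    have T1': "1 \<le> ?T" using t by (rule one_le_power)
    have Cm: "1 + ?c4 * ?c1 + real n * (6 * real d * fact d * V) \<le> Cm" "?c4 * ?c2 \<le> Cm" "real (n + 1) * b0 \<le> Cm" "1 \<le> Cm"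
      unfolding Cm_def using c0 c42 by linarith+
    have "\<bar>A x - B x - C x\<bar> \<le> (?T / ?s * a + ?c4 * ?c1 * ?T / ?s * a + real n * (6 * real d * fact d * V) * ?T / ?s * a) + ?c4 * ?c2 * ?T / real N * Q"
      unfolding AB using T1 T2 T3 by linarith
    also have "?T / ?s * a + ?c4 * ?c1 * ?T / ?s * a + real n * (6 * real d * fact d * V) * ?T / ?s * a =
       (1 + ?c4 * ?c1 + real n * (6 * real d * fact d * V)) * ?T / ?s * a" by (simp add: add_divide_distrib algebra_simps)
    also have "\<dots> + ?c4 * ?c2 * ?T / real N * Q \<le> G x * a + (G x)\<^sup>2 * (\<bar>Y x\<bar> + G x) ^ r"
    proof (intro add_mono mult_mono)
      show "(1 + ?c4 * ?c1 + real n * (6 * real d * fact d * V)) * ?T / ?s \<le> G x"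
        unfolding G_def t_def[symmetric] using Cm T1' by (intro divide_right_mono mult_right_mono) auto
      show "?c4 * ?c2 * ?T / real N \<le> (G x)\<^sup>2"
      proof -
        have "?c4 * ?c2 * ?T \<le> Cm * ?T" using Cm T1' by (intro mult_right_mono) auto
        \<comment> \<open>A number that is at least one lies below its square; the summand
          \<open>1\<close> in \<open>Cm\<close> guarantees this.\<close>
        also have "\<dots> \<le> (Cm * ?T)\<^sup>2"
        proof -
          have "1 \<le> Cm * ?T" using mult_mono[of 1 Cm 1 ?T] Cm T1' by simp
          then show ?thesis by (intro self_le_power) auto
        qed
        finally have "?c4 * ?c2 * ?T / real N \<le> (Cm * ?T)\<^sup>2 / real N" by (rule divide_right_mono) simp
        then show ?thesis unfolding G_def t_def[symmetric] by (simp add: power_divide)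
      qed
      show "Q \<le> (\<bar>Y x\<bar> + G x) ^ r"
        unfolding Q_def G_def t_def[symmetric] using Cm T1' b00 s1
        by (intro power_mono add_left_mono divide_right_mono mult_right_mono add_nonneg_nonneg divide_nonneg_nonneg mult_nonneg_nonneg) auto
    qed (use a0 Q0 Cm T1' in \<open>auto simp: G_def t_def[symmetric]\<close>)
    finally show ?thesis unfolding a_def .
  qed
  have hY: "has_moments M (\<lambda>\<omega>. Y (?e \<omega>))" "has_moments M (\<lambda>\<omega>. Y (?l k \<omega>))" for k
    unfolding Y_def by (intro has_moments_diff has_moments_ntrace has_moments_ntrace_loo has_moments_const)+
  have mY: "Y \<in> borel_measurable SP" unfolding Y_def by (intro borel_measurable_diff measurable_ntrace borel_measurable_const)
  have hA: "has_moments M (\<lambda>\<omega>. A (?e \<omega>))" unfolding A_def by (intro has_moments_mult has_moments_ntrace has_moments_power hY)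
  have hC: "has_moments M (\<lambda>\<omega>. C (?e \<omega>))" unfolding C_def by (intro has_moments_mult has_moments_sum has_moments_ntrace has_moments_power hY has_moments_const)
  have hG: "has_moments M (\<lambda>\<omega>. G (?e \<omega>))" unfolding G_def divide_inverse by (intro has_moments_mult has_moments_power has_moments_size has_moments_const)
  have hg1: "has_moments M (\<lambda>\<omega>. g1 k (?l k \<omega>))" for k
    unfolding g1_def by (intro has_moments_mult has_moments_mtr has_moments_mmul has_moments_word_loo has_moments_power hY has_moments_const)
  have hg2: "has_moments M (\<lambda>\<omega>. g2 k p (?l k \<omega>))" for k p
    unfolding g2_def ptrace_def by (intro has_moments_mult has_moments_mtr has_moments_mmul has_moments_word_loo has_moments_power hY has_moments_const)
  have mg1: "g1 k \<in> borel_measurable SP" for k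
    unfolding g1_def by (intro borel_measurable_times borel_measurable_power measurable_mtr measurable_mmul measurable_word mY borel_measurable_const)
  have mg2: "g2 k p \<in> borel_measurable SP" for k p
    unfolding g2_def ptrace_def by (intro borel_measurable_times borel_measurable_power measurable_mtr measurable_mmul measurable_word mY borel_measurable_const)
  have z1: "expectation (\<lambda>\<omega>. X N k \<omega> * g1 k (?l k \<omega>)) = 0" if "k \<in> ?ND" for k
    by (rule expectation_centered_loo[OF that mg1 hg1])
  have hq: "has_moments M (\<lambda>\<omega>. (X N k \<omega>)\<^sup>2 - entry_var k)" if "k \<in> ?S" for k
    by (intro has_moments_diff has_moments_power has_moments_X that has_moments_const)
  have z2: "expectation (\<lambda>\<omega>. ((X N k \<omega>)\<^sup>2 - entry_var k) * g2 k p (?l k \<omega>)) = 0" if k: "k \<in> ?ND" for k p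
  proof -
    have kS: "k \<in> ?S" using k by simp
    have "expectation (\<lambda>\<omega>. ((X N k \<omega>)\<^sup>2 - entry_var k)) = 0"
      using k has_moments_integrable[OF has_moments_power[OF has_moments_X[OF kS], of 2]] by (simp add: entry_var_def prob_space)
    moreover have "expectation (\<lambda>\<omega>. (\<lambda>x. x\<^sup>2 - entry_var k) (X N k \<omega>) * g2 k p (?l k \<omega>)) =
        expectation (\<lambda>\<omega>. (\<lambda>x. x\<^sup>2 - entry_var k) (X N k \<omega>)) * expectation (\<lambda>\<omega>. g2 k p (?l k \<omega>))"
      by (intro leave_one_out_expectation kS mg2 has_moments_integrable[OF hg2] has_moments_integrable[OF hq[OF kS]]) measurable
    ultimately show ?thesis by simp
  qed
  define Br where "Br \<omega> = 1 / (real N * ?s) * (\<Sum>k\<in>?ND. X N k \<omega> * g1 k (?l k \<omega>) + (\<Sum>p<n. 1 / ?s * (((X N k \<omega>)\<^sup>2 - entry_var k) * g2 k p (?l k \<omega>))))" for \<omega>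
  have Beq: "B (?e \<omega>) = Br \<omega>" for \<omega>
    unfolding B_def Br_def using ent by (intro arg_cong[where f = "\<lambda>y. 1 / (real N * ?s) * y"] sum.cong refl) simp
  have h1: "has_moments M (\<lambda>\<omega>. X N k \<omega> * g1 k (?l k \<omega>))" if "k \<in> ?ND" for k
    using that by (intro has_moments_mult has_moments_X hg1) auto
  have h2: "has_moments M (\<lambda>\<omega>. 1 / ?s * (((X N k \<omega>)\<^sup>2 - entry_var k) * g2 k p (?l k \<omega>)))" if "k \<in> ?ND" for k p
    using that by (intro has_moments_mult[OF has_moments_const] has_moments_mult[OF hq hg2]) auto
  have h3: "has_moments M (\<lambda>\<omega>. X N k \<omega> * g1 k (?l k \<omega>) + (\<Sum>p<n. 1 / ?s * (((X N k \<omega>)\<^sup>2 - entry_var k) * g2 k p (?l k \<omega>))))" if "k \<in> ?ND" for k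
    by (intro has_moments_add h1 has_moments_sum h2 that)
  have hB: "has_moments M Br"
    unfolding Br_def[abs_def] by (intro has_moments_mult[OF has_moments_const] has_moments_sum h3)
  have EB: "expectation Br = 0"
  proof -
    have "expectation Br = 1 / (real N * ?s) * (\<Sum>k\<in>?ND. expectation (\<lambda>\<omega>. X N k \<omega> * g1 k (?l k \<omega>) + (\<Sum>p<n. 1 / ?s * (((X N k \<omega>)\<^sup>2 - entry_var k) * g2 k p (?l k \<omega>)))))"
      unfolding Br_def[abs_def] integral_mult_right_zero
      by (subst Bochner_Integration.integral_sum) (use has_moments_integrable[OF h3] in auto)
    also have "(\<Sum>k\<in>?ND. expectation (\<lambda>\<omega>. X N k \<omega> * g1 k (?l k \<omega>) + (\<Sum>p<n. 1 / ?s * (((X N k \<omega>)\<^sup>2 - entry_var k) * g2 k p (?l k \<omega>))))) = 0"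
    proof (intro sum.neutral ballI)
      fix k assume k: "k \<in> ?ND"
      have "expectation (\<lambda>\<omega>. X N k \<omega> * g1 k (?l k \<omega>) + (\<Sum>p<n. 1 / ?s * (((X N k \<omega>)\<^sup>2 - entry_var k) * g2 k p (?l k \<omega>)))) =
         expectation (\<lambda>\<omega>. X N k \<omega> * g1 k (?l k \<omega>)) + expectation (\<lambda>\<omega>. \<Sum>p<n. 1 / ?s * (((X N k \<omega>)\<^sup>2 - entry_var k) * g2 k p (?l k \<omega>)))"
        by (intro Bochner_Integration.integral_add has_moments_integrable h1 has_moments_sum h2 k)
      also have "expectation (\<lambda>\<omega>. \<Sum>p<n. 1 / ?s * (((X N k \<omega>)\<^sup>2 - entry_var k) * g2 k p (?l k \<omega>))) =
          (\<Sum>p<n. expectation (\<lambda>\<omega>. 1 / ?s * (((X N k \<omega>)\<^sup>2 - entry_var k) * g2 k p (?l k \<omega>))))"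
        by (intro Bochner_Integration.integral_sum has_moments_integrable h2 k)
      finally show "expectation (\<lambda>\<omega>. X N k \<omega> * g1 k (?l k \<omega>) + (\<Sum>p<n. 1 / ?s * (((X N k \<omega>)\<^sup>2 - entry_var k) * g2 k p (?l k \<omega>)))) = 0"
        unfolding integral_mult_right_zero by (simp only: z1[OF k] z2[OF k]) simp
    qed
    finally show ?thesis by simp
  qed
  have eqE: "expectation (\<lambda>\<omega>. A (?e \<omega>)) - expectation (\<lambda>\<omega>. C (?e \<omega>)) = expectation (\<lambda>\<omega>. A (?e \<omega>) - Br \<omega> - C (?e \<omega>))"
    using has_moments_integrable[OF hA] has_moments_integrable[OF hB] has_moments_integrable[OF hC] EB by simp
  have "\<bar>expectation (\<lambda>\<omega>. A (?e \<omega>)) - expectation (\<lambda>\<omega>. C (?e \<omega>))\<bar> \<le> expectation (\<lambda>\<omega>. \<bar>A (?e \<omega>) - Br \<omega> - C (?e \<omega>)\<bar>)"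
    unfolding eqE by (rule integral_abs_bound)
  also have "\<dots> \<le> expectation (\<lambda>\<omega>. G (?e \<omega>) * \<bar>Y (?e \<omega>)\<bar> ^ Suc r + (G (?e \<omega>))\<^sup>2 * (\<bar>Y (?e \<omega>)\<bar> + G (?e \<omega>)) ^ r)"
  proof (rule integral_mono)
    show "integrable M (\<lambda>\<omega>. \<bar>A (?e \<omega>) - Br \<omega> - C (?e \<omega>)\<bar>)"
      by (intro has_moments_integrable has_moments_abs has_moments_diff hA hB hC)
    show "integrable M (\<lambda>\<omega>. G (?e \<omega>) * \<bar>Y (?e \<omega>)\<bar> ^ Suc r + (G (?e \<omega>))\<^sup>2 * (\<bar>Y (?e \<omega>)\<bar> + G (?e \<omega>)) ^ r)"
      by (intro has_moments_integrable has_moments_add has_moments_mult has_moments_power has_moments_abs hG hY)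
    show "\<bar>A (?e \<omega>) - Br \<omega> - C (?e \<omega>)\<bar> \<le> G (?e \<omega>) * \<bar>Y (?e \<omega>)\<bar> ^ Suc r + (G (?e \<omega>))\<^sup>2 * (\<bar>Y (?e \<omega>)\<bar> + G (?e \<omega>)) ^ r" for \<omega>
      using pointwise[of "?e \<omega>"] unfolding Beq .
  qed
  finally show ?thesis unfolding A_def C_def .
qed

end

section \<open>Almost sure convergence of trace moments\<close>

text \<open>\<open>L = 2 ^ (r + 2)\<close> is the threshold for \<open>y / g\<close>: above it each
  of the two terms is at most a quarter of \<open>y ^ (r + 2)\<close>, below it both are multiples
  of \<open>g ^ (r + 2)\<close>.\<close>

lemma young_power:
  fixes y g :: real
  assumes "0 \<le> y" "0 \<le> g"
  shows "g * y ^ Suc r + g\<^sup>2 * (y + g) ^ r \<le> y ^ Suc (Suc r) / 2 + (((2::real) ^ (r + 2)) ^ Suc r + (2 ^ (r + 2) + 1) ^ r) * g ^ Suc (Suc r)"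
proof -
  define L where "L = (2::real) ^ (r + 2)"
  have L: "4 \<le> L" unfolding L_def by simp
  have e: "z ^ Suc (Suc r) = z * z ^ Suc r" "z ^ Suc (Suc r) = z\<^sup>2 * z ^ r" for z :: real
    by (simp_all add: power2_eq_square)
  show ?thesis unfolding L_def[symmetric]
  proof (cases "y \<le> L * g")
    case True
    have "y ^ Suc r \<le> (L * g) ^ Suc r" using True assms by (intro power_mono) auto
    then have "g * y ^ Suc r \<le> g * (L * g) ^ Suc r" using assms by (intro mult_left_mono)
    also have "\<dots> = L ^ Suc r * g ^ Suc (Suc r)" by (simp add: power_mult_distrib)
    finally have 1: "g * y ^ Suc r \<le> L ^ Suc r * g ^ Suc (Suc r)" .
    have "y + g \<le> (L + 1) * g" using True by (simp add: algebra_simps)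
    then have "(y + g) ^ r \<le> ((L + 1) * g) ^ r" using assms by (intro power_mono) auto
    then have "g\<^sup>2 * (y + g) ^ r \<le> g\<^sup>2 * ((L + 1) * g) ^ r" by (intro mult_left_mono) auto
    also have "\<dots> = (L + 1) ^ r * g ^ Suc (Suc r)" by (simp add: power_mult_distrib power2_eq_square)
    finally have 2: "g\<^sup>2 * (y + g) ^ r \<le> (L + 1) ^ r * g ^ Suc (Suc r)" .
    have "0 \<le> y ^ Suc (Suc r)" using assms by simp
    then show "g * y ^ Suc r + g\<^sup>2 * (y + g) ^ r \<le> y ^ Suc (Suc r) / 2 + (L ^ Suc r + (L + 1) ^ r) * g ^ Suc (Suc r)"
      using 1 2 unfolding distrib_right by linarith
  next
    case False
    then have gy: "g \<le> y / L" using L by (simp add: pos_le_divide_eq mult.commute)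
    have yL: "y / L \<le> y / 4" using L assms by (intro divide_left_mono) auto
    have gy': "y + g \<le> 2 * y" using order_trans[OF gy yL] assms by simp
    have "g * y ^ Suc r \<le> y / 4 * y ^ Suc r" using order_trans[OF gy yL] assms by (intro mult_right_mono) auto
    then have 1: "g * y ^ Suc r \<le> y ^ Suc (Suc r) / 4" by simp
    have "g\<^sup>2 * (y + g) ^ r \<le> (y / L)\<^sup>2 * (2 * y) ^ r"
      using gy gy' assms by (intro mult_mono power_mono) auto
    also have "\<dots> = (2 ^ r / L\<^sup>2) * y ^ Suc (Suc r)" by (simp add: power_mult_distrib power_divide power2_eq_square)
    also have "\<dots> \<le> 1 / 4 * y ^ Suc (Suc r)"
    proof (intro mult_right_mono)
      have "2 ^ r * 4 \<le> L * L" using L unfolding L_def by (intro mult_mono) auto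
      then show "2 ^ r / L\<^sup>2 \<le> 1 / 4" using L by (simp add: power2_eq_square field_simps)
    qed (use assms in auto)
    finally have 2: "g\<^sup>2 * (y + g) ^ r \<le> 1 / 4 * y ^ Suc (Suc r)" .
    have "0 \<le> (L ^ Suc r + (L + 1) ^ r) * g ^ Suc (Suc r)" using assms L by (intro mult_nonneg_nonneg add_nonneg_nonneg zero_le_power) auto
    then show "g * y ^ Suc r + g\<^sup>2 * (y + g) ^ r \<le> y ^ Suc (Suc r) / 2 + (L ^ Suc r + (L + 1) ^ r) * g ^ Suc (Suc r)"
      using 1 2 by linarith
  qed
qed

text \<open>Other orders follow from a higher even one. For even \<open>r\<close> the power
  \<open>\<bar>Y\<bar> ^ (r + 2)\<close> is the product of \<open>Y\<close> and
  \<open>Y ^ (r + 1)\<close> without absolute values, the form in which the equation is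
  tested.\<close>

lemma (in prob_space) moment_bounded_even:
  assumes hm: "\<And>N. N \<ge> 1 \<Longrightarrow> has_moments M (f N)"
    and ev: "\<And>r. even r \<Longrightarrow> \<exists>C. \<forall>N\<ge>1. (LINT \<omega>|M. \<bar>f N \<omega>\<bar> ^ Suc (Suc r)) \<le> C * sqrt (real N)"
  shows "moment_bounded M f"
  unfolding moment_bounded_def
proof (intro conjI allI impI hm)
  fix q :: nat
  obtain C where C: "\<And>N. N \<ge> 1 \<Longrightarrow> (LINT \<omega>|M. \<bar>f N \<omega>\<bar> ^ Suc (Suc (2 * q))) \<le> C * sqrt (real N)"
    using ev[of "2 * q"] by auto
  have "(LINT \<omega>|M. \<bar>f N \<omega>\<bar> ^ q) \<le> (1 + C) * sqrt (real N)" if N: "N \<ge> 1" for N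
  proof -
    have i: "integrable M (\<lambda>\<omega>. \<bar>f N \<omega>\<bar> ^ m)" for m by (rule has_moments_abs_power_integrable[OF hm[OF N]])
    have p: "\<bar>y\<bar> ^ q \<le> 1 + \<bar>y\<bar> ^ Suc (Suc (2 * q))" for y :: real
    proof (cases "\<bar>y\<bar> \<le> 1")
      case True
      then have "\<bar>y\<bar> ^ q \<le> 1" by (intro power_le_one) auto
      moreover have "0 \<le> \<bar>y\<bar> ^ Suc (Suc (2 * q))" by simp
      ultimately show ?thesis by linarith
    next
      case False
      then have "\<bar>y\<bar> ^ q \<le> \<bar>y\<bar> ^ Suc (Suc (2 * q))" by (intro power_increasing) auto
      then show ?thesis by simp
    qed
    have "(LINT \<omega>|M. \<bar>f N \<omega>\<bar> ^ q) \<le> (LINT \<omega>|M. 1 + \<bar>f N \<omega>\<bar> ^ Suc (Suc (2 * q)))"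
      by (intro integral_mono p i Bochner_Integration.integrable_add) auto
    also have "\<dots> = 1 + (LINT \<omega>|M. \<bar>f N \<omega>\<bar> ^ Suc (Suc (2 * q)))"
      by (subst Bochner_Integration.integral_add[OF _ i]) (auto simp: prob_space)
    also have "\<dots> \<le> sqrt (real N) + C * sqrt (real N)"
    proof -
      have "1 \<le> sqrt (real N)" using N by simp
      then show ?thesis using C[OF N] by linarith
    qed
    finally show ?thesis by (simp add: algebra_simps)
  qed
  then show "\<exists>C. \<forall>N\<ge>1. (LINT \<omega>|M. \<bar>f N \<omega>\<bar> ^ q) \<le> C * sqrt (real N)" by blast
qed

text \<open>The fourth moment of \<open>Z\<close> is at most of order \<open>sqrt N / N^2\<close>, a
  summable sequence; so the sum of the fourth powers has finite expectation and its terms tend to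
  zero almost surely.\<close>

lemma (in prob_space) moment_bounded_AE_zero:
  assumes "moment_bounded M (\<lambda>N \<omega>. sqrt (real N) * Z N \<omega>)"
  shows "AE \<omega> in M. (\<lambda>N. Z N \<omega>) \<longlonglongrightarrow> 0"
proof -
  \<comment> \<open>The shift avoids \<open>N = 0\<close>, which \<open>moment_bounded\<close> does
    not cover.\<close>
  let ?Z = "\<lambda>N \<omega>. Z (Suc N) \<omega> ^ 4"
  obtain C where C: "C \<ge> 0" "\<And>N. N \<ge> 1 \<Longrightarrow> (LINT \<omega>|M. \<bar>sqrt (real N) * Z N \<omega>\<bar> ^ 4) \<le> C * sqrt (real N)"
    by (rule moment_boundedD[OF assms]) blast
  have hm: "has_moments M (\<lambda>\<omega>. sqrt (real (Suc N)) * Z (Suc N) \<omega>)" for N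
    by (rule moment_bounded_has_moments[OF assms]) simp
  have hZ: "has_moments M (Z (Suc N))" for N
  proof -
    have "Z (Suc N) = (\<lambda>\<omega>. 1 / sqrt (real (Suc N)) * (sqrt (real (Suc N)) * Z (Suc N) \<omega>))" by auto
    then show ?thesis using has_moments_mult[OF has_moments_const hm, of "1 / sqrt (real (Suc N))" N] by simp
  qed
  have int: "integrable M (?Z N)" for N by (rule has_moments_integrable[OF has_moments_power[OF hZ]])
  have bound: "(LINT \<omega>|M. ?Z N \<omega>) \<le> C * (real (Suc N) powr - (3 / 2))" for N
  proof -
    have s: "sqrt (real (Suc N)) ^ 4 = (real (Suc N))\<^sup>2"
      by (metis (no_types, lifting) numeral_Bit0 power_even_abs power_mult_numeral real_sqrt_pow2 of_nat_0_le_iff mult_2 numeral_One power_add semiring_norm(2) power2_eq_square)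
    have "(LINT \<omega>|M. \<bar>sqrt (real (Suc N)) * Z (Suc N) \<omega>\<bar> ^ 4) = (LINT \<omega>|M. (real (Suc N))\<^sup>2 * ?Z N \<omega>)"
      unfolding s[symmetric] by (intro Bochner_Integration.integral_cong refl) (simp add: abs_mult power_mult_distrib)
    also have "\<dots> = (real (Suc N))\<^sup>2 * (LINT \<omega>|M. ?Z N \<omega>)" by simp
    finally have "(real (Suc N))\<^sup>2 * (LINT \<omega>|M. ?Z N \<omega>) \<le> C * sqrt (real (Suc N))" using C(2)[of "Suc N"] by simp
    then have "(LINT \<omega>|M. ?Z N \<omega>) \<le> C * sqrt (real (Suc N)) / (real (Suc N))\<^sup>2"
      by (subst pos_le_divide_eq) (auto simp: mult.commute)
    also have "sqrt (real (Suc N)) / (real (Suc N))\<^sup>2 = real (Suc N) powr - (3 / 2)"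
    proof -
      have "sqrt (real (Suc N)) / (real (Suc N))\<^sup>2 = real (Suc N) powr (1 / 2) / real (Suc N) powr 2"
        by (simp add: powr_half_sqrt powr_numeral)
      also have "\<dots> = real (Suc N) powr (1 / 2 - 2)" by (rule powr_diff[symmetric])
      finally show ?thesis by simp
    qed
    then have "C * sqrt (real (Suc N)) / (real (Suc N))\<^sup>2 = C * (real (Suc N) powr - (3 / 2))" by (metis times_divide_eq_right)
    finally show ?thesis .
  qed
  have "(\<integral>\<^sup>+\<omega>. suminf (\<lambda>N. ennreal (?Z N \<omega>)) \<partial>M) = suminf (\<lambda>N. \<integral>\<^sup>+\<omega>. ennreal (?Z N \<omega>) \<partial>M)"
    using has_moments_measurable[OF has_moments_power[OF hZ]] by (intro nn_integral_suminf) simp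
  also have "\<dots> \<le> suminf (\<lambda>N. ennreal (C * (real (Suc N) powr - (3 / 2))))"
  proof (intro suminf_le allI)
    fix N
    have "(\<integral>\<^sup>+\<omega>. ennreal (?Z N \<omega>) \<partial>M) = ennreal (LINT \<omega>|M. ?Z N \<omega>)"
      by (rule nn_integral_eq_integral[OF int]) auto
    then show "(\<integral>\<^sup>+\<omega>. ennreal (?Z N \<omega>) \<partial>M) \<le> ennreal (C * (real (Suc N) powr - (3 / 2)))" using bound[of N] by (simp add: ennreal_leI)
  qed auto
  also have "\<dots> = ennreal (suminf (\<lambda>N. C * (real (Suc N) powr - (3 / 2))))"
  proof -
    have "summable (\<lambda>N. real N powr - (3 / 2))" by (simp add: summable_real_powr_iff)
    then have "summable (\<lambda>N. real (Suc N) powr - (3 / 2))" by (subst summable_Suc_iff)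
    then have "summable (\<lambda>N. C * (real (Suc N) powr - (3 / 2)))" by (rule summable_mult)
    then show ?thesis using C(1) by (intro suminf_ennreal2) auto
  qed
  finally have "(\<integral>\<^sup>+\<omega>. suminf (\<lambda>N. ennreal (?Z N \<omega>)) \<partial>M) \<noteq> \<infinity>"
    using le_less_trans[OF _ ennreal_less_top] by fastforce
  then have "AE \<omega> in M. suminf (\<lambda>N. ennreal (?Z N \<omega>)) \<noteq> \<infinity>"
    using has_moments_measurable[OF has_moments_power[OF hZ]] by (intro nn_integral_PInf_AE) auto
  then show ?thesis
  proof eventually_elim
    case (elim \<omega>)
    then have "summable (\<lambda>N. ?Z N \<omega>)" by (intro summable_suminf_not_top) auto
    then have "(\<lambda>N. ?Z N \<omega>) \<longlonglongrightarrow> 0" by (rule summable_LIMSEQ_zero)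
    then have r4: "(\<lambda>N. root 4 (?Z N \<omega>)) \<longlonglongrightarrow> root 4 0" by (intro tendsto_intros)
    then have "(\<lambda>N. \<bar>Z (Suc N) \<omega>\<bar>) \<longlonglongrightarrow> 0"
    proof -
      have "root 4 (z ^ 4) = \<bar>z\<bar>" for z :: real using real_root_power_cancel[of 4 "\<bar>z\<bar>"] by simp
      then show ?thesis using r4 by simp
    qed
    then have "(\<lambda>N. Z (Suc N) \<omega>) \<longlonglongrightarrow> 0" by (simp add: tendsto_rabs_zero_iff)
    then show ?case by (rule LIMSEQ_imp_Suc)
  qed
qed

context contraction_coefficients
begin

lemma pair_cov_bound: assumes "subunit U" "subunit U'" shows "\<bar>pair_cov U U'\<bar> \<le> fact d"
proof -
  have "\<bar>pair_cov U U'\<bar> \<le> (\<Sum>l\<in>multi_index N (d - 2). \<bar>U l\<bar> * (\<Sum>l'\<in>rearrangements N l. \<bar>U' l'\<bar>))"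
    unfolding pair_cov_def
  proof (intro order_trans[OF sum_abs] sum_mono)
    fix l assume l: "l \<in> multi_index N (d - 2)"
    let ?c = "(\<Prod>x<N. fact (count_list l x)) / fact d :: real"
    have c0: "0 \<le> ?c" by (intro divide_nonneg_nonneg prod_nonneg) auto
    have "l \<in> rearrangements N l" using l by (simp add: rearrangements_def multi_index_def)
    then have "rearrangements N l \<noteq> {}" by blast
    then have pos: "1 \<le> real (card (rearrangements N l))" using card_gt_0_iff[of "rearrangements N l"] by simp
    have "(\<Prod>x<N. fact (count_list l x) :: real) \<le> real (card (rearrangements N l)) * (\<Prod>x<N. fact (count_list l x))"
      using mult_right_mono[OF pos, of "\<Prod>x<N. fact (count_list l x)"] by (simp add: prod_nonneg)
    also have "\<dots> = fact (d - 2)" by (rule card_rearrangements_eq[OF l])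
    also have "\<dots> \<le> fact d" by (rule fact_mono) simp
    finally have c1: "?c \<le> 1" by simp
    have "\<bar>U l * (?c * (\<Sum>l'\<in>rearrangements N l. U' l'))\<bar> = \<bar>U l\<bar> * (?c * \<bar>\<Sum>l'\<in>rearrangements N l. U' l'\<bar>)"
      by (simp only: abs_mult abs_of_nonneg[OF c0])
    also have "\<dots> \<le> \<bar>U l\<bar> * (1 * (\<Sum>l'\<in>rearrangements N l. \<bar>U' l'\<bar>))"
      using c0 c1 by (intro mult_left_mono mult_mono sum_abs) auto
    finally show "\<bar>U l * (?c * (\<Sum>l'\<in>rearrangements N l. U' l'))\<bar> \<le> \<bar>U l\<bar> * (\<Sum>l'\<in>rearrangements N l. \<bar>U' l'\<bar>)" by simp
  qed
  also have "\<dots> \<le> fact d" by (rule sum_rearrangements_abs[OF assms])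
  finally show ?thesis .
qed

end

text \<open>A constant covariance as majorant gives bounds uniform in the size. The majorant is
  nonnegative because it dominates an absolute value, as the products in the recursion
  require.\<close>

lemma semicircular_moment_bound:
  assumes "\<And>i j. \<bar>K i j\<bar> \<le> c"
  shows "\<bar>semicircular_moment K w\<bar> \<le> semicircular_moment (\<lambda>_ _. c) w"
proof (induction w rule: length_induct)
  case (1 w)
  have c0: "0 \<le> c" using assms abs_ge_zero order_trans by blast
  show ?case
  proof (cases w)
    case (Cons i v)
    have IH: "\<bar>semicircular_moment K u\<bar> \<le> semicircular_moment (\<lambda>_ _. c) u" if "length u < length w" for u
      using 1 that by blast
    have "\<bar>semicircular_moment K w\<bar> \<le> (\<Sum>p<length v. \<bar>K i (v ! p)\<bar> * \<bar>semicircular_moment K (take p v)\<bar> * \<bar>semicircular_moment K (drop (Suc p) v)\<bar>)"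
      using sum_abs[of "\<lambda>p. K i (v ! p) * semicircular_moment K (take p v) * semicircular_moment K (drop (Suc p) v)" "{..<length v}"]
      unfolding Cons by (simp add: abs_mult)
    also have "\<dots> \<le> (\<Sum>p<length v. c * semicircular_moment (\<lambda>_ _. c) (take p v) * semicircular_moment (\<lambda>_ _. c) (drop (Suc p) v))"
    proof (intro sum_mono mult_mono mult_nonneg_nonneg assms IH)
      fix p
      show "0 \<le> semicircular_moment (\<lambda>_ _. c) (take p v)" if "p \<in> {..<length v}"
        using IH[of "take p v"] Cons abs_ge_zero[of "semicircular_moment K (take p v)"] by fastforce
    qed (use c0 Cons in auto)
    finally show ?thesis by (simp add: Cons)
  qed simp
qed

context wigner_tensor
begin

text \<open>A difference of products of traces is linear in the fluctuations of the shorter words,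
  with a trace or a majorant as coefficient. Since \<open>moment_bounded\<close> concerns all orders
  and is stable under products, the induction hypothesis controls these terms in every order at
  once.\<close>

lemma word_trace_moment_bounded:
  fixes Us :: "nat \<Rightarrow> 'i \<Rightarrow> nat list \<Rightarrow> real" and J :: "'i set"
  assumes d: "d \<ge> 3" and J: "finite J" and U: "\<And>N i. N \<ge> 1 \<Longrightarrow> contraction_coefficients.subunit N d (Us N i)"
    and w: "set w \<subseteq> J"
  shows "moment_bounded M (\<lambda>N \<omega>. sqrt (real N) * (contraction_family.ntrace N d (Us N) (entries N \<omega>) w -
     semicircular_moment (\<lambda>i j. contraction_coefficients.pair_cov N d (Us N i) (Us N j)) w))"
proof -
  define tr where "tr N u \<omega> = contraction_family.ntrace N d (Us N) (entries N \<omega>) u" for N u \<omega>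
  define K where "K N i j = contraction_coefficients.pair_cov N d (Us N i) (Us N j)" for N i j
  define m where "m N u = semicircular_moment (K N) u" for N u
  define sz where "sz N \<omega> = contraction_family.size_bound N d (Us N) J (entries N \<omega>)" for N \<omega>
  have loc: "wigner_family M d X N (Us N) J" if "N \<ge> 1" for N
  proof -
    interpret contraction_coefficients N d using d that by unfold_locales auto
    show ?thesis using d that J U[OF that] by unfold_locales auto
  qed
  have Kb: "\<bar>K N i j\<bar> \<le> fact d" if "N \<ge> 1" for N i j
  proof -
    interpret wigner_family M d X N "Us N" J by (rule loc[OF that])
    show ?thesis unfolding K_def by (rule pair_cov_bound[OF subU subU])
  qed
  have mb: "\<bar>m N u\<bar> \<le> semicircular_moment (\<lambda>_ _. fact d) u" if "N \<ge> 1" for N u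
    unfolding m_def by (rule semicircular_moment_bound[OF Kb[OF that]])
  have size_mb: "moment_bounded M sz"
  proof (rule moment_bounded_bound)
    show "moment_bounded M (\<lambda>N \<omega>. 1 + fact d * Xmax N \<omega> + (\<Sum>j\<in>J. opnorm N (contraction_coefficients.ensm N d (Us N j) (entries N \<omega>))))"
      by (intro moment_bounded_add moment_bounded_mult moment_bounded_const Xmax_moment_bounded moment_bounded_sum moment_bounded_opnorm d U)
    fix N :: nat assume N: "N \<ge> 1"
    interpret wigner_family M d X N "Us N" J by (rule loc[OF N])
    show "sz N \<in> borel_measurable M" unfolding sz_def[abs_def] by (rule has_moments_measurable[OF has_moments_size])
    show "\<bar>sz N \<omega>\<bar> \<le> \<bar>1 + fact d * Xmax N \<omega> + (\<Sum>j\<in>J. opnorm N (ensm (Us N j) (entries N \<omega>)))\<bar>" for \<omega>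
      unfolding sz_def size_bound_def fam_def Xmax_def by simp
  qed
  have hmtr: "has_moments M (tr N u)" if "N \<ge> 1" for N u
  proof -
    interpret wigner_family M d X N "Us N" J by (rule loc[OF that])
    show ?thesis unfolding tr_def[abs_def] by (rule has_moments_ntrace)
  qed
  have trb: "\<bar>tr N u \<omega>\<bar> \<le> sz N \<omega> ^ length u" if "N \<ge> 1" "set u \<subseteq> J" for N u \<omega>
  proof -
    interpret wigner_family M d X N "Us N" J by (rule loc[OF that(1)])
    show ?thesis unfolding tr_def sz_def by (rule ntrace_bound[OF that(2)])
  qed
  have sz1: "1 \<le> sz N \<omega>" if "N \<ge> 1" for N \<omega>
  proof -
    interpret wigner_family M d X N "Us N" J by (rule loc[OF that(1)])
    show ?thesis unfolding sz_def by (rule size_ge1)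
  qed
  have tr_mb: "moment_bounded M (\<lambda>N. tr N u)" if "set u \<subseteq> J" for u
    by (rule moment_bounded_bound[OF moment_bounded_power[OF size_mb, of "length u"]])
      (use hmtr trb[OF _ that] in \<open>auto intro: has_moments_measurable order_trans[OF _ abs_ge_self]\<close>)
  obtain C2 where C2: "\<forall>N. \<forall>ks\<in>multi_index N d. sorted ks \<longrightarrow>
       integrable M (\<lambda>\<omega>. \<bar>X N ks \<omega>\<bar> ^ 2) \<and> expectation (\<lambda>\<omega>. \<bar>X N ks \<omega>\<bar> ^ 2) \<le> C2"
    using moments by blast
  define V where "V = max 1 C2"
  have V: "1 \<le> V" "\<And>N k. k \<in> entry_index N d \<Longrightarrow> expectation (\<lambda>\<omega>. (X N k \<omega>)\<^sup>2) \<le> V"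
    using C2 by (force simp: V_def entry_index_def)+
  have "set u \<subseteq> J \<Longrightarrow> moment_bounded M (\<lambda>N \<omega>. sqrt (real N) * (tr N u \<omega> - m N u))" for u
  proof (induction u rule: length_induct)
    case (1 u)
    show ?case
    proof (cases u)
      case Nil
      show ?thesis
      proof (rule moment_bounded_bound[OF moment_bounded_const[of 0]])
        fix N :: nat and \<omega> assume N: "N \<ge> 1"
        interpret wigner_family M d X N "Us N" J by (rule loc[OF N])
        have "tr N u \<omega> = 1" for \<omega> using N by (simp add: tr_def Nil ntrace_def word_mat_def mtr_mid)
        then have z: "sqrt (real N) * (tr N u \<omega> - m N u) = 0" for \<omega> by (simp add: m_def Nil)
        show "(\<lambda>\<omega>. sqrt (real N) * (tr N u \<omega> - m N u)) \<in> borel_measurable M" unfolding z by simp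
        show "\<bar>sqrt (real N) * (tr N u \<omega> - m N u)\<bar> \<le> \<bar>0\<bar>" unfolding z by simp
      qed
    next
      case (Cons i v)
      define n where "n = length v"
      define Y where "Y N \<omega> = tr N u \<omega> - m N u" for N \<omega>
      have iv: "set (i # v) \<subseteq> J" using 1(2) Cons by simp
      have sub: "set (take p v) \<subseteq> J" "set (drop (Suc p) v) \<subseteq> J" for p
        using iv set_take_subset[of p v] set_drop_subset[of "Suc p" v] by auto
      have IH: "moment_bounded M (\<lambda>N \<omega>. sqrt (real N) * (tr N x \<omega> - m N x))" if "length x < length u" "set x \<subseteq> J" for x
        using 1(1) that by blast
      have hY: "has_moments M (Y N)" if "N \<ge> 1" for N
        unfolding Y_def[abs_def] by (intro has_moments_diff hmtr that has_moments_const)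
      show ?thesis unfolding Y_def[symmetric]
      proof (rule moment_bounded_even)
        show "has_moments M (\<lambda>\<omega>. sqrt (real N) * Y N \<omega>)" if "N \<ge> 1" for N
          by (intro has_moments_mult has_moments_const hY that)
        fix r :: nat assume r: "even r"
        define b0 where "b0 = real (card J) * fact d"
        define Cm where "Cm = 1 + (real (card J))\<^sup>2 * fact d * ((real n)\<^sup>2 * b0 * (1 + 2 * V)) + real n * (6 * real d * fact d * V) +
          (real (card J))\<^sup>2 * fact d * ((1 + real n * (1 + V) * b0) * real (Suc r) * real (n + 1)) + real (n + 1) * b0"
        define G where "G N \<omega> = Cm * sz N \<omega> ^ (2 * n + 3) / sqrt (real N)" for N \<omega>
        \<comment> \<open>\<open>sqrt N\<close> times the full error of the recursion: the
          fluctuations of the two factors in each product, and the term \<open>G\<close>. Its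
          moments are bounded by the induction hypothesis, and \<open>g\<close> restores the
          scale.\<close>
        define h where "h N \<omega> = (\<Sum>p<n. fact d * (\<bar>sqrt (real N) * (tr N (take p v) \<omega> - m N (take p v))\<bar> * \<bar>tr N (drop (Suc p) v) \<omega>\<bar> +
           semicircular_moment (\<lambda>_ _. fact d) (take p v) * \<bar>sqrt (real N) * (tr N (drop (Suc p) v) \<omega> - m N (drop (Suc p) v))\<bar>)) +
           Cm * sz N \<omega> ^ (2 * n + 3)" for N \<omega>
        define g where "g N \<omega> = h N \<omega> / sqrt (real N)" for N \<omega>
        have Cm0: "0 \<le> Cm" unfolding Cm_def b0_def using V(1)
          by (intro add_nonneg_nonneg mult_nonneg_nonneg zero_le_power) auto
        have maj0: "0 \<le> semicircular_moment (\<lambda>_ _. fact d) x" for x :: "'i list"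
          using mb[of 1 x] abs_ge_zero[of "m 1 x"] by simp
        have h_mb: "moment_bounded M h" unfolding h_def[abs_def]
        proof (intro moment_bounded_add moment_bounded_sum moment_bounded_mult moment_bounded_const moment_bounded_abs[OF IH] moment_bounded_abs[OF tr_mb] sub moment_bounded_power size_mb)
        qed (use Cons in \<open>auto simp: n_def\<close>)
        \<comment> \<open>The factor \<open>2\<close> comes from moving half of the left side over
          after \<open>young_power\<close>.\<close>
        have key: "(LINT \<omega>|M. \<bar>Y N \<omega>\<bar> ^ Suc (Suc r)) \<le> 2 * (((2::real) ^ (r + 2)) ^ Suc r + (2 ^ (r + 2) + 1) ^ r) * (LINT \<omega>|M. g N \<omega> ^ Suc (Suc r))"
          if N: "N \<ge> 1" for N
        proof -
          interpret wigner_family M d X N "Us N" J by (rule loc[OF N])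
          have sN: "0 < sqrt (real N)" using N by simp
          have Yeq: "Y N \<omega> = ntrace (entries N \<omega>) (i # v) - m N u" for \<omega> by (simp add: Y_def tr_def Cons)
          have Geq: "G N \<omega> = Cm * size_bound (entries N \<omega>) ^ (2 * n + 3) / sqrt (real N)" for \<omega> by (simp add: G_def sz_def)
          let ?P = "\<lambda>\<omega>. \<Sum>p<n. K N i (v ! p) * tr N (take p v) \<omega> * tr N (drop (Suc p) v) \<omega>"
          have SD: "\<bar>expectation (\<lambda>\<omega>. tr N u \<omega> * Y N \<omega> ^ Suc r) - expectation (\<lambda>\<omega>. ?P \<omega> * Y N \<omega> ^ Suc r)\<bar>
            \<le> expectation (\<lambda>\<omega>. G N \<omega> * \<bar>Y N \<omega>\<bar> ^ Suc r + (G N \<omega>)\<^sup>2 * (\<bar>Y N \<omega>\<bar> + G N \<omega>) ^ r)"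
            using schwinger_dyson[OF iv V(1) V(2), of "m N u" r]
            unfolding Yeq Geq Cm_def b0_def n_def tr_def K_def Cons .
          have G0: "0 \<le> G N \<omega>" for \<omega> unfolding G_def using Cm0 sz1[OF N, of \<omega>] by (intro divide_nonneg_nonneg mult_nonneg_nonneg zero_le_power) auto
          have hG: "has_moments M (G N)" unfolding Geq[abs_def] divide_inverse
            by (intro has_moments_mult has_moments_power has_moments_size has_moments_const)
          have hP: "has_moments M ?P" by (intro has_moments_sum has_moments_mult hmtr N has_moments_const)
          have hg: "has_moments M (g N)" unfolding g_def[abs_def] divide_inverse
            by (intro has_moments_mult moment_bounded_has_moments[OF h_mb N] has_moments_const)
          note hYN = hY[OF N]
          have meq: "m N u = (\<Sum>p<n. K N i (v ! p) * m N (take p v) * m N (drop (Suc p) v))"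
            by (simp add: m_def Cons n_def)
          have Pm: "\<bar>?P \<omega> - m N u\<bar> + G N \<omega> \<le> g N \<omega>" for \<omega>
          proof -
            have "\<bar>?P \<omega> - m N u\<bar> \<le> (\<Sum>p<n. fact d * (\<bar>tr N (take p v) \<omega> - m N (take p v)\<bar> * \<bar>tr N (drop (Suc p) v) \<omega>\<bar> +
              semicircular_moment (\<lambda>_ _. fact d) (take p v) * \<bar>tr N (drop (Suc p) v) \<omega> - m N (drop (Suc p) v)\<bar>))"
              unfolding meq sum_subtractf[symmetric]
            proof (intro order_trans[OF sum_abs] sum_mono)
              fix p
              let ?t1 = "tr N (take p v) \<omega>" and ?t2 = "tr N (drop (Suc p) v) \<omega>" and ?m1 = "m N (take p v)" and ?m2 = "m N (drop (Suc p) v)"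
              have "K N i (v ! p) * ?t1 * ?t2 - K N i (v ! p) * ?m1 * ?m2 = K N i (v ! p) * ((?t1 - ?m1) * ?t2 + ?m1 * (?t2 - ?m2))"
                by (simp add: algebra_simps)
              also have "\<bar>\<dots>\<bar> \<le> fact d * (\<bar>?t1 - ?m1\<bar> * \<bar>?t2\<bar> + semicircular_moment (\<lambda>_ _. fact d) (take p v) * \<bar>?t2 - ?m2\<bar>)"
                unfolding abs_mult[of "K N i (v ! p)"]
              proof (rule mult_mono[OF Kb[OF N]])
                have "\<bar>(?t1 - ?m1) * ?t2 + ?m1 * (?t2 - ?m2)\<bar> \<le> \<bar>?t1 - ?m1\<bar> * \<bar>?t2\<bar> + \<bar>?m1\<bar> * \<bar>?t2 - ?m2\<bar>"
                  by (metis abs_mult abs_triangle_ineq)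
                also have "\<bar>?m1\<bar> * \<bar>?t2 - ?m2\<bar> \<le> semicircular_moment (\<lambda>_ _. fact d) (take p v) * \<bar>?t2 - ?m2\<bar>"
                  by (intro mult_right_mono mb N) auto
                finally show "\<bar>(?t1 - ?m1) * ?t2 + ?m1 * (?t2 - ?m2)\<bar> \<le> \<bar>?t1 - ?m1\<bar> * \<bar>?t2\<bar> + semicircular_moment (\<lambda>_ _. fact d) (take p v) * \<bar>?t2 - ?m2\<bar>" by simp
              qed auto
              finally show "\<bar>K N i (v ! p) * ?t1 * ?t2 - K N i (v ! p) * ?m1 * ?m2\<bar> \<le> fact d * (\<bar>?t1 - ?m1\<bar> * \<bar>?t2\<bar> + semicircular_moment (\<lambda>_ _. fact d) (take p v) * \<bar>?t2 - ?m2\<bar>)" .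
            qed
            also have "\<dots> + G N \<omega> = g N \<omega>"
            proof -
              have a: "\<bar>sqrt (real N) * z\<bar> = sqrt (real N) * \<bar>z\<bar>" for z by (simp add: abs_mult)
              have b: "f * (x * y + c * z) = f * (sqrt (real N) * x * y + c * (sqrt (real N) * z)) / sqrt (real N)" for f x y c z
                using sN by (simp add: field_simps)
              show ?thesis
                unfolding g_def h_def G_def add_divide_distrib sum_divide_distrib a
                by (intro arg_cong2[where f = plus] sum.cong refl b)
            qed
            finally show ?thesis by simp
          qed
          have g0: "0 \<le> g N \<omega>" for \<omega> using Pm[of \<omega>] G0[of \<omega>] by linarith
          have Gg: "G N \<omega> \<le> g N \<omega>" for \<omega> using Pm[of \<omega>] by linarith
          have i1: "integrable M (\<lambda>\<omega>. tr N u \<omega> * Y N \<omega> ^ Suc r)" "integrable M (\<lambda>\<omega>. ?P \<omega> * Y N \<omega> ^ Suc r)" "integrable M (\<lambda>\<omega>. m N u * Y N \<omega> ^ Suc r)"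
            "integrable M (\<lambda>\<omega>. G N \<omega> * \<bar>Y N \<omega>\<bar> ^ Suc r + (G N \<omega>)\<^sup>2 * (\<bar>Y N \<omega>\<bar> + G N \<omega>) ^ r)"
            by (intro has_moments_integrable has_moments_mult has_moments_add has_moments_power has_moments_abs hmtr N hP hYN hG has_moments_const)+
          have absY: "\<bar>Y N \<omega>\<bar> ^ Suc (Suc r) = tr N u \<omega> * Y N \<omega> ^ Suc r - m N u * Y N \<omega> ^ Suc r" for \<omega>
          proof -
            have "\<bar>Y N \<omega>\<bar> ^ Suc (Suc r) = Y N \<omega> ^ Suc (Suc r)" using r by (simp add: power_even_abs)
            also have "\<dots> = Y N \<omega> * Y N \<omega> ^ Suc r" by simp
            finally show ?thesis by (simp only: Y_def left_diff_distrib)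
          qed
          have "(LINT \<omega>|M. \<bar>Y N \<omega>\<bar> ^ Suc (Suc r)) = expectation (\<lambda>\<omega>. tr N u \<omega> * Y N \<omega> ^ Suc r) - expectation (\<lambda>\<omega>. m N u * Y N \<omega> ^ Suc r)"
            unfolding absY by (rule Bochner_Integration.integral_diff[OF i1(1,3)])
          also have "\<dots> \<le> expectation (\<lambda>\<omega>. ?P \<omega> * Y N \<omega> ^ Suc r) + expectation (\<lambda>\<omega>. G N \<omega> * \<bar>Y N \<omega>\<bar> ^ Suc r + (G N \<omega>)\<^sup>2 * (\<bar>Y N \<omega>\<bar> + G N \<omega>) ^ r) - expectation (\<lambda>\<omega>. m N u * Y N \<omega> ^ Suc r)"
            using SD by linarith
          also have "\<dots> = expectation (\<lambda>\<omega>. ?P \<omega> * Y N \<omega> ^ Suc r + (G N \<omega> * \<bar>Y N \<omega>\<bar> ^ Suc r + (G N \<omega>)\<^sup>2 * (\<bar>Y N \<omega>\<bar> + G N \<omega>) ^ r) - m N u * Y N \<omega> ^ Suc r)"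
            by (subst Bochner_Integration.integral_diff, intro Bochner_Integration.integrable_add i1, rule i1, subst Bochner_Integration.integral_add[OF i1(2,4)]) rule
          also have "\<dots> \<le> expectation (\<lambda>\<omega>. \<bar>Y N \<omega>\<bar> ^ Suc (Suc r) / 2 + (((2::real) ^ (r + 2)) ^ Suc r + (2 ^ (r + 2) + 1) ^ r) * g N \<omega> ^ Suc (Suc r))"
          proof (rule integral_mono)
            show "integrable M (\<lambda>\<omega>. ?P \<omega> * Y N \<omega> ^ Suc r + (G N \<omega> * \<bar>Y N \<omega>\<bar> ^ Suc r + (G N \<omega>)\<^sup>2 * (\<bar>Y N \<omega>\<bar> + G N \<omega>) ^ r) - m N u * Y N \<omega> ^ Suc r)"
              by (intro Bochner_Integration.integrable_diff Bochner_Integration.integrable_add i1)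
            show "integrable M (\<lambda>\<omega>. \<bar>Y N \<omega>\<bar> ^ Suc (Suc r) / 2 + (((2::real) ^ (r + 2)) ^ Suc r + (2 ^ (r + 2) + 1) ^ r) * g N \<omega> ^ Suc (Suc r))"
              unfolding divide_inverse
              by (intro has_moments_integrable has_moments_add has_moments_mult has_moments_power has_moments_abs hYN hg has_moments_const)
            fix \<omega>
            let ?y = "\<bar>Y N \<omega>\<bar>"
            have "?P \<omega> * Y N \<omega> ^ Suc r - m N u * Y N \<omega> ^ Suc r \<le> \<bar>?P \<omega> - m N u\<bar> * ?y ^ Suc r"
              unfolding left_diff_distrib[symmetric] power_abs[symmetric] abs_mult[symmetric] by (rule abs_ge_self)
            moreover have "\<bar>?P \<omega> - m N u\<bar> * ?y ^ Suc r + G N \<omega> * ?y ^ Suc r \<le> g N \<omega> * ?y ^ Suc r"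
              unfolding distrib_right[symmetric] by (intro mult_right_mono Pm) auto
            moreover have "(G N \<omega>)\<^sup>2 * (?y + G N \<omega>) ^ r \<le> (g N \<omega>)\<^sup>2 * (?y + g N \<omega>) ^ r"
              using Gg[of \<omega>] G0[of \<omega>] by (intro mult_mono power_mono) auto
            moreover have "g N \<omega> * ?y ^ Suc r + (g N \<omega>)\<^sup>2 * (?y + g N \<omega>) ^ r \<le> ?y ^ Suc (Suc r) / 2 + (((2::real) ^ (r + 2)) ^ Suc r + (2 ^ (r + 2) + 1) ^ r) * g N \<omega> ^ Suc (Suc r)"
              by (rule young_power[OF abs_ge_zero g0])
            ultimately show "?P \<omega> * Y N \<omega> ^ Suc r + (G N \<omega> * ?y ^ Suc r + (G N \<omega>)\<^sup>2 * (?y + G N \<omega>) ^ r) - m N u * Y N \<omega> ^ Suc r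
               \<le> ?y ^ Suc (Suc r) / 2 + (((2::real) ^ (r + 2)) ^ Suc r + (2 ^ (r + 2) + 1) ^ r) * g N \<omega> ^ Suc (Suc r)" by linarith
          qed
          also have "\<dots> = (LINT \<omega>|M. \<bar>Y N \<omega>\<bar> ^ Suc (Suc r)) / 2 + (((2::real) ^ (r + 2)) ^ Suc r + (2 ^ (r + 2) + 1) ^ r) * (LINT \<omega>|M. g N \<omega> ^ Suc (Suc r))"
          proof -
            have "integrable M (\<lambda>\<omega>. \<bar>Y N \<omega>\<bar> ^ Suc (Suc r) / 2)" "integrable M (\<lambda>\<omega>. (((2::real) ^ (r + 2)) ^ Suc r + (2 ^ (r + 2) + 1) ^ r) * g N \<omega> ^ Suc (Suc r))"
              unfolding divide_inverse by (intro has_moments_integrable has_moments_mult has_moments_power has_moments_abs hYN hg has_moments_const)+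
            from Bochner_Integration.integral_add[OF this] show ?thesis
              unfolding integral_mult_right_zero integral_divide_zero .
          qed
          finally show ?thesis by linarith
        qed
        obtain C where C: "\<And>N. N \<ge> 1 \<Longrightarrow> (LINT \<omega>|M. \<bar>h N \<omega>\<bar> ^ Suc (Suc r)) \<le> C * sqrt (real N)"
          using h_mb unfolding moment_bounded_def by blast
        define Q where "Q = 2 * (((2::real) ^ (r + 2)) ^ Suc r + (2 ^ (r + 2) + 1) ^ r)"
        have Q0: "0 \<le> Q" unfolding Q_def by (intro mult_nonneg_nonneg add_nonneg_nonneg zero_le_power) auto
        have "(LINT \<omega>|M. \<bar>sqrt (real N) * Y N \<omega>\<bar> ^ Suc (Suc r)) \<le> (Q * C) * sqrt (real N)" if N: "N \<ge> 1" for N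
        proof -
          have sN: "0 < sqrt (real N)" using N by simp
          have "(LINT \<omega>|M. \<bar>sqrt (real N) * Y N \<omega>\<bar> ^ Suc (Suc r)) = sqrt (real N) ^ Suc (Suc r) * (LINT \<omega>|M. \<bar>Y N \<omega>\<bar> ^ Suc (Suc r))"
            unfolding integral_mult_right_zero[symmetric] abs_mult power_mult_distrib by simp
          also have "\<dots> \<le> sqrt (real N) ^ Suc (Suc r) * (Q * (LINT \<omega>|M. g N \<omega> ^ Suc (Suc r)))"
            unfolding Q_def by (intro mult_left_mono key N zero_le_power) simp
          also have "\<dots> = Q * (LINT \<omega>|M. \<bar>h N \<omega>\<bar> ^ Suc (Suc r))"
          proof -
            have "\<bar>h N \<omega>\<bar> ^ Suc (Suc r) = sqrt (real N) ^ Suc (Suc r) * g N \<omega> ^ Suc (Suc r)" for \<omega>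
            proof -
              have "\<bar>h N \<omega>\<bar> ^ Suc (Suc r) = h N \<omega> ^ Suc (Suc r)" using r by (intro power_even_abs) simp
              moreover have heq: "h N \<omega> = sqrt (real N) * g N \<omega>" using sN by (simp add: g_def)
              ultimately show ?thesis by (simp only: heq power_mult_distrib)
            qed
            then show ?thesis by (simp only: integral_mult_right_zero mult.left_commute)
          qed
          also have "\<dots> \<le> Q * (C * sqrt (real N))" by (intro mult_left_mono C N Q0)
          finally show ?thesis by (simp only: mult.assoc)
        qed
        then show "\<exists>C. \<forall>N\<ge>1. (LINT \<omega>|M. \<bar>sqrt (real N) * Y N \<omega>\<bar> ^ Suc (Suc r)) \<le> C * sqrt (real N)" by blast
      qed
    qed
  qed
  from this[OF w] show ?thesis unfolding tr_def m_def K_def .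
qed

end

section \<open>The semicircle law and the method of moments\<close>

text \<open>
  By symmetry, weighting the summands of a convolution of length \<open>m\<close> by \<open>i\<close> multiplies it by
  \<open>m / 2\<close>; so the first-order recursion of \<open>c\<close> passes to the convolution.
\<close>

lemma catalan_convolution:
  fixes c :: "nat \<Rightarrow> real"
  assumes c0: "c 0 = 1"
    and rec: "\<And>k. (real k + 2) * c (Suc k) = (4 * real k + 2) * c k"
  shows "(\<Sum>i\<le>n. c i * c (n - i)) = c (Suc n)"
proof (induction n)
  case 0
  show ?case using c0 rec[of 0] by simp
next
  case (Suc n)
  define S where "S m = (\<Sum>i\<le>m. c i * c (m - i))" for m
  have T: "(\<Sum>i\<le>m. real i * (c i * c (m - i))) = real m / 2 * S m" for m
  proof -
    have "(\<Sum>i\<le>m. real i * (c i * c (m - i))) = (\<Sum>i\<le>m. real (m - i) * (c i * c (m - i)))"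
      by (rule sum.reindex_bij_witness[of _ "\<lambda>i. m - i" "\<lambda>i. m - i"]) (auto simp: mult.commute)
    then have "2 * (\<Sum>i\<le>m. real i * (c i * c (m - i))) =
        (\<Sum>i\<le>m. real i * (c i * c (m - i))) + (\<Sum>i\<le>m. real (m - i) * (c i * c (m - i)))" by simp
    also have "\<dots> = (\<Sum>i\<le>m. real m * (c i * c (m - i)))"
      unfolding sum.distrib[symmetric] by (intro sum.cong) (auto simp: of_nat_diff algebra_simps)
    also have "\<dots> = real m * S m" by (simp add: S_def sum_distrib_left)
    finally show ?thesis by simp
  qed
  have "(\<Sum>i\<le>n. (real i + 2) * c (Suc i) * c (n - i)) = (\<Sum>i\<le>n. (4 * real i + 2) * (c i * c (n - i)))"
    by (intro sum.cong) (auto simp: rec)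
  also have "\<dots> = 4 * (\<Sum>i\<le>n. real i * (c i * c (n - i))) + 2 * S n"
    by (simp add: S_def sum_distrib_left sum.distrib distrib_right mult.assoc)
  finally have r: "(\<Sum>i\<le>n. (real i + 2) * c (Suc i) * c (n - i)) = (2 * real n + 2) * S n"
    unfolding T by (simp add: algebra_simps)
  have "(\<Sum>i\<le>Suc n. (real i + 1) * (c i * c (Suc n - i))) = c (Suc n) + (\<Sum>i\<le>n. (real i + 2) * c (Suc i) * c (n - i))"
    by (subst sum.atMost_Suc_shift) (simp add: c0 algebra_simps)
  moreover have "(\<Sum>i\<le>Suc n. (real i + 1) * (c i * c (Suc n - i))) = (real (Suc n) / 2 + 1) * S (Suc n)"
    by (simp add: distrib_right sum.distrib T S_def del: sum.atMost_Suc)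
  ultimately have "(real n + 3) / 2 * S (Suc n) = c (Suc n) + (2 * real n + 2) * S n" using r by (simp add: field_simps)
  also have "S n = c (Suc n)" using Suc by (simp add: S_def)
  finally have "(real n + 3) / 2 * S (Suc n) = (2 * real n + 3) * c (Suc n)" by (simp add: algebra_simps)
  also have "\<dots> = (real n + 3) / 2 * c (Suc (Suc n))" using rec[of "Suc n"] by (simp add: algebra_simps)
  finally show ?case by (simp add: S_def)
qed

section \<open>Moments of the semicircle density\<close>

context
  fixes v :: real
  assumes v: "0 < v"
begin

definition sroot :: "real \<Rightarrow> real" where "sroot x = sqrt (max 0 (4 * v - x\<^sup>2))"

lemma sroot_continuous [continuous_intros]: "continuous_on A sroot"
  unfolding sroot_def by (intro continuous_intros)

lemma sroot_measurable [measurable]: "sroot \<in> borel_measurable borel"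
  by (intro borel_measurable_continuous_onI sroot_continuous)

lemma sroot_outside: "x \<notin> {-(2 * sqrt v)..2 * sqrt v} \<Longrightarrow> sroot x = 0"
proof -
  assume "x \<notin> {-(2 * sqrt v)..2 * sqrt v}"
  then have "2 * sqrt v \<le> \<bar>x\<bar>" by auto
  then have "(2 * sqrt v)\<^sup>2 \<le> \<bar>x\<bar>\<^sup>2" using v by (intro power_mono) auto
  then show ?thesis using v by (simp add: sroot_def power_mult_distrib)
qed

lemma sroot_DERIV:
  assumes "x \<in> {-(2 * sqrt v)<..<2 * sqrt v}"
  shows "(sroot has_real_derivative - x / sroot x) (at x)" "sroot x > 0" "(sroot x)\<^sup>2 = 4 * v - x\<^sup>2"
proof -
  have pos: "4 * v - y\<^sup>2 > 0" if "y \<in> {-(2 * sqrt v)<..<2 * sqrt v}" for y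
  proof -
    have "\<bar>y\<bar>\<^sup>2 < (2 * sqrt v)\<^sup>2" using that by (intro power_strict_mono) auto
    then show ?thesis using v by (simp add: power_mult_distrib)
  qed
  note p = pos[OF assms]
  have "((\<lambda>x. sqrt (4 * v - x\<^sup>2)) has_real_derivative - x / sroot x) (at x)"
    using p by (auto intro!: derivative_eq_intros simp: sroot_def max_def field_simps)
  then show "(sroot has_real_derivative - x / sroot x) (at x)"
    by (rule has_field_derivative_transform_within_open[OF _ _ assms]) (use pos in \<open>auto simp: sroot_def max_def less_imp_le dest!: pos\<close>)
  show "sroot x > 0" "(sroot x)\<^sup>2 = 4 * v - x\<^sup>2" using p by (auto simp: sroot_def)
qed

text \<open>Moments without normalization; division by \<open>smom 0\<close>, that is
  \<open>2 * pi * v\<close>, gives those of the probability density.\<close>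

definition smom :: "nat \<Rightarrow> real" where "smom n = integral {-(2 * sqrt v)..2 * sqrt v} (\<lambda>x. x ^ n * sroot x)"

lemma smom_has_integral: "((\<lambda>x. x ^ n * sroot x) has_integral smom n) {-(2 * sqrt v)..2 * sqrt v}"
  unfolding smom_def by (intro integrable_integral integrable_continuous_interval continuous_intros)

lemma sroot_end [simp]: "sroot (2 * sqrt v) = 0" "sroot (- (2 * sqrt v)) = 0"
  using v by (auto simp: sroot_def power_mult_distrib)

text \<open>The antiderivative is
  \<open>x * sroot x / 2 + 2 * v * arcsin (x / (2 * sqrt v))\<close>. Its two summands have infinite
  slope at the end points, so derivatives are taken in the interior only.\<close>

lemma smom_0: "smom 0 = 2 * pi * v"
proof -
  let ?r = "2 * sqrt v"
  have r: "?r > 0" using v by simp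
  have "((\<lambda>x. sroot x) has_integral ((\<lambda>x. x * sroot x / 2 + 2 * v * arcsin (x / ?r)) ?r - (\<lambda>x. x * sroot x / 2 + 2 * v * arcsin (x / ?r)) (- ?r))) {- ?r..?r}"
  proof (intro fundamental_theorem_of_calculus_interior)
    show "continuous_on {- ?r..?r} (\<lambda>x. x * sroot x / 2 + 2 * v * arcsin (x / ?r))"
      using r by (intro continuous_intros) (auto simp: field_simps)
    fix x assume x: "x \<in> {- ?r<..<?r}"
    note d = sroot_DERIV[OF x]
    have a: "((\<lambda>x. arcsin (x / ?r)) has_real_derivative inverse (sqrt (1 - (x / ?r)\<^sup>2)) * (1 / ?r)) (at x)"
      using x r by (intro DERIV_chain2[OF DERIV_arcsin] derivative_eq_intros) (auto simp: field_simps)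
    have "1 - (x / ?r)\<^sup>2 = (sroot x / ?r)\<^sup>2" unfolding power_divide d(3) using v by (simp add: power_mult_distrib field_simps)
    then have "sqrt (1 - (x / ?r)\<^sup>2) = sroot x / ?r" using d(2) r by simp
    then have a': "((\<lambda>x. arcsin (x / ?r)) has_real_derivative 1 / sroot x) (at x)" using a v by simp
    have "((\<lambda>x. x * sroot x / 2 + 2 * v * arcsin (x / ?r)) has_real_derivative
        (1 * sroot x + (- x / sroot x) * x) / 2 + 2 * v * (1 / sroot x)) (at x)"
      by (intro DERIV_add DERIV_cdivide DERIV_cmult DERIV_mult DERIV_ident d(1) a')
    moreover have "(1 * sroot x + (- x / sroot x) * x) / 2 + 2 * v * (1 / sroot x) = sroot x"
      using d(2,3) by (simp add: field_simps power2_eq_square)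
    ultimately show "((\<lambda>x. x * sroot x / 2 + 2 * v * arcsin (x / ?r)) has_vector_derivative sroot x) (at x)"
      unfolding has_real_derivative_iff_has_vector_derivative[symmetric] by simp
  qed (use r in auto)
  then have "((\<lambda>x. x ^ 0 * sroot x) has_integral 2 * (pi * v)) {- ?r..?r}" using v by (simp add: arcsin_minus)
  then show ?thesis using smom_has_integral[of 0] has_integral_unique by (simp only: mult.assoc) blast
qed

text \<open>The derivative of \<open>x ^ k * ((4 * v - x^2) * sroot x)\<close> integrates to zero,
  as this function vanishes at both end points. The choice \<open>k = n + 1\<close> gives the
  recursion, \<open>k = 0\<close> the first moment.\<close>

lemma smom_step: "(real n + 4) * smom (n + 2) = (real n + 1) * (4 * v) * smom n"
  and smom_1: "smom 1 = 0"
proof -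
  let ?r = "2 * sqrt v"
  have r: "?r > 0" using v by simp
  have key: "((\<lambda>x. real k * x ^ (k - 1) * ((4 * v - x\<^sup>2) * sroot x) - 3 * (x ^ Suc k * sroot x)) has_integral 0) {- ?r..?r}" for k
  proof -
    let ?F = "\<lambda>x. x ^ k * ((4 * v - x\<^sup>2) * sroot x)"
    have "((\<lambda>x. real k * x ^ (k - 1) * ((4 * v - x\<^sup>2) * sroot x) - 3 * (x ^ Suc k * sroot x)) has_integral ?F ?r - ?F (- ?r)) {- ?r..?r}"
    proof (intro fundamental_theorem_of_calculus_interior continuous_intros)
      fix x assume x: "x \<in> {- ?r<..<?r}"
      note d = sroot_DERIV[OF x]
      have "(?F has_real_derivative (real k * x ^ (k - 1)) * ((4 * v - x\<^sup>2) * sroot x) + (- (2 * x) * sroot x + (- x / sroot x) * (4 * v - x\<^sup>2)) * x ^ k) (at x)"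
        by (intro DERIV_mult d(1)) (auto intro!: derivative_eq_intros)
      moreover have m: "(- x / sroot x) * (4 * v - x\<^sup>2) = - x * sroot x" using d(2) unfolding d(3)[symmetric] by (simp add: power2_eq_square)
      moreover from m have "(real k * x ^ (k - 1)) * ((4 * v - x\<^sup>2) * sroot x) + (- (2 * x) * sroot x + (- x / sroot x) * (4 * v - x\<^sup>2)) * x ^ k =
          real k * x ^ (k - 1) * ((4 * v - x\<^sup>2) * sroot x) - 3 * (x ^ Suc k * sroot x)"
        by (simp only:) (simp add: algebra_simps)
      ultimately show "(?F has_vector_derivative real k * x ^ (k - 1) * ((4 * v - x\<^sup>2) * sroot x) - 3 * (x ^ Suc k * sroot x)) (at x)"
        unfolding has_real_derivative_iff_has_vector_derivative[symmetric] by (simp only:)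
    qed (use r in auto)
    then show ?thesis by simp
  qed
  have "((\<lambda>x. (real n + 1) * (4 * v) * (x ^ n * sroot x) - (real n + 4) * (x ^ (n + 2) * sroot x)) has_integral
      (real n + 1) * (4 * v) * smom n - (real n + 4) * smom (n + 2)) {- ?r..?r}"
    by (intro has_integral_diff has_integral_mult_right smom_has_integral)
  moreover have "(\<lambda>x. (real n + 1) * (4 * v) * (x ^ n * sroot x) - (real n + 4) * (x ^ (n + 2) * sroot x)) =
      (\<lambda>x. real (Suc n) * x ^ (Suc n - 1) * ((4 * v - x\<^sup>2) * sroot x) - 3 * (x ^ Suc (Suc n) * sroot x))"
    by (intro ext) (simp add: algebra_simps power2_eq_square)
  ultimately show "(real n + 4) * smom (n + 2) = (real n + 1) * (4 * v) * smom n"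
    using key[of "Suc n"] by (metis (no_types, lifting) has_integral_unique right_minus_eq)
  have "((\<lambda>x. - 3 * (x ^ 1 * sroot x)) has_integral - 3 * smom 1) {- ?r..?r}"
    by (intro has_integral_mult_right smom_has_integral)
  moreover have "(\<lambda>x. real 0 * x ^ (0 - 1) * ((4 * v - x\<^sup>2) * sroot x) - 3 * (x ^ Suc 0 * sroot x)) = (\<lambda>x. - 3 * (x ^ 1 * sroot x))"
    by simp
  ultimately have "- 3 * smom 1 = 0" using key[of 0] has_integral_unique by metis
  then show "smom 1 = 0" by simp
qed

lemma smom_odd: "smom (2 * k + 1) = 0"
proof (induction k)
  case (Suc k)
  have "(real (2 * k + 1) + 4) * smom (2 * Suc k + 1) = 0" using smom_step[of "2 * k + 1"] Suc by simp
  moreover have "real (2 * k + 1) + 4 \<noteq> 0" by linarith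
  ultimately show ?case by simp
qed (use smom_1 in simp)

text \<open>After division by \<open>v ^ j\<close> the normalized even moments are the Catalan
  numbers. Integration by parts provides their first-order recursion, and
  \<open>catalan_convolution\<close> turns it into the convolution that noncrossing pairings ask
  for.\<close>

lemma smom_even_convolution:
  "smom (2 * Suc k) / (2 * pi * v) = v * (\<Sum>i\<le>k. smom (2 * i) / (2 * pi * v) * (smom (2 * (k - i)) / (2 * pi * v)))"
proof -
  define c where "c j = smom (2 * j) / (2 * pi * v) / v ^ j" for j
  have m: "smom (2 * j) / (2 * pi * v) = v ^ j * c j" for j using v by (simp add: c_def)
  have "(\<Sum>i\<le>k. c i * c (k - i)) = c (Suc k)"
  proof (rule catalan_convolution)
    show "c 0 = 1" using v by (simp add: c_def smom_0)
    fix j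
    have e: "(2 * real j + 4) * smom (2 * Suc j) = (2 * real j + 1) * (4 * v) * smom (2 * j)" using smom_step[of "2 * j"] by simp
    have "(real j + 2) * c (Suc j) = ((2 * real j + 4) * smom (2 * Suc j)) / (4 * pi * v * v ^ Suc j)"
      using v by (simp add: c_def field_simps)
    also have "\<dots> = (4 * real j + 2) * c j" unfolding e using v by (simp add: c_def field_simps)
    finally show "(real j + 2) * c (Suc j) = (4 * real j + 2) * c j" .
  qed
  moreover have "(\<Sum>i\<le>k. v ^ i * c i * (v ^ (k - i) * c (k - i))) = v ^ k * (\<Sum>i\<le>k. c i * c (k - i))"
    unfolding sum_distrib_left
  proof (intro sum.cong refl)
    fix i assume "i \<in> {..k}"
    then have "v ^ k = v ^ i * v ^ (k - i)" by (simp flip: power_add)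
    then show "v ^ i * c i * (v ^ (k - i) * c (k - i)) = v ^ k * (c i * c (k - i))" by simp
  qed
  ultimately show ?thesis unfolding m by simp
qed

text \<open>Odd moments vanish, so only even \<open>p\<close> contribute; for words of odd length
  every product contains an odd moment.\<close>

lemma semicircular_moment_single:
  "semicircular_moment (\<lambda>_ _. v) (replicate n ()) = smom n / (2 * pi * v)"
proof (induction n rule: less_induct)
  case (less n)
  show ?case
  proof (cases n)
    case 0
    then show ?thesis using smom_0 v by simp
  next
    case (Suc m)
    have "semicircular_moment (\<lambda>_ _. v) (replicate n ()) =
        (\<Sum>p<m. v * (smom p / (2 * pi * v)) * (smom (m - Suc p) / (2 * pi * v)))"
      unfolding Suc using less[unfolded Suc] by (auto intro!: sum.cong simp: take_replicate drop_replicate min_def)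
    also have "\<dots> = smom n / (2 * pi * v)"
    proof (cases "even m")
      case True
      then obtain k where k: "m = 2 * k" by blast
      have z: "smom p * smom (m - Suc p) = 0" if "p < m" for p
      proof (cases "even p")
        case True
        then have "odd (m - Suc p)" using that k by auto
        then show ?thesis using smom_odd by (metis mult_zero_right oddE)
      next
        case False
        then show ?thesis using smom_odd by (metis mult_zero_left oddE)
      qed
      have "smom n = 0" unfolding Suc k using smom_odd[of k] by simp
      then show ?thesis using z by (auto intro!: sum.neutral)
    next
      case False
      then obtain k where k: "m = 2 * k + 1" by (metis oddE)
      let ?f = "\<lambda>p. v * (smom p / (2 * pi * v)) * (smom (m - Suc p) / (2 * pi * v))"
      have "(\<Sum>p<m. ?f p) = (\<Sum>p\<in>(\<lambda>i. 2 * i) ` {..k}. ?f p)"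
      proof (intro sum.mono_neutral_right ballI)
        show "(\<lambda>i. 2 * i) ` {..k} \<subseteq> {..<m}" using k by auto
        fix p assume p: "p \<in> {..<m} - (\<lambda>i. 2 * i) ` {..k}"
        have "odd p"
        proof
          assume "even p"
          then obtain i where "p = 2 * i" by blast
          with p k show False by auto
        qed
        then show "?f p = 0" using smom_odd by (metis (no_types, lifting) div_0 mult_zero_left mult_zero_right oddE)
      qed simp
      also have "\<dots> = (\<Sum>i\<le>k. ?f (2 * i))" by (subst sum.reindex) (auto simp: inj_on_def)
      also have "\<dots> = v * (\<Sum>i\<le>k. smom (2 * i) / (2 * pi * v) * (smom (2 * (k - i)) / (2 * pi * v)))"
        unfolding sum_distrib_left by (intro sum.cong) (auto simp: k diff_mult_distrib2 mult.assoc)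
      also have "\<dots> = smom (2 * Suc k) / (2 * pi * v)" by (rule smom_even_convolution[symmetric])
      finally show ?thesis using Suc k by simp
    qed
    finally show ?thesis .
  qed
qed

lemma semicircle_distribution_integral:
  fixes g :: "real \<Rightarrow> real"
  assumes g: "continuous_on UNIV g"
  shows "integrable (semicircle_distribution v) g"
    "(LINT x|semicircle_distribution v. g x) = integral {-(2 * sqrt v)..2 * sqrt v} (\<lambda>x. g x * sroot x) / (2 * pi * v)"
proof -
  let ?D = "\<lambda>x. 1 / (2 * pi * v) * sroot x"
  have S: "semicircle_distribution v = density lborel (\<lambda>x. ennreal (?D x))"
    by (simp add: semicircle_distribution_def sroot_def)
  have D0: "AE x in lborel. 0 \<le> ?D x" using v by (auto simp: sroot_def)
  have gm: "g \<in> borel_measurable borel" using g by (rule borel_measurable_continuous_onI)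
  let ?I = "{-(2 * sqrt v)..2 * sqrt v}"
  have c: "continuous_on ?I (\<lambda>x. g x * sroot x)" by (intro continuous_intros continuous_on_subset[OF g]) auto
  have si: "set_integrable lborel ?I (\<lambda>x. g x * sroot x)" by (rule borel_integrable_atLeastAtMost'[OF c])
  have e: "(\<lambda>x. indicator ?I x *\<^sub>R (g x * sroot x)) = (\<lambda>x. g x * sroot x)"
    using sroot_outside by (auto simp: indicator_def fun_eq_iff)
  have e2: "?D x *\<^sub>R g x = (g x * sroot x) / (2 * pi * v)" for x by simp
  have i: "integrable lborel (\<lambda>x. g x * sroot x)" using si unfolding set_integrable_def e .
  then have "integrable lborel (\<lambda>x. ?D x *\<^sub>R g x)" unfolding e2 by (rule integrable_divide_zero)
  then show "integrable (semicircle_distribution v) g"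
    unfolding S by (subst integrable_density[OF _ _ D0]) (use gm in auto)
  have "(LINT x|semicircle_distribution v. g x) = (LINT x|lborel. ?D x *\<^sub>R g x)"
    unfolding S by (subst integral_density[OF _ _ D0]) (use gm in auto)
  also have "\<dots> = (LINT x|lborel. g x * sroot x) / (2 * pi * v)" unfolding e2 by simp
  also have "(LINT x|lborel. g x * sroot x) = integral ?I (\<lambda>x. g x * sroot x)"
    using set_borel_integral_eq_integral(2)[OF si] unfolding set_lebesgue_integral_def e .
  finally show "(LINT x|semicircle_distribution v. g x) = integral ?I (\<lambda>x. g x * sroot x) / (2 * pi * v)" .
qed

lemma semicircle_distribution_moment:
  "(LINT x|semicircle_distribution v. x ^ n) = semicircular_moment (\<lambda>_ _. v) (replicate n ())"
  unfolding semicircular_moment_single smom_def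
  by (subst semicircle_distribution_integral(2)) (auto intro!: continuous_intros)

lemma real_distribution_semicircle: "real_distribution (semicircle_distribution v)"
proof -
  have "emeasure (semicircle_distribution v) (space (semicircle_distribution v)) = 1"
  proof -
    have "integrable (semicircle_distribution v) (\<lambda>_. 1 :: real)"
      by (rule semicircle_distribution_integral) (intro continuous_intros)
    then have f: "emeasure (semicircle_distribution v) (space (semicircle_distribution v)) < \<infinity>"
      unfolding integrable_iff_bounded by simp
    have "measure (semicircle_distribution v) (space (semicircle_distribution v)) = 1"
      using semicircle_distribution_moment[of 0] by simp
    then show ?thesis using f by (simp add: emeasure_eq_ennreal_measure)
  qed
  then show ?thesis
    by (intro real_distribution.intro prob_spaceI real_distribution_axioms.intro) (auto simp: semicircle_distribution_def)
qed

lemma semicircle_distribution_AE_bounded: "AE x in semicircle_distribution v. \<bar>x\<bar> \<le> 2 * sqrt v"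
proof -
  have "AE x in lborel. 0 < ennreal (1 / (2 * pi * v) * sroot x) \<longrightarrow> \<bar>x\<bar> \<le> 2 * sqrt v"
  proof (intro AE_I2 impI)
    fix x :: real assume "0 < ennreal (1 / (2 * pi * v) * sroot x)"
    then have "sroot x \<noteq> 0" by auto
    then have "x \<in> {-(2 * sqrt v)..2 * sqrt v}" using sroot_outside by blast
    then show "\<bar>x\<bar> \<le> 2 * sqrt v" by (auto simp: abs_le_iff)
  qed
  then show ?thesis unfolding semicircle_distribution_def sroot_def[symmetric] by (subst AE_density) auto
qed

end

text \<open>A polynomial \<open>g\<close> approximates \<open>f\<close> on an interval twice as long
  as needed to carry the limit law. Beyond it \<open>f - g\<close> is at most
  \<open>C * (x / (2 * S)) ^ (2 * k)\<close>, whose integral against the limit law is at most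
  \<open>C * (1 / 4) ^ k\<close>; convergence of this one high moment plays the role of
  tightness.\<close>

lemma moments_imp_weak_conv:
  fixes \<mu>s :: "nat \<Rightarrow> real measure" and \<mu> :: "real measure"
  assumes \<mu>s: "\<And>n. real_distribution (\<mu>s n)" and \<mu>: "real_distribution \<mu>"
    and int: "\<And>n k. integrable (\<mu>s n) (\<lambda>x. x ^ k)"
    and bd: "AE x in \<mu>. \<bar>x\<bar> \<le> R"
    and conv: "\<And>k. (\<lambda>n. LINT x|\<mu>s n. x ^ k) \<longlonglongrightarrow> (LINT x|\<mu>. x ^ k)"
  shows "weak_conv_m \<mu>s \<mu>"
proof (rule integral_bdd_continuous_conv_imp_weak_conv[OF \<mu>s \<mu>])
  interpret \<mu>: real_distribution \<mu> by (rule \<mu>)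
  interpret \<mu>s: real_distribution "\<mu>s n" for n by (rule \<mu>s)
  fix f :: "real \<Rightarrow> real" assume f: "\<And>x. isCont f x" "\<And>x. \<bar>f x\<bar> \<le> 1"
  define S where "S = max 1 R"
  have S: "1 \<le> S" "R \<le> S" by (auto simp: S_def)
  have fm: "f \<in> borel_measurable borel" using f(1) by (intro borel_measurable_continuous_onI continuous_at_imp_continuous_on) auto
  have fi: "integrable \<nu> f" if "real_distribution \<nu>" for \<nu>
  proof -
    interpret \<nu>: real_distribution \<nu> by (rule that)
    show ?thesis using fm f(2) by (intro \<nu>.integrable_const_bound[of _ 1]) auto
  qed
  show "(\<lambda>n. integral\<^sup>L (\<mu>s n) f) \<longlonglongrightarrow> integral\<^sup>L \<mu> f"
  proof (rule LIMSEQ_I)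
    fix \<epsilon> :: real assume \<epsilon>: "0 < \<epsilon>"
    \<comment> \<open>The final comparison adds up at most five portions \<open>e\<close>.\<close>
    define e where "e = \<epsilon> / 8"
    have e: "0 < e" using \<epsilon> by (simp add: e_def)
    obtain g where g: "real_polynomial_function g" "\<And>x. x \<in> {- (2 * S)..2 * S} \<Longrightarrow> \<bar>f x - g x\<bar> < e"
      using Stone_Weierstrass_real_polynomial_function[of "{- (2 * S)..2 * S}" f e] f(1) e
      by (metis compact_Icc continuous_at_imp_continuous_on)
    then obtain a m where gs: "g = (\<lambda>x. \<Sum>i\<le>m. a i * x ^ i)" unfolding real_polynomial_function_iff_sum by auto
    define B where "B = 1 + (\<Sum>i\<le>m. \<bar>a i\<bar>)"
    have B: "1 \<le> B" unfolding B_def by (simp add: sum_nonneg)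
    define C where "C = B * (2 * S) ^ m"
    have C: "0 \<le> C" using B S by (simp add: C_def)
    have "(\<lambda>k. C * (1 / 4) ^ k) \<longlonglongrightarrow> C * 0" by (intro tendsto_intros LIMSEQ_realpow_zero) auto
    then have "\<forall>\<^sub>F k in sequentially. C * (1 / 4) ^ k < e" using e by (intro order_tendstoD) auto
    \<comment> \<open>\<open>m \<le> k\<close> lets the even power \<open>2 * k\<close> dominate the
      degree of \<open>g\<close>.\<close>
    then obtain k where k: "m \<le> k" "C * (1 / 4) ^ k < e"
      by (metis (no_types, lifting) eventually_sequentially linorder_le_cases)
    have "\<bar>f x - g x\<bar> \<le> e + C / (2 * S) ^ (2 * k) * x ^ (2 * k)" for x
    proof (cases "\<bar>x\<bar> \<le> 2 * S")
      case True
      then have "\<bar>f x - g x\<bar> < e" by (intro g(2)) auto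
      moreover have "0 \<le> C / (2 * S) ^ (2 * k) * x ^ (2 * k)" using C S by simp
      ultimately show ?thesis by linarith
    next
      case False
      define y where "y = \<bar>x\<bar> / (2 * S)"
      have y: "1 \<le> y" "\<bar>x\<bar> = 2 * S * y" using False S by (auto simp: y_def field_simps)
      have x1: "1 \<le> \<bar>x\<bar>" using False S by linarith
      have "\<bar>g x\<bar> \<le> (\<Sum>i\<le>m. \<bar>a i * x ^ i\<bar>)" unfolding gs by (rule sum_abs)
      also have "\<dots> \<le> (\<Sum>i\<le>m. \<bar>a i\<bar> * \<bar>x\<bar> ^ m)"
        unfolding abs_mult power_abs by (intro sum_mono mult_left_mono power_increasing x1) auto
      finally have "\<bar>g x\<bar> \<le> (\<Sum>i\<le>m. \<bar>a i\<bar>) * \<bar>x\<bar> ^ m" by (simp add: sum_distrib_right)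
      moreover have "\<bar>f x\<bar> \<le> \<bar>x\<bar> ^ m" using f(2)[of x] one_le_power[OF x1, of m] by linarith
      ultimately have "\<bar>f x - g x\<bar> \<le> B * \<bar>x\<bar> ^ m" unfolding B_def distrib_right by linarith
      also have "\<dots> = C * y ^ m" unfolding y(2) C_def by (simp add: power_mult_distrib)
      also have "\<dots> \<le> C * y ^ (2 * k)" using k(1) by (intro mult_left_mono power_increasing y C) auto
      also have "\<dots> = C / (2 * S) ^ (2 * k) * x ^ (2 * k)" by (simp add: y_def power_divide power_even_abs)
      finally show ?thesis using e by linarith
    qed
    note ptw = this
    have gi: "integrable \<nu> g" if "\<And>i. integrable \<nu> (\<lambda>x. x ^ i)" for \<nu> :: "real measure"
      unfolding gs by (intro Bochner_Integration.integrable_sum integrable_mult_right that)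
    have diff: "\<bar>(LINT x|\<nu>. f x) - (LINT x|\<nu>. g x)\<bar> \<le> e + C / (2 * S) ^ (2 * k) * (LINT x|\<nu>. x ^ (2 * k))"
      if \<nu>: "real_distribution \<nu>" and i: "\<And>i. integrable \<nu> (\<lambda>x. x ^ i)" for \<nu>
    proof -
      interpret \<nu>: real_distribution \<nu> by (rule \<nu>)
      have "\<bar>(LINT x|\<nu>. f x) - (LINT x|\<nu>. g x)\<bar> = \<bar>LINT x|\<nu>. f x - g x\<bar>"
        by (subst Bochner_Integration.integral_diff[OF fi[OF \<nu>] gi[OF i]]) simp
      also have "\<dots> \<le> (LINT x|\<nu>. e + C / (2 * S) ^ (2 * k) * x ^ (2 * k))"
        using integral_abs_bound[of \<nu> "\<lambda>x. f x - g x"]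
        by (rule order_trans) (intro integral_mono ptw integrable_abs Bochner_Integration.integrable_diff fi[OF \<nu>] gi[OF i] Bochner_Integration.integrable_add integrable_mult_right i \<nu>.integrable_const)
      also have "\<dots> = e + C / (2 * S) ^ (2 * k) * (LINT x|\<nu>. x ^ (2 * k))"
        by (subst Bochner_Integration.integral_add) (use i \<nu>.prob_space in auto)
      finally show ?thesis .
    qed
    have \<mu>i: "integrable \<mu> (\<lambda>x. x ^ i)" for i
    proof (rule \<mu>.integrable_const_bound[of _ "S ^ i"])
      show "AE x in \<mu>. norm (x ^ i) \<le> S ^ i"
        using bd by eventually_elim (use S in \<open>auto simp: power_abs intro!: power_mono\<close>)
    qed auto
    let ?m = "LINT x|\<mu>. x ^ (2 * k)"
    have "?m \<le> (LINT x|\<mu>. S ^ (2 * k))"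
    proof (intro integral_mono_AE \<mu>i)
      show "AE x in \<mu>. x ^ (2 * k) \<le> S ^ (2 * k)"
        using bd
      proof eventually_elim
        case (elim x)
        have "\<bar>x\<bar> ^ (2 * k) \<le> S ^ (2 * k)" using elim S by (intro power_mono) auto
        then show ?case by (simp add: power_even_abs)
      qed
    qed simp
    then have "?m \<le> S ^ (2 * k)" using \<mu>.prob_space by simp
    then have "C / (2 * S) ^ (2 * k) * ?m \<le> C / (2 * S) ^ (2 * k) * S ^ (2 * k)" using C S by (intro mult_left_mono) auto
    also have "\<dots> = C * (1 / 4) ^ k" using S by (simp add: power_mult_distrib power_mult power_divide)
    finally have small: "C / (2 * S) ^ (2 * k) * ?m < e" using k by linarith
    have "(\<lambda>n. LINT x|\<mu>s n. g x) \<longlonglongrightarrow> (LINT x|\<mu>. g x)"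
      unfolding gs by (subst (1 2) Bochner_Integration.integral_sum) (auto intro!: tendsto_intros conv integrable_mult_right int \<mu>i)
    then have "\<forall>\<^sub>F n in sequentially. \<bar>(LINT x|\<mu>s n. g x) - (LINT x|\<mu>. g x)\<bar> < e"
      using e unfolding tendsto_iff dist_real_def by blast
    moreover have "\<forall>\<^sub>F n in sequentially. C / (2 * S) ^ (2 * k) * (LINT x|\<mu>s n. x ^ (2 * k)) < e"
      by (rule order_tendstoD(2)[OF _ small]) (intro tendsto_intros conv)
    ultimately have "\<forall>\<^sub>F n in sequentially. norm ((LINT x|\<mu>s n. f x) - (LINT x|\<mu>. f x)) < \<epsilon>"
    proof eventually_elim
      case (elim n)
      have "8 * e = \<epsilon>" by (simp add: e_def)
      then show ?case using elim diff[OF \<mu>s[of n] int] diff[OF \<mu> \<mu>i] small e unfolding real_norm_def by linarith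
    qed
    then show "\<exists>no. \<forall>n\<ge>no. norm (integral\<^sup>L (\<mu>s n) f - integral\<^sup>L \<mu> f) < \<epsilon>"
      unfolding eventually_sequentially .
  qed
qed

section \<open>Spectral moments\<close>

text \<open>Over the complex numbers the polynomial splits. The Hermitian form of \<open>A\<close>
  at an eigenvector equals its own conjugate by symmetry, so every root is real and the
  factorization descends to the reals.\<close>

lemma symmetric_char_poly_splits:
  fixes A :: "real mat"
  assumes A: "A \<in> carrier_mat n n" and sym: "\<And>i j. i < n \<Longrightarrow> j < n \<Longrightarrow> A $$ (i, j) = A $$ (j, i)"
  obtains es where "char_poly A = (\<Prod>a\<leftarrow>es. [:- a, 1:])" "length es = n"
proof -
  let ?B = "map_mat complex_of_real A"
  have B: "?B \<in> carrier_mat n n" using A by simp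
  obtain as where as: "char_poly ?B = (\<Prod>a\<leftarrow>as. [:- a, 1:])" "length as = n"
    using char_poly_factorized[OF B] by blast
  have real: "complex_of_real (Re a) = a" if "a \<in> set as" for a
  proof -
    have "poly (char_poly ?B) a = 0" unfolding as(1) poly_prod_list using that
      by (auto simp: prod_list_zero_iff)
    then obtain v where v: "v \<in> carrier_vec n" "v \<noteq> 0\<^sub>v n" "?B *\<^sub>v v = a \<cdot>\<^sub>v v"
      using eigenvalue_root_char_poly[OF B] B unfolding eigenvalue_def eigenvector_def by auto
    define h where "h = (\<Sum>i<n. \<Sum>j<n. cnj (v $ i) * complex_of_real (A $$ (i, j)) * v $ j)"
    have Bv: "(\<Sum>j<n. complex_of_real (A $$ (i, j)) * v $ j) = a * v $ i" if "i < n" for i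
    proof -
      have "(?B *\<^sub>v v) $ i = (a \<cdot>\<^sub>v v) $ i" using v(3) by simp
      then show ?thesis using that v(1) A by (simp add: scalar_prod_def atLeast0LessThan)
    qed
    have "cnj h = (\<Sum>i<n. \<Sum>j<n. v $ i * complex_of_real (A $$ (i, j)) * cnj (v $ j))" by (simp add: h_def)
    also have "\<dots> = (\<Sum>j<n. \<Sum>i<n. v $ i * complex_of_real (A $$ (i, j)) * cnj (v $ j))" by (rule sum.swap)
    also have "\<dots> = h" unfolding h_def by (intro sum.cong refl) (simp add: sym)
    finally have hh: "cnj h = h" .
    have ha: "h = a * (\<Sum>i<n. cnj (v $ i) * v $ i)"
    proof -
      have "h = (\<Sum>i<n. cnj (v $ i) * (\<Sum>j<n. complex_of_real (A $$ (i, j)) * v $ j))"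
        by (simp only: h_def mult.assoc sum_distrib_left)
      also have "\<dots> = (\<Sum>i<n. cnj (v $ i) * (a * v $ i))" by (simp add: Bv)
      finally show ?thesis by (simp add: sum_distrib_left mult_ac)
    qed
    have q: "(\<Sum>i<n. cnj (v $ i) * v $ i) = complex_of_real (\<Sum>i<n. (cmod (v $ i))\<^sup>2)"
      unfolding of_real_sum complex_norm_square by (simp add: mult.commute)
    have s0: "(\<Sum>i<n. (cmod (v $ i))\<^sup>2) \<noteq> 0"
    proof
      assume "(\<Sum>i<n. (cmod (v $ i))\<^sup>2) = 0"
      then have "v $ i = 0" if "i < n" for i using that by (subst (asm) sum_nonneg_eq_0_iff) auto
      then have "v = 0\<^sub>v n" using v(1) by (intro eq_vecI) auto
      with v(2) show False ..
    qed
    have "cnj a * complex_of_real (\<Sum>i<n. (cmod (v $ i))\<^sup>2) = a * complex_of_real (\<Sum>i<n. (cmod (v $ i))\<^sup>2)"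
      using hh unfolding ha q complex_cnj_mult complex_cnj_complex_of_real .
    then have "cnj a = a" using s0 by (simp only: mult_cancel_right of_real_eq_0_iff) simp
    then show ?thesis by (simp add: complex_eq_iff)
  qed
  interpret mp: map_poly_comm_ring_hom complex_of_real ..
  define es where "es = map Re as"
  have mp: "map_poly complex_of_real (\<Prod>a\<leftarrow>map Re bs. [:- a, 1:]) = (\<Prod>a\<leftarrow>bs. [:- a, 1:])" if "set bs \<subseteq> set as" for bs
    using that
  proof (induction bs)
    case (Cons b bs)
    have "map_poly complex_of_real ([:- Re b, 1:] * (\<Prod>a\<leftarrow>map Re bs. [:- a, 1:])) =
        map_poly complex_of_real [:- Re b, 1:] * map_poly complex_of_real (\<Prod>a\<leftarrow>map Re bs. [:- a, 1:])"
      by (rule mp.hom_mult)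
    then show ?case using Cons real[of b] by simp
  qed simp
  have "map_poly complex_of_real (\<Prod>a\<leftarrow>es. [:- a, 1:]) = map_poly complex_of_real (char_poly A)"
  proof -
    have "char_poly ?B = map_poly complex_of_real (char_poly A)" by (rule of_real_hom.char_poly_hom[OF A])
    with as(1) show ?thesis using mp[of as] by (simp only: es_def order_refl)
  qed
  then have "char_poly A = (\<Prod>a\<leftarrow>es. [:- a, 1:])"
    by (simp add: poly_eq_iff coeff_map_poly)
  then show thesis using that[of es] as(2) by (simp add: es_def)
qed

lemma trace_mult_comm:
  fixes A B :: "'a :: comm_semiring_1 mat"
  assumes "A \<in> carrier_mat n n" "B \<in> carrier_mat n n"
  shows "(\<Sum>i<n. (A * B) $$ (i, i)) = (\<Sum>i<n. (B * A) $$ (i, i))"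
proof -
  have "(\<Sum>i<n. (A * B) $$ (i, i)) = (\<Sum>i<n. \<Sum>j<n. A $$ (i, j) * B $$ (j, i))"
    using assms by (simp add: scalar_prod_def atLeast0LessThan)
  also have "\<dots> = (\<Sum>j<n. \<Sum>i<n. A $$ (i, j) * B $$ (j, i))" by (rule sum.swap)
  also have "\<dots> = (\<Sum>i<n. (B * A) $$ (i, i))"
    using assms by (simp add: scalar_prod_def atLeast0LessThan mult.commute)
  finally show ?thesis .
qed

lemma upper_triangular_power:
  fixes B :: "'a :: comm_semiring_1 mat"
  assumes B: "B \<in> carrier_mat n n" and u: "upper_triangular B"
  shows "\<forall>i<n. (B ^\<^sub>m k) $$ (i, i) = B $$ (i, i) ^ k \<and> (\<forall>j<i. (B ^\<^sub>m k) $$ (i, j) = 0)"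
proof (induction k)
  case (Suc k)
  let ?P = "B ^\<^sub>m k"
  have z: "?P $$ (i, l) * B $$ (l, j) = 0" if "i < n" "l < n" "j \<le> i" "l \<noteq> i \<or> j < i" for i l j
  proof (cases "l < i")
    case True
    then show ?thesis using Suc that by simp
  next
    case False
    then have "j < l" using that by auto
    then show ?thesis using upper_triangularD[OF u, of j l] B that by simp
  qed
  have e: "(B ^\<^sub>m Suc k) $$ (i, j) = (\<Sum>l<n. ?P $$ (i, l) * B $$ (l, j))" if "i < n" "j < n" for i j
    using B that by (simp add: scalar_prod_def atLeast0LessThan)
  show ?case
  proof (intro allI impI conjI)
    fix i assume i: "i < n"
    have "(\<Sum>l<n. ?P $$ (i, l) * B $$ (l, i)) = (\<Sum>l\<in>{i}. ?P $$ (i, l) * B $$ (l, i))"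
      by (intro sum.mono_neutral_right) (use i z in auto)
    then show "(B ^\<^sub>m Suc k) $$ (i, i) = B $$ (i, i) ^ Suc k" using Suc i e[OF i i] by (simp add: mult.commute)
    fix j assume j: "j < i"
    show "(B ^\<^sub>m Suc k) $$ (i, j) = 0"
      unfolding e[OF i less_trans[OF j i]] by (intro sum.neutral) (use i j z in auto)
  qed
qed (use B in auto)

text \<open>A Schur decomposition makes \<open>A\<close> similar to a triangular matrix with
  diagonal \<open>es\<close>; taking powers acts on the diagonal entrywise, and the trace is
  invariant.\<close>

lemma trace_power_eq_sum_roots:
  fixes A :: "real mat"
  assumes A: "A \<in> carrier_mat n n" and c: "char_poly A = (\<Prod>a\<leftarrow>es. [:- a, 1:])"
  shows "(\<Sum>i<n. (A ^\<^sub>m k) $$ (i, i)) = (\<Sum>a\<leftarrow>es. a ^ k)"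
proof -
  obtain B P Q where "schur_decomposition A es = (B, P, Q)" by (metis prod_cases3)
  from schur_decomposition[OF A c this]
  have wit: "similar_mat_wit A B P Q" and u: "upper_triangular B" and d: "diag_mat B = es" by auto
  from similar_mat_wit_pow_id[OF wit] have pow: "A ^\<^sub>m k = P * B ^\<^sub>m k * Q" .
  note w = similar_mat_witD2[OF A wit]
  have Bk: "B ^\<^sub>m k \<in> carrier_mat n n" using w by simp
  have "(\<Sum>i<n. (A ^\<^sub>m k) $$ (i, i)) = (\<Sum>i<n. (Q * (P * B ^\<^sub>m k)) $$ (i, i))"
    unfolding pow using w Bk by (intro trace_mult_comm mult_carrier_mat[of _ n n]) auto
  also have "Q * (P * B ^\<^sub>m k) = (Q * P) * B ^\<^sub>m k" using w Bk by (intro assoc_mult_mat[symmetric, of _ n n]) auto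
  also have "\<dots> = B ^\<^sub>m k" using w Bk by simp
  also have "(\<Sum>i<n. (B ^\<^sub>m k) $$ (i, i)) = (\<Sum>i<n. B $$ (i, i) ^ k)"
    using upper_triangular_power[OF _ u, of n k] w by simp
  also have "\<dots> = (\<Sum>a\<leftarrow>es. a ^ k)"
    unfolding d[symmetric] diag_mat_def using w
    by (simp add: o_def interv_sum_list_conv_sum_set_nat atLeast0LessThan)
  finally show ?thesis .
qed

lemma empirical_spectral_distribution_moment:
  fixes A :: "real mat"
  assumes A: "A \<in> carrier_mat n n" and sym: "\<And>i j. i < n \<Longrightarrow> j < n \<Longrightarrow> A $$ (i, j) = A $$ (j, i)" and n: "0 < n"
  shows "real_distribution (empirical_spectral_distribution A)"
    "integrable (empirical_spectral_distribution A) (\<lambda>x. x ^ k)"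
    "(LINT x|empirical_spectral_distribution A. x ^ k) = (\<Sum>i<n. (A ^\<^sub>m k) $$ (i, i)) / real n"
proof -
  obtain es where es: "char_poly A = (\<Prod>a\<leftarrow>es. [:- a, 1:])" "length es = n"
    using symmetric_char_poly_splits[OF A sym] by blast
  have "proots (\<Prod>a\<leftarrow>bs. [:- a, 1:]) = mset bs" for bs :: "real list"
  proof (induction bs)
    case (Cons b bs)
    have "(\<Prod>a\<leftarrow>bs. [:- a, 1:]) \<noteq> 0" by (auto simp: prod_list_zero_iff)
    then show ?case using Cons by (simp add: proots_mult del: mult_pCons_left)
  qed simp
  then have ev: "eigenvalue_list A = sort es"
    unfolding eigenvalue_list_def es(1) by simp
  have E: "empirical_spectral_distribution A = distr (uniform_count_measure {..<n}) borel (\<lambda>k. sort es ! k)"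
    unfolding empirical_spectral_distribution_def ev using A by simp
  have m: "(\<lambda>k. sort es ! k) \<in> measurable (uniform_count_measure {..<n}) borel"
    by (simp add: measurable_def space_uniform_count_measure sets_uniform_count_measure)
  interpret U: prob_space "uniform_count_measure {..<n}"
    by (rule prob_space_uniform_count_measure) (use n in auto)
  show "real_distribution (empirical_spectral_distribution A)" unfolding E using m by (rule U.real_distribution_distr)
  have i: "integrable (uniform_count_measure {..<n}) f" for f :: "nat \<Rightarrow> real"
    unfolding uniform_count_measure_def by (rule integrable_point_measure_finite) simp
  show "integrable (empirical_spectral_distribution A) (\<lambda>x. x ^ k)"
    unfolding E by (subst integrable_distr_eq[OF m]) (auto intro: i)
  have "(LINT x|empirical_spectral_distribution A. x ^ k) = (\<Sum>j<n. (sort es ! j) ^ k) / real n"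
    unfolding E by (subst integral_distr[OF m]) (auto simp: integral_uniform_count_measure)
  also have "(\<Sum>j<n. (sort es ! j) ^ k) = (\<Sum>a\<leftarrow>sort es. a ^ k)"
    unfolding sum_list_sum_nth using es(2) by (simp add: atLeast0LessThan)
  also have "\<dots> = (\<Sum>a\<leftarrow>es. a ^ k)"
    by (simp flip: sum_mset_sum_list)
  also have "\<dots> = (\<Sum>i<n. (A ^\<^sub>m k) $$ (i, i))" by (rule trace_power_eq_sum_roots[OF A es(1), symmetric])
  finally show "(LINT x|empirical_spectral_distribution A. x ^ k) = (\<Sum>i<n. (A ^\<^sub>m k) $$ (i, i)) / real n" .
qed

section \<open>Positivity of the covariance\<close>

lemma tensor_inner_tensor_prod:
  assumes "length vs = length ws"
  shows "tensor_inner N (length vs) (tensor_prod vs) (tensor_prod ws) =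
    (\<Prod>j<length vs. \<Sum>k<N. vec_index (vs ! j) k * vec_index (ws ! j) k)"
  using assms
proof (induction vs ws rule: list_induct2)
  case Nil
  show ?case by (simp only: tensor_inner_def list.size sum_multi_index_0) simp
next
  case (Cons v vs w ws)
  have "tensor_inner N (Suc (length vs)) (tensor_prod (v # vs)) (tensor_prod (w # ws)) =
      (\<Sum>k<N. \<Sum>l\<in>multi_index N (length vs). (vec_index v k * vec_index w k) * (tensor_prod vs l * tensor_prod ws l))"
    unfolding tensor_inner_def sum_multi_index_Suc by (simp add: mult_ac)
  also have "\<dots> = (\<Sum>k<N. vec_index v k * vec_index w k) * tensor_inner N (length vs) (tensor_prod vs) (tensor_prod ws)"
    unfolding tensor_inner_def sum_product ..
  finally show ?case unfolding Cons.IH by (simp add: prod.lessThan_Suc_shift del: prod.lessThan_Suc)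
qed

lemma tensor_inner_sym: "tensor_inner N p S T = tensor_inner N p T S"
  by (simp add: tensor_inner_def mult.commute)

text \<open>Among the signed sums of the given unit vectors one of maximal norm has inner product at least
  one, in absolute value, with each of them, since no change of a single sign makes it longer.\<close>

lemma ex_vector_large_inner:
  assumes "\<And>v. v \<in> set vs \<Longrightarrow> v \<in> unit_sphere N"
  obtains x where "\<And>j. j < length vs \<Longrightarrow> 1 \<le> \<bar>\<Sum>k<N. vec_index (vs ! j) k * x k\<bar>"
    "(\<Sum>k<N. (x k)\<^sup>2) \<le> (real (length vs))\<^sup>2"
proof -
  define p where "p = length vs"
  define v where "v j k = vec_index (vs ! j) k" for j k
  define E where "E = ({..<p} \<rightarrow>\<^sub>E {- 1, 1 :: real})"
  define X where "X e k = (\<Sum>j<p. e j * v j k)" for e :: "nat \<Rightarrow> real" and k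
  define Q where "Q e = (\<Sum>k<N. (X e k)\<^sup>2)" for e
  have unit: "(\<Sum>k<N. (v j k)\<^sup>2) = 1" if "j < p" for j
  proof -
    have "vs ! j \<in> unit_sphere N" using assms that by (simp add: p_def)
    then have c: "vs ! j \<in> carrier_vec N" and s: "scalar_prod (vs ! j) (vs ! j) = 1" by (simp_all add: unit_sphere_def)
    from s show ?thesis unfolding scalar_prod_def carrier_vecD[OF c] v_def by (simp add: atLeast0LessThan power2_eq_square)
  qed
  have fin: "finite E" unfolding E_def by (intro finite_PiE) auto
  have ne: "E \<noteq> {}" unfolding E_def by (simp add: PiE_eq_empty_iff)
  obtain e where e: "e \<in> E" "\<And>e'. e' \<in> E \<Longrightarrow> Q e' \<le> Q e"
  proof -
    have "Max (Q ` E) \<in> Q ` E" using fin ne by (intro Max_in) auto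
    then obtain e where "e \<in> E" "Q e = Max (Q ` E)" by auto
    then show thesis using that fin by (metis Max_ge finite_imageI imageI)
  qed
  have sgn: "e j = 1 \<or> e j = - 1" if "j < p" for j using e(1) that by (auto simp: E_def PiE_def Pi_def)
  have "1 \<le> \<bar>\<Sum>k<N. v j k * X e k\<bar>" if j: "j < p" for j
  proof -
    let ?e = "e(j := - e j)"
    have "?e \<in> E" using e(1) j sgn[OF j] by (auto simp: E_def PiE_def Pi_def extensional_def)
    have X: "X ?e k = X e k - 2 * e j * v j k" for k
    proof -
      have "X ?e k - X e k = (\<Sum>i<p. if i = j then - 2 * e j * v j k else 0)"
        unfolding X_def sum_subtractf[symmetric] by (intro sum.cong) auto
      also have "\<dots> = - 2 * e j * v j k" using j by simp
      finally show ?thesis by simp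
    qed
    have "Q ?e = (\<Sum>k<N. (X e k)\<^sup>2 - 4 * e j * (v j k * X e k) + 4 * (e j)\<^sup>2 * (v j k)\<^sup>2)"
      unfolding Q_def X by (intro sum.cong) (auto simp: power2_eq_square algebra_simps)
    also have "\<dots> = Q e - 4 * e j * (\<Sum>k<N. v j k * X e k) + 4 * (e j)\<^sup>2 * (\<Sum>k<N. (v j k)\<^sup>2)"
      unfolding Q_def by (simp add: sum.distrib sum_subtractf sum_distrib_left)
    \<comment> \<open>Flipping \<open>e j\<close> changes the squared norm by \<open>4\<close> minus
      four times the signed inner product, so maximality forces the latter to be at least
      one.\<close>
    finally have "Q ?e = Q e - 4 * e j * (\<Sum>k<N. v j k * X e k) + 4" using unit[OF j] sgn[OF j] by auto
    moreover have "Q ?e \<le> Q e" using \<open>?e \<in> E\<close> by (rule e(2))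
    ultimately have "1 \<le> e j * (\<Sum>k<N. v j k * X e k)" by simp
    then show ?thesis using sgn[OF j] by auto
  qed
  moreover have "Q e \<le> (real p)\<^sup>2"
  proof -
    have "(X e k)\<^sup>2 \<le> real p * (\<Sum>j<p. (v j k)\<^sup>2)" for k
    proof -
      have "(X e k)\<^sup>2 \<le> (\<Sum>j<p. (e j)\<^sup>2) * (\<Sum>j<p. (v j k)\<^sup>2)" unfolding X_def by (rule Cauchy_Schwarz_ineq_sum)
      also have "(\<Sum>j<p. (e j)\<^sup>2) = (\<Sum>j<p. 1)" by (intro sum.cong) (use sgn in force)+
      finally show ?thesis by simp
    qed
    then have "Q e \<le> (\<Sum>k<N. real p * (\<Sum>j<p. (v j k)\<^sup>2))" unfolding Q_def by (intro sum_mono)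
    also have "\<dots> = real p * (\<Sum>j<p. \<Sum>k<N. (v j k)\<^sup>2)" unfolding sum_distrib_left[symmetric] by (subst sum.swap) rule
    also have "\<dots> = (real p)\<^sup>2" using unit by (simp add: power2_eq_square)
    finally show ?thesis .
  qed
  ultimately show thesis using that[of "X e"] by (simp add: p_def v_def Q_def)
qed

text \<open>Test against the tensor power of \<open>x\<close>, which is symmetric. The inner product
  is the product of the inner products of the vectors with \<open>x\<close>, hence at least one in
  absolute value, and the tensor power has squared norm at most \<open>p ^ (2 * p)\<close> for
  \<open>p\<close> vectors.\<close>

lemma sym_tensor_prod_norm_ge:
  assumes "\<And>v. v \<in> set vs \<Longrightarrow> v \<in> unit_sphere N"
  shows "1 \<le> tensor_inner N (length vs) (sym_tensor_prod vs) (sym_tensor_prod vs) * real (length vs) ^ (2 * length vs)"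
proof -
  let ?p = "length vs"
  obtain x where x: "\<And>j. j < ?p \<Longrightarrow> 1 \<le> \<bar>\<Sum>k<N. vec_index (vs ! j) k * x k\<bar>" "(\<Sum>k<N. (x k)\<^sup>2) \<le> (real ?p)\<^sup>2"
    using ex_vector_large_inner[OF assms] by blast
  define xs where "xs = replicate ?p (vec N x)"
  have xs: "length xs = ?p" "\<And>j k. j < ?p \<Longrightarrow> k < N \<Longrightarrow> vec_index (xs ! j) k = x k" by (auto simp: xs_def)
  have "permute_list \<sigma> xs = xs" if "\<sigma> permutes {..<?p}" for \<sigma>
    using that permutes_in_image[OF that] by (intro nth_equalityI) (auto simp: permute_list_def xs_def)
  then have S: "sym_tensor_prod xs ks = tensor_prod xs ks" for ks
    unfolding sym_tensor_prod_def by (simp add: xs(1) card_permutations)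
  let ?n = "tensor_inner N ?p (sym_tensor_prod vs) (sym_tensor_prod vs)"
  have "tensor_inner N ?p (sym_tensor_prod vs) (tensor_prod xs) = tensor_inner N ?p (tensor_prod vs) (tensor_prod xs)"
    using sym_tensor_prod_inner[of vs ?p xs N] xs(1) unfolding tensor_inner_def S by simp
  also have "\<dots> = (\<Prod>j<?p. \<Sum>k<N. vec_index (vs ! j) k * vec_index (xs ! j) k)"
    by (rule tensor_inner_tensor_prod) (simp add: xs)
  also have "\<dots> = (\<Prod>j<?p. \<Sum>k<N. vec_index (vs ! j) k * x k)" using xs(2) by simp
  finally have "\<bar>tensor_inner N ?p (sym_tensor_prod vs) (tensor_prod xs)\<bar> = (\<Prod>j<?p. \<bar>\<Sum>k<N. vec_index (vs ! j) k * x k\<bar>)"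
    by (simp add: abs_prod)
  moreover have "1 \<le> (\<Prod>j<?p. \<bar>\<Sum>k<N. vec_index (vs ! j) k * x k\<bar>)" using x(1) by (intro prod_ge_1) auto
  ultimately have "1 \<le> (tensor_inner N ?p (sym_tensor_prod vs) (tensor_prod xs))\<^sup>2"
    by (metis abs_ge_zero one_le_power power2_abs)
  also have "\<dots> \<le> ?n * tensor_inner N ?p (tensor_prod xs) (tensor_prod xs)"
    unfolding tensor_inner_def power2_eq_square[symmetric] by (rule Cauchy_Schwarz_ineq_sum)
  also have "\<dots> \<le> ?n * real ?p ^ (2 * ?p)"
  proof (intro mult_left_mono)
    have "tensor_inner N ?p (tensor_prod xs) (tensor_prod xs) = (\<Prod>j<?p. \<Sum>k<N. vec_index (xs ! j) k * vec_index (xs ! j) k)"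
      using tensor_inner_tensor_prod[of xs xs N] by (simp add: xs)
    also have "\<dots> = (\<Sum>k<N. (x k)\<^sup>2) ^ ?p" using xs(2) by (simp add: power2_eq_square)
    also have "\<dots> \<le> ((real ?p)\<^sup>2) ^ ?p" using x(2) by (intro power_mono) (auto intro: sum_nonneg)
    finally show "tensor_inner N ?p (tensor_prod xs) (tensor_prod xs) \<le> real ?p ^ (2 * ?p)" by (simp add: power_mult)
    show "0 \<le> ?n" unfolding tensor_inner_def by (intro sum_nonneg) simp
  qed
  finally show ?thesis .
qed

lemma contraction_cov_sym: "contraction_cov d u N i j = contraction_cov d u N j i"
  by (simp add: contraction_cov_def tensor_inner_sym)

text \<open>The covariance is a positive multiple of the Gram matrix of the symmetrized
  tensors.\<close>

lemma contraction_cov_psd: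
  assumes "d \<ge> 3"
  shows "0 \<le> (\<Sum>i\<in>F. \<Sum>j\<in>F. c i * c j * contraction_cov d u N i j)"
proof -
  let ?S = "\<lambda>i. sym_tensor_prod (map (u N i) [0..<d - 2])" and ?q = "1 / (real d * (real d - 1))"
  have "(\<Sum>i\<in>F. \<Sum>j\<in>F. c i * c j * contraction_cov d u N i j) =
      (\<Sum>i\<in>F. \<Sum>j\<in>F. \<Sum>k\<in>multi_index N (d - 2). ?q * ((c i * ?S i k) * (c j * ?S j k)))"
    unfolding contraction_cov_def tensor_inner_def sum_distrib_left by (simp add: mult_ac)
  also have "\<dots> = (\<Sum>i\<in>F. \<Sum>k\<in>multi_index N (d - 2). \<Sum>j\<in>F. ?q * ((c i * ?S i k) * (c j * ?S j k)))"
    by (intro sum.cong refl sum.swap)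
  also have "\<dots> = (\<Sum>k\<in>multi_index N (d - 2). \<Sum>i\<in>F. \<Sum>j\<in>F. ?q * ((c i * ?S i k) * (c j * ?S j k)))"
    by (rule sum.swap)
  also have "\<dots> = (\<Sum>k\<in>multi_index N (d - 2). ?q * (\<Sum>i\<in>F. c i * ?S i k)\<^sup>2)"
    by (simp only: power2_eq_square sum_product) (simp only: sum_distrib_left)
  also have "0 \<le> \<dots>" using assms by (intro sum_nonneg mult_nonneg_nonneg) auto
  finally show ?thesis .
qed

lemma contraction_cov_ge:
  assumes d: "d \<ge> 3" and u: "\<And>j. j < d - 2 \<Longrightarrow> u N i j \<in> unit_sphere N"
  shows "1 / (real d * (real d - 1) * real (d - 2) ^ (2 * (d - 2))) \<le> contraction_cov d u N i i"
proof -
  let ?vs = "map (u N i) [0..<d - 2]"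
  have "1 \<le> tensor_inner N (d - 2) (sym_tensor_prod ?vs) (sym_tensor_prod ?vs) * real (d - 2) ^ (2 * (d - 2))"
  proof -
    have "v \<in> unit_sphere N" if "v \<in> set ?vs" for v using that u by auto
    from sym_tensor_prod_norm_ge[of ?vs N, OF this] show ?thesis by simp
  qed
  moreover have "0 < real (d - 2) ^ (2 * (d - 2))" using d by simp
  ultimately have "1 / real (d - 2) ^ (2 * (d - 2)) \<le> tensor_inner N (d - 2) (sym_tensor_prod ?vs) (sym_tensor_prod ?vs)"
    by (simp add: pos_divide_le_eq)
  then have "1 / (real d * (real d - 1)) * (1 / real (d - 2) ^ (2 * (d - 2))) \<le> contraction_cov d u N i i"
    unfolding contraction_cov_def using d by (intro mult_left_mono) auto
  then show ?thesis by simp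
qed

section \<open>The free algebra\<close>

lemma semicircular_moment_cong:
  "(\<And>i j. i \<in> set w \<Longrightarrow> j \<in> set w \<Longrightarrow> K i j = L i j) \<Longrightarrow> semicircular_moment K w = semicircular_moment L w"
proof (induction w rule: length_induct)
  case (1 w)
  show ?case
  proof (cases w)
    case (Cons i v)
    have "semicircular_moment K (take p v) = semicircular_moment L (take p v)" for p
      by (rule 1(1)[rule_format]) (use 1(2) in \<open>auto simp: Cons dest: in_set_takeD\<close>)
    moreover have "semicircular_moment K (drop p v) = semicircular_moment L (drop p v)" for p
      by (rule 1(1)[rule_format]) (use 1(2) in \<open>auto simp: Cons dest: in_set_dropD\<close>)
    ultimately show ?thesis using 1(2) by (simp add: Cons)
  qed simp
qed

lemma semicircular_moment_replicate:
  "semicircular_moment K (replicate n i) = semicircular_moment (\<lambda>_ _. K i i) (replicate n ())"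
proof (induction n rule: less_induct)
  case (less n)
  show ?case
  proof (cases n)
    case (Suc m)
    show ?thesis unfolding Suc using less[unfolded Suc]
      by (auto intro!: sum.cong simp: take_replicate drop_replicate min_def)
  qed simp
qed

lemma semicircular_moment_tendsto:
  assumes "\<And>i j. i \<in> set w \<Longrightarrow> j \<in> set w \<Longrightarrow> (\<lambda>N. Ks N i j) \<longlonglongrightarrow> K i j"
  shows "(\<lambda>N. semicircular_moment (Ks N) w) \<longlonglongrightarrow> semicircular_moment K w"
  using assms
proof (induction w rule: length_induct)
  case (1 w)
  show ?case
  proof (cases w)
    case (Cons i v)
    have "(\<lambda>N. semicircular_moment (Ks N) (take p v)) \<longlonglongrightarrow> semicircular_moment K (take p v)" for p
      by (rule 1(1)[rule_format]) (use 1(2) in \<open>auto simp: Cons dest: in_set_takeD\<close>)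
    moreover have "(\<lambda>N. semicircular_moment (Ks N) (drop p v)) \<longlonglongrightarrow> semicircular_moment K (drop p v)" for p
      by (rule 1(1)[rule_format]) (use 1(2) in \<open>auto simp: Cons dest: in_set_dropD\<close>)
    ultimately show ?thesis unfolding Cons semicircular_moment.simps
      by (intro tendsto_intros) (use 1(2) in \<open>auto simp: Cons\<close>)
  qed simp
qed

lemma semicircular_family_iff:
  "semicircular_family I K smul \<phi> s \<longleftrightarrow> nc_prob_space smul \<phi> \<and> psd_on I K \<and>
     (\<forall>js. set js \<subseteq> I \<longrightarrow> \<phi> (prod_list (map s js)) = complex_of_real (semicircular_moment K js))"
  unfolding semicircular_family_def semicircular_moment_eq ..

lemma semicircular_family_nc_eval:
  assumes S: "semicircular_family I K smul \<phi> s" and P: "P \<in> free_algebra I"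
  shows "\<phi> (nc_eval smul s P) =
    (\<Sum>w\<in>Poly_Mapping.keys P. Poly_Mapping.lookup P w * complex_of_real (semicircular_moment K (letters w)))"
proof -
  interpret nc_prob_space smul \<phi> using S by (simp add: semicircular_family_iff)
  interpret L: Vector_Spaces.linear smul "(*)" \<phi> by (rule linear_functional)
  show ?thesis unfolding nc_eval_def L.sum L.scale
    by (intro sum.cong refl) (use S P in \<open>auto simp: semicircular_family_iff free_algebra_def\<close>)
qed

section \<open>Linear functionals on the free algebra\<close>

definition word_functional :: "('i list \<Rightarrow> complex) \<Rightarrow> 'i ncpoly \<Rightarrow> complex" where
  "word_functional m P = (\<Sum>w\<in>Poly_Mapping.keys P. Poly_Mapping.lookup P w * m (letters w))"

lemma word_functional_superset:
  assumes "finite A" "Poly_Mapping.keys P \<subseteq> A"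
  shows "word_functional m P = (\<Sum>w\<in>A. Poly_Mapping.lookup P w * m (letters w))"
  unfolding word_functional_def by (rule sum.mono_neutral_left) (use assms in \<open>auto simp: in_keys_iff\<close>)

lemma word_functional_add: "word_functional m (P + Q) = word_functional m P + word_functional m Q"
proof -
  let ?A = "Poly_Mapping.keys P \<union> Poly_Mapping.keys Q"
  have "Poly_Mapping.keys (P + Q) \<subseteq> ?A" by (rule Poly_Mapping.keys_add)
  then show ?thesis
    using word_functional_superset[of ?A "P + Q" m] word_functional_superset[of ?A P m] word_functional_superset[of ?A Q m]
    by (simp add: lookup_add distrib_right sum.distrib)
qed

text \<open>Scaling as multiplication by a constant polynomial: the laws of a complex algebra then
  reduce to ring laws and the centrality of constants.\<close>

definition ncscale :: "complex \<Rightarrow> 'i ncpoly \<Rightarrow> 'i ncpoly" where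
  "ncscale c P = Poly_Mapping.single 0 c * P"

lemma sum_single_lookup: "(\<Sum>w\<in>Poly_Mapping.keys P. Poly_Mapping.single w (Poly_Mapping.lookup P w)) = P"
proof (rule poly_mapping_eqI)
  fix k
  have "Poly_Mapping.lookup (\<Sum>w\<in>Poly_Mapping.keys P. Poly_Mapping.single w (Poly_Mapping.lookup P w)) k =
      (\<Sum>w\<in>Poly_Mapping.keys P. if w = k then Poly_Mapping.lookup P w else 0)"
    by (simp add: lookup_sum lookup_single when_def)
  then show "Poly_Mapping.lookup (\<Sum>w\<in>Poly_Mapping.keys P. Poly_Mapping.single w (Poly_Mapping.lookup P w)) k = Poly_Mapping.lookup P k"
    by (simp add: in_keys_iff)
qed

lemma ncscale_commute: "P * Poly_Mapping.single 0 c = ncscale c (P :: 'i ncpoly)"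
proof -
  have "P * Poly_Mapping.single 0 c = (\<Sum>w\<in>Poly_Mapping.keys P. Poly_Mapping.single w (Poly_Mapping.lookup P w)) * Poly_Mapping.single 0 c"
    by (simp only: sum_single_lookup)
  also have "\<dots> = Poly_Mapping.single 0 c * (\<Sum>w\<in>Poly_Mapping.keys P. Poly_Mapping.single w (Poly_Mapping.lookup P w))"
    unfolding sum_distrib_left sum_distrib_right by (intro sum.cong) (simp_all add: mult_single mult.commute)
  finally show ?thesis by (simp only: sum_single_lookup ncscale_def)
qed

lemma word_functional_scale: "word_functional m (ncscale c P) = c * word_functional m P"
proof -
  have e: "ncscale c P = Poly_Mapping.map ((*) c) P"
    unfolding ncscale_def by (simp add: mult_map_scale_conv_mult)
  have l: "Poly_Mapping.lookup (ncscale c P) w = c * Poly_Mapping.lookup P w" for w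
    unfolding e by (simp add: Poly_Mapping.map.rep_eq when_def)
  then have "Poly_Mapping.keys (ncscale c P) \<subseteq> Poly_Mapping.keys P" by (auto simp: in_keys_iff)
  then show ?thesis
    using word_functional_superset[of "Poly_Mapping.keys P" "ncscale c P" m]
    by (simp add: l word_functional_def sum_distrib_left mult.assoc)
qed

lemma prod_list_letters:
  "prod_list (map (\<lambda>i. Poly_Mapping.single (NCWord [i]) 1) js) = (Poly_Mapping.single (NCWord js) 1 :: 'i ncpoly)"
proof (induction js)
  case Nil
  show ?case by (simp flip: single_one zero_ncword_def)
next
  case (Cons j js)
  then show ?case by (simp add: mult_single plus_ncword_def)
qed

lemma nc_prob_space_free:
  assumes "m [] = 1"
  shows "nc_prob_space ncscale (word_functional m :: 'i ncpoly \<Rightarrow> complex)"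
proof -
  have vs: "vector_space (ncscale :: complex \<Rightarrow> 'i ncpoly \<Rightarrow> 'i ncpoly)"
    by standard (simp_all add: ncscale_def distrib_left distrib_right single_add mult_single flip: mult.assoc)
  show ?thesis
  proof (intro nc_prob_space.intro nc_prob_space_axioms.intro vs)
    fix c and x y :: "'i ncpoly"
    show "ncscale c x * y = ncscale c (x * y)" by (simp add: ncscale_def mult.assoc)
    show "x * ncscale c y = ncscale c (x * y)"
      unfolding ncscale_def mult.assoc[symmetric] ncscale_commute ..
    have "vector_space ((*) :: complex \<Rightarrow> complex \<Rightarrow> complex)" by standard (simp_all add: algebra_simps)
    then show "Vector_Spaces.linear ncscale (*) (word_functional m :: 'i ncpoly \<Rightarrow> complex)"
      unfolding Vector_Spaces.linear_iff by (simp add: word_functional_add word_functional_scale vs)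
    show "word_functional m (1 :: 'i ncpoly) = 1"
      using assms by (simp add: word_functional_def zero_ncword_def flip: single_one)
  qed
qed

text \<open>The free algebra itself serves as the probability space: any values on words, with
  \<open>1\<close> on the empty word, extend to a unital linear functional, and the indeterminates
  form the family.\<close>

lemma ex_semicircular_family:
  fixes K :: "'i \<Rightarrow> 'i \<Rightarrow> real"
  assumes "psd_on I K"
  shows "semicircular_family I K ncscale (word_functional (\<lambda>w. complex_of_real (semicircular_moment K w)))
    (\<lambda>i. Poly_Mapping.single (NCWord [i]) 1 :: 'i ncpoly)"
  unfolding semicircular_family_iff prod_list_letters
  using assms by (auto intro!: nc_prob_space_free simp: word_functional_def)

section \<open>Contracted Wigner tensors\<close>

locale contracted_wigner = wigner_tensor M d X for M :: "'w measure" and d X +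
  fixes I :: "'i set" and u :: "nat \<Rightarrow> 'i \<Rightarrow> nat \<Rightarrow> real vec"
  assumes d3: "d \<ge> 3" and unit: "\<And>N i j. \<lbrakk>N \<ge> 1; i \<in> I; j < d - 2\<rbrakk> \<Longrightarrow> u N i j \<in> unit_sphere N"
begin

text \<open>Outside \<open>I\<close> nothing is known about the vectors; the zero tensor there makes
  the norm bound hold for every label.\<close>

definition coeffs :: "nat \<Rightarrow> 'i \<Rightarrow> nat list \<Rightarrow> real" where
  "coeffs N i = (if i \<in> I then tensor_prod (map (u N i) [0..<d - 2]) else (\<lambda>_. 0))"

abbreviation ens :: "nat \<Rightarrow> 'i \<Rightarrow> 'w \<Rightarrow> real mat" where
  "ens N i \<omega> \<equiv> contracted_ensemble d X u N i \<omega>"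

abbreviation cov :: "nat \<Rightarrow> 'i \<Rightarrow> 'i \<Rightarrow> real" where
  "cov N \<equiv> contraction_cov d u N"

definition trace_moment :: "nat \<Rightarrow> 'w \<Rightarrow> 'i list \<Rightarrow> real" where
  "trace_moment N \<omega> w = contraction_family.ntrace N d (coeffs N) (entries N \<omega>) w"

lemma coeffs_subunit: "N \<ge> 1 \<Longrightarrow> contraction_coefficients.subunit N d (coeffs N i)"
proof -
  assume N: "N \<ge> 1"
  interpret contraction_coefficients N d using d3 N by unfold_locales
  show ?thesis
  proof (cases "i \<in> I")
    case True
    have "v \<in> unit_sphere N" if "v \<in> set (map (u N i) [0..<d - 2])" for v using that unit[OF N True] by auto
    from tensor_prod_norm[of "map (u N i) [0..<d - 2]" N, OF this] show ?thesis using True by (simp add: subunit_def coeffs_def)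
  qed (simp add: subunit_def coeffs_def)
qed

lemma family: "N \<ge> 1 \<Longrightarrow> finite J \<Longrightarrow> contraction_family N d (coeffs N) J"
  using coeffs_subunit d3 by (simp add: contraction_family_def contraction_family_axioms_def contraction_coefficients_def)

text \<open>Words over a finite alphabet are countable, so the exceptional null sets can be united.
  Both directions of the equivalence start from here.\<close>

lemma AE_trace_moment:
  assumes J: "finite J" "J \<subseteq> I"
  shows "AE \<omega> in M. \<forall>w. set w \<subseteq> J \<longrightarrow> (\<lambda>N. trace_moment N \<omega> w - semicircular_moment (cov N) w) \<longlonglongrightarrow> 0"
proof -
  have c: "countable {w. set w \<subseteq> J}" using countable_lists[OF countable_finite[OF J(1)]] by (simp add: lists_eq_set)
  have "AE \<omega> in M. (\<lambda>N. trace_moment N \<omega> w - semicircular_moment (cov N) w) \<longlonglongrightarrow> 0" if w: "set w \<subseteq> J" for w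
  proof -
    have "AE \<omega> in M. (\<lambda>N. trace_moment N \<omega> w -
        semicircular_moment (\<lambda>i j. contraction_coefficients.pair_cov N d (coeffs N i) (coeffs N j)) w) \<longlonglongrightarrow> 0"
      unfolding trace_moment_def
      by (rule moment_bounded_AE_zero[OF word_trace_moment_bounded[OF d3 J(1) coeffs_subunit w]])
    then show ?thesis
    proof eventually_elim
      case (elim \<omega>)
      show ?case
      proof (rule Lim_transform_eventually[OF elim])
        show "\<forall>\<^sub>F N in sequentially. trace_moment N \<omega> w -
            semicircular_moment (\<lambda>i j. contraction_coefficients.pair_cov N d (coeffs N i) (coeffs N j)) w =
            trace_moment N \<omega> w - semicircular_moment (cov N) w"
          using eventually_ge_at_top[of 1]
        proof eventually_elim
          case (elim N)
          interpret contraction_coefficients N d using d3 elim by unfold_locales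
          have "semicircular_moment (\<lambda>i j. pair_cov (coeffs N i) (coeffs N j)) w = semicircular_moment (cov N) w"
            by (rule semicircular_moment_cong) (use w J(2) in \<open>auto simp: contraction_cov_eq coeffs_def\<close>)
          then show ?case by simp
        qed
      qed
    qed
  qed
  then have "AE \<omega> in M. \<forall>w\<in>{w. set w \<subseteq> J}. (\<lambda>N. trace_moment N \<omega> w - semicircular_moment (cov N) w) \<longlonglongrightarrow> 0"
    unfolding AE_ball_countable[OF c] by blast
  then show ?thesis by simp
qed

lemma ens_carrier [simp]: "ens N i \<omega> \<in> carrier_mat N N"
  by (simp add: contracted_ensemble_def contraction_def)

lemma ens_dim [simp]: "dim_row (ens N i \<omega>) = N" "dim_col (ens N i \<omega>) = N"
  using ens_carrier[of N i \<omega>] by (simp_all del: ens_carrier)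

text \<open>Connects the matrices of the statement, built from unsorted indices, with the function
  matrices, built from the family of sorted ones.\<close>

lemma ens_index:
  assumes N: "N \<ge> 1" and i: "i \<in> I" and ab: "a < N" "b < N"
  shows "ens N i \<omega> $$ (a, b) = contraction_family.fam N d (coeffs N) (entries N \<omega>) i a b"
proof -
  interpret contraction_family N d "coeffs N" "{}" by (rule family[OF N]) simp
  have e: "entries N \<omega> (sort (a # b # l)) = wigner_entries X N \<omega> (a # b # l)" if "l \<in> multi_index N (d - 2)" for l
    using sort_MI[OF Cons2_MI[OF ab that]] by (simp add: entries_def wigner_entries_def)
  show ?thesis
    using ab i by (simp add: contracted_ensemble_def contraction_def fam_def ensm_def coeffs_def e del: sort_key_simps(2))
qed

lemma ens_sym: "N \<ge> 1 \<Longrightarrow> i \<in> I \<Longrightarrow> a < N \<Longrightarrow> b < N \<Longrightarrow> ens N i \<omega> $$ (a, b) = ens N i \<omega> $$ (b, a)"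
proof -
  assume *: "N \<ge> 1" "i \<in> I" "a < N" "b < N"
  interpret contraction_family N d "coeffs N" "{}" by (rule family[OF *(1)]) simp
  show ?thesis using * by (simp add: ens_index fam_def ensm_sym[of _ _ a b])
qed

lemma word_product:
  assumes N: "N \<ge> 1" and w: "set w \<subseteq> I"
  shows "foldr (\<lambda>i B. ens N i \<omega> * B) w (1\<^sub>m N) =
    mat N N (\<lambda>(a, b). contraction_family.word_mat N d (coeffs N) (entries N \<omega>) w a b)"
proof -
  interpret contraction_family N d "coeffs N" "{}" by (rule family[OF N]) simp
  show ?thesis using w
  proof (induction w)
    case Nil
    show ?case by (rule eq_matI) (auto simp: word_mat_def mid_def)
  next
    case (Cons i w)
    then have IH: "foldr (\<lambda>i B. ens N i \<omega> * B) w (1\<^sub>m N) = mat N N (\<lambda>(a, b). word_mat (entries N \<omega>) w a b)" and i: "i \<in> I" by auto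
    show ?case
    proof (rule eq_matI)
      fix a b assume ab: "a < dim_row (mat N N (\<lambda>(a, b). word_mat (entries N \<omega>) (i # w) a b))"
        "b < dim_col (mat N N (\<lambda>(a, b). word_mat (entries N \<omega>) (i # w) a b))"
      then show "foldr (\<lambda>i B. ens N i \<omega> * B) (i # w) (1\<^sub>m N) $$ (a, b) =
          mat N N (\<lambda>(a, b). word_mat (entries N \<omega>) (i # w) a b) $$ (a, b)"
        by (simp add: IH scalar_prod_def atLeast0LessThan word_mat_def mmul_def ens_index[OF N i])
    qed (simp_all add: IH)
  qed
qed

lemma trace_moment_eq:
  assumes N: "N \<ge> 1" and w: "set w \<subseteq> I"
  shows "trace_moment N \<omega> w = (\<Sum>a<N. foldr (\<lambda>i B. ens N i \<omega> * B) w (1\<^sub>m N) $$ (a, a)) / real N"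
proof -
  interpret contraction_family N d "coeffs N" "{}" by (rule family[OF N]) simp
  show ?thesis unfolding word_product[OF assms] by (simp add: trace_moment_def ntrace_def mtr_def)
qed

lemma foldr_map_mat:
  "foldr (\<lambda>i B. map_mat complex_of_real (ens N i \<omega>) * B) w (1\<^sub>m N) = map_mat complex_of_real (foldr (\<lambda>i B. ens N i \<omega> * B) w (1\<^sub>m N))"
  and foldr_carrier: "foldr (\<lambda>i B. ens N i \<omega> * B) w (1\<^sub>m N) \<in> carrier_mat N N"
proof (induction w)
  case Nil
  { case 1 show ?case by (simp add: of_real_hom.mat_hom_one) }
  { case 2 show ?case by simp }
next
  case (Cons i w)
  { case 1 show ?case using Cons by (simp add: of_real_hom.mat_hom_mult[OF ens_carrier]) }
  { case 2 show ?case using Cons by (simp add: mult_carrier_mat[OF ens_carrier]) }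
qed

lemma normalized_trace_eq:
  assumes N: "N \<ge> 1" and P: "P \<in> free_algebra J" "J \<subseteq> I"
  shows "normalized_trace N (mat_nc_eval N (\<lambda>i. map_mat complex_of_real (ens N i \<omega>)) P) =
    word_functional (\<lambda>w. complex_of_real (trace_moment N \<omega> w)) P"
proof -
  have "normalized_trace N (mat_nc_eval N (\<lambda>i. map_mat complex_of_real (ens N i \<omega>)) P) =
      1 / of_nat N * (\<Sum>a<N. \<Sum>w\<in>Poly_Mapping.keys P. Poly_Mapping.lookup P w *
        complex_of_real (foldr (\<lambda>i B. ens N i \<omega> * B) (letters w) (1\<^sub>m N) $$ (a, a)))"
    unfolding normalized_trace_def mat_nc_eval_def foldr_map_mat by (simp add: carrier_matD[OF foldr_carrier])
  also have "\<dots> = (\<Sum>w\<in>Poly_Mapping.keys P. Poly_Mapping.lookup P w *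
        complex_of_real ((\<Sum>a<N. foldr (\<lambda>i B. ens N i \<omega> * B) (letters w) (1\<^sub>m N) $$ (a, a)) / real N))"
    by (subst sum.swap) (simp add: sum_distrib_left sum_divide_distrib)
  also have "\<dots> = word_functional (\<lambda>w. complex_of_real (trace_moment N \<omega> w)) P"
    unfolding word_functional_def
  proof (intro sum.cong refl)
    fix w assume "w \<in> Poly_Mapping.keys P"
    then have "set (letters w) \<subseteq> I" using P by (auto simp: free_algebra_def)
    from trace_moment_eq[OF N this, of \<omega>] show "Poly_Mapping.lookup P w *
        complex_of_real ((\<Sum>a<N. foldr (\<lambda>i B. ens N i \<omega> * B) (letters w) (1\<^sub>m N) $$ (a, a)) / real N) =
        Poly_Mapping.lookup P w * complex_of_real (trace_moment N \<omega> (letters w))" by simp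
  qed
  finally show ?thesis .
qed

lemma AE_trace_moment_limit:
  assumes K: "\<forall>i\<in>I. \<forall>j\<in>I. (\<lambda>N. cov N i j) \<longlonglongrightarrow> K i j" and J: "finite J" "J \<subseteq> I"
  shows "AE \<omega> in M. \<forall>w. set w \<subseteq> J \<longrightarrow> (\<lambda>N. trace_moment N \<omega> w) \<longlonglongrightarrow> semicircular_moment K w"
  using AE_trace_moment[OF J]
proof eventually_elim
  case (elim \<omega>)
  show ?case
  proof (intro allI impI)
    fix w assume w: "set w \<subseteq> J"
    have "(\<lambda>N. (trace_moment N \<omega> w - semicircular_moment (cov N) w) + semicircular_moment (cov N) w) \<longlonglongrightarrow> 0 + semicircular_moment K w"
      by (intro tendsto_add elim[rule_format, OF w] semicircular_moment_tendsto K[rule_format]) (use w J in auto)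
    then show "(\<lambda>N. trace_moment N \<omega> w) \<longlonglongrightarrow> semicircular_moment K w" by simp
  qed
qed

lemma AE_normalized_trace_limit:
  assumes K: "\<forall>i\<in>I. \<forall>j\<in>I. (\<lambda>N. cov N i j) \<longlonglongrightarrow> K i j" and J: "finite J" "J \<subseteq> I"
  shows "AE \<omega> in M. \<forall>P\<in>free_algebra J. (\<lambda>N. normalized_trace N (mat_nc_eval N (\<lambda>i. map_mat complex_of_real (ens N i \<omega>)) P))
    \<longlonglongrightarrow> word_functional (\<lambda>w. complex_of_real (semicircular_moment K w)) P"
  using AE_trace_moment_limit[OF K J]
proof eventually_elim
  case (elim \<omega>)
  show ?case
  proof
    fix P :: "'i ncpoly" assume P: "P \<in> free_algebra J"
    have "(\<lambda>N. word_functional (\<lambda>w. complex_of_real (trace_moment N \<omega> w)) P)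
        \<longlonglongrightarrow> word_functional (\<lambda>w. complex_of_real (semicircular_moment K w)) P"
      unfolding word_functional_def
      by (intro tendsto_sum tendsto_mult tendsto_const tendsto_of_real elim[rule_format])
        (use P in \<open>auto simp: free_algebra_def\<close>)
    moreover have "\<forall>\<^sub>F N in sequentially. word_functional (\<lambda>w. complex_of_real (trace_moment N \<omega> w)) P =
        normalized_trace N (mat_nc_eval N (\<lambda>i. map_mat complex_of_real (ens N i \<omega>)) P)"
      using eventually_ge_at_top[of 1] by eventually_elim (simp add: normalized_trace_eq[OF _ P J(2)])
    ultimately show "(\<lambda>N. normalized_trace N (mat_nc_eval N (\<lambda>i. map_mat complex_of_real (ens N i \<omega>)) P))
        \<longlonglongrightarrow> word_functional (\<lambda>w. complex_of_real (semicircular_moment K w)) P"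
      by (rule Lim_transform_eventually)
  qed
qed

lemma converges_to_semicircular:
  assumes K: "\<forall>i\<in>I. \<forall>j\<in>I. (\<lambda>N. cov N i j) \<longlonglongrightarrow> K i j" and S: "semicircular_family I K smul \<phi> s"
  shows "nc_converges_as_to M I (\<lambda>N i \<omega>. map_mat complex_of_real (ens N i \<omega>)) smul \<phi> s"
  unfolding nc_converges_as_to_def
proof (intro allI impI)
  fix J assume J: "finite J \<and> J \<subseteq> I"
  have "\<phi> (nc_eval smul s P) = word_functional (\<lambda>w. complex_of_real (semicircular_moment K w)) P" if "P \<in> free_algebra J" for P
    unfolding word_functional_def by (rule semicircular_family_nc_eval[OF S]) (use that J in \<open>auto simp: free_algebra_def\<close>)
  then show "AE \<omega> in M. \<forall>P\<in>free_algebra J. (\<lambda>N. normalized_trace N (mat_nc_eval N (\<lambda>i. map_mat complex_of_real (ens N i \<omega>)) P))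
      \<longlonglongrightarrow> \<phi> (nc_eval smul s P)"
    using AE_normalized_trace_limit[OF K, of J] J by simp
qed

lemma converges_iff:
  "nc_converges_as M I (\<lambda>N i \<omega>. map_mat complex_of_real (ens N i \<omega>)) \<longleftrightarrow> (\<forall>i\<in>I. \<forall>j\<in>I. convergent (\<lambda>N. cov N i j))"
proof
  assume conv: "nc_converges_as M I (\<lambda>N i \<omega>. map_mat complex_of_real (ens N i \<omega>))"
  show "\<forall>i\<in>I. \<forall>j\<in>I. convergent (\<lambda>N. cov N i j)"
  proof (intro ballI)
    fix i j assume ij: "i \<in> I" "j \<in> I"
    let ?J = "{i, j}"
    have J: "finite ?J" "?J \<subseteq> I" using ij by auto
    have "AE \<omega> in M. \<forall>P\<in>free_algebra ?J. convergent (\<lambda>N. normalized_trace N (mat_nc_eval N (\<lambda>i. map_mat complex_of_real (ens N i \<omega>)) P))"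
      using conv J unfolding nc_converges_as_def by blast
    with AE_trace_moment[OF J] have "AE \<omega> in M. convergent (\<lambda>N. cov N i j)"
    proof eventually_elim
      case (elim \<omega>)
      \<comment> \<open>The two-letter word recovers the covariance: its only pairing contributes
        \<open>cov N i j\<close>.\<close>
      let ?P = "Poly_Mapping.single (NCWord [i, j]) 1 :: 'i ncpoly"
      have P: "?P \<in> free_algebra ?J" by (simp add: free_algebra_def)
      obtain l where l: "(\<lambda>N. normalized_trace N (mat_nc_eval N (\<lambda>i. map_mat complex_of_real (ens N i \<omega>)) ?P)) \<longlonglongrightarrow> l"
        using elim(2) P unfolding convergent_def by blast
      have "(\<lambda>N. complex_of_real (trace_moment N \<omega> [i, j])) \<longlonglongrightarrow> l"
      proof (rule Lim_transform_eventually[OF l])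
        show "\<forall>\<^sub>F N in sequentially. normalized_trace N (mat_nc_eval N (\<lambda>i. map_mat complex_of_real (ens N i \<omega>)) ?P) =
            complex_of_real (trace_moment N \<omega> [i, j])"
          using eventually_ge_at_top[of 1] by eventually_elim (simp add: normalized_trace_eq[OF _ P J(2)] word_functional_def)
      qed
      then have "(\<lambda>N. trace_moment N \<omega> [i, j]) \<longlonglongrightarrow> Re l" using tendsto_Re by fastforce
      moreover have "(\<lambda>N. trace_moment N \<omega> [i, j] - cov N i j) \<longlonglongrightarrow> 0" using elim(1)[rule_format, of "[i, j]"] by simp
      ultimately have "(\<lambda>N. trace_moment N \<omega> [i, j] - (trace_moment N \<omega> [i, j] - cov N i j)) \<longlonglongrightarrow> Re l - 0" by (intro tendsto_diff)
      then show ?case unfolding convergent_def by auto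
    qed
    then show "convergent (\<lambda>N. cov N i j)" by simp
  qed
next
  assume "\<forall>i\<in>I. \<forall>j\<in>I. convergent (\<lambda>N. cov N i j)"
  then have K: "\<forall>i\<in>I. \<forall>j\<in>I. (\<lambda>N. cov N i j) \<longlonglongrightarrow> lim (\<lambda>N. cov N i j)"
    by (simp add: convergent_LIMSEQ_iff)
  show "nc_converges_as M I (\<lambda>N i \<omega>. map_mat complex_of_real (ens N i \<omega>))"
    unfolding nc_converges_as_def
  proof (intro allI impI)
    fix J assume J: "finite J \<and> J \<subseteq> I"
    have "AE \<omega> in M. \<forall>P\<in>free_algebra J. (\<lambda>N. normalized_trace N (mat_nc_eval N (\<lambda>i. map_mat complex_of_real (ens N i \<omega>)) P))
      \<longlonglongrightarrow> word_functional (\<lambda>w. complex_of_real (semicircular_moment (\<lambda>i j. lim (\<lambda>N. cov N i j)) w)) P"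
      by (rule AE_normalized_trace_limit[OF K]) (use J in auto)
    then show "AE \<omega> in M. \<forall>P\<in>free_algebra J. convergent (\<lambda>N. normalized_trace N (mat_nc_eval N (\<lambda>i. map_mat complex_of_real (ens N i \<omega>)) P))"
      by eventually_elim (auto simp: convergent_def)
  qed
qed

section \<open>The limiting covariance and the spectral distribution\<close>

lemma cov_limit_psd:
  assumes K: "\<forall>i\<in>I. \<forall>j\<in>I. (\<lambda>N. cov N i j) \<longlonglongrightarrow> K i j"
  shows "psd_on I K"
  unfolding psd_on_def
proof (intro conjI ballI allI impI)
  fix i j assume "i \<in> I" "j \<in> I"
  then have "(\<lambda>N. cov N i j) \<longlonglongrightarrow> K i j" "(\<lambda>N. cov N i j) \<longlonglongrightarrow> K j i"
    using K[rule_format, of i j] K[rule_format, of j i] by (simp_all add: contraction_cov_sym[of d u _ j i])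
  then show "K i j = K j i" by (rule LIMSEQ_unique)
next
  fix F and c :: "'i \<Rightarrow> real" assume F: "finite F \<and> F \<subseteq> I"
  have "(\<lambda>N. \<Sum>i\<in>F. \<Sum>j\<in>F. c i * c j * cov N i j) \<longlonglongrightarrow> (\<Sum>i\<in>F. \<Sum>j\<in>F. c i * c j * K i j)"
    by (intro tendsto_sum tendsto_mult tendsto_const K[rule_format]) (use F in auto)
  then show "0 \<le> (\<Sum>i\<in>F. \<Sum>j\<in>F. c i * c j * K i j)"
    by (rule LIMSEQ_le_const) (use contraction_cov_psd[OF d3] in blast)
qed

lemma cov_limit_pos:
  assumes i: "i \<in> I" and K: "(\<lambda>N. cov N i i) \<longlonglongrightarrow> k"
  shows "0 < k"
proof -
  let ?c = "1 / (real d * (real d - 1) * real (d - 2) ^ (2 * (d - 2)))"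
  have "?c \<le> k" using K
  proof (rule LIMSEQ_le_const)
    have "?c \<le> cov N i i" if "N \<ge> 1" for N by (rule contraction_cov_ge[OF d3]) (rule unit[OF that i])
    then show "\<exists>n. \<forall>N\<ge>n. ?c \<le> cov N i i" by blast
  qed
  moreover have "0 < ?c" using d3 by simp
  ultimately show ?thesis by linarith
qed

text \<open>Matrix powers append the new factor on the right, words on the left; the inner induction
  moves it across.\<close>

lemma pow_eq_foldr: "ens N i \<omega> ^\<^sub>m k = foldr (\<lambda>i B. ens N i \<omega> * B) (replicate k i) (1\<^sub>m N)"
proof (induction k)
  case (Suc k)
  have "ens N i \<omega> ^\<^sub>m Suc k = ens N i \<omega> * ens N i \<omega> ^\<^sub>m k"
  proof (induction k)
    case (Suc k)
    have "ens N i \<omega> ^\<^sub>m Suc (Suc k) = (ens N i \<omega> * ens N i \<omega> ^\<^sub>m k) * ens N i \<omega>" using Suc by simp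
    also have "\<dots> = ens N i \<omega> * ens N i \<omega> ^\<^sub>m Suc k"
      by (simp add: assoc_mult_mat[OF ens_carrier pow_carrier_mat[OF ens_carrier] ens_carrier])
    finally show ?case .
  qed simp
  with Suc show ?case by simp
qed simp

lemma spectral_distribution_converges:
  assumes i: "i \<in> I" and K: "\<forall>i\<in>I. \<forall>j\<in>I. (\<lambda>N. cov N i j) \<longlonglongrightarrow> K i j"
  shows "AE \<omega> in M. weak_conv_m (\<lambda>N. empirical_spectral_distribution (ens N i \<omega>)) (semicircle_distribution (K i i))"
proof -
  have pos: "0 < K i i" by (rule cov_limit_pos[OF i K[rule_format, OF i i]])
  have "AE \<omega> in M. \<forall>w. set w \<subseteq> {i} \<longrightarrow> (\<lambda>N. trace_moment N \<omega> w) \<longlonglongrightarrow> semicircular_moment K w"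
    by (rule AE_trace_moment_limit[OF K]) (use i in auto)
  then show ?thesis
  proof eventually_elim
    case (elim \<omega>)
    \<comment> \<open>At \<open>N = 0\<close> the uniform measure on the empty set is not a
      probability measure, so the sequence is shifted here and shifted back at the end.\<close>
    let ?A = "\<lambda>N. ens (Suc N) i \<omega>"
    have m: "real_distribution (empirical_spectral_distribution (?A N))"
      "integrable (empirical_spectral_distribution (?A N)) (\<lambda>x. x ^ k)"
      "(LINT x|empirical_spectral_distribution (?A N). x ^ k) = (\<Sum>a<Suc N. (?A N ^\<^sub>m k) $$ (a, a)) / real (Suc N)" for N k
      by (rule empirical_spectral_distribution_moment[OF ens_carrier]; use i ens_sym in simp)+
    have "weak_conv_m (\<lambda>N. empirical_spectral_distribution (?A N)) (semicircle_distribution (K i i))"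
    proof (rule moments_imp_weak_conv[OF m(1) real_distribution_semicircle[OF pos] m(2) semicircle_distribution_AE_bounded[OF pos]])
      fix k
      have w: "set (replicate k i) \<subseteq> {i}" by auto
      have "(LINT x|empirical_spectral_distribution (?A N). x ^ k) = trace_moment (Suc N) \<omega> (replicate k i)" for N
        unfolding m(3) pow_eq_foldr by (rule trace_moment_eq[symmetric]) (use i w in auto)
      moreover have "(LINT x|semicircle_distribution (K i i). x ^ k) = semicircular_moment K (replicate k i)"
        unfolding semicircle_distribution_moment[OF pos] by (rule semicircular_moment_replicate[symmetric])
      ultimately show "(\<lambda>N. LINT x|empirical_spectral_distribution (?A N). x ^ k) \<longlonglongrightarrow> (LINT x|semicircle_distribution (K i i). x ^ k)"
        using LIMSEQ_Suc[OF elim[rule_format, OF w]] by simp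
    qed
    then show ?case
      unfolding weak_conv_m_def weak_conv_def by (subst (asm) filterlim_sequentially_Suc)
  qed
qed

end

text \<open>Types cannot be quantified inside the statement. So the existence of a limit family is
  asserted in the free algebra, and convergence to every semicircular family of covariance
  \<open>K\<close> in an arbitrary algebra of type \<open>'a\<close>.\<close>

theorem theorem1p5:
  fixes M :: "'w measure"
    and d :: nat
    and X :: "nat \<Rightarrow> nat list \<Rightarrow> 'w \<Rightarrow> real"
    and I :: "'i set"
    and u :: "nat \<Rightarrow> 'i \<Rightarrow> nat \<Rightarrow> real vec"
  assumes "d \<ge> 3"
    and "wigner_tensor M d X"
    and "\<And>N i j. \<lbrakk>N \<ge> 1; i \<in> I; j < d - 2\<rbrakk> \<Longrightarrow> u N i j \<in> unit_sphere N"
  shows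
    "(nc_converges_as M I (\<lambda>N i \<omega>. map_mat complex_of_real (contracted_ensemble d X u N i \<omega>))
       \<longleftrightarrow> (\<forall>i\<in>I. \<forall>i'\<in>I. convergent (\<lambda>N. contraction_cov d u N i i')))
     \<and> (\<forall>K :: 'i \<Rightarrow> 'i \<Rightarrow> real.
          (\<forall>i\<in>I. \<forall>i'\<in>I. (\<lambda>N. contraction_cov d u N i i') \<longlonglongrightarrow> K i i') \<longrightarrow>
            (\<exists>(smul :: complex \<Rightarrow> 'i ncpoly \<Rightarrow> 'i ncpoly) \<phi> s.
               semicircular_family I K smul \<phi> s \<and>
               nc_converges_as_to M I
                 (\<lambda>N i \<omega>. map_mat complex_of_real (contracted_ensemble d X u N i \<omega>)) smul \<phi> s)
          \<and> (\<forall>(smul :: complex \<Rightarrow> 'a \<Rightarrow> 'a::ring_1) \<phi> s.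
               semicircular_family I K smul \<phi> s \<longrightarrow>
               nc_converges_as_to M I
                 (\<lambda>N i \<omega>. map_mat complex_of_real (contracted_ensemble d X u N i \<omega>)) smul \<phi> s)
          \<and> (\<forall>i\<in>I. AE \<omega> in M.
               weak_conv_m
                 (\<lambda>N. empirical_spectral_distribution (contracted_ensemble d X u N i \<omega>))
                 (semicircle_distribution (K i i))))"
proof -
  interpret wigner_tensor M d X by (rule assms(2))
  interpret contracted_wigner M d X I u using assms(1,3) by unfold_locales
  show ?thesis
  proof (intro conjI allI impI)
    show "nc_converges_as M I (\<lambda>N i \<omega>. map_mat complex_of_real (contracted_ensemble d X u N i \<omega>))
       \<longleftrightarrow> (\<forall>i\<in>I. \<forall>i'\<in>I. convergent (\<lambda>N. contraction_cov d u N i i'))"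
      by (rule converges_iff)
  next
    fix K :: "'i \<Rightarrow> 'i \<Rightarrow> real"
    assume K: "\<forall>i\<in>I. \<forall>i'\<in>I. (\<lambda>N. contraction_cov d u N i i') \<longlonglongrightarrow> K i i'"
    note S = ex_semicircular_family[OF cov_limit_psd[OF K]]
    show "\<exists>(smul :: complex \<Rightarrow> 'i ncpoly \<Rightarrow> 'i ncpoly) \<phi> s.
        semicircular_family I K smul \<phi> s \<and>
        nc_converges_as_to M I (\<lambda>N i \<omega>. map_mat complex_of_real (contracted_ensemble d X u N i \<omega>)) smul \<phi> s"
      using S converges_to_semicircular[OF K S] by blast
    show "nc_converges_as_to M I (\<lambda>N i \<omega>. map_mat complex_of_real (contracted_ensemble d X u N i \<omega>)) smul \<phi> s"
      if "semicircular_family I K smul \<phi> s" for smul :: "complex \<Rightarrow> 'a \<Rightarrow> 'a" and \<phi> s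
      by (rule converges_to_semicircular[OF K that])
    show "\<forall>i\<in>I. AE \<omega> in M. weak_conv_m (\<lambda>N. empirical_spectral_distribution (contracted_ensemble d X u N i \<omega>))
        (semicircle_distribution (K i i))"
      using spectral_distribution_converges[OF _ K] by blast
  qed
qed

end
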